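(* Up to automorphism of $\mathbb P^2_{\mathbb C}$, there are exactly four convex foliations of degree three on $\mathbb P^2_{\mathbb C}$, namely the foliations $\mathcal H_1,\mathcal H_3,\mathcal F_1,\mathcal F_3$ described in an affine chart respectively by the $1$-forms $$\omega_1=y^3\mathrm dx-x^3\mathrm dy,\qquad \omega_3=y^2(3x+y)\mathrm dx-x^2(x+3y)\mathrm dy,$$ $$\overline{\omega}_1=y^3\mathrm dx+x^3(x\mathrm dy-y\mathrm dx),\qquad \overline{\omega}_3=(x^3-x)\mathrm dy-(y^3-y)\mathrm dx.$$
   Context: A foliation $\mathcal F$ of degree $d$ on $\mathbb P^2_{\mathbb C}$ is given in homogeneous coordinates $[x:y:z]$, up to a nonzero scalar, by a $1$-form $\Omega=a\,\mathrm dx+b\,\mathrm dy+c\,\mathrm dz$ with $a,b,c$ homogeneous polynomials of degree $d+1$ without common factor satisfying $xa+yb+zc=0$. Equivalently it is given by a homogeneous vector field $Z$ on $\mathbb C^3$ with coefficients of degree $d$ without common factor, with $\Omega=i_{\mathrm R}i_Z(\mathrm dx\wedge\mathrm dy\wedge\mathrm dz)$, where $\mathrm R=x\partial_x+y\partial_y+z\partial_z$. In the affine chart $z=1$ the foliation is described by a polynomial $1$-form $A\,\mathrm dx+B\,\mathrm dy$ with $\gcd(A,B)=1$. "Up to automorphism" refers to the action of $\mathrm{Aut}(\mathbb P^2_{\mathbb C})=\mathrm{PGL}_3(\mathbb C)$. The inflection divisor $\mathrm I_{\mathcal F}$ is the divisor of degree $3d$ defined by $$\det\begin{pmatrix}x&Z(x)&Z^2(x)\\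 y&Z(y)&Z^2(y)\\ z&Z(z)&Z^2(z)\end{pmatrix}=0.$$ The foliation $\mathcal F$ is convex if its inflection divisor is invariant by $\mathcal F$, i.e. if $\mathrm I_{\mathcal F}$ is a product of $\mathcal F$-invariant lines; equivalently, the leaves of $\mathcal F$ other than straight lines have no inflection points. *)

theory Defs
  imports "HOL-Analysis.Analysis" "HOL-Computational_Algebra.Polynomial"
begin

text \<open>
  The coefficient of \<open>x^i y^j z^k\<close> in \<open>P :: poly3\<close> is \<open>coeff (coeff (coeff P k) j) i\<close>:
  \<open>x\<close> is the innermost and \<open>z\<close> the outermost variable.  Consequently \<open>poly P 1\<close> is
  the restriction of \<open>P\<close> to the affine chart \<open>z = 1\<close>.
\<close>

type_synonym poly2 = "complex poly poly"
type_synonym poly3 = "complex poly poly poly"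

abbreviation const3 :: "complex \<Rightarrow> poly3" where
  "const3 c \<equiv> [:[:[:c:]:]:]"

definition coords :: "poly3 ^ 3" where
  "coords = vector [[:[:[:0, 1:]:]:], [:[:0, 1:]:], [:0, 1:]]"

definition homogeneous :: "nat \<Rightarrow> poly3 \<Rightarrow> bool" where
  "homogeneous n P \<longleftrightarrow>
     (\<forall>i j k. coeff (coeff (coeff P k) j) i \<noteq> 0 \<longrightarrow> i + j + k = n)"

definition no_common_factor :: "poly3 ^ 3 \<Rightarrow> bool" where
  "no_common_factor v \<longleftrightarrow> (\<forall>p. (\<forall>i. p dvd v $ i) \<longrightarrow> p dvd 1)"

definition gradient :: "poly3 \<Rightarrow> poly3 ^ 3" where
  "gradient P = vector [map_poly (map_poly pderiv) P, map_poly pderiv P, pderiv P]"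

definition subst3 :: "poly3 ^ 3 \<Rightarrow> poly3 \<Rightarrow> poly3" where
  "subst3 Q P =
     poly (map_poly (\<lambda>p. poly (map_poly (\<lambda>q. poly (map_poly const3 q) (Q $ 1)) p) (Q $ 2)) P) (Q $ 3)"


subsection \<open>Foliations of the projective plane\<close>

text \<open>
  A \<open>1\<close>-form \<open>a dx + b dy + c dz\<close> and a vector field \<open>u \<partial>x + v \<partial>y + w \<partial>z\<close> are both
  represented by their vector of coefficients.  A foliation is the set of all the \<open>1\<close>-forms
  that define it, i.e. a \<open>1\<close>-form up to a nonzero scalar.
\<close>

definition foliation_form :: "nat \<Rightarrow> poly3 ^ 3 \<Rightarrow> bool" where
  "foliation_form d \<Omega> \<longleftrightarrow>
     (\<forall>i. homogeneous (d + 1) (\<Omega> $ i)) \<and> no_common_factor \<Omega> \<and>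
     (\<Sum>i\<in>UNIV. coords $ i * \<Omega> $ i) = 0"

definition foliation_of :: "poly3 ^ 3 \<Rightarrow> (poly3 ^ 3) set" where
  "foliation_of \<Omega> = {const3 c *s \<Omega> |c. c \<noteq> 0}"

definition foliations :: "nat \<Rightarrow> (poly3 ^ 3) set set" where
  "foliations d = foliation_of ` {\<Omega>. foliation_form d \<Omega>}"

definition foliation_field :: "nat \<Rightarrow> poly3 ^ 3 \<Rightarrow> bool" where
  "foliation_field d V \<longleftrightarrow> (\<forall>i. homogeneous d (V $ i)) \<and> no_common_factor V"

text \<open>\<open>i\<^sub>R i\<^sub>V (dx \<and> dy \<and> dz)\<close> sends a vector \<open>w\<close> to \<open>det (V, R, w)\<close>, where \<open>R\<close> is the
  radial vector field, with coefficients \<^term>\<open>coords\<close>.\<close>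

definition form_of_field :: "poly3 ^ 3 \<Rightarrow> poly3 ^ 3" where
  "form_of_field V = (\<chi> k. det (vector [V, coords, axis k 1] :: poly3 ^ 3 ^ 3))"

definition act :: "poly3 ^ 3 \<Rightarrow> poly3 \<Rightarrow> poly3" where
  "act V P = (\<Sum>i\<in>UNIV. V $ i * gradient P $ i)"


subsection \<open>Convexity\<close>

definition inflection :: "poly3 ^ 3 \<Rightarrow> poly3" where
  "inflection V =
     det (\<chi> i. vector [coords $ i, act V (coords $ i), act V (act V (coords $ i))] :: poly3 ^ 3 ^ 3)"

definition invariant_line :: "poly3 ^ 3 \<Rightarrow> poly3 \<Rightarrow> bool" where
  "invariant_line V L \<longleftrightarrow> homogeneous 1 L \<and> L \<noteq> 0 \<and> L dvd act V L"

text \<open>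
  The field \<open>V\<close> defining a foliation is unique up to a scalar and up to adding a multiple of the
  radial field.  The latter does not change \<^term>\<open>inflection V\<close> nor the lines invariant
  by \<open>V\<close>, so that the choice of \<open>V\<close> below is irrelevant.
\<close>

definition convex_foliations :: "nat \<Rightarrow> (poly3 ^ 3) set set" where
  "convex_foliations d =
     {F \<in> foliations d. \<exists>V. foliation_field d V \<and> form_of_field V \<in> F \<and>
        (\<exists>c Ls. c \<noteq> 0 \<and> (\<forall>L\<in>set Ls. invariant_line V L) \<and>
           inflection V = const3 c * prod_list Ls)}"


subsection \<open>Automorphisms of the projective plane\<close>

definition pullback :: "complex ^ 3 ^ 3 \<Rightarrow> poly3 ^ 3 \<Rightarrow> poly3 ^ 3" where
  "pullback M \<Omega> =
     (let N = (\<chi> i j. const3 (M $ i $ j)) in (\<chi> i. subst3 (N *v coords) (\<Omega> $ i)) v* N)"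

text \<open>Scalar matrices fix every foliation, so that the action of the general linear group
  on foliations is that of the projective linear group.\<close>

definition aut_equiv :: "((poly3 ^ 3) set \<times> (poly3 ^ 3) set) set" where
  "aut_equiv = {(F, G). \<exists>M :: complex ^ 3 ^ 3. invertible M \<and> G = pullback M ` F}"


subsection \<open>Foliations given in the affine chart \<open>z = 1\<close>\<close>

abbreviation aff_x :: poly2 where "aff_x \<equiv> [:[:0, 1:]:]"
abbreviation aff_y :: poly2 where "aff_y \<equiv> [:0, 1:]"
abbreviation aff_dx :: "poly2 ^ 2" where "aff_dx \<equiv> axis 1 1"
abbreviation aff_dy :: "poly2 ^ 2" where "aff_dy \<equiv> axis 2 1"

definition affine_part :: "poly3 ^ 3 \<Rightarrow> poly2 ^ 2" where
  "affine_part \<Omega> = poly (\<Omega> $ 1) 1 *s aff_dx + poly (\<Omega> $ 2) 1 *s aff_dy"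

text \<open>A foliation of the projective plane is determined by any \<open>1\<close>-form describing it in
  the chart \<open>z = 1\<close>; its degree is not prescribed here.\<close>

definition affine_foliation :: "poly2 ^ 2 \<Rightarrow> (poly3 ^ 3) set" where
  "affine_foliation \<omega> =
     {\<Omega>. (\<exists>d. foliation_form d \<Omega>) \<and> (\<exists>c. c \<noteq> 0 \<and> affine_part \<Omega> = [:[:c:]:] *s \<omega>)}"

definition H1 :: "(poly3 ^ 3) set" where
  "H1 = affine_foliation (aff_y^3 *s aff_dx - aff_x^3 *s aff_dy)"

definition H3 :: "(poly3 ^ 3) set" where
  "H3 = affine_foliation ((aff_y^2 * (3 * aff_x + aff_y)) *s aff_dx - (aff_x^2 * (aff_x + 3 * aff_y)) *s aff_dy)"

definition F1 :: "(poly3 ^ 3) set" where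
  "F1 = affine_foliation (aff_y^3 *s aff_dx + aff_x^3 *s (aff_x *s aff_dy - aff_y *s aff_dx))"

definition F3 :: "(poly3 ^ 3) set" where
  "F3 = affine_foliation ((aff_x^3 - aff_x) *s aff_dy - (aff_y^3 - aff_y) *s aff_dx)"

end

theory Submission imports Defs "HOL-Computational_Algebra.Fundamental_Theorem_Algebra" begin

text \<open>
  Evaluation of polynomials turns a homogeneous field of degree three into a map \<open>Z\<close> of
  \<open>\<complex>\<^sup>3\<close>.  The maps \<open>Z\<close> and \<open>Z + g R\<close>, where \<open>g\<close> is a quadratic form and \<open>R\<close> the radial field,
  define the same foliation and have the same inflection polynomial \<open>infl Z\<close>.  Convexity says that
  \<open>infl Z\<close> is a product of nine invariant lines (\<open>convex_field\<close>).  Comparing \<open>infl Z\<close> with such a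
  product, along a line or coefficient by coefficient, forces \<open>Z\<close> into a normal form.

  Two kinds of singular points matter: the degenerate ones, where the form of the foliation
  vanishes to order two, and the radial ones of order two, for which \<open>Z\<close> can be written
  \<open>(A(x, y), 0, C)\<close> with a term \<open>z\<^sup>3\<close> in \<open>C\<close>.  Let the inflection lines not be concurrent.  Then
  each inflection line carries a point of one of the two kinds (\<open>line_dichotomy\<close>): on the line,
  the field induces a rational self-map of degree three whose critical points are met by other
  invariant lines, hence are fixed, and such a map has a double critical point
  (\<open>double_critical_point\<close>), which is a radial point of order two.  Two degenerate points cannot
  be separated by the inflection lines (\<open>two_degenerate\<close>), so there is a radial point of order two.

  In suitable coordinates the field is \<open>(- P\<^sub>y, P\<^sub>x, z\<^sup>3 + w\<^sub>1 z + w\<^sub>0)\<close> with a quartic form \<open>P\<close> and forms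
  \<open>w\<^sub>1\<close>, \<open>w\<^sub>0\<close> in \<open>x, y\<close> (locale \<open>radial_normal\<close>), and \<open>infl Z = 4 P Q\<close> with \<open>Q\<close> of degree five in
  \<open>z\<close>.  Thus \<open>Q = 3 \<Prod> (z - l\<^sub>i)\<close> for five linear forms \<open>l\<^sub>i\<close> in \<open>x, y\<close>, and invariance of these lines
  means \<open>l\<^sup>3 + w\<^sub>1 l + w\<^sub>0 = l\<^sub>y P\<^sub>x - l\<^sub>x P\<^sub>y\<close>.  Summing over the five roots and using the missing
  coefficients of \<open>Q\<close> gives \<open>w\<^sub>0 = 0\<close> and roots \<open>0, l, - l, m, - m\<close>, after which \<open>P\<close> is determined:
  independent \<open>l, m\<close> give the foliation \<open>F3\<close>, proportional ones \<open>H1\<close> or \<open>H3\<close>, and \<open>l = m = 0\<close> gives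
  \<open>F1\<close> (\<open>radial_two_classification\<close>).  If the lines are concurrent, the foliation is \<open>F1\<close>
  (\<open>concurrent_lines\<close>).

  The four foliations are inequivalent because an automorphism preserves the multiplicities of
  the inflection lines (\<open>equivalent_multiplicities\<close>), which are \<open>1, 1, 1, 3, 3\<close> for \<open>H1\<close>,
  \<open>1, 1, 2, 2, 3\<close> for \<open>H3\<close>, \<open>4, 5\<close> for \<open>F1\<close> and nine times \<open>1\<close> for \<open>F3\<close>.
\<close>

section \<open>Vectors and linear forms\<close>

definition dot :: "complex^3 \<Rightarrow> complex^3 \<Rightarrow> complex" where
  "dot a b = a$1 * b$1 + a$2 * b$2 + a$3 * b$3"

definition ccross :: "complex^3 \<Rightarrow> complex^3 \<Rightarrow> complex^3" where
  "ccross a b = vector [a$2 * b$3 - a$3 * b$2, a$3 * b$1 - a$1 * b$3, a$1 * b$2 - a$2 * b$1]"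

lemma ccross_nth [simp]:
  "ccross a b $ 1 = a$2 * b$3 - a$3 * b$2"
  "ccross a b $ 2 = a$3 * b$1 - a$1 * b$3"
  "ccross a b $ 3 = a$1 * b$2 - a$2 * b$1"
  by (simp_all add: ccross_def)

lemma vec3_eq_iff: "(a :: 'a^3) = b \<longleftrightarrow> a$1 = b$1 \<and> a$2 = b$2 \<and> a$3 = b$3"
  by (simp add: vec_eq_iff forall_3)

lemma vec3_collapse: "vector [p$1, p$2, p$3] = (p :: complex^3)"
  by (simp add: vec3_eq_iff)

lemma all_vec3: "(\<forall>p :: complex^3. P p) \<longleftrightarrow> (\<forall>x y z. P (vector [x, y, z]))"
  by (metis vec3_collapse)

lemma mv3_nth: "((M :: complex^3^3) *v p) $ i = M$i$1 * p$1 + M$i$2 * p$2 + M$i$3 * p$3"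
  by (simp add: matrix_vector_mult_def sum_3)

lemma vm3_nth: "(p v* (M :: complex^3^3)) $ i = M$1$i * p$1 + M$2$i * p$2 + M$3$i * p$3"
  by (simp add: vector_matrix_mult_def sum_3)

lemma dot_vm: "dot (L v* M) p = dot L (M *v p)"
  by (simp add: dot_def mv3_nth vm3_nth algebra_simps)

lemma dot_simps [simp]:
  "dot L (a + b) = dot L a + dot L b" "dot L (a - b) = dot L a - dot L b"
  "dot L (c *s a) = c * dot L a" "dot L 0 = 0" "dot 0 L = 0"
  "dot (c *s a) L = c * dot a L"
  "dot (a + b) L = dot a L + dot b L" "dot (a - b) L = dot a L - dot b L"
  by (simp_all add: dot_def algebra_simps)

lemma dot_all_0: "(\<forall>p. dot L p = 0) \<Longrightarrow> L = 0"
  apply (simp add: all_vec3 dot_def vec3_eq_iff)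
  apply (metis add.right_neutral add_0 mult_zero_right mult.right_neutral)
  done

lemma det3_mult:
  "dot (M *v a) (ccross (M *v b) (M *v c)) = det M * dot a (ccross b c)"
  unfolding dot_def ccross_nth mv3_nth det_3 by algebra

lemma ccross_mult: "ccross (M *v a) (M *v b) v* M = det M *s ccross a b"
  unfolding vec3_eq_iff vm3_nth vector_smult_component ccross_nth mv3_nth det_3
  by (intro conjI; algebra)

section \<open>Homogeneous polynomial functions\<close>

text \<open>The recursive encoding lets closure properties, gradients and invariance under linear
  substitutions be proved by induction on the degree.\<close>

primrec hom :: "nat \<Rightarrow> (complex^3 \<Rightarrow> complex) \<Rightarrow> bool" where
  "hom 0 f = (\<exists>c. f = (\<lambda>_. c))"
| "hom (Suc n) f = (\<exists>f1 f2 f3. hom n f1 \<and> hom n f2 \<and> hom n f3 \<and>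
     f = (\<lambda>p. p$1 * f1 p + p$2 * f2 p + p$3 * f3 p))"

lemma hom_const: "hom 0 (\<lambda>_. c)" by auto

lemma hom_zero: "hom n (\<lambda>_. 0)"
proof (induction n)
  case (Suc n)
  show ?case unfolding hom.simps
    by (rule exI[of _ "\<lambda>_. 0"])+ (use Suc in auto)
qed auto

lemma hom_add: "hom n f \<Longrightarrow> hom n g \<Longrightarrow> hom n (\<lambda>p. f p + g p)"
proof (induction n arbitrary: f g)
  case (Suc n)
  from Suc.prems obtain f1 f2 f3 g1 g2 g3 where
    *: "hom n f1" "hom n f2" "hom n f3" "hom n g1" "hom n g2" "hom n g3"
       "f = (\<lambda>p. p$1 * f1 p + p$2 * f2 p + p$3 * f3 p)" "g = (\<lambda>p. p$1 * g1 p + p$2 * g2 p + p$3 * g3 p)"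
    by auto
  show ?case unfolding hom.simps
    by (rule exI[of _ "\<lambda>p. f1 p + g1 p"], rule exI[of _ "\<lambda>p. f2 p + g2 p"], rule exI[of _ "\<lambda>p. f3 p + g3 p"])
       (use * Suc.IH in \<open>auto simp: algebra_simps\<close>)
qed auto

lemma hom_scale: "hom n f \<Longrightarrow> hom n (\<lambda>p. c * f p)"
proof (induction n arbitrary: f)
  case (Suc n)
  from Suc.prems obtain f1 f2 f3 where
    *: "hom n f1" "hom n f2" "hom n f3" "f = (\<lambda>p. p$1 * f1 p + p$2 * f2 p + p$3 * f3 p)" by auto
  show ?case unfolding hom.simps
    by (rule exI[of _ "\<lambda>p. c * f1 p"], rule exI[of _ "\<lambda>p. c * f2 p"], rule exI[of _ "\<lambda>p. c * f3 p"])
       (use * Suc.IH in \<open>auto simp: algebra_simps\<close>)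
qed auto

lemma hom_coord: assumes f: "hom n f" shows "hom (Suc n) (\<lambda>p. p$i * f p)"
proof -
  define e where "e j = (if j = i then f else (\<lambda>_. 0))" for j :: 3
  have e: "hom n (e j)" for j using f hom_zero by (simp add: e_def)
  have "(\<lambda>p. p$i * f p) = (\<lambda>p. p$1 * e 1 p + p$2 * e 2 p + p$3 * e 3 p)"
    using exhaust_3[of i] by (auto simp: e_def fun_eq_iff)
  then show ?thesis unfolding hom.simps using e by blast
qed

lemma hom_dot: "hom n f \<Longrightarrow> hom (Suc n) (\<lambda>p. dot L p * f p)"
proof -
  assume f: "hom n f"
  have "hom (Suc n) (\<lambda>p. L$1 * (p$1 * f p) + L$2 * (p$2 * f p) + L$3 * (p$3 * f p))"
    by (intro hom_add hom_scale hom_coord f)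
  then show ?thesis by (simp add: dot_def algebra_simps)
qed

lemma hom_linear: "hom n f \<Longrightarrow> hom n (\<lambda>p. f (M *v p))"
proof (induction n arbitrary: f)
  case (Suc n)
  from Suc.prems obtain f1 f2 f3 where
    *: "hom n f1" "hom n f2" "hom n f3" "f = (\<lambda>p. p$1 * f1 p + p$2 * f2 p + p$3 * f3 p)" by auto
  have r: "(M *v p) $ i = dot (M $ i) p" for i p by (simp add: mv3_nth dot_def)
  have "hom (Suc n) (\<lambda>p. dot (M$1) p * f1 (M *v p) + dot (M$2) p * f2 (M *v p) + dot (M$3) p * f3 (M *v p))"
    by (intro hom_add hom_dot Suc.IH *)
  then show ?case unfolding *(4) r .
qed auto

lemma hom_mult: "hom n f \<Longrightarrow> hom m g \<Longrightarrow> hom (n + m) (\<lambda>p. f p * g p)"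
proof (induction n arbitrary: f)
  case 0 then show ?case by (auto intro: hom_scale)
next
  case (Suc n)
  from Suc.prems obtain f1 f2 f3 where
    *: "hom n f1" "hom n f2" "hom n f3" "f = (\<lambda>p. p$1 * f1 p + p$2 * f2 p + p$3 * f3 p)" by auto
  have "hom (Suc (n+m)) (\<lambda>p. p$1 * (f1 p * g p) + p$2 * (f2 p * g p) + p$3 * (f3 p * g p))"
    by (intro hom_add hom_coord Suc.IH * Suc.prems)
  then show ?case by (simp add: *(4) algebra_simps)
qed

lemma hom_sum: "finite S \<Longrightarrow> (\<And>i. i \<in> S \<Longrightarrow> hom n (f i)) \<Longrightarrow> hom n (\<lambda>p. \<Sum>i\<in>S. f i p)"
  by (induction S rule: finite_induct) (auto intro: hom_zero hom_add)

lemma hom_coord1: "hom 1 (\<lambda>p. p$i)"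
  using hom_coord[OF hom_const[of 1]] by simp

lemma hom_power: "hom n f \<Longrightarrow> hom (n * k) (\<lambda>p. f p ^ k)"
  by (induction k) (use hom_const[of 1] hom_mult in auto)

lemma hom_diff: "hom n f \<Longrightarrow> hom n g \<Longrightarrow> hom n (\<lambda>p. f p - g p)"
  using hom_add[of n f "\<lambda>p. (-1) * g p"] hom_scale[of n g "-1"] by simp

lemma hom_homogeneous: "hom n f \<Longrightarrow> f (t *s p) = t ^ n * f p"
proof (induction n arbitrary: f)
  case (Suc n)
  from Suc.prems obtain f1 f2 f3 where
    *: "hom n f1" "hom n f2" "hom n f3" "f = (\<lambda>p. p$1 * f1 p + p$2 * f2 p + p$3 * f3 p)" by auto
  show ?case unfolding *(4) by (simp add: Suc.IH * algebra_simps)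
qed auto

text \<open>Being polynomial along every line is inherited by sums and products without any
  bookkeeping of degrees, and it suffices for the absence of zero divisors.\<close>

definition poly_on_lines :: "(complex^3 \<Rightarrow> complex) \<Rightarrow> bool" where
  "poly_on_lines f \<longleftrightarrow> (\<forall>p v. \<exists>q. \<forall>t. f (p + t *s v) = poly q t)"

lemma pol_add: "poly_on_lines f \<Longrightarrow> poly_on_lines g \<Longrightarrow> poly_on_lines (\<lambda>p. f p + g p)"
  unfolding poly_on_lines_def by (metis poly_add)

lemma pol_mult: "poly_on_lines f \<Longrightarrow> poly_on_lines g \<Longrightarrow> poly_on_lines (\<lambda>p. f p * g p)"
  unfolding poly_on_lines_def by (metis poly_mult)

lemma pol_const: "poly_on_lines (\<lambda>_. c)"
  unfolding poly_on_lines_def by (auto intro!: exI[of _ "[:c:]"])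

lemma pol_coord: "poly_on_lines (\<lambda>p. p$i)"
  unfolding poly_on_lines_def by (auto intro!: exI[of _ "[:_$i, _$i:]"])

lemma pol_hom: "hom n f \<Longrightarrow> poly_on_lines f"
  by (induction n arbitrary: f) (auto intro!: pol_add pol_mult pol_const pol_coord)

lemma pol_dot: "poly_on_lines (\<lambda>p. dot L p)"
  unfolding dot_def by (intro pol_add pol_mult pol_const pol_coord)

lemma pol_prod_list: "poly_on_lines (\<lambda>p. \<Prod>L\<leftarrow>Ls. dot L p)"
  by (induction Ls) (auto intro: pol_const pol_mult pol_dot)

lemma pol_domain:
  assumes "poly_on_lines f" "poly_on_lines g" "\<And>p. f p * g p = 0"
  shows "(\<forall>p. f p = 0) \<or> (\<forall>p. g p = 0)"
proof (rule ccontr)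
  assume "\<not> ?thesis"
  then obtain a b where ab: "f a \<noteq> 0" "g b \<noteq> 0" by auto
  obtain q where q: "\<And>t. f (a + t *s (b - a)) = poly q t" using assms(1) unfolding poly_on_lines_def by metis
  obtain r where r: "\<And>t. g (a + t *s (b - a)) = poly r t" using assms(2) unfolding poly_on_lines_def by metis
  have "q \<noteq> 0" using q[of 0] ab by auto
  moreover have "r \<noteq> 0" using r[of 1] ab by auto
  ultimately have "q * r \<noteq> 0" by simp
  moreover have "poly (q * r) t = 0" for t using assms(3) by (simp flip: q r)
  ultimately show False using poly_all_0_iff_0 by blast
qed

lemma pol_cancel_dot:
  assumes "poly_on_lines f" "poly_on_lines g" "L \<noteq> 0" "\<And>p. dot L p * f p = dot L p * g p"
  shows "f p = g p"
proof -
  have "poly_on_lines (\<lambda>p. f p + (-1) * g p)" using assms by (intro pol_add pol_mult pol_const)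
  from pol_domain[OF pol_dot this, of L] assms show ?thesis
    by (auto simp: algebra_simps dest: dot_all_0)
qed

text \<open>Directional derivatives at a point depend linearly on the direction.  This is what lets the
  field act as a derivation in \<open>infl_gauge\<close> and \<open>infl_transport\<close>.\<close>

lemma hom_gradient:
  assumes "hom n f"
  obtains G where "\<And>p v. ((\<lambda>t. f (p + t *s v)) has_field_derivative dot (G p) v) (at 0)"
proof -
  have "\<exists>G. \<forall>p v. ((\<lambda>t. f (p + t *s v)) has_field_derivative dot (G p) v) (at 0)"
    using assms
  proof (induction n arbitrary: f)
    case 0 then show ?case by (auto intro!: exI[of _ "\<lambda>_. 0"])
  next
    case (Suc n)
    from Suc.prems obtain f1 f2 f3 where
      *: "hom n f1" "hom n f2" "hom n f3" "f = (\<lambda>p. p$1 * f1 p + p$2 * f2 p + p$3 * f3 p)" by auto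
    obtain G1 G2 G3 where G: "\<And>p v. ((\<lambda>t. f1 (p + t *s v)) has_field_derivative dot (G1 p) v) (at 0)"
      "\<And>p v. ((\<lambda>t. f2 (p + t *s v)) has_field_derivative dot (G2 p) v) (at 0)"
      "\<And>p v. ((\<lambda>t. f3 (p + t *s v)) has_field_derivative dot (G3 p) v) (at 0)"
      using Suc.IH[OF *(1)] Suc.IH[OF *(2)] Suc.IH[OF *(3)] by blast
    show ?case
    proof (rule exI, intro allI)
      fix p v
      show "((\<lambda>t. f (p + t *s v)) has_field_derivative
          dot (p$1 *s G1 p + p$2 *s G2 p + p$3 *s G3 p + vector [f1 p, f2 p, f3 p]) v) (at 0)"
        unfolding *(4)
        by (auto intro!: derivative_eq_intros G simp: algebra_simps) (simp add: dot_def algebra_simps)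
    qed
  qed
  then show ?thesis using that by blast
qed

section \<open>Cubic fields and their inflection polynomial\<close>

text \<open>The form \<open>i\<^sub>R i\<^sub>Z (dx \<and> dy \<and> dz)\<close>, in coordinates.\<close>

definition field_form :: "(complex^3 \<Rightarrow> complex^3) \<Rightarrow> complex^3 \<Rightarrow> complex^3" where
  "field_form Z p = ccross (Z p) p"

definition field_square :: "(complex^3 \<Rightarrow> complex^3) \<Rightarrow> complex^3 \<Rightarrow> complex^3" where
  "field_square Z p = (\<chi> i. deriv (\<lambda>t. Z (p + t *s Z p) $ i) 0)"

definition infl :: "(complex^3 \<Rightarrow> complex^3) \<Rightarrow> complex^3 \<Rightarrow> complex" where
  "infl Z p = dot p (ccross (Z p) (field_square Z p))"

text \<open>Coprimality of the coefficients of the form enters the classification through the last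
  condition, which excludes linear common factors.\<close>

definition convex_field :: "(complex^3 \<Rightarrow> complex^3) \<Rightarrow> (complex^3) list \<Rightarrow> bool" where
  "convex_field Z Ls \<longleftrightarrow>
     (\<forall>i. hom 3 (\<lambda>p. Z p $ i)) \<and>
     (\<exists>c. c \<noteq> 0 \<and> (\<forall>p. infl Z p = c * (\<Prod>L\<leftarrow>Ls. dot L p))) \<and>
     (\<forall>L\<in>set Ls. L \<noteq> 0 \<and> (\<forall>p. dot L p = 0 \<longrightarrow> dot L (Z p) = 0)) \<and>
     (\<forall>L. L \<noteq> 0 \<longrightarrow> (\<exists>p. dot L p = 0 \<and> field_form Z p \<noteq> 0))"

lemma field_form_gauge: "field_form (\<lambda>p. s *s Z p + g p *s p) p = s *s field_form Z p"
  by (simp add: field_form_def vec3_eq_iff algebra_simps)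

text \<open>With \<open>W = s Z + g R\<close>, homogeneity of \<open>Z\<close> makes \<open>W(W) - s\<^sup>2 Z(Z)\<close> a combination of \<open>Z\<close> and \<open>R\<close>,
  which the determinant does not see.\<close>

lemma infl_gauge:
  assumes Z: "\<And>i. hom 3 (\<lambda>p. Z p $ i)" and g: "hom 2 g"
  shows "infl (\<lambda>p. s *s Z p + g p *s p) p = s^3 * infl Z p"
proof -
  let ?W = "\<lambda>p. s *s Z p + g p *s p"
  have "\<exists>G. \<forall>p v. ((\<lambda>t. Z (p + t *s v) $ i) has_field_derivative dot (G p) v) (at 0)" for i
    using hom_gradient[OF Z[of i]] by metis
  then obtain G where G: "\<And>i p v. ((\<lambda>t. Z (p + t *s v) $ i) has_field_derivative dot (G i p) v) (at 0)"
    by metis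
  obtain H where H: "\<And>p v. ((\<lambda>t. g (p + t *s v)) has_field_derivative dot (H p) v) (at 0)"
    using hom_gradient[OF g] by metis
  have euler: "dot (G i p) p = 3 * Z p $ i" for i p
  proof -
    have "Z (p + t *s p) $ i = (1 + t)^3 * Z p $ i" for t
      using hom_homogeneous[OF Z[of i], of "1+t" p] by (simp add: vector_sadd_rdistrib)
    then have "((\<lambda>t. (1+t)^3 * Z p $ i) has_field_derivative dot (G i p) p) (at 0)"
      using G[of p p i] by simp
    moreover have "((\<lambda>t. (1+t)^3 * Z p $ i) has_field_derivative 3 * Z p $ i) (at 0)"
      by (auto intro!: derivative_eq_intros)
    ultimately show ?thesis using DERIV_unique by blast
  qed
  have 1: "field_square Z p $ i = dot (G i p) (Z p)" for i
    unfolding field_square_def by (simp add: DERIV_imp_deriv[OF G])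
  have 2: "field_square ?W p $ i = s^2 * field_square Z p $ i + 4 * s * g p * Z p $ i
      + (g p ^2 + dot (H p) (?W p)) * p $ i" for i
  proof -
    define w where "w = ?W p"
    have "((\<lambda>t. s * Z (p + t *s w) $ i + g (p + t *s w) * (p $ i + w $ i * t)) has_field_derivative
        (s * dot (G i p) w + (dot (H p) w * p $ i + g p * w $ i))) (at 0)"
      by (rule DERIV_cong[OF DERIV_add[OF DERIV_cmult[OF G] DERIV_mult[OF H DERIV_add[OF DERIV_const DERIV_cmult_Id]]]])
         (simp add: algebra_simps)
    then have "((\<lambda>t. ?W (p + t *s ?W p) $ i) has_field_derivative
        (s * dot (G i p) (?W p) + (dot (H p) (?W p) * p $ i + g p * ?W p $ i))) (at 0)"
      unfolding w_def by (simp add: algebra_simps)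
    then have "field_square ?W p $ i = s * dot (G i p) (?W p) + (dot (H p) (?W p) * p $ i + g p * ?W p $ i)"
      unfolding field_square_def by (simp add: DERIV_imp_deriv del: dot_simps)
    then show ?thesis by (simp add: 1 euler algebra_simps power2_eq_square)
  qed
  show ?thesis
    unfolding infl_def dot_def ccross_nth 2 vector_add_component vector_smult_component
    by algebra
qed

lemma matrix_inv: assumes "invertible (M :: complex^3^3)"
  shows "M ** matrix_inv M = mat 1" "matrix_inv M ** M = mat 1"
  using someI_ex[OF assms[unfolded invertible_def]] by (auto simp: matrix_inv_def)

definition transport :: "complex^3^3 \<Rightarrow> (complex^3 \<Rightarrow> complex^3) \<Rightarrow> complex^3 \<Rightarrow> complex^3" where
  "transport M Z p = matrix_inv M *v Z (M *v p)"

lemma matrix_inv3: assumes "invertible (M :: complex^3^3)"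
  shows "M *v (matrix_inv M *v p) = p" "matrix_inv M *v (M *v p) = p"
  using matrix_inv[OF assms] by (simp_all add: matrix_vector_mul_assoc)

lemma field_form_transport:
  assumes "invertible M"
  shows "field_form Z (M *v q) v* M = det M *s field_form (transport M Z) q"
  using ccross_mult[of M "transport M Z q" q] assms
  by (simp add: field_form_def transport_def matrix_inv3)

lemma infl_transport:
  assumes Z: "\<And>i. hom 3 (\<lambda>p. Z p $ i)" and M: "invertible M"
  shows "infl Z (M *v q) = det M * infl (transport M Z) q"
proof -
  have "\<exists>G. \<forall>p v. ((\<lambda>t. Z (p + t *s v) $ i) has_field_derivative dot (G p) v) (at 0)" for i
    using hom_gradient[OF Z[of i]] by metis
  then obtain G where G: "\<And>i p v. ((\<lambda>t. Z (p + t *s v) $ i) has_field_derivative dot (G i p) v) (at 0)"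
    by metis
  let ?N = "matrix_inv M"
  have arg: "M *v (q + t *s (?N *v v)) = M *v q + t *s v" for t v
    by (simp add: matrix_vector_right_distrib vector_scalar_commute matrix_inv3[OF M])
  have "field_square (transport M Z) q $ i = (?N *v field_square Z (M *v q)) $ i" for i
  proof -
    have "((\<lambda>t. ?N$i$1 * Z (M *v q + t *s Z (M *v q)) $ 1 + ?N$i$2 * Z (M *v q + t *s Z (M *v q)) $ 2
        + ?N$i$3 * Z (M *v q + t *s Z (M *v q)) $ 3) has_field_derivative
       ?N$i$1 * dot (G 1 (M *v q)) (Z (M *v q)) + ?N$i$2 * dot (G 2 (M *v q)) (Z (M *v q)) + ?N$i$3 * dot (G 3 (M *v q)) (Z (M *v q))) (at 0)"
      by (intro DERIV_add DERIV_cmult G)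
    from DERIV_imp_deriv[OF this] show ?thesis
      unfolding field_square_def transport_def arg
      by (simp add: mv3_nth DERIV_imp_deriv[OF G])
  qed
  then have fs: "field_square (transport M Z) q = ?N *v field_square Z (M *v q)" by (simp add: vec_eq_iff)
  show ?thesis
    using det3_mult[of M q "transport M Z q" "field_square (transport M Z) q"]
    by (simp add: infl_def fs matrix_inv3[OF M]) (simp add: transport_def matrix_inv3[OF M])
qed

lemma convex_field_gauge:
  assumes "convex_field Z Ls" "hom 2 g" "s \<noteq> 0"
  shows "convex_field (\<lambda>p. s *s Z p + g p *s p) Ls"
proof -
  have Z: "\<And>i. hom 3 (\<lambda>p. Z p $ i)" using assms by (auto simp: convex_field_def)
  obtain c where c: "c \<noteq> 0" "\<And>p. infl Z p = c * (\<Prod>L\<leftarrow>Ls. dot L p)" using assms(1) unfolding convex_field_def by blast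
  have three: "Suc 2 = 3" by simp
  have h: "hom 3 (\<lambda>p. (s *s Z p + g p *s p) $ i)" for i
    using hom_add[OF hom_scale[OF Z[of i], of s] hom_coord[OF assms(2), of i, unfolded three]]
    by (simp add: algebra_simps)
  show ?thesis
    unfolding convex_field_def field_form_gauge
  proof (intro conjI)
    show "\<exists>c. c \<noteq> 0 \<and> (\<forall>p. infl (\<lambda>p. s *s Z p + g p *s p) p = c * (\<Prod>L\<leftarrow>Ls. dot L p))"
      by (rule exI[of _ "s^3 * c"]) (use c assms in \<open>auto simp: infl_gauge[OF Z assms(2)]\<close>)
  qed (use assms h in \<open>auto simp: convex_field_def\<close>)
qed

lemma vm_eq_0: assumes "invertible (M :: complex^3^3)" "L v* M = 0" shows "L = 0"
proof (rule dot_all_0, rule allI)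
  fix p show "dot L p = 0" using dot_vm[of L M "matrix_inv M *v p"] assms by (simp add: matrix_inv3)
qed

lemma dot_matrix_inv: assumes "invertible M" shows "dot (L v* M) (matrix_inv M *v a) = dot L a"
  by (simp add: dot_vm matrix_inv3[OF assms])

lemma convex_field_transport:
  assumes cf: "convex_field Z Ls" and M: "invertible M"
  shows "convex_field (transport M Z) (map (\<lambda>L. L v* M) Ls)"
proof -
  have Z: "\<And>i. hom 3 (\<lambda>p. Z p $ i)" using cf by (auto simp: convex_field_def)
  have dM: "det M \<noteq> 0" using M invertible_det_nz by blast
  obtain c where c: "c \<noteq> 0" "\<And>p. infl Z p = c * (\<Prod>L\<leftarrow>Ls. dot L p)" using cf unfolding convex_field_def by blast
  have h: "hom 3 (\<lambda>p. transport M Z p $ i)" for i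
    unfolding transport_def mv3_nth by (intro hom_add hom_scale hom_linear Z)
  show ?thesis
    unfolding convex_field_def
  proof (intro conjI allI ballI impI)
    show "\<exists>c. c \<noteq> 0 \<and> (\<forall>p. infl (transport M Z) p = c * (\<Prod>L\<leftarrow>map (\<lambda>L. L v* M) Ls. dot L p))"
    proof (rule exI[of _ "c / det M"], intro conjI allI)
      fix p
      have "det M * infl (transport M Z) p = c * (\<Prod>L\<leftarrow>Ls. dot (L v* M) p)"
        using infl_transport[OF Z M, of p] c(2) by (simp add: dot_vm)
      then show "infl (transport M Z) p = c / det M * (\<Prod>L\<leftarrow>map (\<lambda>L. L v* M) Ls. dot L p)"
        using dM by (simp add: field_simps o_def)
    qed (use c dM in auto)
  next
    fix L assume "L \<in> set (map (\<lambda>L. L v* M) Ls)"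
    then obtain K where K: "K \<in> set Ls" "L = K v* M" by auto
    show "L \<noteq> 0" using K vm_eq_0[OF M] cf by (auto simp: convex_field_def)
    fix p assume "dot L p = 0"
    then have "dot K (Z (M *v p)) = 0" using K cf by (simp add: convex_field_def dot_vm)
    then show "dot L (transport M Z p) = 0" by (simp add: K transport_def dot_matrix_inv[OF M])
  next
    fix L :: "complex^3" assume "L \<noteq> 0"
    have "matrix_inv M ** M = mat 1" "M ** matrix_inv M = mat 1" using matrix_inv[OF M] by simp_all
    then have iM: "invertible (matrix_inv M)" unfolding invertible_def by blast
    have "L v* matrix_inv M \<noteq> 0" using vm_eq_0[OF iM] \<open>L \<noteq> 0\<close> by blast
    then obtain p where p: "dot (L v* matrix_inv M) p = 0" "field_form Z p \<noteq> 0" using cf unfolding convex_field_def by blast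
    let ?q = "matrix_inv M *v p"
    have "field_form Z p v* M = det M *s field_form (transport M Z) ?q"
      using field_form_transport[OF M, of Z ?q] by (simp add: matrix_inv3[OF M])
    then have "field_form (transport M Z) ?q \<noteq> 0" using vm_eq_0[OF M] p(2) by force
    then show "\<exists>p. dot L p = 0 \<and> field_form (transport M Z) p \<noteq> 0" using p(1) by (auto simp: dot_vm)
  qed (rule h)
qed

lemma convex_field_length: assumes "convex_field Z Ls" shows "length Ls = 9"
proof -
  have Z: "\<And>i. hom 3 (\<lambda>p. Z p $ i)" using assms by (auto simp: convex_field_def)
  obtain c where c: "c \<noteq> 0" "\<And>p. infl Z p = c * (\<Prod>L\<leftarrow>Ls. dot L p)" using assms(1) unfolding convex_field_def by blast
  have "\<exists>G. \<forall>p v. ((\<lambda>t. Z (p + t *s v) $ i) has_field_derivative dot (G p) v) (at 0)" for i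
    using hom_gradient[OF Z[of i]] by metis
  then obtain G where G: "\<And>i p v. ((\<lambda>t. Z (p + t *s v) $ i) has_field_derivative dot (G i p) v) (at 0)"
    by metis
  have Zs: "Z (s *s p) = s^3 *s Z p" for s p using hom_homogeneous[OF Z] by (simp add: vec_eq_iff)
  have fsq: "field_square Z (2 *s p) = 32 *s field_square Z p" for p
  proof -
    have "field_square Z (2 *s p) $ i = 32 * field_square Z p $ i" for i
    proof -
      have eq: "Z (2 *s p + t *s Z (2 *s p)) $ i = 8 * Z (p + (4 * t) *s Z p) $ i" for t
      proof -
        have "2 *s p + t *s Z (2 *s p) = 2 *s (p + (4 * t) *s Z p)"
          by (simp add: Zs vec_eq_iff algebra_simps)
        then show ?thesis using Zs[of 2 "p + (4 * t) *s Z p"] by simp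
      qed
      have "((\<lambda>t. Z (p + t *s Z p) $ i) has_field_derivative dot (G i p) (Z p)) (at (4*0))" using G by simp
      then have "((\<lambda>t. 8 * Z (p + (4*t) *s Z p) $ i) has_field_derivative 8 * (dot (G i p) (Z p) * 4)) (at 0)"
        by (intro DERIV_cmult DERIV_chain2[where g="\<lambda>t. 4*t"]) (auto intro!: derivative_eq_intros)
      from DERIV_imp_deriv[OF this] have "field_square Z (2 *s p) $ i = 8 * (dot (G i p) (Z p) * 4)"
        by (simp only: field_square_def vec_lambda_beta eq)
      moreover have "field_square Z p $ i = dot (G i p) (Z p)"
        by (simp only: field_square_def vec_lambda_beta DERIV_imp_deriv[OF G])
      ultimately show ?thesis by simp
    qed
    then show ?thesis by (simp add: vec_eq_iff)
  qed
  have "infl Z (2 *s p) = 2^9 * infl Z p" for p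
    unfolding infl_def fsq Zs dot_def ccross_nth vector_smult_component by algebra
  moreover have "(\<Prod>L\<leftarrow>Ls. dot L (2 *s p)) = 2^length Ls * (\<Prod>L\<leftarrow>Ls. dot L p)" for p
    by (induction Ls) auto
  ultimately have eq: "2^length Ls * infl Z p = 2^9 * infl Z p" for p using c(2) by (metis mult.left_commute)
  have nz: "\<exists>p. (\<Prod>L\<leftarrow>Ls. dot L p) \<noteq> 0"
    using assms unfolding convex_field_def
  proof (induction Ls)
    case (Cons L Ls)
    have "L \<noteq> 0" using Cons.prems by auto
    then have "\<not> (\<forall>p. dot L p = 0)" using dot_all_0 by blast
    moreover have "\<not> (\<forall>p. (\<Prod>L\<leftarrow>Ls. dot L p) = 0)"
    proof -
      have "\<And>Ls :: (complex^3) list. (\<forall>L\<in>set Ls. L \<noteq> 0) \<Longrightarrow> \<not> (\<forall>p. (\<Prod>L\<leftarrow>Ls. dot L p) = 0)"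
      proof -
        fix Ls :: "(complex^3) list" assume "\<forall>L\<in>set Ls. L \<noteq> 0"
        then show "\<not> (\<forall>p. (\<Prod>L\<leftarrow>Ls. dot L p) = 0)"
        proof (induction Ls)
          case (Cons a as)
          show ?case
          proof
            assume "\<forall>p. (\<Prod>L\<leftarrow>a # as. dot L p) = 0"
            then have "(\<forall>p. dot a p = 0) \<or> (\<forall>p. (\<Prod>L\<leftarrow>as. dot L p) = 0)"
              by (intro pol_domain pol_dot pol_prod_list) auto
            then show False using Cons dot_all_0 by auto
          qed
        qed simp
      qed
      then show ?thesis using Cons.prems by auto
    qed
    ultimately show ?case using pol_domain[OF pol_dot pol_prod_list, of L Ls] by auto
  qed auto
  then obtain p where "infl Z p \<noteq> 0" using c by auto
  with eq[of p] have "(2::complex)^length Ls = 2^9" by (metis mult_right_cancel)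
  then have "norm ((2::complex)^length Ls) = norm ((2::complex)^9)" by simp
  then have "(2::real)^length Ls = 2^9" by (simp add: norm_power)
  then show ?thesis using power_inject_exp[of "2::real" "length Ls" 9] by simp
qed

section \<open>Binary and ternary forms in coefficients\<close>

definition bq1 :: "complex \<Rightarrow> complex \<Rightarrow> complex \<Rightarrow> complex \<Rightarrow> complex" where
  "bq1 a b x y = a * x + b * y"
definition bq2 :: "complex \<Rightarrow> complex \<Rightarrow> complex \<Rightarrow> complex \<Rightarrow> complex \<Rightarrow> complex" where
  "bq2 a b c x y = a * x^2 + b * x * y + c * y^2"
definition bq3 :: "complex \<Rightarrow> complex \<Rightarrow> complex \<Rightarrow> complex \<Rightarrow> complex \<Rightarrow> complex \<Rightarrow> complex" where
  "bq3 a b c d x y = a * x^3 + b * x^2 * y + c * x * y^2 + d * y^3"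

lemmas bq_defs = bq1_def bq2_def bq3_def

text \<open>The ten coefficients are ordered by the power of \<open>z\<close>: \<open>a 0\<close> to \<open>a 3\<close> belong to \<open>z\<^sup>0\<close>, \<open>a 4\<close> to \<open>a 6\<close>
  to \<open>z\<close>, \<open>a 7\<close> and \<open>a 8\<close> to \<open>z\<^sup>2\<close>, and \<open>a 9\<close> to \<open>z\<^sup>3\<close>.  Expansions in \<open>z\<close> at the point \<open>(0, 0, 1)\<close> are used
  throughout.\<close>

definition cubic :: "(nat \<Rightarrow> complex) \<Rightarrow> complex \<Rightarrow> complex \<Rightarrow> complex \<Rightarrow> complex" where
  "cubic a x y z = bq3 (a 0) (a 1) (a 2) (a 3) x y + z * bq2 (a 4) (a 5) (a 6) x y
     + z^2 * bq1 (a 7) (a 8) x y + z^3 * a 9"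
definition cubic_x :: "(nat \<Rightarrow> complex) \<Rightarrow> complex \<Rightarrow> complex \<Rightarrow> complex \<Rightarrow> complex" where
  "cubic_x a x y z = bq2 (3 * a 0) (2 * a 1) (a 2) x y + z * bq1 (2 * a 4) (a 5) x y + z^2 * a 7"
definition cubic_y :: "(nat \<Rightarrow> complex) \<Rightarrow> complex \<Rightarrow> complex \<Rightarrow> complex \<Rightarrow> complex" where
  "cubic_y a x y z = bq2 (a 1) (2 * a 2) (3 * a 3) x y + z * bq1 (a 5) (2 * a 6) x y + z^2 * a 8"
definition cubic_z :: "(nat \<Rightarrow> complex) \<Rightarrow> complex \<Rightarrow> complex \<Rightarrow> complex \<Rightarrow> complex" where
  "cubic_z a x y z = bq2 (a 4) (a 5) (a 6) x y + 2 * z * bq1 (a 7) (a 8) x y + 3 * z^2 * a 9"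

lemmas cubic_defs = cubic_def cubic_x_def cubic_y_def cubic_z_def bq_defs

lemma cubic_deriv:
  "((\<lambda>t. cubic a (x+t*u) (y+t * v) (z+t*w)) has_field_derivative
     cubic_x a x y z * u + cubic_y a x y z * v + cubic_z a x y z * w) (at 0)"
  unfolding cubic_defs
  by (auto intro!: derivative_eq_intros) (algebra)

lemma infl_cubic:
  assumes "\<And>x y z. Z (vector [x, y, z]) = vector [A x y z, B x y z, C x y z]"
    and "\<And>x y z u v w. ((\<lambda>t. A (x+t*u) (y+t * v) (z+t*w)) has_field_derivative (Ax x y z * u + Ay x y z * v + Az x y z * w)) (at 0)"
    and "\<And>x y z u v w. ((\<lambda>t. B (x+t*u) (y+t * v) (z+t*w)) has_field_derivative (Bx x y z * u + By x y z * v + Bz x y z * w)) (at 0)"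
    and "\<And>x y z u v w. ((\<lambda>t. C (x+t*u) (y+t * v) (z+t*w)) has_field_derivative (Cx x y z * u + Cy x y z * v + Cz x y z * w)) (at 0)"
  shows "infl Z (vector [x, y, z]) =
     (let a = A x y z; b = B x y z; c = C x y z;
          a' = Ax x y z * a + Ay x y z * b + Az x y z * c;
          b' = Bx x y z * a + By x y z * b + Bz x y z * c;
          c' = Cx x y z * a + Cy x y z * b + Cz x y z * c
      in x * (b * c' - c * b') + y * (c * a' - a * c') + z * (a * b' - b * a'))"
proof -
  let ?p = "vector [x, y, z] :: complex^3"
  have arg: "?p + t *s vector [A x y z, B x y z, C x y z] = vector [x + t * A x y z, y + t * B x y z, z + t * C x y z]" for t
    by (simp add: vec3_eq_iff)
  have "field_square Z ?p = vector
    [Ax x y z * A x y z + Ay x y z * B x y z + Az x y z * C x y z,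
     Bx x y z * A x y z + By x y z * B x y z + Bz x y z * C x y z,
     Cx x y z * A x y z + Cy x y z * B x y z + Cz x y z * C x y z]"
    unfolding field_square_def assms(1) arg
    by (simp add: vec3_eq_iff DERIV_imp_deriv[OF assms(2)] DERIV_imp_deriv[OF assms(3)] DERIV_imp_deriv[OF assms(4)])
  then show ?thesis by (simp add: infl_def assms(1) dot_def Let_def algebra_simps)
qed

lemma hom1_coeffs: assumes "hom 1 f" shows "\<exists>a b c. \<forall>x y z. f (vector [x, y, z]) = a * x + b * y + c * z"
proof -
  have "hom (Suc 0) f" using assms by simp
  then obtain f1 f2 f3 where *: "hom 0 f1" "hom 0 f2" "hom 0 f3"
    "f = (\<lambda>p. p$1 * f1 p + p$2 * f2 p + p$3 * f3 p)" unfolding hom.simps(2) by blast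
  then obtain a b c where "f1 = (\<lambda>_. a)" "f2 = (\<lambda>_. b)" "f3 = (\<lambda>_. c)" by auto
  then show ?thesis unfolding *(4)
    by (rule_tac x=a in exI, rule_tac x=b in exI, rule_tac x=c in exI) (simp add: algebra_simps)
qed

lemma hom2_coeffs: assumes "hom 2 f"
  shows "\<exists>a b c d e g. \<forall>x y z. f (vector [x, y, z]) = bq2 a b c x y + z * bq1 d e x y + z^2 * g"
proof -
  have "hom (Suc 1) f" using assms by (simp add: numeral_2_eq_2)
  then obtain f1 f2 f3 where *: "hom 1 f1" "hom 1 f2" "hom 1 f3"
    "f = (\<lambda>p. p$1 * f1 p + p$2 * f2 p + p$3 * f3 p)" unfolding hom.simps(2) by blast
  obtain a1 b1 c1 where 1: "\<And>x y z. f1 (vector [x, y, z]) = a1 * x + b1 * y + c1 * z" using hom1_coeffs[OF *(1)] by blast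
  obtain a2 b2 c2 where 2: "\<And>x y z. f2 (vector [x, y, z]) = a2 * x + b2 * y + c2 * z" using hom1_coeffs[OF *(2)] by blast
  obtain a3 b3 c3 where 3: "\<And>x y z. f3 (vector [x, y, z]) = a3 * x + b3 * y + c3 * z" using hom1_coeffs[OF *(3)] by blast
  have "f (vector [x, y, z]) = bq2 a1 (b1+a2) b2 x y + z * bq1 (c1+a3) (c2+b3) x y + z^2 * c3" for x y z
    unfolding *(4) 1 2 3 bq_defs by (simp add: algebra_simps power2_eq_square)
  then show ?thesis by blast
qed

lemma hom3_coeffs: assumes "hom 3 f"
  shows "\<exists>a. \<forall>x y z. f (vector [x, y, z]) = cubic a x y z"
proof -
  have "hom (Suc 2) f" using assms by (simp add: numeral_3_eq_3 numeral_2_eq_2 del: hom.simps)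
  then obtain f1 f2 f3 where *: "hom 2 f1" "hom 2 f2" "hom 2 f3"
    "f = (\<lambda>p. p$1 * f1 p + p$2 * f2 p + p$3 * f3 p)" unfolding hom.simps(2) by blast
  obtain a1 b1 c1 d1 e1 g1 where 1: "\<And>x y z. f1 (vector [x, y, z]) = bq2 a1 b1 c1 x y + z * bq1 d1 e1 x y + z^2 * g1"
    using hom2_coeffs[OF *(1)] by blast
  obtain a2 b2 c2 d2 e2 g2 where 2: "\<And>x y z. f2 (vector [x, y, z]) = bq2 a2 b2 c2 x y + z * bq1 d2 e2 x y + z^2 * g2"
    using hom2_coeffs[OF *(2)] by blast
  obtain a3 b3 c3 d3 e3 g3 where 3: "\<And>x y z. f3 (vector [x, y, z]) = bq2 a3 b3 c3 x y + z * bq1 d3 e3 x y + z^2 * g3"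
    using hom2_coeffs[OF *(3)] by blast
  define a where "a n = [a1, b1+a2, c1+b2, c2, d1+a3, e1+d2+b3, e2+c3, g1+d3, g2+e3, g3] ! n" for n
  have "f (vector [x, y, z]) = cubic a x y z" for x y z
    unfolding *(4) 1 2 3 bq_defs cubic_def vector_3 a_def by (simp add: algebra_simps power2_eq_square power3_eq_cube)
  then show ?thesis by blast
qed

lemma hom_quadratic: "hom 2 (\<lambda>p. bq2 a b c (p$1) (p$2) + p$3 * bq1 d e (p$1) (p$2) + (p$3)^2 * g)"
proof -
  have h: "hom 2 (\<lambda>p. p$i * (p$j * 1))" for i j :: 3
    using hom_coord[OF hom_coord[OF hom_const[of 1]], of i j] by (simp add: numeral_2_eq_2 del: hom.simps)
  have "hom 2 (\<lambda>p. a * (p$1 * (p$1 * 1)) + b * (p$1 * (p$2 * 1)) + c * (p$2 * (p$2 * 1))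
    + d * (p$3 * (p$1 * 1)) + e * (p$3 * (p$2 * 1)) + g * (p$3 * (p$3 * 1)))"
    by (intro hom_add hom_scale h)
  then show ?thesis unfolding bq_defs by (simp add: algebra_simps power2_eq_square)
qed

section \<open>Equivalence of fields and adapted coordinates\<close>

text \<open>A linear map pulls the foliation of \<open>Z\<close> back to the foliation of \<open>Z'\<close>.\<close>

definition field_equiv where
  "field_equiv Z Z' \<longleftrightarrow> (\<exists>M :: complex^3^3. invertible M \<and> (\<exists>s. s \<noteq> 0 \<and>
     (\<forall>p. field_form Z (M *v p) v* M = s *s field_form Z' p)))"

text \<open>A singular point of algebraic multiplicity at least two.\<close>

definition degenerate_at :: "(complex^3 \<Rightarrow> complex^3) \<Rightarrow> complex^3 \<Rightarrow> bool" where
  "degenerate_at Z p \<longleftrightarrow> p \<noteq> 0 \<and> (\<forall>v i. \<exists>q. \<forall>t. field_form Z (p + t *s v) $ i = t^2 * poly q t)"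

lemma vm_id: "(v :: complex^3) v* mat 1 = v"
  by (simp add: vec3_eq_iff vm3_nth mat_def)

lemma invertible_one: "invertible (mat 1 :: complex^3^3)"
  unfolding invertible_def by (rule exI[of _ "mat 1"]) simp

lemma vm_assoc: "(L v* M) v* N = L v* ((M :: complex^3^3) ** N)"
  by (simp add: vector_matrix_mul_assoc)

lemma vm_scale: "(s *s L) v* (M :: complex^3^3) = s *s (L v* M)"
  by (simp add: vec3_eq_iff vm3_nth algebra_simps)

lemma invertible_inv: "invertible (M :: complex^3^3) \<Longrightarrow> invertible (matrix_inv M)"
  using matrix_inv unfolding invertible_def by blast

lemma vm_inv: assumes "invertible (M :: complex^3^3)"
  shows "L v* M v* matrix_inv M = L" "L v* matrix_inv M v* M = L"
  unfolding vm_assoc matrix_inv[OF assms] vm_id by simp_all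

lemma field_equiv_transport:
  assumes M: "invertible M" and e: "field_equiv (transport M Z) Y"
  shows "field_equiv Z Y"
proof -
  obtain N s where N: "invertible N" "s \<noteq> 0" "\<And>p. field_form (transport M Z) (N *v p) v* N = s *s field_form Y p"
    using e unfolding field_equiv_def by blast
  have "field_form Z ((M ** N) *v p) v* (M ** N) = (det M * s) *s field_form Y p" for p
  proof -
    have "field_form Z ((M ** N) *v p) v* (M ** N) = (field_form Z (M *v (N *v p)) v* M) v* N"
      by (simp only: vm_assoc[symmetric] matrix_vector_mul_assoc[symmetric])
    also have "\<dots> = (det M * s) *s field_form Y p"
      by (simp add: field_form_transport[OF M] vm_scale N(3))
    finally show ?thesis .
  qed
  moreover have "invertible (M ** N)" using M N(1) by (rule invertible_mult)
  moreover have "det M * s \<noteq> 0" using M N(2) invertible_det_nz by auto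
  ultimately show ?thesis unfolding field_equiv_def by blast
qed

lemma field_equiv_form:
  assumes "\<And>p. field_form Z' p = s *s field_form Z p" "s \<noteq> 0" "field_equiv Z' Y"
  shows "field_equiv Z Y"
proof -
  obtain N r where N: "invertible N" "r \<noteq> 0" "\<And>p. field_form Z' (N *v p) v* N = r *s field_form Y p"
    using assms unfolding field_equiv_def by blast
  have "field_form Z (N *v p) v* N = (r / s) *s field_form Y p" for p
  proof -
    have "s *s (field_form Z (N *v p) v* N) = r *s field_form Y p" using N(3)[of p] by (simp add: assms(1) vm_scale)
    then show ?thesis using assms(2) by (simp add: vec3_eq_iff field_simps)
  qed
  then show ?thesis unfolding field_equiv_def using N assms(2) by (metis divide_eq_0_iff)
qed

text \<open>The relation \<open>N Z(p) = s Y(N p) + g(p) N p\<close> says that \<open>N\<close> carries \<open>Z\<close> to \<open>Y\<close> modulo scalars and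
  the radial field.  It is checked on coordinates in each case of the classification.\<close>

lemma field_equivI:
  assumes N: "invertible N" and s: "s \<noteq> 0" and "\<And>p. N *v Z p = s *s Y (N *v p) + g p *s (N *v p)"
  shows "field_equiv Z Y"
proof -
  have "field_form (transport (matrix_inv N) Z) q = s *s field_form Y q" for q
  proof -
    have "matrix_inv (matrix_inv N) *v p = N *v p" for p
      using matrix_inv3(2)[OF invertible_inv[OF N], of "N *v p"] by (simp only: matrix_inv3(2)[OF N])
    then have "transport (matrix_inv N) Z q = s *s Y q + g (matrix_inv N *v q) *s q"
      by (simp add: transport_def assms(3) matrix_inv3[OF N])
    then show ?thesis by (simp add: field_form_def vec3_eq_iff algebra_simps)
  qed
  moreover have "field_equiv Y Y" unfolding field_equiv_def
    by (rule exI[of _ "mat 1"]) (auto simp: invertible_one vm_id intro!: exI[of _ 1])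
  ultimately have "field_equiv (transport (matrix_inv N) Z) Y"
    using s unfolding field_equiv_def by (auto intro!: exI[of _ "mat 1"] simp: invertible_one vm_id)
  then show ?thesis using field_equiv_transport[OF invertible_inv[OF N]] by blast
qed

lemma degenerate_form:
  assumes "\<And>p. field_form Z' p = field_form Z p" "degenerate_at Z' p" shows "degenerate_at Z p"
  using assms by (simp add: degenerate_at_def)

lemma degenerate_transport:
  assumes M: "invertible M" and d: "degenerate_at (transport M Z) q"
  shows "degenerate_at Z (M *v q)"
  unfolding degenerate_at_def
proof (intro conjI allI)
  show "M *v q \<noteq> 0" using matrix_inv3(2)[OF M, of q] d by (auto simp: degenerate_at_def)
  fix v i
  have "\<exists>r. \<forall>t. field_form (transport M Z) (q + t *s (matrix_inv M *v v)) $ j = t^2 * poly r t" for j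
    using d by (simp add: degenerate_at_def)
  then obtain r where r: "\<And>j t. field_form (transport M Z) (q + t *s (matrix_inv M *v v)) $ j = t^2 * poly (r j) t"
    by metis
  have "field_form Z (M *v q + t *s v) = (det M *s field_form (transport M Z) (q + t *s (matrix_inv M *v v))) v* matrix_inv M" for t
  proof -
    have "M *v (q + t *s (matrix_inv M *v v)) = M *v q + t *s v"
      by (simp add: matrix_vector_right_distrib vector_scalar_commute matrix_inv3[OF M])
    then show ?thesis using field_form_transport[OF M, of Z "q + t *s (matrix_inv M *v v)"] vm_inv(1)[OF M] by metis
  qed
  then show "\<exists>q'. \<forall>t. field_form Z (M *v q + t *s v) $ i = t\<^sup>2 * poly q' t"
    by (intro exI[of _ "smult (det M * matrix_inv M $1$i) (r 1) + smult (det M * matrix_inv M $2$i) (r 2) + smult (det M * matrix_inv M $3$i) (r 3)"])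
       (simp add: vm3_nth r algebra_simps)
qed

abbreviation "ex1 \<equiv> vector [1, 0, 0] :: complex^3"
abbreviation "ex2 \<equiv> vector [0, 1, 0] :: complex^3"
abbreviation "ex3 \<equiv> vector [0, 0, 1] :: complex^3"

lemma dot_ex [simp]: "dot ex1 p = p$1" "dot ex2 p = p$2" "dot ex3 p = p$3"
  "dot p ex1 = p$1" "dot p ex2 = p$2" "dot p ex3 = p$3"
  by (simp_all add: dot_def)

text \<open>The inverse of the matrix with rows \<open>K, L, N\<close> makes these forms the coordinates.\<close>

lemma adapt_rows:
  assumes d: "dot N (ccross K L) \<noteq> 0"
  obtains M where "invertible M" "K v* M = ex1" "L v* M = ex2" "N v* M = ex3"
proof -
  define R :: "complex^3^3" where "R = vector [K, L, N]"
  have "det R = dot N (ccross K L)" by (simp add: R_def det_3 dot_def algebra_simps)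
  then have R: "invertible R" using d by (simp add: invertible_det_nz)
  have "K = ex1 v* R" "L = ex2 v* R" "N = ex3 v* R" by (simp_all add: vec3_eq_iff vm3_nth R_def)
  then have "K v* matrix_inv R = ex1" "L v* matrix_inv R = ex2" "N v* matrix_inv R = ex3" using vm_inv(1)[OF R] by metis+
  then show ?thesis using that invertible_inv[OF R] by blast
qed

lemma mv_eqI: assumes "invertible M" "K v* M = ex1" "L v* M = ex2" "N v* M = ex3"
  shows "matrix_inv M *v p = vector [dot K p, dot L p, dot N p]"
proof -
  have "dot (A v* M) (matrix_inv M *v p) = dot A p" for A using dot_matrix_inv[OF assms(1)] by simp
  from this[of K] this[of L] this[of N] show ?thesis unfolding assms(2-4) by (simp add: vec3_eq_iff)
qed

lemma adapt_two:
  assumes "ccross K L \<noteq> 0" "p \<noteq> 0" "dot K p = 0" "dot L p = 0"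
  obtains M where "invertible M" "K v* M = ex1" "L v* M = ex2" "M *v ex3 = p"
proof -
  have "\<exists>N. dot N p \<noteq> 0"
  proof -
    have "dot p ex1 \<noteq> 0 \<or> dot p ex2 \<noteq> 0 \<or> dot p ex3 \<noteq> 0" using assms(2) by (auto simp: vec3_eq_iff)
    then show ?thesis by (auto simp: dot_def mult.commute intro: exI[of _ ex1] exI[of _ ex2] exI[of _ ex3])
  qed
  then obtain N0 where N0: "dot N0 p \<noteq> 0" by blast
  define N where "N = (1 / dot N0 p) *s N0"
  have N: "dot N p = 1" using N0 by (simp add: N_def)
  \<comment> \<open>the kernel of two independent linear forms is spanned by their cross product\<close>
  have "dot N p *s ccross K L = dot N (ccross K L) *s p"
  proof -
    have "dot N p *s ccross K L - dot N (ccross K L) *s p = ccross N (ccross (ccross K L) p)"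
      by (simp add: vec3_eq_iff dot_def algebra_simps)
    moreover have "ccross (ccross K L) p = dot K p *s L - dot L p *s K"
      by (simp add: vec3_eq_iff dot_def algebra_simps)
    ultimately show ?thesis using assms by (simp add: vec3_eq_iff)
  qed
  then have d: "dot N (ccross K L) \<noteq> 0" using assms(1) N by auto
  obtain M where M: "invertible M" "K v* M = ex1" "L v* M = ex2" "N v* M = ex3" using adapt_rows[OF d] .
  have "matrix_inv M *v p = ex3" using mv_eqI[OF M, of p] assms N by simp
  then have "M *v ex3 = p" using matrix_inv3(1)[OF M(1), of p] by simp
  then show ?thesis using that M by blast
qed

lemma dot_commute: "dot a b = dot b a" by (simp add: dot_def)

lemma adapt_one:
  assumes "L \<noteq> 0" "p \<noteq> 0" "dot L p = 0"
  obtains M where "invertible M" "L v* M = ex2" "M *v ex3 = p"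
proof -
  obtain w where w: "dot L w \<noteq> 0" using dot_all_0 assms(1) by blast
  let ?K = "ccross p w"
  have "ccross ?K L = dot L p *s w - dot L w *s p"
    by (simp add: vec3_eq_iff dot_def algebra_simps)
  then have "ccross ?K L \<noteq> 0" using w assms by (auto simp: vec3_eq_iff)
  moreover have "dot ?K p = 0" by (simp add: dot_def algebra_simps)
  ultimately show ?thesis using adapt_two[of ?K L p] assms that by metis
qed

lemma ccross_transport:
  assumes M: "invertible M" shows "ccross (K v* M) (L v* M) = 0 \<longleftrightarrow> ccross K L = 0"
proof -
  have e: "v v* M = transpose M *v v" for v :: "complex^3" and M :: "complex^3^3"
    by (simp add: vec3_eq_iff vm3_nth mv3_nth transpose_def)
  have eq: "ccross (K v* M) (L v* M) v* transpose M = det M *s ccross K L"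
    using ccross_mult[of "transpose M" K L] by (simp only: e det_transpose)
  have iT: "invertible (transpose M)" using M by (simp add: invertible_det_nz det_transpose)
  have dM: "det M \<noteq> 0" using M invertible_det_nz by blast
  show ?thesis
  proof
    assume "ccross (K v* M) (L v* M) = 0"
    then have "det M *s ccross K L = 0" by (simp flip: eq)
    then show "ccross K L = 0" using dM by simp
  next
    assume "ccross K L = 0"
    then have "ccross (K v* M) (L v* M) v* transpose M = 0" unfolding eq by simp
    then show "ccross (K v* M) (L v* M) = 0" by (rule vm_eq_0[OF iT])
  qed
qed

section \<open>Fields in the gauge of an invariant line\<close>

lemma bq_all_0:
  "(\<forall>x y. bq1 a b x y = 0) \<Longrightarrow> a = 0 \<and> b = 0"
  "(\<forall>x y. bq2 a b c x y = 0) \<Longrightarrow> a = 0 \<and> b = 0 \<and> c = 0"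
  "(\<forall>x y. bq3 a b c d x y = 0) \<Longrightarrow> a = 0 \<and> b = 0 \<and> c = 0 \<and> d = 0"
proof -
  assume "\<forall>x y. bq1 a b x y = 0"
  from this[rule_format, of 1 0] this[rule_format, of 0 1] show "a = 0 \<and> b = 0" by (simp add: bq1_def)
next
  assume h: "\<forall>x y. bq2 a b c x y = 0"
  have "poly [:c, b, a:] x = 0" for x using h[rule_format, of x 1] by (simp add: bq2_def algebra_simps power2_eq_square)
  then have "[:c, b, a:] = 0" using poly_all_0_iff_0 by blast
  then show "a = 0 \<and> b = 0 \<and> c = 0" by simp
next
  assume h: "\<forall>x y. bq3 a b c d x y = 0"
  have "poly [:d, c, b, a:] x = 0" for x
    using h[rule_format, of x 1] by (simp add: bq3_def algebra_simps power2_eq_square power3_eq_cube)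
  then have "[:d, c, b, a:] = 0" using poly_all_0_iff_0 by blast
  then show "a = 0 \<and> b = 0 \<and> c = 0 \<and> d = 0" by simp
qed

text \<open>If the line \<open>y = 0\<close> is invariant, the second component of \<open>Z\<close> is divisible by \<open>y\<close> and
  a multiple of the radial field cancels it (\<open>planar_gauge\<close>).  The polynomial \<open>planar_infl\<close> is then
  \<open>infl Z\<close> divided by \<open>- y\<close>, and its restriction to \<open>y = 0\<close> describes the intersections of the other
  lines with \<open>y = 0\<close>.\<close>

definition planar :: "(complex^3 \<Rightarrow> complex^3) \<Rightarrow> (nat \<Rightarrow> complex) \<Rightarrow> (nat \<Rightarrow> complex) \<Rightarrow> bool" where
  "planar Z a c \<longleftrightarrow> (\<forall>x y z. Z (vector [x, y, z]) = vector [cubic a x y z, 0, cubic c x y z])"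

definition planar_infl :: "(nat \<Rightarrow> complex) \<Rightarrow> (nat \<Rightarrow> complex) \<Rightarrow> complex \<Rightarrow> complex \<Rightarrow> complex \<Rightarrow> complex" where
  "planar_infl a c x y z = (cubic a x y z)^2 * cubic_x c x y z
     + cubic a x y z * cubic c x y z * (cubic_z c x y z - cubic_x a x y z) - (cubic c x y z)^2 * cubic_z a x y z"

lemma planar_infl:
  assumes "planar Z a c" shows "infl Z (vector [x, y, z]) = - (y * planar_infl a c x y z)"
proof -
  have 0: "((\<lambda>t. 0) has_field_derivative (0 * u + 0 * v + 0 * w)) (at 0)" for u v w :: complex by simp
  show ?thesis
    using infl_cubic[of Z "cubic a" "\<lambda>_ _ _. 0" "cubic c" "cubic_x a" "cubic_y a" "cubic_z a"
       "\<lambda>_ _ _. 0" "\<lambda>_ _ _. 0" "\<lambda>_ _ _. 0" "cubic_x c" "cubic_y c" "cubic_z c" x y z, OF _ cubic_deriv 0 cubic_deriv] assms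
    by (simp add: planar_def Let_def planar_infl_def algebra_simps power2_eq_square)
qed

lemma prod_list_dot_nonzero:
  "\<forall>L\<in>set Ls. L \<noteq> 0 \<Longrightarrow> \<exists>p. (\<Prod>L\<leftarrow>Ls. dot L p) \<noteq> 0"
proof (induction Ls)
  case (Cons a as)
  show ?case
  proof (rule ccontr)
    assume "\<not> ?case"
    then have "(\<forall>p. dot a p = 0) \<or> (\<forall>p. (\<Prod>L\<leftarrow>as. dot L p) = 0)"
      by (intro pol_domain pol_dot pol_prod_list) auto
    then show False using Cons dot_all_0 by auto
  qed
qed simp

lemma pol_power: "poly_on_lines f \<Longrightarrow> poly_on_lines (\<lambda>p. f p ^ n)"
  by (induction n) (auto intro: pol_const pol_mult)

lemma pol_diff: "poly_on_lines f \<Longrightarrow> poly_on_lines g \<Longrightarrow> poly_on_lines (\<lambda>p. f p - g p)"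
  using pol_add[OF _ pol_mult[OF pol_const[of "-1"]], of f g] by simp

lemmas pol_intros = pol_add pol_diff pol_mult pol_power pol_const pol_coord

lemma convex_fieldD:
  assumes "convex_field Z Ls"
  shows "hom 3 (\<lambda>p. Z p $ i)" "L \<in> set Ls \<Longrightarrow> L \<noteq> 0"
    "L \<in> set Ls \<Longrightarrow> dot L p = 0 \<Longrightarrow> dot L (Z p) = 0"
    "L \<noteq> 0 \<Longrightarrow> \<exists>p. dot L p = 0 \<and> field_form Z p \<noteq> 0"
    "\<exists>c. c \<noteq> 0 \<and> (\<forall>p. infl Z p = c * (\<Prod>L\<leftarrow>Ls. dot L p))"
  using assms unfolding convex_field_def by blast+

lemma prod_list_remove1:
  "L \<in> set Ls \<Longrightarrow> (\<Prod>K\<leftarrow>Ls. f K) = f L * (\<Prod>K\<leftarrow>remove1 L Ls. (f K :: complex))"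
  by (induction Ls) auto

lemma planar_rest:
  assumes cf: "convex_field Z Ls" "ex2 \<in> set Ls" "planar Z a c"
  obtains k where "k \<noteq> 0" "\<And>x y z. planar_infl a c x y z = k * (\<Prod>L\<leftarrow>remove1 ex2 Ls. dot L (vector [x, y, z]))"
proof -
  obtain k where k: "k \<noteq> 0" "\<And>p. infl Z p = k * (\<Prod>L\<leftarrow>Ls. dot L p)" using convex_fieldD(5)[OF cf(1)] by blast
  let ?f = "\<lambda>p. planar_infl a c (p$1) (p$2) (p$3)" and ?g = "\<lambda>p. (-k) * (\<Prod>L\<leftarrow>remove1 ex2 Ls. dot L p)"
  have "dot ex2 p * ?f p = dot ex2 p * ?g p" for p
    using planar_infl[OF cf(3), of "p$1" "p$2" "p$3"] k(2)[of p] prod_list_remove1[OF cf(2), of "\<lambda>L. dot L p"]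
    unfolding vec3_collapse by (simp add: algebra_simps)
  moreover have "poly_on_lines ?f" unfolding planar_infl_def cubic_defs by (intro pol_intros)
  moreover have "poly_on_lines ?g" by (intro pol_mult pol_const pol_prod_list)
  moreover have "ex2 \<noteq> 0" by (simp add: vec3_eq_iff)
  ultimately have "?f p = ?g p" for p by (intro pol_cancel_dot[where L=ex2 and f="?f" and g="?g"]) 
  from this[of "vector [_,_,_]"] show ?thesis by (intro that[of "-k"]) (use k in auto)
qed

lemma planar_gauge:
  assumes cf: "convex_field Z Ls" "ex2 \<in> set Ls"
  obtains Z' a c where "convex_field Z' Ls" "\<And>p. field_form Z' p = field_form Z p" "planar Z' a c"
proof -
  obtain b where b: "\<And>x y z. Z (vector [x, y, z]) $ 2 = cubic b x y z"
    using hom3_coeffs[OF convex_fieldD(1)[OF cf(1), of 2]] by blast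
  have b0: "cubic b x 0 z = 0" for x z
    using convex_fieldD(3)[OF cf, of "vector [x, 0, z]"] by (simp add: b)
  have "bq3 (b 0) (b 4) (b 7) (b 9) x y = 0" for x y
    using b0[of x y] by (simp add: cubic_defs algebra_simps power2_eq_square power3_eq_cube)
  then have bz: "b 0 = 0" "b 4 = 0" "b 7 = 0" "b 9 = 0" using bq_all_0(3)[of "b 0" "b 4" "b 7" "b 9"] by blast+
  let ?g = "\<lambda>p :: complex^3. bq2 (- b 1) (- b 2) (- b 3) (p$1) (p$2) + p$3 * bq1 (- b 5) (- b 6) (p$1) (p$2) + (p$3)^2 * (- b 8)"
  define Z' where "Z' = (\<lambda>p. 1 *s Z p + ?g p *s p)"
  have cZ: "convex_field Z' Ls" unfolding Z'_def by (rule convex_field_gauge[OF cf(1) hom_quadratic]) simp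
  have Z2: "Z' (vector [x, y, z]) $ 2 = 0" for x y z
    by (simp add: Z'_def b cubic_defs bz algebra_simps power2_eq_square power3_eq_cube)
  obtain a where a: "\<And>x y z. Z' (vector [x, y, z]) $ 1 = cubic a x y z"
    using hom3_coeffs[OF convex_fieldD(1)[OF cZ, of 1]] by metis
  obtain c where c: "\<And>x y z. Z' (vector [x, y, z]) $ 3 = cubic c x y z"
    using hom3_coeffs[OF convex_fieldD(1)[OF cZ, of 3]] by metis
  have "planar Z' a c" unfolding planar_def
    by (intro allI) (simp only: vec3_eq_iff vector_3 a c Z2)
  moreover have "field_form Z' p = field_form Z p" for p using field_form_gauge[of 1 Z ?g p] by (simp add: Z'_def)
  ultimately show ?thesis using that cZ by metis
qed

lemma planar_no_common_line:
  assumes "convex_field Z Ls" "planar Z a c" "L \<noteq> 0"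
  obtains x y z where "dot L (vector [x, y, z]) = 0"
    "y * cubic c x y z \<noteq> 0 \<or> x * cubic c x y z \<noteq> z * cubic a x y z \<or> y * cubic a x y z \<noteq> 0"
proof -
  obtain p where p: "dot L p = 0" "field_form Z p \<noteq> 0" using convex_fieldD(4)[OF assms(1,3)] by blast
  have "Z p = vector [cubic a (p$1) (p$2) (p$3), 0, cubic c (p$1) (p$2) (p$3)]"
    using assms(2) vec3_collapse[of p] unfolding planar_def by metis
  with p show ?thesis by (intro that[of "p$1" "p$2" "p$3"]) (auto simp: vec3_collapse field_form_def vec3_eq_iff algebra_simps)
qed

lemma planar_invariant:
  assumes "convex_field Z Ls" "planar Z a c" "L \<in> set Ls" "dot L (vector [x, y, z]) = 0"
  shows "L$1 * cubic a x y z + L$3 * cubic c x y z = 0"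
  using convex_fieldD(3)[OF assms(1,3,4)] assms(2) by (simp add: planar_def dot_def)

text \<open>Over a fixed point \<open>(x, y)\<close> only the lines that avoid \<open>(0, 0, 1)\<close> contribute to the degree in
  \<open>z\<close>.  Counting lines through that point thus becomes a comparison of coefficients.\<close>

lemma prod_lines_degree:
  assumes "\<And>z. k * (\<Prod>L\<leftarrow>Ls. dot L (vector [x, y, z])) = poly q z" "q \<noteq> 0"
  shows "degree q = length (filter (\<lambda>L. L$3 \<noteq> 0) Ls)"
proof -
  let ?P = "\<lambda>Ls. (\<Prod>L\<leftarrow>Ls. [:L$1 * x + L$2 * y, L$3:])"
  have "poly q z = poly (smult k (?P Ls)) z" for z
  proof -
    have "poly (?P Ls) z = (\<Prod>L\<leftarrow>Ls. dot L (vector [x, y, z]))"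
      by (induction Ls) (auto simp: dot_def algebra_simps)
    then show ?thesis using assms(1)[of z] by simp
  qed
  then have "poly q = poly (smult k (?P Ls))" by (rule ext)
  then have q: "q = smult k (?P Ls)" by (simp only: poly_eq_poly_eq_iff)
  have "?P Ls \<noteq> 0 \<Longrightarrow> degree (?P Ls) = length (filter (\<lambda>L. L$3 \<noteq> 0) Ls)"
  proof (induction Ls)
    case (Cons L Ls)
    let ?l = "[:L$1 * x + L$2 * y, L$3:]"
    have nz: "?l \<noteq> 0" "?P Ls \<noteq> 0" using Cons.prems by auto
    have "degree (?l * ?P Ls) = degree ?l + degree (?P Ls)" by (rule degree_mult_eq[OF nz])
    moreover have "degree ?l = (if L$3 \<noteq> 0 then 1 else 0)" by simp
    ultimately show ?case using Cons.IH[OF nz(2)] by simp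
  qed simp
  then show ?thesis using q assms(2) by (simp add: degree_smult_eq)
qed

lemma prod_lines_coeff:
  assumes "\<And>z. k * (\<Prod>L\<leftarrow>Ls. dot L (vector [x, y, z])) = poly q z" "length (filter (\<lambda>L. L$3 \<noteq> 0) Ls) < j"
  shows "coeff q j = 0"
proof (cases "q = 0")
  case False
  show ?thesis by (rule coeff_eq_0) (use prod_lines_degree[OF assms(1) False] assms(2) in simp)
qed simp

abbreviation avoid3 :: "(complex^3) list \<Rightarrow> nat" where
  "avoid3 Ls \<equiv> length (filter (\<lambda>L. L$3 \<noteq> 0) Ls)"

lemma avoid3_remove1: "K$3 = 0 \<Longrightarrow> avoid3 (remove1 K Ls) = avoid3 Ls"
  by (induction Ls) auto

definition zpoly :: "(nat \<Rightarrow> complex) \<Rightarrow> complex \<Rightarrow> complex \<Rightarrow> complex poly" where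
  "zpoly a x y = [:bq3 (a 0) (a 1) (a 2) (a 3) x y, bq2 (a 4) (a 5) (a 6) x y, bq1 (a 7) (a 8) x y, a 9:]"
definition zpoly_x :: "(nat \<Rightarrow> complex) \<Rightarrow> complex \<Rightarrow> complex \<Rightarrow> complex poly" where
  "zpoly_x a x y = [:bq2 (3 * a 0) (2 * a 1) (a 2) x y, bq1 (2 * a 4) (a 5) x y, a 7:]"
definition zpoly_infl :: "(nat \<Rightarrow> complex) \<Rightarrow> (nat \<Rightarrow> complex) \<Rightarrow> complex \<Rightarrow> complex \<Rightarrow> complex poly" where
  "zpoly_infl a c x y = (zpoly a x y)^2 * zpoly_x c x y
     + zpoly a x y * zpoly c x y * (pderiv (zpoly c x y) - zpoly_x a x y) - (zpoly c x y)^2 * pderiv (zpoly a x y)"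

lemma poly_zpoly_infl: "poly (zpoly_infl a c x y) z = planar_infl a c x y z"
proof -
  have "poly (zpoly a x y) z = cubic a x y z" "poly (zpoly_x a x y) z = cubic_x a x y z"
    "poly (pderiv (zpoly a x y)) z = cubic_z a x y z" for a
    by (simp_all add: zpoly_def zpoly_x_def cubic_def cubic_x_def cubic_z_def pderiv_pCons algebra_simps power2_eq_square power3_eq_cube)
  then show ?thesis by (simp add: zpoly_infl_def planar_infl_def)
qed

lemma planar_coeff:
  assumes "convex_field Z Ls" "ex2 \<in> set Ls" "planar Z a c" "avoid3 Ls < j"
  shows "coeff (zpoly_infl a c x y) j = 0"
proof -
  obtain k where "k \<noteq> 0" "\<And>x y z. planar_infl a c x y z = k * (\<Prod>L\<leftarrow>remove1 ex2 Ls. dot L (vector [x, y, z]))"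
    using planar_rest[OF assms(1-3)] by blast
  then show ?thesis using prod_lines_coeff[where k=k and Ls="remove1 ex2 Ls" and x=x and y=y and q="zpoly_infl a c x y" and j=j] assms(4)
    by (simp add: poly_zpoly_infl avoid3_remove1)
qed

lemma planar_not_all_0:
  assumes "convex_field Z Ls" "ex2 \<in> set Ls" "planar Z a c"
  shows "\<exists>x y z. planar_infl a c x y z \<noteq> 0"
proof -
  obtain k where k: "k \<noteq> 0" "\<And>x y z. planar_infl a c x y z = k * (\<Prod>L\<leftarrow>remove1 ex2 Ls. dot L (vector [x, y, z]))"
    using planar_rest[OF assms(1-3)] by blast
  obtain p where "(\<Prod>L\<leftarrow>remove1 ex2 Ls. dot L p) \<noteq> 0"
    using prod_list_dot_nonzero[of "remove1 ex2 Ls"] convex_fieldD(2)[OF assms(1)] by (meson notin_set_remove1)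
  then show ?thesis using k vec3_collapse[of p] by (metis mult_eq_0_iff)
qed

text \<open>If \<open>(0, 0, 1)\<close> is a radial singularity, the coefficients of \<open>z\<^sup>7\<close>, \<open>z\<^sup>6\<close> and \<open>z\<^sup>5\<close> of the inflection
  polynomial contain the coefficients of \<open>z\<^sup>2\<close>, \<open>z\<close> and \<open>1\<close> of \<open>A\<close> as a factor.  They would all vanish
  if fewer than five lines avoided the point, and then \<open>A\<close> and the inflection polynomial would be
  zero.\<close>

lemma radial_point:
  assumes cf: "convex_field Z Ls" "ex2 \<in> set Ls" "planar Z a c"
    and a: "a 9 = 0" "a 7 = 0" "c 9 \<noteq> 0"
  shows "5 \<le> avoid3 Ls" "avoid3 Ls \<le> 5 \<Longrightarrow> a 8 = 0 \<and> a 4 = 0 \<and> a 5 = 0 \<and> a 6 = 0"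
proof -
  have *: "a 8 = 0 \<and> a 4 = 0 \<and> a 5 = 0 \<and> a 6 = 0" if "avoid3 Ls \<le> 5"
  proof -
    have c7: "coeff (zpoly_infl a c 0 1) 7 = 0" by (rule planar_coeff[OF cf]) (use that in simp)
    have a8: "a 8 = 0" using c7 a
      by (simp add: zpoly_infl_def zpoly_def zpoly_x_def bq_defs pderiv_pCons power2_eq_square numeral_eq_Suc)
    have "coeff (zpoly_infl a c x y) 6 = 0" for x y by (rule planar_coeff[OF cf]) (use that in simp)
    then have "bq2 (a 4) (a 5) (a 6) x y = 0" for x y using a a8
      by (auto simp: zpoly_infl_def zpoly_def zpoly_x_def bq1_def pderiv_pCons power2_eq_square numeral_eq_Suc)
    then show ?thesis using bq_all_0(2) a8 by blast
  qed
  then show "avoid3 Ls \<le> 5 \<Longrightarrow> a 8 = 0 \<and> a 4 = 0 \<and> a 5 = 0 \<and> a 6 = 0" .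
  show "5 \<le> avoid3 Ls"
  proof (rule ccontr)
    assume n: "\<not> 5 \<le> avoid3 Ls"
    then have a': "a 8 = 0" "a 4 = 0" "a 5 = 0" "a 6 = 0" using * by auto
    have "coeff (zpoly_infl a c x y) 5 = 0" for x y by (rule planar_coeff[OF cf]) (use n in simp)
    then have A3: "bq3 (a 0) (a 1) (a 2) (a 3) x y = 0" for x y using a a'
      by (auto simp: zpoly_infl_def zpoly_def zpoly_x_def bq1_def bq2_def pderiv_pCons power2_eq_square numeral_eq_Suc)
    have "a 0 = 0" "a 1 = 0" "a 2 = 0" "a 3 = 0" using bq_all_0(3)[of "a 0" "a 1" "a 2" "a 3"] A3 by blast+
    then have "planar_infl a c x y z = 0" for x y z
      using a a' by (simp add: planar_infl_def cubic_defs)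
    then show False using planar_not_all_0[OF cf] by blast
  qed
qed

section \<open>Saddle-nodes\<close>

lemma length_filter_remove1:
  "x \<in> set xs \<Longrightarrow> length (filter P xs) = (if P x then 1 else 0) + length (filter P (remove1 x xs))"
  by (induction xs) auto

lemma length_filter_split:
  "length (filter P xs) = length (filter (\<lambda>x. P x \<and> Q x) xs) + length (filter (\<lambda>x. P x \<and> \<not> Q x) xs)"
  by (induction xs) auto

lemma length_filter_not: "length xs = length (filter P xs) + length (filter (\<lambda>x. \<not> P x) xs)"
  by (induction xs) auto

text \<open>Without terms in \<open>z\<^sup>2\<close> and \<open>z\<^sup>3\<close> in \<open>A\<close>, and without \<open>z\<^sup>3\<close> in \<open>C\<close>, the form starts with quadratic terms
  at \<open>(0, 0, 1)\<close>.\<close>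

lemma planar_degenerate:
  assumes "planar Z a c" "a 7 = 0" "a 8 = 0" "a 9 = 0" "c 9 = 0"
  shows "degenerate_at Z ex3"
  unfolding degenerate_at_def
proof (intro conjI allI)
  show "ex3 \<noteq> 0" by (simp add: vec3_eq_iff)
  fix v :: "complex^3" and i :: 3
  define x where "x = v$1" define y where "y = v$2" define w where "w = v$3"
  have arg: "ex3 + t *s v = vector [t * x, t * y, 1 + t * w]" for t
    by (simp add: vec3_eq_iff x_def y_def w_def)
  define qa where "qa = smult (bq3 (a 0) (a 1) (a 2) (a 3) x y) [:0, 1:] + smult (bq2 (a 4) (a 5) (a 6) x y) [:1, w:]"
  define qc where "qc = smult (bq3 (c 0) (c 1) (c 2) (c 3) x y) [:0, 0, 1:] + smult (bq2 (c 4) (c 5) (c 6) x y) [:0, 1, w:]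
     + smult (bq1 (c 7) (c 8) x y) ([:1, w:]^2)"
  have A: "cubic a (t * x) (t * y) (1 + t * w) = t^2 * poly qa t" for t
    using assms by (simp add: cubic_def bq_defs qa_def algebra_simps power2_eq_square power3_eq_cube)
  have C: "cubic c (t * x) (t * y) (1 + t * w) = t * poly qc t" for t
    using assms by (simp add: cubic_def bq_defs qc_def algebra_simps power2_eq_square power3_eq_cube)
  have ff: "field_form Z (ex3 + t *s v) = vector [- (t * poly qc t * (t * y)),
      t * poly qc t * (t * x) - t^2 * poly qa t * (1 + t * w), t^2 * poly qa t * (t * y)]" for t
    using assms(1) unfolding planar_def field_form_def arg by (simp add: vec3_eq_iff A C)
  have "i = 1 \<or> i = 2 \<or> i = 3" using exhaust_3 by blast
  then show "\<exists>q. \<forall>t. field_form Z (ex3 + t *s v) $ i = t\<^sup>2 * poly q t"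
  proof (elim disjE)
    assume "i = 1" then show ?thesis unfolding ff
      by (intro exI[of _ "smult (- y) qc"]) (simp add: power2_eq_square)
  next
    assume "i = 2" then show ?thesis unfolding ff
      by (intro exI[of _ "smult x qc - qa * [:1, w:]"]) (simp add: power2_eq_square algebra_simps)
  next
    assume "i = 3" then show ?thesis unfolding ff
      by (intro exI[of _ "smult y qa * [:0, 1:]"]) (simp add: power2_eq_square algebra_simps)
  qed
qed

text \<open>Here \<open>A = x U\<close>, and \<open>T\<close> is the inflection polynomial divided by the equations of both lines.  On
  \<open>x = 0\<close> it is \<open>C (U C' - U\<^sup>2 - C U')\<close> with derivatives in \<open>z\<close>, which has degree between four and six
  because \<open>C\<close> has degree at most two.  So between three and five of the nine lines pass
  through \<open>(0, 0, 1)\<close>, and invariance only allows them to be \<open>x = 0\<close> or \<open>y = 0\<close>.  As \<open>T\<close> does not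
  vanish on \<open>x = 0\<close>, this line is simple.\<close>

lemma saddle_node_coords:
  assumes cf: "convex_field Z Ls" "ex2 \<in> set Ls" "planar Z a c" and e1: "ex1 \<in> set Ls"
    and z: "c 9 = 0" and m: "a 7 \<noteq> 0"
  shows "\<forall>L\<in>set Ls. L$3 = 0 \<longrightarrow> L$1 = 0 \<or> L$2 = 0"
    "length (filter (\<lambda>L. L$3 = 0 \<and> L$1 \<noteq> 0) Ls) = 1"
    "2 \<le> length (filter (\<lambda>L. L$3 = 0 \<and> L$1 = 0) Ls)" "length (filter (\<lambda>L. L$3 = 0 \<and> L$1 = 0) Ls) \<le> 4"
proof -
  have "bq3 (a 3) (a 6) (a 8) (a 9) y z = 0" for y z
    using planar_invariant[OF cf(1,3) e1, of 0 y z] by (simp add: cubic_def bq_defs algebra_simps power2_eq_square)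
  then have a0: "a 3 = 0" "a 6 = 0" "a 8 = 0" "a 9 = 0" using bq_all_0(3)[of "a 3" "a 6" "a 8" "a 9"] by blast+
  define U where "U x y z = bq2 (a 0) (a 1) (a 2) x y + z * bq1 (a 4) (a 5) x y + z^2 * a 7" for x y z
  define Ux where "Ux x y z = bq1 (2 * a 0) (a 1) x y + z * a 4" for x y z
  define Uz where "Uz x y z = bq1 (a 4) (a 5) x y + 2 * z * a 7" for x y z
  define T where "T x y z = x * (U x y z)^2 * cubic_x c x y z
     + U x y z * cubic c x y z * (cubic_z c x y z - U x y z - x * Ux x y z) - (cubic c x y z)^2 * Uz x y z" for x y z
  have A: "cubic a x y z = x * U x y z" "cubic_x a x y z = U x y z + x * Ux x y z" "cubic_z a x y z = x * Uz x y z" for x y z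
    using a0 by (simp_all add: cubic_defs U_def Ux_def Uz_def algebra_simps power2_eq_square power3_eq_cube)
  have e12: "ex1 \<in> set (remove1 ex2 Ls)" using e1 by (simp add: vec3_eq_iff)
  define R where "R = remove1 ex1 (remove1 ex2 Ls)"
  obtain k where k: "k \<noteq> 0" "\<And>x y z. planar_infl a c x y z = k * (\<Prod>L\<leftarrow>remove1 ex2 Ls. dot L (vector [x, y, z]))"
    using planar_rest[OF cf] by blast
  have T: "T x y z = k * (\<Prod>L\<leftarrow>R. dot L (vector [x, y, z]))" for x y z
  proof -
    let ?f = "\<lambda>p. T (p$1) (p$2) (p$3)" and ?g = "\<lambda>p. k * (\<Prod>L\<leftarrow>R. dot L p)"
    have "dot ex1 p * ?f p = dot ex1 p * ?g p" for p
    proof -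
      have "dot ex1 p * ?f p = planar_infl a c (p$1) (p$2) (p$3)"
        unfolding T_def planar_infl_def A by (simp add: algebra_simps power2_eq_square)
      then show ?thesis
        using k(2)[of "p$1" "p$2" "p$3"] prod_list_remove1[OF e12, of "\<lambda>L. dot L p"]
        unfolding vec3_collapse R_def by (simp add: algebra_simps)
    qed
    moreover have "poly_on_lines ?f" unfolding T_def U_def Ux_def Uz_def cubic_defs by (intro pol_intros)
    moreover have "poly_on_lines ?g" by (intro pol_mult pol_const pol_prod_list)
    moreover have "ex1 \<noteq> 0" by (simp add: vec3_eq_iff)
    ultimately have "?f p = ?g p" for p by (intro pol_cancel_dot[where L=ex1 and f="?f" and g="?g"])
    from this[of "vector [x, y, z]"] show ?thesis by simp
  qed
  let ?C = "[:c 3, c 6, c 8:]" and ?U = "[:a 2, a 5, a 7:]"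
  let ?b = "?U * pderiv ?C - (?U)^2 - ?C * pderiv ?U"
  have eq: "k * (\<Prod>L\<leftarrow>R. dot L (vector [0, 1, z])) = poly (?C * ?b) z" for z
    unfolding T[symmetric] T_def U_def Ux_def Uz_def cubic_defs using z
    by (simp add: pderiv_pCons algebra_simps power2_eq_square power3_eq_cube)
  have C0: "?C \<noteq> 0"
  proof
    assume "?C = 0"
    then have c0: "c 3 = 0" "c 6 = 0" "c 8 = 0" by auto
    obtain x y w where *: "dot ex1 (vector [x, y, w]) = 0"
      "y * cubic c x y w \<noteq> 0 \<or> x * cubic c x y w \<noteq> w * cubic a x y w \<or> y * cubic a x y w \<noteq> 0"
      by (rule planar_no_common_line[OF cf(1,3), of ex1]) (auto simp: vec3_eq_iff)
    then show False using c0 z a0 by (simp add: cubic_def bq_defs)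
  qed
  have b4: "coeff ?b 4 = - ((a 7)\<^sup>2)" by (simp add: pderiv_pCons power2_eq_square numeral_eq_Suc)
  have "degree ?b \<le> 4"
    by (rule degree_le) (auto simp: pderiv_pCons power2_eq_square numeral_eq_Suc coeff_pCons split: nat.splits)
  moreover have "4 \<le> degree ?b" by (rule le_degree) (use b4 m in simp)
  ultimately have db: "degree ?b = 4" by simp
  then have b0: "?b \<noteq> 0" by fastforce
  have "degree (?C * ?b) = degree ?C + 4" using degree_mult_eq[OF C0 b0] db by simp
  moreover have "degree ?C \<le> 2" by simp
  moreover have "avoid3 R = degree (?C * ?b)" using prod_lines_degree[OF eq] C0 b0 by (metis mult_eq_0_iff)
  ultimately have av: "4 \<le> avoid3 Ls" "avoid3 Ls \<le> 6" by (simp_all add: R_def avoid3_remove1)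
  show i: "\<forall>L\<in>set Ls. L$3 = 0 \<longrightarrow> L$1 = 0 \<or> L$2 = 0"
  proof (intro ballI impI, rule ccontr)
    fix L assume L: "L \<in> set Ls" "L$3 = 0" "\<not> (L$1 = 0 \<or> L$2 = 0)"
    have "poly [:L$1 * bq3 (a 0) (a 1) (a 2) (a 3) (L$2) (- L$1), L$1 * bq2 (a 4) (a 5) (a 6) (L$2) (- L$1), L$1 * (a 7 * L$2):] w = 0" for w
      using planar_invariant[OF cf(1,3) L(1), of "L$2" "- L$1" w] L a0
      by (simp add: dot_def cubic_def bq1_def algebra_simps power2_eq_square)
    then show False using L m poly_all_0_iff_0[of "[:_, _, _:]"] by (metis pCons_eq_0_iff mult_eq_0_iff)
  qed
  have none: "L$3 = 0 \<and> L$1 \<noteq> 0 \<longrightarrow> L \<notin> set R" for L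
  proof (intro impI notI)
    assume L: "L$3 = 0 \<and> L$1 \<noteq> 0" "L \<in> set R"
    then have "L \<in> set Ls" unfolding R_def by (meson notin_set_remove1)
    then have "L$2 = 0" using i L by auto
    then have "dot L (vector [0, 1, w]) = 0" for w using L by (simp add: dot_def)
    then have "(\<Prod>L\<leftarrow>R. dot L (vector [0, 1, w])) = 0" for w
      using L(2) by (auto simp: prod_list_zero_iff image_iff)
    then have "\<forall>w. poly (?C * ?b) w = 0" using eq by simp
    then show False using C0 b0 poly_all_0_iff_0[of "?C * ?b"] by (metis mult_eq_0_iff)
  qed
  have "length (filter (\<lambda>L. L$3 = 0 \<and> L$1 \<noteq> 0) Ls) = 1 + length (filter (\<lambda>L. L$3 = 0 \<and> L$1 \<noteq> 0) R)"
    unfolding length_filter_remove1[OF cf(2)] R_def using length_filter_remove1[OF e12, of "\<lambda>L. L$3 = 0 \<and> L$1 \<noteq> 0"] by simp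
  moreover have "filter (\<lambda>L. L$3 = 0 \<and> L$1 \<noteq> 0) R = []" using none by (auto simp: filter_empty_conv)
  ultimately show one: "length (filter (\<lambda>L. L$3 = 0 \<and> L$1 \<noteq> 0) Ls) = 1" by simp
  have "9 = avoid3 Ls + length (filter (\<lambda>L. L$3 = 0) Ls)"
    using length_filter_not[of Ls "\<lambda>L. L$3 \<noteq> 0"] convex_field_length[OF cf(1)] by simp
  moreover have "length (filter (\<lambda>L. L$3 = 0) Ls) = length (filter (\<lambda>L. L$3 = 0 \<and> L$1 = 0) Ls) + 1"
    using length_filter_split[of "\<lambda>L. L$3 = 0" Ls "\<lambda>L. L$1 = 0"] one by simp
  ultimately show "2 \<le> length (filter (\<lambda>L. L$3 = 0 \<and> L$1 = 0) Ls)" "length (filter (\<lambda>L. L$3 = 0 \<and> L$1 = 0) Ls) \<le> 4"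
    using av by auto
qed

lemma planar_exists:
  assumes "convex_field Z Ls" "\<And>v. dot ex2 (Z v) = 0" obtains a c where "planar Z a c"
proof -
  obtain a where a: "\<And>x y z. Z (vector [x, y, z]) $ 1 = cubic a x y z"
    using hom3_coeffs[OF convex_fieldD(1)[OF assms(1), of 1]] by metis
  obtain c where c: "\<And>x y z. Z (vector [x, y, z]) $ 3 = cubic c x y z"
    using hom3_coeffs[OF convex_fieldD(1)[OF assms(1), of 3]] by metis
  show ?thesis using that[of a c] assms(2) a c by (simp add: planar_def vec3_eq_iff)
qed

lemma vm_nth3: "(J v* M) $ 3 = dot J (M *v ex3)"
  using dot_vm[of J M ex3] by simp

lemma ccross_ex2: "ccross J ex2 = 0 \<longleftrightarrow> J$3 = 0 \<and> J$1 = 0"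
  by (auto simp: vec3_eq_iff)

text \<open>At a singular point that is neither degenerate nor radial for the normalization along \<open>L\<close>,
  there is exactly one inflection line besides the multiples of \<open>L\<close>, and \<open>L\<close> has multiplicity between
  two and four.\<close>

lemma saddle_node:
  assumes cf: "convex_field Z Ls" and KL: "K \<in> set Ls" "L \<in> set Ls" "ccross K L \<noteq> 0"
    and p: "p \<noteq> 0" "dot K p = 0" "dot L p = 0" and Z: "\<And>v. dot L (Z v) = 0" "Z p = 0" and nd: "\<not> degenerate_at Z p"
  shows "length (filter (\<lambda>J. dot J p = 0 \<and> ccross J L \<noteq> 0) Ls) = 1"
    "2 \<le> length (filter (\<lambda>J. ccross J L = 0) Ls)" "length (filter (\<lambda>J. ccross J L = 0) Ls) \<le> 4"
proof -
  obtain M where M: "invertible M" "K v* M = ex1" "L v* M = ex2" "M *v ex3 = p" using adapt_two[OF KL(3) p] by metis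
  let ?Z = "transport M Z" and ?Ls = "map (\<lambda>L. L v* M) Ls"
  have cf': "convex_field ?Z ?Ls" by (rule convex_field_transport[OF cf M(1)])
  have "dot ex2 (?Z v) = 0" for v using dot_matrix_inv[OF M(1), of L] M(3) Z(1) by (simp add: transport_def)
  then obtain a c where pl: "planar ?Z a c" using planar_exists[OF cf'] by metis
  have "?Z ex3 = 0" by (simp add: transport_def M(4) Z(2))
  then have ac: "a 9 = 0" "c 9 = 0" using pl by (auto simp: planar_def cubic_def bq_defs vec3_eq_iff)
  have mem: "ex1 \<in> set ?Ls" "ex2 \<in> set ?Ls" using KL M(2,3) by (force simp: image_iff)+
  have "bq3 (a 3) (a 6) (a 8) (a 9) y z = 0" for y z
    using planar_invariant[OF cf' pl mem(1), of 0 y z] by (simp add: cubic_def bq_defs algebra_simps power2_eq_square)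
  then have a0: "a 8 = 0" using bq_all_0(3)[of "a 3" "a 6" "a 8" "a 9"] by blast
  have m: "a 7 \<noteq> 0" using planar_degenerate[OF pl _ a0 ac] degenerate_transport[OF M(1)] nd M(4) by auto
  have par: "ccross J L = 0 \<longleftrightarrow> (J v* M)$3 = 0 \<and> (J v* M)$1 = 0" for J
    using ccross_transport[OF M(1), of J L] by (simp only: M(3) ccross_ex2)
  have d: "(J v* M)$3 = dot J p" for J by (simp add: vm_nth3 M(4))
  note * = saddle_node_coords[OF cf' mem(2) pl mem(1) ac(2) m]
  show "length (filter (\<lambda>J. dot J p = 0 \<and> ccross J L \<noteq> 0) Ls) = 1"
    using *(2) by (simp add: filter_map o_def par d cong: conj_cong)
  show "2 \<le> length (filter (\<lambda>J. ccross J L = 0) Ls)" "length (filter (\<lambda>J. ccross J L = 0) Ls) \<le> 4"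
    using *(3,4) by (simp_all add: filter_map o_def par)
qed

section \<open>Rational maps with fixed critical points\<close>

lemma card_roots_rsquarefree:
  assumes "rsquarefree (p :: complex poly)" shows "card {z. poly p z = 0} = degree p"
proof -
  have p0: "p \<noteq> 0" using assms by (simp add: rsquarefree_def)
  have "degree p = degree (\<Prod>z|poly p z = 0. [:- z, 1:])"
    using complex_poly_decompose_rsquarefree[OF assms] p0 by (metis degree_smult_eq leading_coeff_0_iff)
  also have "\<dots> = (\<Sum>z|poly p z = 0. degree [:- z, 1:])"
    by (rule degree_prod_eq_sum_degree) auto
  also have "\<dots> = card {z. poly p z = 0}" by simp
  finally show ?thesis by simp
qed

text \<open>The critical points of \<open>p / q\<close> are the roots of \<open>W\<close>.  If they were four distinct fixed points,
  \<open>x q' - p'\<close>, of degree at most three, would vanish at all of them, hence identically.  Then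
  \<open>W = q' (x q - p)\<close>, and a root of \<open>q'\<close>, being a fixed point, is a root of both factors.\<close>

lemma double_critical_point:
  fixes p q :: "complex poly"
  defines "W \<equiv> pderiv p * q - p * pderiv q"
  assumes deg: "degree p \<le> 3" "degree q \<le> 3" "degree W = 4"
    and nc: "\<And>r. poly p r = 0 \<Longrightarrow> poly q r = 0 \<Longrightarrow> False"
    and crit_fixed: "\<And>r. poly W r = 0 \<Longrightarrow> poly p r = r * poly q r"
  shows "\<exists>r. poly W r = 0 \<and> poly (pderiv W) r = 0"
proof (rule ccontr)
  assume no: "\<not> (\<exists>r. poly W r = 0 \<and> poly (pderiv W) r = 0)"
  then have sf: "rsquarefree W" by (simp add: rsquarefree_roots)
  let ?D = "[:0, 1:] * pderiv q - pderiv p" and ?F = "[:0, 1:] * q - p"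
  have D: "poly ?D r = 0" if W: "poly W r = 0" for r
  proof -
    have q: "poly q r \<noteq> 0" using crit_fixed[OF W] nc[of r] by auto
    have "poly (pderiv p) r * poly q r = r * poly q r * poly (pderiv q) r"
      using W crit_fixed[OF W] by (simp add: W_def)
    then show ?thesis using q by (simp add: algebra_simps)
  qed
  have dD: "degree ?D \<le> 3"
  proof (rule degree_diff_le)
    show "degree ([:0, 1:] * pderiv q) \<le> 3"
      using degree_mult_le[of "[:0, 1:]" "pderiv q"] deg by (simp add: degree_pderiv)
    show "degree (pderiv p) \<le> 3" using deg by (simp add: degree_pderiv)
  qed
  have D0: "?D = 0"
  proof (rule ccontr)
    assume n: "?D \<noteq> 0"
    have "4 = card {r. poly W r = 0}" using card_roots_rsquarefree[OF sf] deg by simp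
    also have "\<dots> \<le> card {r. poly ?D r = 0}" by (rule card_mono[OF poly_roots_finite[OF n]]) (use D in auto)
    also have "\<dots> \<le> 3" using card_poly_roots_bound[OF n] dD by simp
    finally show False by simp
  qed
  then have pq: "pderiv p = [:0, 1:] * pderiv q" by simp
  have W: "W = pderiv q * ?F" unfolding W_def pq by (simp add: algebra_simps)
  have dq: "degree (pderiv q) \<le> 1"
  proof (cases "pderiv q = 0")
    case False
    have "degree (pderiv p) = 1 + degree (pderiv q)" unfolding pq using degree_mult_eq[of "[:0, 1:]" "pderiv q"] False by simp
    then show ?thesis using deg(1) by (simp add: degree_pderiv)
  qed simp
  have "W \<noteq> 0" using deg(3) by auto
  then have nz: "pderiv q \<noteq> 0" "?F \<noteq> 0" using W by auto
  have "degree (pderiv q) \<noteq> 0"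
  proof
    assume d: "degree (pderiv q) = 0"
    then have "degree q \<le> 1" by (simp add: degree_pderiv)
    then have "degree ([:0, 1:] * q) \<le> 2" using degree_mult_le[of "[:0, 1:]" q] by simp
    then have "degree ?F \<le> 3" using deg(1) by (intro degree_diff_le) auto
    then have "degree W \<le> 3" unfolding W using d degree_mult_le[of "pderiv q" ?F] by simp
    then show False using deg by simp
  qed
  then obtain r where r: "poly (pderiv q) r = 0"
    using fundamental_theorem_of_algebra[of "pderiv q"] constant_degree[of "pderiv q"] by auto
  then have Wr: "poly W r = 0" by (simp add: W)
  then have "poly ?F r = 0" using crit_fixed[OF Wr] by simp
  then have "poly (pderiv W) r = 0" using r by (simp add: W pderiv_mult del: mult_pCons_left)
  then show False using no Wr by blast
qed

section \<open>Radial points of order two on a line\<close>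

text \<open>In the chart \<open>z = 1\<close> the field is \<open>- C (x \<partial>\<^sub>x + y \<partial>\<^sub>y) + A \<partial>\<^sub>x\<close> with \<open>C \<noteq> 0\<close> at the origin, and the
  deviation \<open>A\<close> from the radial direction is a cubic form in \<open>x, y\<close>.\<close>

definition radial_two :: "(complex^3 \<Rightarrow> complex^3) \<Rightarrow> bool" where
  "radial_two Z \<longleftrightarrow> (\<exists>a c. planar Z a c \<and> a 9 = 0 \<and> a 7 = 0 \<and> a 8 = 0 \<and> a 4 = 0 \<and> a 5 = 0 \<and> a 6 = 0 \<and> c 9 \<noteq> 0)"

lemma planar_infl_line:
  "planar_infl a c x 0 1 = (x * cubic c x 0 1 - cubic a x 0 1) *
     poly (pderiv [:a 9, a 7, a 4, a 0:] * [:c 9, c 7, c 4, c 0:] - [:a 9, a 7, a 4, a 0:] * pderiv [:c 9, c 7, c 4, c 0:]) x"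
  unfolding planar_infl_def cubic_defs by (simp add: pderiv_pCons) algebra

lemma cubic_line: "cubic a x 0 1 = poly [:a 9, a 7, a 4, a 0:] x"
  by (simp add: cubic_def bq_defs algebra_simps power2_eq_square power3_eq_cube)

text \<open>The restriction of \<open>(A, C)\<close> to the line is a rational self-map of degree three.  An inflection line
  through a critical point is invariant and meets the invariant line \<open>y = 0\<close> there, so the critical
  point is fixed.  The double critical point is moved to the origin of the line, where it reduces
  \<open>A\<close> on the line to a multiple of \<open>x\<^sup>3\<close>, and \<open>radial_point\<close> kills the other terms containing \<open>z\<close>.\<close>

lemma radial_two_on_line:
  assumes cf: "convex_field Z Ls" "ex2 \<in> set Ls" "planar Z a c" and T1: "planar_infl a c 1 0 0 \<noteq> 0"
    and nd: "\<And>p. p$2 = 0 \<Longrightarrow> \<not> degenerate_at Z p"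
  obtains M where "invertible M" "ex2 v* M = ex2" "radial_two (transport M Z)"
proof -
  obtain k where k: "k \<noteq> 0" "\<And>x y z. planar_infl a c x y z = k * (\<Prod>L\<leftarrow>remove1 ex2 Ls. dot L (vector [x, y, z]))"
    using planar_rest[OF cf] by blast
  define R where "R = remove1 ex2 Ls"
  have R: "L$1 \<noteq> 0" "L \<in> set Ls" if "L \<in> set R" for L
  proof -
    show "L \<in> set Ls" using that unfolding R_def by (meson notin_set_remove1)
    show "L$1 \<noteq> 0" using k(2)[of 1 0 0] T1 that unfolding R_def[symmetric]
      by (auto simp: prod_list_zero_iff image_iff)
  qed
  define p where "p = [:a 9, a 7, a 4, a 0:]"
  define q where "q = [:c 9, c 7, c 4, c 0:]"
  define W where "W = pderiv p * q - p * pderiv q"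
  have T: "planar_infl a c x 0 1 = (x * poly q x - poly p x) * poly W x" for x
    unfolding planar_infl_line cubic_line p_def q_def W_def ..
  have W4: "coeff W 4 = a 0 * c 4 - a 4 * c 0" unfolding W_def p_def q_def
    by (simp add: pderiv_pCons numeral_eq_Suc algebra_simps)
  have "planar_infl a c 1 0 0 = c 0 * (a 0 * c 4 - a 4 * c 0)"
    unfolding planar_infl_def cubic_defs by (simp add: algebra_simps power2_eq_square)
  then have W4': "coeff W 4 \<noteq> 0" using T1 W4 by auto
  have "degree W \<le> 4" unfolding W_def p_def q_def
    by (rule degree_le) (auto simp: pderiv_pCons numeral_eq_Suc coeff_pCons algebra_simps split: nat.splits)
  then have dW: "degree W = 4" using le_degree[OF W4'] by simp
  have root: "\<exists>L\<in>set R. L$1 * r + L$3 = 0" if "(r * poly q r - poly p r) * poly W r = 0" for r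
    using k(2)[of r 0 1] that k(1) unfolding R_def[symmetric] T by (auto simp: prod_list_zero_iff image_iff dot_def)
  have nc: False if "poly p r = 0" "poly q r = 0" for r
  proof -
    have "(r * poly q r - poly p r) * poly W r = 0" using that by simp
    then obtain L where L: "L \<in> set R" "L$1 * r + L$3 = 0" using root by blast
    let ?p = "vector [r, 0, 1] :: complex^3"
    have "2 \<le> length (filter (\<lambda>J. ccross J ex2 = 0) Ls)"
    proof (rule saddle_node(2)[OF cf(1) R(2)[OF L(1)] cf(2), of ?p])
      show "ccross L ex2 \<noteq> 0" using R(1)[OF L(1)] ccross_ex2 by blast
      show "dot L ?p = 0" using L by (simp add: dot_def)
      show "dot ex2 (Z v) = 0" for v using cf(3) vec3_collapse[of v] unfolding planar_def by (metis dot_ex(2) vector_3(2))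
      show "Z ?p = 0" using cf(3) that by (simp add: planar_def cubic_line p_def q_def vec3_eq_iff)
      show "\<not> degenerate_at Z ?p" by (rule nd) simp
    qed (auto simp: vec3_eq_iff)
    moreover have "length (filter (\<lambda>J. ccross J ex2 = 0) Ls) = 1 + length (filter (\<lambda>J. ccross J ex2 = 0) R)"
      using length_filter_remove1[OF cf(2), of "\<lambda>J. ccross J ex2 = 0"] ccross_ex2[of ex2] by (simp add: R_def)
    moreover have "filter (\<lambda>J. ccross J ex2 = 0) R = []" using R ccross_ex2 by (auto simp: filter_empty_conv)
    ultimately show False by simp
  qed
  have fixed: "poly p r = r * poly q r" if W: "poly W r = 0" for r
  proof -
    have "(r * poly q r - poly p r) * poly W r = 0" using W by simp
    then obtain L where L: "L \<in> set R" "L$1 * r + L$3 = 0" using root by blast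
    have "L$1 * poly p r + L$3 * poly q r = 0"
      using planar_invariant[OF cf(1,3) R(2)[OF L(1)], of r 0 1] L by (simp add: dot_def cubic_line p_def q_def)
    then have "L$1 * (poly p r - r * poly q r) = 0" using L(2) by algebra
    then show ?thesis using R(1)[OF L(1)] by simp
  qed
  have "degree p \<le> 3" "degree q \<le> 3" by (simp_all add: p_def q_def)
  then obtain r where r: "poly W r = 0" "poly (pderiv W) r = 0"
    using double_critical_point[of p q] dW nc fixed unfolding W_def by blast
  have qr: "poly q r \<noteq> 0" using fixed[OF r(1)] nc[of r] by auto
  have p1: "poly (pderiv p) r = r * poly (pderiv q) r"
    using r(1) fixed[OF r(1)] qr by (simp add: W_def)
  have p2: "poly (pderiv (pderiv p)) r = r * poly (pderiv (pderiv q)) r"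
    using r(2) fixed[OF r(1)] qr p1 by (simp add: W_def pderiv_mult pderiv_diff algebra_simps)
  \<comment> \<open>move the double critical point to the origin of the line\<close>
  define M :: "complex^3^3" where "M = vector [vector [1, 0, r], vector [0, 1, 0], vector [0, 0, 1]]"
  have M: "invertible M" by (simp add: invertible_det_nz det_3 M_def)
  have Mv: "M *v vector [x, y, z] = vector [x + r * z, y, z]" for x y z
    by (simp add: vec3_eq_iff mv3_nth M_def)
  have Mi: "matrix_inv M *v v = vector [v$1 - r * v$3, v$2, v$3]" for v
  proof -
    have "M *v vector [v$1 - r * v$3, v$2, v$3] = v" by (simp add: Mv vec3_eq_iff)
    then show ?thesis using matrix_inv3(2)[OF M, of "vector [v$1 - r * v$3, v$2, v$3]"] by simp
  qed
  have e2: "ex2 v* M = ex2" by (simp add: vec3_eq_iff vm3_nth M_def)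
  let ?Z = "transport M Z" and ?Ls = "map (\<lambda>L. L v* M) Ls"
  have cf': "convex_field ?Z ?Ls" by (rule convex_field_transport[OF cf(1) M])
  have mem: "ex2 \<in> set ?Ls" using cf(2) e2 by (force simp: image_iff)
  have Zv: "?Z (vector [x, y, z]) = vector [cubic a (x + r * z) y z - r * cubic c (x + r * z) y z, 0, cubic c (x + r * z) y z]" for x y z
    using cf(3) by (simp add: transport_def Mv Mi planar_def)
  have "dot ex2 (?Z v) = 0" for v using Zv[of "v$1" "v$2" "v$3"] by (simp add: vec3_collapse)
  then obtain a' c' where pl: "planar ?Z a' c'" using planar_exists[OF cf'] by metis
  have ac: "cubic a' x y z = cubic a (x + r * z) y z - r * cubic c (x + r * z) y z"
     "cubic c' x y z = cubic c (x + r * z) y z" for x y z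
    using pl Zv[of x y z] by (simp_all add: planar_def vec3_eq_iff)
  have "c' 9 = poly q r" using ac(2)[of 0 0 1] by (simp add: cubic_line q_def)
  then have c9: "c' 9 \<noteq> 0" using qr by simp
  have "poly [:a' 9, a' 7, a' 4, a' 0:] x = poly (pcompose (p - smult r q) [:r, 1:]) x" for x
    using ac(1)[of x 0 1] by (simp add: cubic_line poly_pcompose p_def q_def algebra_simps)
  then have pc: "[:a' 9, a' 7, a' 4, a' 0:] = pcompose (p - smult r q) [:r, 1:]" using poly_eq_poly_eq_iff ext by blast
  have a9: "a' 9 = 0" using arg_cong[OF pc, of "\<lambda>f. poly f 0"] fixed[OF r(1)] by (simp add: poly_pcompose)
  have a7: "a' 7 = 0" using arg_cong[OF pc, of "\<lambda>f. poly (pderiv f) 0"] p1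
    by (simp add: pderiv_pCons pderiv_pcompose poly_pcompose pderiv_diff pderiv_smult)
  have a4: "a' 4 = 0" using arg_cong[OF pc, of "\<lambda>f. poly (pderiv (pderiv f)) 0"] p2
    by (simp add: pderiv_pCons pderiv_pcompose poly_pcompose pderiv_diff pderiv_smult)
  have "(r * poly q r - poly p r) * poly W r = 0" using r(1) by simp
  then obtain L where L: "L \<in> set R" "L$1 * r + L$3 = 0" using root by blast
  have a8: "a' 8 = 0"
  proof -
    let ?L = "L v* M"
    have L': "?L$1 = L$1" "?L$2 = L$2" "?L$3 = 0" using L by (simp_all add: vm3_nth M_def algebra_simps)
    have "poly [:L$1 * bq3 (a' 0) (a' 1) (a' 2) (a' 3) (L$2) (- L$1), L$1 * bq2 (a' 4) (a' 5) (a' 6) (L$2) (- L$1), - (L$1 * (a' 8 * L$1)):] w = 0" for w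
      using planar_invariant[OF cf' pl, of ?L "L$2" "- L$1" w] L' R(2)[OF L(1)] a9 a7
      by (simp add: dot_def cubic_def bq1_def algebra_simps power2_eq_square)
    then have "L$1 * (a' 8 * L$1) = 0" using poly_all_0_iff_0[of "[:_, _, _:]"] by (metis pCons_eq_0_iff neg_equal_0_iff_equal)
    then show ?thesis using R(1)[OF L(1)] by simp
  qed
  have av: "avoid3 ?Ls \<le> 5"
  proof -
    obtain k' where k': "k' \<noteq> 0" "\<And>x y z. planar_infl a' c' x y z = k' * (\<Prod>L\<leftarrow>remove1 ex2 ?Ls. dot L (vector [x, y, z]))"
      using planar_rest[OF cf' mem pl] by blast
    have eq: "k' * (\<Prod>L\<leftarrow>remove1 ex2 ?Ls. dot L (vector [1, 0, z])) = poly (zpoly_infl a' c' 1 0) z" for z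
      by (simp add: poly_zpoly_infl k'(2))
    have "degree (zpoly_infl a' c' 1 0) \<le> 5" using a9 a7 a4 a8
      by (intro degree_le) (auto simp: zpoly_infl_def zpoly_def zpoly_x_def bq_defs pderiv_pCons power2_eq_square
        numeral_eq_Suc coeff_pCons algebra_simps split: nat.splits)
    moreover have "zpoly_infl a' c' 1 0 \<noteq> 0"
    proof -
      have "infl Z (vector [1, y, 0]) = det M * infl ?Z (vector [1, y, 0])" for y
        using infl_transport[of Z M "vector [1, y, 0]"] convex_fieldD(1)[OF cf(1)] M by (simp add: Mv)
      then have "y * planar_infl a c 1 y 0 = det M * (y * planar_infl a' c' 1 y 0)" for y
        unfolding planar_infl[OF cf(3)] planar_infl[OF pl] by simp
      then have "planar_infl a c 1 0 0 = det M * planar_infl a' c' 1 0 0"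
      proof -
        let ?f = "\<lambda>p. planar_infl a c (p$1 - p$1 + 1) (p$2) (p$3 - p$3)" and ?g = "\<lambda>p. det M * planar_infl a' c' (p$1 - p$1 + 1) (p$2) (p$3 - p$3)"
        assume h: "\<And>y. y * planar_infl a c 1 y 0 = det M * (y * planar_infl a' c' 1 y 0)"
        have "poly_on_lines ?f" "poly_on_lines ?g" unfolding planar_infl_def cubic_defs by (intro pol_intros)+
        then have "?f ex3 = ?g ex3"
          by (rule pol_cancel_dot[where L=ex2]) (use h in \<open>auto simp: vec3_eq_iff algebra_simps\<close>)
        then show ?thesis by simp
      qed
      then have "planar_infl a' c' 1 0 0 \<noteq> 0" using T1 by auto
      then show ?thesis using poly_zpoly_infl[of a' c' 1 0 0] by auto
    qed
    ultimately show ?thesis using prod_lines_degree[OF eq] by (simp add: avoid3_remove1)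
  qed
  have "a' 8 = 0 \<and> a' 4 = 0 \<and> a' 5 = 0 \<and> a' 6 = 0" by (rule radial_point(2)[OF cf' mem pl a9 a7 c9 av])
  then have "radial_two ?Z" unfolding radial_two_def using pl a9 a7 c9 by blast
  then show ?thesis using that M e2 by blast
qed

section \<open>Multiple lines\<close>

lemma distinct_mapI: "(\<And>v. length (filter (\<lambda>x. f x = v) xs) \<le> 1) \<Longrightarrow> distinct (map f xs)"
proof (induction xs)
  case (Cons x xs)
  have "length (filter (\<lambda>y. f y = v) xs) \<le> 1" for v using Cons.prems[of v] by (simp split: if_splits)
  moreover have "filter (\<lambda>y. f y = f x) xs = []" using Cons.prems[of "f x"] by simp
  ultimately show ?case using Cons.IH by (auto simp: filter_empty_conv)
qed simp

text \<open>The lines that do not pass through \<open>(0, 0, 1)\<close> meet \<open>y = 0\<close> at roots of the cubic \<open>C(1, 0, t)\<close>.  These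
  points satisfy \<open>saddle_node\<close>, so the lines meet \<open>y = 0\<close> at distinct points and there are at most three
  of them, while the line \<open>y = 0\<close> counts at most four times.  As every other line through \<open>(0, 0, 1)\<close> is
  excluded by invariance, seven lines remain instead of nine.\<close>

lemma multiple_line_coords:
  assumes cf: "convex_field Z Ls" "ex2 \<in> set Ls" "planar Z a c" and a0: "a 0 = 0" "a 4 = 0" "a 7 = 0" "a 9 = 0"
    and nd: "\<And>p. p$2 = 0 \<Longrightarrow> \<not> degenerate_at Z p"
  shows "\<forall>L\<in>set Ls. L$3 = 0"
proof (rule ccontr)
  let ?h = "[:c 0, c 4, c 7, c 9:]"
  have A: "cubic a x 0 z = 0" for x z using a0 by (simp add: cubic_def bq_defs)
  have C: "cubic c x 0 z = c 0 * x^3 + c 4 * x^2 * z + c 7 * x * z^2 + c 9 * z^3" for x z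
    by (simp add: cubic_def bq_defs algebra_simps)
  have h0: "?h \<noteq> 0"
  proof
    assume "?h = 0"
    then have c0: "c 0 = 0" "c 4 = 0" "c 7 = 0" "c 9 = 0" by auto
    obtain x y z where *: "dot ex2 (vector [x, y, z]) = 0"
      "y * cubic c x y z \<noteq> 0 \<or> x * cubic c x y z \<noteq> z * cubic a x y z \<or> y * cubic a x y z \<noteq> 0"
      by (rule planar_no_common_line[OF cf(1,3), of ex2]) (auto simp: vec3_eq_iff)
    then show False using A C c0 by simp
  qed
  assume n: "\<not> (\<forall>L\<in>set Ls. L$3 = 0)"
  define R where "R = filter (\<lambda>L. L$3 \<noteq> 0) Ls"
  define \<xi> where "\<xi> L = - L$1 / L$3" for L :: "complex^3"
  let ?q = "\<lambda>t. vector [1, 0, t] :: complex^3"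
  have dq: "dot L (?q t) = 0 \<longleftrightarrow> \<xi> L = t" if "L$3 \<noteq> 0" for L t
  proof -
    have "\<xi> L = t \<longleftrightarrow> - L$1 = t * L$3" unfolding \<xi>_def divide_eq_eq using that by simp
    also have "\<dots> \<longleftrightarrow> dot L (?q t) = 0" by (simp add: dot_def) algebra
    finally show ?thesis by simp
  qed
  have R: "L \<in> set Ls" "L$3 \<noteq> 0" if "L \<in> set R" for L using that by (auto simp: R_def)
  have root: "poly ?h (\<xi> L) = 0" if L: "L \<in> set R" for L
  proof -
    have "L$1 * cubic a 1 0 (\<xi> L) + L$3 * cubic c 1 0 (\<xi> L) = 0"
      by (rule planar_invariant[OF cf(1,3) R(1)[OF L]]) (use dq[OF R(2)[OF L]] in simp)
    then have "cubic c 1 0 (\<xi> L) = 0" using R(2)[OF L] by (simp add: A)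
    then show ?thesis by (simp add: C algebra_simps power2_eq_square power3_eq_cube)
  qed
  have saddle: "length (filter (\<lambda>J. dot J (?q (\<xi> L)) = 0 \<and> ccross J ex2 \<noteq> 0) Ls) = 1"
      "length (filter (\<lambda>J. ccross J ex2 = 0) Ls) \<le> 4" if L: "L \<in> set R" for L
  proof -
    note s = saddle_node[OF cf(1) R(1)[OF L] cf(2), of "?q (\<xi> L)"]
    have 1: "ccross L ex2 \<noteq> 0" using R(2)[OF L] ccross_ex2 by blast
    have 2: "?q (\<xi> L) \<noteq> 0" by (simp add: vec3_eq_iff)
    have 3: "dot L (?q (\<xi> L)) = 0" using dq[OF R(2)[OF L]] by simp
    have 4: "dot ex2 (Z v) = 0" for v using cf(3) vec3_collapse[of v] unfolding planar_def by (metis dot_ex(2) vector_3(2))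
    have 5: "Z (?q (\<xi> L)) = 0" using cf(3) root[OF L]
      by (simp add: planar_def A C vec3_eq_iff algebra_simps power2_eq_square power3_eq_cube)
    have 6: "\<not> degenerate_at Z (?q (\<xi> L))" by (rule nd) simp
    show "length (filter (\<lambda>J. dot J (?q (\<xi> L)) = 0 \<and> ccross J ex2 \<noteq> 0) Ls) = 1"
      "length (filter (\<lambda>J. ccross J ex2 = 0) Ls) \<le> 4"
      using s(1,3)[OF 1 2 3 _ 4 5 6] by simp_all
  qed
  have "distinct (map \<xi> R)"
  proof (rule distinct_mapI)
    fix v
    show "length (filter (\<lambda>x. \<xi> x = v) R) \<le> 1"
    proof (cases "filter (\<lambda>x. \<xi> x = v) R")
      case (Cons L xs)
      have "L \<in> set (filter (\<lambda>x. \<xi> x = v) R)" by (simp only: Cons list.set_intros)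
      then have L: "L \<in> set R" "\<xi> L = v" by auto
      have eq: "filter (\<lambda>x. \<xi> x = v) R = filter (\<lambda>x. \<xi> x = v) (filter (\<lambda>L. L$3 \<noteq> 0) (filter (\<lambda>J. dot J (?q (\<xi> L)) = 0 \<and> ccross J ex2 \<noteq> 0) Ls))"
        unfolding R_def filter_filter by (rule filter_cong) (use L dq ccross_ex2 in auto)
      have "length (filter (\<lambda>x. \<xi> x = v) R) \<le> length (filter (\<lambda>J. dot J (?q (\<xi> L)) = 0 \<and> ccross J ex2 \<noteq> 0) Ls)"
        by (subst eq) (rule order.trans[OF length_filter_le length_filter_le])
      then show ?thesis using saddle(1)[OF L(1)] by simp
    qed simp
  qed
  then have "length R = card (\<xi> ` set R)" by (metis distinct_card length_map set_map)
  also have "\<dots> \<le> card {t. poly ?h t = 0}" by (rule card_mono[OF poly_roots_finite[OF h0]]) (use root in auto)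
  also have "\<dots> \<le> degree ?h" by (rule card_poly_roots_bound[OF h0])
  also have "\<dots> \<le> 3" by simp
  finally have av: "avoid3 Ls \<le> 3" by (simp add: R_def)
  have c9: "c 9 = 0" using radial_point(1)[OF cf a0(4,3)] av by auto
  have a8: "a 8 \<noteq> 0" using planar_degenerate[OF cf(3) a0(3) _ a0(4) c9] nd[of ex3] by auto
  have thru: "L$1 = 0" if L: "L \<in> set Ls" "L$3 = 0" for L
  proof -
    have "poly [:L$1 * bq3 (a 0) (a 1) (a 2) (a 3) (L$2) (- L$1), L$1 * bq2 (a 4) (a 5) (a 6) (L$2) (- L$1), - (L$1 * (a 8 * L$1)):] w = 0" for w
      using planar_invariant[OF cf(1,3) L(1), of "L$2" "- L$1" w] L(2) a0
      by (simp add: dot_def cubic_def bq1_def algebra_simps power2_eq_square)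
    then have "L$1 * (a 8 * L$1) = 0" using poly_all_0_iff_0[of "[:_, _, _:]"] by (metis pCons_eq_0_iff neg_equal_0_iff_equal)
    then show ?thesis using a8 by simp
  qed
  have "filter (\<lambda>J. ccross J ex2 = 0) Ls = filter (\<lambda>J. \<not> J$3 \<noteq> 0) Ls"
    by (rule filter_cong) (use thru ccross_ex2 in auto)
  moreover have "9 = avoid3 Ls + length (filter (\<lambda>L. \<not> L$3 \<noteq> 0) Ls)"
    using length_filter_not[of Ls "\<lambda>L. L$3 \<noteq> 0"] convex_field_length[OF cf(1)] by simp
  moreover obtain L where "L \<in> set R" using n by (auto simp: R_def)
  ultimately show False using saddle(2)[of L] av by simp
qed

text \<open>A vanishing Wronskian means proportionality.  The proof is by two-by-two minors of the
  coefficients, to which the coefficients of the Wronskian reduce.\<close>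

lemma proportional_cubics:
  assumes "\<And>x. poly (pderiv [:a0, a1, a2, a3:] * [:c0, c1, c2, c3:] - [:a0, a1, a2, a3:] * pderiv [:c0, c1, c2, c3:]) x = (0::complex)"
  shows "\<exists>s t. (s, t) \<noteq> (0, 0) \<and> s * a0 + t * c0 = 0 \<and> s * a1 + t * c1 = 0 \<and> s * a2 + t * c2 = 0 \<and> s * a3 + t * c3 = 0"
proof -
  let ?W = "pderiv [:a0, a1, a2, a3:] * [:c0, c1, c2, c3:] - [:a0, a1, a2, a3:] * pderiv [:c0, c1, c2, c3:]"
  have W: "?W = 0" using assms poly_all_0_iff_0 by blast
  have m01: "a1 * c0 - a0 * c1 = 0" using arg_cong[OF W, of "\<lambda>p. coeff p 0"] by (simp add: pderiv_pCons algebra_simps)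
  have m02: "a2 * c0 - a0 * c2 = 0" using arg_cong[OF W, of "\<lambda>p. coeff p 1"] by (simp add: pderiv_pCons algebra_simps)
  have s: "3 * (a3 * c0 - a0 * c3) + (a2 * c1 - a1 * c2) = 0" using arg_cong[OF W, of "\<lambda>p. coeff p 2"]
    by (simp add: pderiv_pCons numeral_eq_Suc algebra_simps)
  have m13: "a3 * c1 - a1 * c3 = 0" using arg_cong[OF W, of "\<lambda>p. coeff p 3"]
    by (simp add: pderiv_pCons numeral_eq_Suc algebra_simps)
  have m23: "a3 * c2 - a2 * c3 = 0" using arg_cong[OF W, of "\<lambda>p. coeff p 4"]
    by (simp add: pderiv_pCons numeral_eq_Suc algebra_simps)
  \<comment> \<open>the Pluecker relation of the six minors\<close>
  have "(a3 * c0 - a0 * c3) * (a2 * c1 - a1 * c2) = 0" using m01 m02 m13 m23 by algebra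
  then have m03: "a3 * c0 - a0 * c3 = 0" and m12: "a2 * c1 - a1 * c2 = 0" using s by auto
  show ?thesis
  proof (cases "c0 = 0 \<and> c1 = 0 \<and> c2 = 0 \<and> c3 = 0")
    case True then show ?thesis by (intro exI[of _ 0] exI[of _ 1]) auto
  next
    case False
    then consider "c0 \<noteq> 0" | "c1 \<noteq> 0" | "c2 \<noteq> 0" | "c3 \<noteq> 0" by blast
    then show ?thesis
    proof cases
      case 1 then show ?thesis using m01 m02 m03 by (intro exI[of _ c0] exI[of _ "- a0"]) (auto simp: algebra_simps)
    next
      case 2 then show ?thesis using m01 m12 m13 by (intro exI[of _ c1] exI[of _ "- a1"]) (auto simp: algebra_simps)
    next
      case 3 then show ?thesis using m02 m12 m23 by (intro exI[of _ c2] exI[of _ "- a2"]) (auto simp: algebra_simps)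
    next
      case 4 then show ?thesis using m03 m13 m23 by (intro exI[of _ c3] exI[of _ "- a3"]) (auto simp: algebra_simps)
    qed
  qed
qed

text \<open>A line of multiplicity at least two makes \<open>(A, C)\<close> constant in direction along it, and a rotation of
  the coordinates turns this direction into that of \<open>(0, 0, 1)\<close>.\<close>

lemma multiple_line_center:
  assumes cf: "convex_field Z Ls" "ex2 \<in> set Ls" "planar Z a c" and T: "\<And>x z. planar_infl a c x 0 z = 0"
  obtains M a' c' where "invertible M" "ex2 v* M = ex2" "planar (transport M Z) a' c'"
    "a' 0 = 0" "a' 4 = 0" "a' 7 = 0" "a' 9 = 0"
proof -
  let ?p = "[:a 9, a 7, a 4, a 0:]" and ?q = "[:c 9, c 7, c 4, c 0:]"
  let ?W = "pderiv ?p * ?q - ?p * pderiv ?q" and ?F = "[:0, 1:] * ?q - ?p"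
  have F: "?F \<noteq> 0"
  proof
    assume F0: "?F = 0"
    obtain x y z where *: "dot ex2 (vector [x, y, z]) = 0"
      "y * cubic c x y z \<noteq> 0 \<or> x * cubic c x y z \<noteq> z * cubic a x y z \<or> y * cubic a x y z \<noteq> 0"
      by (rule planar_no_common_line[OF cf(1,3), of ex2]) (auto simp: vec3_eq_iff)
    have e: "a 9 = 0" "c 9 = a 7" "c 7 = a 4" "c 4 = a 0" "c 0 = 0" using F0 by auto
    show False using * by (simp add: cubic_def bq_defs e algebra_simps power2_eq_square power3_eq_cube)
  qed
  have "poly (?F * ?W) x = 0" for x
  proof -
    have "poly (?F * ?W) x = (x * poly ?q x - poly ?p x) * poly ?W x" by (simp only: poly_mult poly_diff poly_pCons) simp
    then show ?thesis using T[of x 1] unfolding planar_infl_line cubic_line by metis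
  qed
  then have "?F * ?W = 0" using poly_all_0_iff_0 by blast
  then have "?W = 0" using F by (metis mult_eq_0_iff)
  then have "poly ?W x = 0" for x by (metis poly_0)
  from proportional_cubics[OF this] obtain s t where st: "(s, t) \<noteq> (0, 0)"
    "s * a 9 + t * c 9 = 0" "s * a 7 + t * c 7 = 0" "s * a 4 + t * c 4 = 0" "s * a 0 + t * c 0 = 0" by blast
  let ?K = "vector [s, 0, t] :: complex^3"
  define N where "N = (if s = 0 then ex1 else ex3)"
  have "dot N (ccross ?K ex2) \<noteq> 0" using st(1) by (auto simp: N_def dot_def)
  from adapt_rows[OF this] obtain M where M: "invertible M" "?K v* M = ex1" "ex2 v* M = ex2" "N v* M = ex3" .
  let ?Z = "transport M Z" and ?Ls = "map (\<lambda>L. L v* M) Ls"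
  have cf': "convex_field ?Z ?Ls" by (rule convex_field_transport[OF cf(1) M(1)])
  have Z2: "dot ex2 (Z v) = 0" for v using cf(3) vec3_collapse[of v] unfolding planar_def by (metis dot_ex(2) vector_3(2))
  have d: "?Z v = vector [dot ?K (Z (M *v v)), dot ex2 (Z (M *v v)), dot N (Z (M *v v))]" for v
    unfolding transport_def by (rule mv_eqI[OF M])
  have "dot ex2 (?Z v) = 0" for v using d[of v] Z2[of "M *v v"] by simp
  then obtain a' c' where pl: "planar ?Z a' c'" using planar_exists[OF cf'] by metis
  have "cubic a' x 0 z = 0" for x z
  proof -
    let ?v = "M *v vector [x, 0, z]"
    have "?v $ 2 = dot (ex2 v* M) (vector [x, 0, z])" using dot_vm[of ex2 M "vector [x, 0, z]"] by simp
    then have v2: "?v $ 2 = 0" by (simp add: M(3))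
    have "Z ?v = vector [cubic a (?v$1) 0 (?v$3), 0, cubic c (?v$1) 0 (?v$3)]"
      using cf(3) vec3_collapse[of ?v] v2 unfolding planar_def by metis
    then have "dot ?K (Z ?v) = s * cubic a (?v$1) 0 (?v$3) + t * cubic c (?v$1) 0 (?v$3)" by (simp add: dot_def)
    also have "\<dots> = (s * a 0 + t * c 0) * (?v$1)^3 + (s * a 4 + t * c 4) * (?v$1)^2 * ?v$3
        + (s * a 7 + t * c 7) * ?v$1 * (?v$3)^2 + (s * a 9 + t * c 9) * (?v$3)^3"
      by (simp add: cubic_def bq_defs algebra_simps)
    also have "\<dots> = 0" by (simp add: st)
    finally have "dot ?K (Z ?v) = 0" .
    then have "?Z (vector [x, 0, z]) $ 1 = 0" using d by simp
    then show ?thesis using pl by (simp add: planar_def)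
  qed
  then have "bq3 (a' 0) (a' 4) (a' 7) (a' 9) x z = 0" for x z
    by (simp add: cubic_def bq_defs algebra_simps power2_eq_square)
  then have "a' 0 = 0" "a' 4 = 0" "a' 7 = 0" "a' 9 = 0" using bq_all_0(3)[of "a' 0" "a' 4" "a' 7" "a' 9"] by blast+
  then show ?thesis using that M pl by blast
qed

lemma transport_keeps_ex2:
  assumes "ex2 v* M = ex2" shows "(M *v p) $ 2 = p $ 2"
  using dot_vm[of ex2 M p] by (simp add: assms)

lemma planar_infl_transport:
  assumes cf: "convex_field Z Ls" and pl: "planar Z a c" and M: "invertible M" "ex2 v* M = ex2"
    and pl': "planar (transport M Z) a' c'"
  shows "planar_infl a c ((M *v p)$1) ((M *v p)$2) ((M *v p)$3) = det M * planar_infl a' c' (p$1) (p$2) (p$3)"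
proof -
  let ?f = "\<lambda>p. planar_infl a c (dot (M$1) p) (dot (M$2) p) (dot (M$3) p)" and ?g = "\<lambda>p. det M * planar_infl a' c' (p$1) (p$2) (p$3)"
  have Mp: "(M *v p) $ i = dot (M $ i) p" for p i by (simp add: mv3_nth dot_def)
  have "infl Z (M *v p) = det M * infl (transport M Z) p" for p
    by (rule infl_transport[OF convex_fieldD(1)[OF cf] M(1)])
  then have "(M *v p)$2 * ?f p = det M * (p$2 * planar_infl a' c' (p$1) (p$2) (p$3))" for p
    using planar_infl[OF pl, of "(M *v p)$1" "(M *v p)$2" "(M *v p)$3"] planar_infl[OF pl', of "p$1" "p$2" "p$3"]
    unfolding vec3_collapse by (simp add: Mp)
  then have h: "dot ex2 p * ?f p = dot ex2 p * ?g p" for p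
    using transport_keeps_ex2[OF M(2)] by (simp add: algebra_simps)
  have "poly_on_lines ?f" unfolding planar_infl_def cubic_defs by (intro pol_intros pol_dot)
  moreover have "poly_on_lines ?g" unfolding planar_infl_def cubic_defs by (intro pol_intros)
  moreover have "ex2 \<noteq> 0" by (simp add: vec3_eq_iff)
  ultimately have "?f p = ?g p" using h by (intro pol_cancel_dot[where L=ex2 and f="?f" and g="?g"])
  then show ?thesis by (simp add: Mp)
qed

lemma adapt_line_point:
  assumes "p \<noteq> 0" "p$2 = 0"
  obtains M where "invertible M" "ex2 v* M = ex2" "M *v ex1 = p"
proof -
  obtain M where M: "invertible M" "ex2 v* M = ex2" "M *v ex3 = p"
    using adapt_one[of ex2 p] assms by (auto simp: vec3_eq_iff)
  define P :: "complex^3^3" where "P = vector [ex3, ex2, ex1]"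
  have "invertible (M ** P)" using M(1) by (intro invertible_mult) (simp_all add: invertible_det_nz det_3 P_def)
  moreover have "ex2 v* (M ** P) = ex2"
    by (simp only: vm_assoc[symmetric] M(2)) (simp add: vec3_eq_iff vm3_nth P_def)
  moreover have "(M ** P) *v ex1 = p"
  proof -
    have "P *v ex1 = ex3" by (simp add: vec3_eq_iff mv3_nth P_def)
    then show ?thesis by (simp only: matrix_vector_mul_assoc[symmetric] M(3))
  qed
  ultimately show ?thesis using that by blast
qed

text \<open>A simple inflection line carries a radial point of order two by \<open>radial_two_on_line\<close>; a multiple
  one makes all lines pass through one point by \<open>multiple_line_coords\<close>.  Both arguments assume that
  there is no degenerate point on the line.\<close>

lemma line_dichotomy:
  assumes cf: "convex_field Z Ls" "L \<in> set Ls" and nc: "\<And>p. p \<noteq> 0 \<Longrightarrow> \<exists>K\<in>set Ls. dot K p \<noteq> 0"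
  shows "(\<exists>p. dot L p = 0 \<and> degenerate_at Z p) \<or>
    (\<exists>Y Ks. convex_field Y Ks \<and> ex2 \<in> set Ks \<and> radial_two Y \<and> (\<forall>W. field_equiv Y W \<longrightarrow> field_equiv Z W))"
proof (cases "\<exists>p. dot L p = 0 \<and> degenerate_at Z p")
  case False
  have L0: "L \<noteq> 0" using convex_fieldD(2)[OF cf] .
  obtain p0 where p0: "p0 \<noteq> 0" "dot L p0 = 0"
  proof -
    obtain p where "dot L p = 0" "field_form Z p \<noteq> 0" using convex_fieldD(4)[OF cf(1) L0] by blast
    then show ?thesis by (intro that[of p]) (auto simp: field_form_def vec3_eq_iff)
  qed
  obtain M where M: "invertible M" "L v* M = ex2" using adapt_one[OF L0 p0] by metis
  let ?Ls = "map (\<lambda>L. L v* M) Ls"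
  have mem: "ex2 \<in> set ?Ls" using cf(2) M(2) by (force simp: image_iff)
  obtain Z2 a c where Z2: "convex_field Z2 ?Ls" "\<And>p. field_form Z2 p = field_form (transport M Z) p" "planar Z2 a c"
    using planar_gauge[OF convex_field_transport[OF cf(1) M(1)] mem] by metis
  have nd: "\<not> degenerate_at Z2 p" if "p$2 = 0" for p
  proof
    assume "degenerate_at Z2 p"
    then have "degenerate_at Z (M *v p)" using degenerate_form[of "transport M Z" Z2] degenerate_form[of Z2 "transport M Z"] Z2(2)
      degenerate_transport[OF M(1)] by metis
    moreover have "dot L (M *v p) = 0" using that dot_vm[of L M p] by (simp add: M(2))
    ultimately show False using False by blast
  qed
  have eq: "field_equiv Z2 W \<longrightarrow> field_equiv Z W" for W
    using field_equiv_transport[OF M(1), of Z W] field_equiv_form[of Z2 1 "transport M Z" W] Z2(2) by simp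
  show ?thesis
  proof (cases "\<forall>x z. planar_infl a c x 0 z = 0")
    case True
    obtain N a' c' where N: "invertible N" "ex2 v* N = ex2" "planar (transport N Z2) a' c'"
      "a' 0 = 0" "a' 4 = 0" "a' 7 = 0" "a' 9 = 0" using multiple_line_center[OF Z2(1) mem Z2(3)] True by metis
    let ?Ks = "map (\<lambda>L. L v* N) ?Ls"
    have mem': "ex2 \<in> set ?Ks" using mem N(2) by (metis image_eqI list.set_map)
    have "\<not> degenerate_at (transport N Z2) p" if "p$2 = 0" for p
      using degenerate_transport[OF N(1)] nd transport_keeps_ex2[OF N(2)] that by metis
    then have *: "\<forall>L\<in>set ?Ks. L$3 = 0"
      using multiple_line_coords[OF convex_field_transport[OF Z2(1) N(1)] mem' N(3-7)] by blast
    let ?p = "M *v (N *v ex3)"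
    have "?p \<noteq> 0" using matrix_inv3(2)[OF M(1), of "N *v ex3"] matrix_inv3(2)[OF N(1), of ex3]
      by (metis matrix_vector_mult_0_right vector_3(3) zero_index zero_neq_one)
    then obtain K where K: "K \<in> set Ls" "dot K ?p \<noteq> 0" using nc by blast
    have "(K v* M v* N) $ 3 = dot K ?p" by (simp add: vm_nth3 dot_vm)
    then show ?thesis using * K by auto
  next
    case nz: False
    then obtain x z where xz: "planar_infl a c x 0 z \<noteq> 0" by blast
    let ?p = "vector [x, 0, z] :: complex^3"
    have "?p \<noteq> 0"
    proof
      assume "?p = 0"
      then have "x = 0" "z = 0" by (simp_all add: vec3_eq_iff)
      then show False using xz by (simp add: planar_infl_def cubic_defs)
    qed
    then obtain N where N: "invertible N" "ex2 v* N = ex2" "N *v ex1 = ?p" using adapt_line_point[of ?p] by auto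
    let ?Ks = "map (\<lambda>L. L v* N) ?Ls" and ?Z3 = "transport N Z2"
    have mem': "ex2 \<in> set ?Ks" using mem N(2) by (metis image_eqI list.set_map)
    have cf3: "convex_field ?Z3 ?Ks" by (rule convex_field_transport[OF Z2(1) N(1)])
    have z2: "dot ex2 (Z2 v) = 0" for v using Z2(3) vec3_collapse[of v] unfolding planar_def by (metis dot_ex(2) vector_3(2))
    have "dot ex2 (?Z3 v) = 0" for v using dot_matrix_inv[OF N(1), of ex2] z2 unfolding N(2) transport_def by metis
    then obtain a' c' where pl: "planar ?Z3 a' c'" using planar_exists[OF cf3] by metis
    have T1: "planar_infl a' c' 1 0 0 \<noteq> 0"
      using planar_infl_transport[OF Z2(1,3) N(1,2) pl, of ex1] xz by (auto simp: N(3))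
    have nd3: "\<not> degenerate_at ?Z3 p" if "p$2 = 0" for p
      using degenerate_transport[OF N(1)] nd transport_keeps_ex2[OF N(2)] that by metis
    obtain M' where M': "invertible M'" "ex2 v* M' = ex2" "radial_two (transport M' ?Z3)"
      using radial_two_on_line[OF cf3 mem' pl T1 nd3] by metis
    let ?Ks' = "map (\<lambda>L. L v* M') ?Ks"
    have "convex_field (transport M' ?Z3) ?Ks'" by (rule convex_field_transport[OF cf3 M'(1)])
    moreover have "ex2 \<in> set ?Ks'" using mem' M'(2) by (metis image_eqI list.set_map)
    moreover have "field_equiv (transport M' ?Z3) W \<longrightarrow> field_equiv Z W" for W
      using field_equiv_transport[OF M'(1)] field_equiv_transport[OF N(1)] eq by blast
    ultimately show ?thesis using M'(3) by blast
  qed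
qed blast

section \<open>Concurrent lines\<close>

definition ZH1 :: "complex^3 \<Rightarrow> complex^3" where "ZH1 p = vector [(p$1)^3, (p$2)^3, 0]"
definition ZH3 :: "complex^3 \<Rightarrow> complex^3" where
  "ZH3 p = vector [(p$1)^2 * (p$1 + 3 * p$2), (p$2)^2 * (3 * p$1 + p$2), 0]"
definition ZF1 :: "complex^3 \<Rightarrow> complex^3" where "ZF1 p = vector [0, (p$2)^3, (p$1)^3]"
definition ZF3 :: "complex^3 \<Rightarrow> complex^3" where "ZF3 p = vector [(p$1)^3, (p$2)^3, (p$3)^3]"

lemma poly4_coeffs:
  assumes "\<And>x::complex. c0 + c1 * x + c2 * x^2 + c3 * x^3 + c4 * x^4 = 0"
  shows "c0 = 0" "c1 = 0" "c2 = 0" "c3 = 0" "c4 = 0"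
proof -
  have "poly [:c0, c1, c2, c3, c4:] x = 0" for x
    using assms[of x] by (simp add: algebra_simps power2_eq_square power3_eq_cube power4_eq_xxxx)
  then have "[:c0, c1, c2, c3, c4:] = 0" using poly_all_0_iff_0 by blast
  then show "c0 = 0" "c1 = 0" "c2 = 0" "c3 = 0" "c4 = 0" by auto
qed

text \<open>This and the next two lemmas: binary forms \<open>B\<close> and \<open>h\<close> satisfying \<open>h B\<^sub>x = B h\<^sub>x\<close> have a quotient that
  depends on \<open>y\<close> only.  If the degree of \<open>B\<close> is one more than that of \<open>h\<close>, the quotient is a multiple of \<open>y\<close>.\<close>

lemma proportional_by_derivative_1:
  assumes h: "(h0, h1) \<noteq> (0, 0)"
    and e: "\<And>x y. bq1 h0 h1 x y * bq1 (2 * b0) b1 x y = bq2 b0 b1 b2 x y * h0"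
  obtains l where "b0 = 0" "b1 = l * h0" "b2 = l * h1"
proof -
  have "(h1 * b1 - b2 * h0) + (2 * h1 * b0) * x + (h0 * b0) * x^2 + 0 * x^3 + 0 * x^4 = 0" for x
    using e[of x 1] unfolding bq_defs power_one mult_1_right by algebra
  note c = poly4_coeffs[OF this]
  show ?thesis
  proof (cases "h0 = 0")
    case True then show ?thesis using c h by (intro that[of "b2 / h1"]) auto
  next
    case False then show ?thesis using c by (intro that[of "b1 / h0"]) (auto simp: field_simps)
  qed
qed

lemma proportional_by_derivative_2:
  assumes h: "(h0, h1, h2) \<noteq> (0, 0, 0)"
    and e: "\<And>x y. bq2 h0 h1 h2 x y * bq2 (3 * b0) (2 * b1) b2 x y = bq3 b0 b1 b2 b3 x y * bq1 (2 * h0) h1 x y"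
  obtains l where "b0 = 0" "b1 = l * h0" "b2 = l * h1" "b3 = l * h2"
proof -
  have "(h2 * b2 - b3 * h1) + (2 * h2 * b1 - 2 * b3 * h0) * x + (3 * h2 * b0 + h1 * b1 - h0 * b2) * x^2
      + (2 * h1 * b0) * x^3 + (h0 * b0) * x^4 = 0" for x
    using e[of x 1] unfolding bq_defs power_one mult_1_right by algebra
  note c = poly4_coeffs[OF this]
  consider "h0 \<noteq> 0" | "h0 = 0" "h1 \<noteq> 0" | "h0 = 0" "h1 = 0" "h2 \<noteq> 0" using h by blast
  then show ?thesis
  proof cases
    case 1 then show ?thesis using c by (intro that[of "b1 / h0"]) (auto simp: field_simps)
  next
    case 2 then show ?thesis using c by (intro that[of "b2 / h1"]) (auto simp: field_simps)
  next
    case 3 then show ?thesis using c by (intro that[of "b3 / h2"]) (auto simp: field_simps)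
  qed
qed

lemma proportional_quadratics:
  assumes h: "(h0, h1, h2) \<noteq> (0, 0, 0)"
    and e: "\<And>x y. bq2 h0 h1 h2 x y * bq1 (2 * b0) b1 x y = bq2 b0 b1 b2 x y * bq1 (2 * h0) h1 x y"
  obtains l where "b0 = l * h0" "b1 = l * h1" "b2 = l * h2"
proof -
  have "(h2 * b1 - b2 * h1) + (2 * h2 * b0 - 2 * h0 * b2) * x + (h1 * b0 - h0 * b1) * x^2
      + 0 * x^3 + 0 * x^4 = 0" for x
    using e[of x 1] unfolding bq_defs power_one mult_1_right by algebra
  note c = poly4_coeffs[OF this]
  consider "h0 \<noteq> 0" | "h0 = 0" "h1 \<noteq> 0" | "h0 = 0" "h1 = 0" "h2 \<noteq> 0" using h by blast
  then show ?thesis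
  proof cases
    case 1 then show ?thesis using c by (intro that[of "b0 / h0"]) (auto simp: field_simps)
  next
    case 2 then show ?thesis using c by (intro that[of "b1 / h1"]) (auto simp: field_simps)
  next
    case 3 then show ?thesis using c by (intro that[of "b2 / h2"]) (auto simp: field_simps)
  qed
qed

lemma bq_domain:
  assumes "\<And>x y. f x y * g x y = (0::complex)"
    "poly_on_lines (\<lambda>p. f (p$1) (p$2))" "poly_on_lines (\<lambda>p. g (p$1) (p$2))"
  shows "(\<forall>x y. f x y = 0) \<or> (\<forall>x y. g x y = 0)"
  using pol_domain[OF assms(2,3)] assms(1) by (simp add: all_vec3)

lemma quadratic_splits:
  assumes "(h0, h1, h2) \<noteq> (0, 0, 0)"
  obtains u v where "(u, v) \<noteq> (0, 0)" "\<And>x y. u * x + v * y = 0 \<Longrightarrow> bq2 h0 h1 h2 x y = 0"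
proof (cases "h0 = 0")
  case True then show ?thesis by (intro that[of 0 1]) (auto simp: bq2_def)
next
  case False
  then have "degree [:h2, h1, h0:] = 2" by simp
  then obtain r where r: "poly [:h2, h1, h0:] r = 0"
    using fundamental_theorem_of_algebra[of "[:h2, h1, h0:]"] constant_degree[of "[:h2, h1, h0:]"] by auto
  have "bq2 h0 h1 h2 x y = 0" if "1 * x + (- r) * y = 0" for x y
  proof -
    have "x = r * y" using that by simp
    then have "bq2 h0 h1 h2 x y = y^2 * poly [:h2, h1, h0:] r" by (simp add: bq2_def algebra_simps power2_eq_square)
    then show ?thesis using r by simp
  qed
  then show ?thesis by (intro that[of 1 "- r"]) auto
qed

text \<open>With \<open>A\<close> and \<open>C\<close> free of \<open>z\<close>, the inflection polynomial is \<open>A (A C\<^sub>x - C A\<^sub>x)\<close> and every root of the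
  Wronskian is a root of \<open>A\<close>.  Hence it is a multiple root of \<open>A\<close>, and the only possibility is that \<open>A\<close> is the
  cube of a linear form and \<open>C\<close>, modulo \<open>A\<close>, a multiple of \<open>y\<^sup>3\<close>.\<close>

lemma zfree_pair:
  assumes cf: "convex_field Z Ls" "ex2 \<in> set Ls" "planar Z a c" and thru: "\<And>L. L \<in> set Ls \<Longrightarrow> L$3 = 0"
    and a: "a 4 = 0" "a 5 = 0" "a 6 = 0" "a 7 = 0" "a 8 = 0" "a 9 = 0"
    and c: "c 4 = 0" "c 5 = 0" "c 6 = 0" "c 7 = 0" "c 8 = 0" "c 9 = 0"
  shows "field_equiv Z ZF1"
proof -
  define p where "p = [:a 3, a 2, a 1, a 0:]"
  define q where "q = [:c 3, c 2, c 1, c 0:]"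
  define V where "V = p * pderiv q - q * pderiv p"
  have A: "cubic a x y z = bq3 (a 0) (a 1) (a 2) (a 3) x y" "cubic c x y z = bq3 (c 0) (c 1) (c 2) (c 3) x y" for x y z
    using a c by (simp_all add: cubic_def bq1_def bq2_def)
  have p1: "bq3 (a 0) (a 1) (a 2) (a 3) x 1 = poly p x" "bq3 (c 0) (c 1) (c 2) (c 3) x 1 = poly q x" for x
    by (simp_all add: p_def q_def bq3_def algebra_simps power2_eq_square power3_eq_cube)
  have T: "planar_infl a c x 1 0 = poly p x * poly V x" for x
    unfolding planar_infl_def A p1 cubic_x_def cubic_z_def V_def using a c
    by (simp add: p_def q_def bq_defs pderiv_pCons algebra_simps power2_eq_square)
  obtain k where k: "k \<noteq> 0" "\<And>x y z. planar_infl a c x y z = k * (\<Prod>L\<leftarrow>remove1 ex2 Ls. dot L (vector [x, y, z]))"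
    using planar_rest[OF cf] by blast
  have Vp: "poly p r = 0" if "poly V r = 0" for r
  proof -
    note V0 = that
    obtain L where L: "L \<in> set (remove1 ex2 Ls)" "dot L (vector [r, 1, 0]) = 0"
    proof -
      have "k * (\<Prod>L\<leftarrow>remove1 ex2 Ls. dot L (vector [r, 1, 0])) = 0" using k(2)[of r 1 0] T[of r] V0 by simp
      then have "(\<Prod>L\<leftarrow>remove1 ex2 Ls. dot L (vector [r, 1, 0])) = 0" using k(1) by simp
      then show ?thesis using that by (auto simp: prod_list_zero_iff)
    qed
    have L': "L \<in> set Ls" using L(1) by (meson notin_set_remove1)
    have "L$1 \<noteq> 0"
    proof
      assume "L$1 = 0"
      then have "L = 0" using L(2) thru[OF L'] by (simp add: vec3_eq_iff dot_def)
      then show False using convex_fieldD(2)[OF cf(1) L'] by simp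
    qed
    then show ?thesis using planar_invariant[OF cf(1,3) L' L(2)] thru[OF L'] by (simp add: A p1 del: One_nat_def)
  qed
  have nc: False if "poly p r = 0" "poly q r = 0" for r
  proof -
    obtain x y z where *: "dot (vector [1, - r, 0]) (vector [x, y, z]) = 0"
      "y * cubic c x y z \<noteq> 0 \<or> x * cubic c x y z \<noteq> z * cubic a x y z \<or> y * cubic a x y z \<noteq> 0"
      by (rule planar_no_common_line[OF cf(1,3), of "vector [1, - r, 0]"]) (auto simp: vec3_eq_iff)
    have x: "x = r * y" using *(1) by (simp add: dot_def)
    have "bq3 d0 d1 d2 d3 x y = y^3 * bq3 d0 d1 d2 d3 r 1" for d0 d1 d2 d3 by (simp add: x bq3_def algebra_simps power2_eq_square power3_eq_cube)
    then show False using * that by (simp add: A p1 del: One_nat_def)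
  qed
  have nc0: "a 0 \<noteq> 0 \<or> c 0 \<noteq> 0"
  proof (rule ccontr)
    assume "\<not> ?thesis"
    moreover obtain x y z where "dot ex2 (vector [x, y, z]) = 0"
      "y * cubic c x y z \<noteq> 0 \<or> x * cubic c x y z \<noteq> z * cubic a x y z \<or> y * cubic a x y z \<noteq> 0"
      by (rule planar_no_common_line[OF cf(1,3), of "ex2"]) (auto simp: vec3_eq_iff)
    ultimately show False by (simp add: A bq3_def)
  qed
  have p0: "p \<noteq> 0"
  proof
    assume "p = 0"
    then have "planar_infl a c x y z = 0" for x y z
      using a by (simp add: p_def planar_infl_def A bq_defs cubic_z_def)
    then show False using planar_not_all_0[OF cf] by blast
  qed
  have has_root: "\<exists>r. poly f r = 0" if "degree f \<noteq> 0" for f :: "complex poly"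
    using fundamental_theorem_of_algebra[of f] constant_degree[of f] that by auto
  have dbl: "poly p r = 0 \<and> poly (pderiv p) r = 0 \<and> poly q r \<noteq> 0" if "poly V r = 0" for r
    using that Vp[OF that] nc[of r] by (auto simp: V_def)
  \<comment> \<open>otherwise \<open>A = a 1 y (x - r y)\<^sup>2\<close>, and the remaining factor of \<open>V\<close> has a root that is not \<open>r\<close>\<close>
  have a0: "a 0 \<noteq> 0"
  proof
    assume a0: "a 0 = 0"
    then have c0: "c 0 \<noteq> 0" using nc0 by simp
    have V4: "coeff V 4 = a 1 * c 0" "a 1 = 0 \<Longrightarrow> coeff V 3 = 2 * a 2 * c 0" "a 1 = 0 \<Longrightarrow> a 2 = 0 \<Longrightarrow> coeff V 2 = 3 * a 3 * c 0"
      using a0 by (simp_all add: V_def p_def q_def pderiv_pCons numeral_eq_Suc algebra_simps)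
    have "degree V \<noteq> 0"
    proof
      assume d: "degree V = 0"
      then have z: "coeff V 4 = 0" "coeff V 3 = 0" "coeff V 2 = 0" by (simp_all add: coeff_eq_0)
      then have "a 1 = 0" using V4(1) c0 by simp
      moreover from this have "a 2 = 0" using V4(2) c0 z by simp
      ultimately have "a 3 = 0" using V4(3) c0 z by simp
      then show False using p0 a0 \<open>a 1 = 0\<close> \<open>a 2 = 0\<close> by (simp add: p_def)
    qed
    then obtain r where r: "poly V r = 0" using has_root by blast
    note d = dbl[OF r]
    have a2: "a 2 = - 2 * a 1 * r" "a 3 = a 1 * r^2" using d a0
      by (simp add: p_def pderiv_pCons algebra_simps; algebra)+
    have a1: "a 1 \<noteq> 0" using p0 a0 a2 by (auto simp: p_def)
    have "degree ([:- r, 1:] * pderiv q - smult 2 q) \<noteq> 0"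
    proof
      assume d: "degree ([:- r, 1:] * pderiv q - smult 2 q) = 0"
      have "coeff ([:- r, 1:] * pderiv q - smult 2 q) 3 = c 0"
        by (simp add: q_def pderiv_pCons numeral_eq_Suc algebra_simps)
      moreover have "coeff ([:- r, 1:] * pderiv q - smult 2 q) 3 = 0" by (rule coeff_eq_0) (use d in linarith)
      ultimately show False using c0 by metis
    qed
    then obtain t where t: "poly ([:- r, 1:] * pderiv q - smult 2 q) t = 0" using has_root by blast
    have pr: "p = smult (a 1) ([:- r, 1:]^2)" unfolding p_def a0 a2 by (simp add: power2_eq_square algebra_simps)
    have "poly V t = a 1 * (t - r) * poly ([:- r, 1:] * pderiv q - smult 2 q) t"
      unfolding V_def pr by (simp add: pderiv_smult pderiv_power pderiv_pCons algebra_simps power2_eq_square)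
    then have "poly p t = 0" using Vp t by simp
    then have "t = r" using a1 by (simp add: pr)
    then show False using t d by simp
  qed
  define e where "e = c 0 / a 0"
  define w where "w = q - smult e p"
  have w: "w = [:c 3 - e * a 3, c 2 - e * a 2, c 1 - e * a 1:]" using a0 by (simp add: w_def p_def q_def e_def)
  define w0 where "w0 = c 3 - e * a 3"
  define w1 where "w1 = c 2 - e * a 2"
  define w2 where "w2 = c 1 - e * a 1"
  have w: "w = [:w0, w1, w2:]" using w by (simp add: w0_def w1_def w2_def)
  have Vw: "V = p * pderiv w - w * pderiv p" by (simp add: V_def w_def pderiv_diff pderiv_smult algebra_simps)
  have wr: "poly w r \<noteq> 0" if "poly p r = 0" for r using nc[OF that] that by (auto simp: w_def)
  have V4: "coeff V 4 = - w2 * a 0" "w2 = 0 \<Longrightarrow> coeff V 3 = - 2 * w1 * a 0" "w2 = 0 \<Longrightarrow> w1 = 0 \<Longrightarrow> coeff V 2 = - 3 * w0 * a 0"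
    by (simp_all add: Vw p_def w pderiv_pCons numeral_eq_Suc algebra_simps)
  have "\<exists>r. poly p r = 0" by (rule has_root) (use a0 in \<open>simp add: p_def\<close>)
  then have w_nz: "w \<noteq> 0" using wr by auto
  have "degree V \<noteq> 0"
  proof
    assume d: "degree V = 0"
    then have z: "coeff V 4 = 0" "coeff V 3 = 0" "coeff V 2 = 0" by (simp_all add: coeff_eq_0)
    then have "w2 = 0" using V4(1) a0 by simp
    moreover from this have "w1 = 0" using V4(2) a0 z by simp
    ultimately have "w0 = 0" using V4(3) a0 z by simp
    then show False using w_nz \<open>w2 = 0\<close> \<open>w1 = 0\<close> w by simp
  qed
  then obtain r where r: "poly V r = 0" using has_root by blast
  note d = dbl[OF r]
  define s where "s = - a 1 / a 0 - 2 * r"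
  have a1: "a 1 = - a 0 * (s + 2 * r)" using a0 by (simp add: s_def field_simps)
  have d1: "a 3 + a 2 * r + a 1 * r^2 + a 0 * r^3 = 0" and d2: "a 2 + 2 * a 1 * r + 3 * a 0 * r^2 = 0"
    using d by (simp_all add: p_def pderiv_pCons algebra_simps power2_eq_square power3_eq_cube)
  have a2: "a 2 = a 0 * (r^2 + 2 * r * s)" using d2 unfolding a1 by algebra
  have a3: "a 3 = - a 0 * r^2 * s" using d1 unfolding a1 a2 by algebra
  have pr: "p = smult (a 0) ([:- r, 1:] * [:- r, 1:] * [:- s, 1:])"
    unfolding p_def a1 a2 a3 by (simp add: power2_eq_square algebra_simps)
  have pt: "poly p t = a 0 * ((t - r) * (t - r) * (t - s))" for t by (simp add: pr algebra_simps)
  have sr: "s = r"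
  proof (rule ccontr)
    assume n: "s \<noteq> r"
    let ?G = "[:- r, 1:] * [:- s, 1:] * pderiv w - w * [:- 2 * s - r, 3:]"
    have Vt: "poly V t = a 0 * (t - r) * poly ?G t" for t
      unfolding Vw pr by (simp add: pderiv_smult pderiv_mult pderiv_pCons algebra_simps)
    have G: "coeff ?G 3 = - w2" "w2 = 0 \<Longrightarrow> coeff ?G 2 = - 2 * w1" "w2 = 0 \<Longrightarrow> w1 = 0 \<Longrightarrow> coeff ?G 1 = - 3 * w0"
      by (simp_all add: w pderiv_pCons numeral_eq_Suc algebra_simps)
    have "degree ?G \<noteq> 0"
    proof
      assume d: "degree ?G = 0"
      have z: "coeff ?G 3 = 0" "coeff ?G 2 = 0" "coeff ?G 1 = 0" by (rule coeff_eq_0; use d in linarith)+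
      then have "w2 = 0" using G(1) by simp
      moreover from this have "w1 = 0" using G(2) z by simp
      ultimately have "w0 = 0" using G(3) z by simp
      then show False using w_nz \<open>w2 = 0\<close> \<open>w1 = 0\<close> w by simp
    qed
    then obtain t where t: "poly ?G t = 0" using has_root by blast
    then have "poly p t = 0" using Vt[of t] Vp by simp
    then have "t = r \<or> t = s" using a0 by (simp add: pt)
    moreover have "poly ?G r = - poly w r * (2 * (r - s))" "poly ?G s = - poly w s * (s - r)" by (simp_all add: algebra_simps)
    moreover have "poly w r \<noteq> 0" "poly w s \<noteq> 0" using wr by (simp_all add: pt)
    ultimately show False using t n by auto
  qed
  let ?G = "[:- r, 1:] * pderiv w - smult 3 w"
  have Vt: "poly V t = a 0 * (t - r)^2 * poly ?G t" for t
    unfolding Vw pr sr by (simp add: pderiv_smult pderiv_mult pderiv_pCons algebra_simps power2_eq_square)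
  have "degree ?G = 0"
  proof (rule ccontr)
    assume "degree ?G \<noteq> 0"
    then obtain t where t: "poly ?G t = 0" using has_root by blast
    then have "poly p t = 0" using Vt[of t] Vp by simp
    then have "t = r" using a0 by (simp add: pt sr)
    then show False using t wr[of r] by (simp add: pt)
  qed
  then have z: "coeff ?G 2 = 0" "coeff ?G 1 = 0" by (intro coeff_eq_0; linarith)+
  have "w2 = 0" using z(1) by (simp add: w pderiv_pCons numeral_eq_Suc)
  then have w1: "w1 = 0" using z(2) by (simp add: w pderiv_pCons numeral_eq_Suc)
  have w0: "w0 \<noteq> 0" using w_nz w \<open>w2 = 0\<close> w1 by simp
  have A3: "bq3 (a 0) (a 1) (a 2) (a 3) x y = a 0 * (x - r * y)^3" for x y
    unfolding bq3_def a1 a2 a3 sr by algebra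
  have C3: "bq3 (c 0) (c 1) (c 2) (c 3) x y = e * (a 0 * (x - r * y)^3) + w0 * y^3" for x y
  proof -
    have "c 0 = e * a 0" "c 1 = e * a 1" "c 2 = e * a 2" "c 3 = e * a 3 + w0"
      using a0 \<open>w2 = 0\<close> w1 by (simp_all add: e_def w2_def w1_def w0_def)
    then show ?thesis unfolding A3[symmetric] bq3_def by (simp add: algebra_simps)
  qed
  let ?N = "vector [vector [0, 1, 0], vector [1, - r, 0], vector [- e * (a 0 / w0), 0, a 0 / w0]] :: complex^3^3"
  show ?thesis
  proof (rule field_equivI)
    show "invertible ?N" using a0 w0 by (simp add: invertible_det_nz det_3)
    show "a 0 \<noteq> 0" by (rule a0)
    fix v
    have "Z v = vector [cubic a (v$1) (v$2) (v$3), 0, cubic c (v$1) (v$2) (v$3)]"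
      using cf(3) vec3_collapse[of v] unfolding planar_def by metis
    then have Zv: "Z v = vector [a 0 * (v$1 - r * v$2)^3, 0, e * (a 0 * (v$1 - r * v$2)^3) + w0 * (v$2)^3]"
      by (simp only: A A3 C3)
    show "?N *v Z v = a 0 *s ZF1 (?N *v v) + 0 *s (?N *v v)"
      unfolding Zv using w0 by (simp add: vec3_eq_iff mv3_nth ZF1_def field_simps)
  qed
qed

lemma pol_bq:
  "poly_on_lines (\<lambda>p. bq1 a b (p$i) (p$j))" "poly_on_lines (\<lambda>p. bq2 a b c (p$i) (p$j))"
  "poly_on_lines (\<lambda>p. bq3 a b c d (p$i) (p$j))"
  unfolding bq_defs by (intro pol_intros)+

lemma cubic_zcoeffs:
  assumes "\<And>z. cubic a x y z = p0 + p1 * z + p2 * z^2 + p3 * z^3"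
  shows "bq3 (a 0) (a 1) (a 2) (a 3) x y = p0" "bq2 (a 4) (a 5) (a 6) x y = p1" "bq1 (a 7) (a 8) x y = p2" "a 9 = p3"
proof -
  have "(bq3 (a 0) (a 1) (a 2) (a 3) x y - p0) + (bq2 (a 4) (a 5) (a 6) x y - p1) * z
     + (bq1 (a 7) (a 8) x y - p2) * z^2 + (a 9 - p3) * z^3 + 0 * z^4 = 0" for z
    using assms[of z] by (simp add: cubic_def algebra_simps)
  from poly4_coeffs[OF this] show "bq3 (a 0) (a 1) (a 2) (a 3) x y = p0" "bq2 (a 4) (a 5) (a 6) x y = p1"
    "bq1 (a 7) (a 8) x y = p2" "a 9 = p3" by simp_all
qed

lemma bq_cancel:
  assumes "\<And>x y. f x y * g x y = (0::complex)" "\<not> (\<forall>x y. f x y = 0)"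
    "poly_on_lines (\<lambda>p. f (p$1) (p$2))" "poly_on_lines (\<lambda>p. g (p$1) (p$2))"
  shows "g x y = 0"
  using bq_domain[of f g] assms by blast

lemmas form_intros = pol_bq pol_intros

text \<open>If all lines pass through \<open>(0, 0, 1)\<close>, these coefficients of powers of \<open>z\<close> vanish.  Each of them is a
  product of a nonzero form with one that leads to \<open>proportional_by_derivative_1\<close> or its variants.\<close>

lemma zpoly_infl_degenerate:
  assumes "a 7 = 0" "a 8 = 0" "a 9 = 0" "c 9 = 0"
  defines "A3 \<equiv> \<lambda>x y. bq3 (a 0) (a 1) (a 2) (a 3) x y" and "A2 \<equiv> \<lambda>x y. bq2 (a 4) (a 5) (a 6) x y"
    and "A3x \<equiv> \<lambda>x y. bq2 (3 * a 0) (2 * a 1) (a 2) x y" and "A2x \<equiv> \<lambda>x y. bq1 (2 * a 4) (a 5) x y"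
    and "C2 \<equiv> \<lambda>x y. bq2 (c 4) (c 5) (c 6) x y" and "C1 \<equiv> \<lambda>x y. bq1 (c 7) (c 8) x y"
    and "C2x \<equiv> \<lambda>x y. bq1 (2 * c 4) (c 5) x y"
  shows "coeff (zpoly_infl a c x y) 4 = A2 x y * (A2 x y * c 7 + C1 x y * C1 x y - C1 x y * A2x x y)"
    "coeff (zpoly_infl a c x y) 3 = A2 x y * A2 x y * C2x x y + 2 * A2 x y * A3 x y * c 7
       + A2 x y * C1 x y * (C2 x y - A3x x y) + (A2 x y * C2 x y + A3 x y * C1 x y) * (2 * C1 x y - A2x x y)
       - 2 * C1 x y * C2 x y * A2 x y"
    "a 4 = 0 \<Longrightarrow> a 5 = 0 \<Longrightarrow> a 6 = 0 \<Longrightarrow> c 7 = 0 \<Longrightarrow> c 8 = 0 \<Longrightarrow>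
       coeff (zpoly_infl a c x y) 1 = A3 x y * (A3 x y * C2x x y + C2 x y * C2 x y - C2 x y * A3x x y)"
  using assms(1-4) unfolding A3_def A2_def A3x_def A2x_def C2_def C1_def C2x_def
  by (simp_all add: zpoly_infl_def zpoly_def zpoly_x_def pderiv_pCons power2_eq_square numeral_eq_Suc algebra_simps bq1_def[of 0 0] bq2_def[of 0 0 0])

text \<open>The coefficients of \<open>z\<^sup>3\<close>, \<open>z\<^sup>2\<close> and \<open>z\<close> show one after the other that the quadratic form
  \<open>A\<^sub>2 = a 4 x\<^sup>2 + a 5 x y + a 6 y\<^sup>2\<close> divides \<open>A\<close> and \<open>C\<close>, against the absence of common factors.\<close>

lemma node_quadratic:
  assumes cf: "convex_field Z Ls" "ex2 \<in> set Ls" "planar Z a c" and thru: "\<And>L. L \<in> set Ls \<Longrightarrow> L$3 = 0"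
    and a: "a 7 = 0" "a 8 = 0" "a 9 = 0" and c: "c 7 = 0" "c 8 = 0" "c 9 = 0"
    and A2: "(a 4, a 5, a 6) \<noteq> (0, 0, 0)"
  shows False
proof -
  have av: "avoid3 Ls = 0" using thru by (simp add: filter_empty_conv)
  have co: "coeff (zpoly_infl a c x y) j = 0" if "0 < j" for j x y using planar_coeff[OF cf] av that by simp
  let ?A2 = "\<lambda>x y. bq2 (a 4) (a 5) (a 6) x y" and ?A2x = "\<lambda>x y. bq1 (2 * a 4) (a 5) x y"
  let ?A3 = "\<lambda>x y. bq3 (a 0) (a 1) (a 2) (a 3) x y" and ?A3x = "\<lambda>x y. bq2 (3 * a 0) (2 * a 1) (a 2) x y"
  let ?C2 = "\<lambda>x y. bq2 (c 4) (c 5) (c 6) x y" and ?C2x = "\<lambda>x y. bq1 (2 * c 4) (c 5) x y"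
  have A2nz: "\<not> (\<forall>x y. ?A2 x y = 0)" using bq_all_0(2)[of "a 4" "a 5" "a 6"] A2 by blast
  have "?A2 x y * (?A2 x y * ?C2x x y - ?C2 x y * ?A2x x y) = 0" for x y
    using co[of 3 x y] zpoly_infl_degenerate(2)[of a c x y] a c by (simp add: bq1_def[of 0 0] algebra_simps)
  from bq_cancel[where f="?A2" and g="\<lambda>x y. ?A2 x y * ?C2x x y - ?C2 x y * ?A2x x y", OF this A2nz]
  have "?A2 x y * ?C2x x y - ?C2 x y * ?A2x x y = 0" for x y by (simp add: form_intros)
  then have "?A2 x y * ?C2x x y = ?C2 x y * ?A2x x y" for x y by simp
  from proportional_quadratics[OF A2 this] obtain l where l: "c 4 = l * a 4" "c 5 = l * a 5" "c 6 = l * a 6" by metis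
  define d where "d i = c i - l * a i" for i
  have C: "cubic c x y z = l * cubic a x y z + bq3 (d 0) (d 1) (d 2) (d 3) x y" for x y z
    using a c l by (simp add: cubic_def d_def bq_defs algebra_simps)
  let ?D = "\<lambda>x y. bq3 (d 0) (d 1) (d 2) (d 3) x y" and ?Dx = "\<lambda>x y. bq2 (3 * d 0) (2 * d 1) (d 2) x y"
  define Q where "Q x y = [:?A3 x y * ?A3 x y * ?Dx x y - ?A3 x y * ?D x y * ?A3x x y - ?D x y * ?D x y * ?A2 x y - l * ?A3 x y * ?D x y * ?A2 x y,
      2 * ?A2 x y * ?A3 x y * ?Dx x y - ?D x y * (?A2 x y * ?A3x x y + ?A3 x y * ?A2x x y) - l * ?D x y * ?A2 x y * ?A2 x y,
      ?A2 x y * (?A2 x y * ?Dx x y - ?D x y * ?A2x x y):]" for x y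
  have T: "planar_infl a c x y z = poly (Q x y) z" for x y z
  proof -
    have A: "cubic a x y z = z * ?A2 x y + ?A3 x y" "cubic_x a x y z = z * ?A2x x y + ?A3x x y" "cubic_z a x y z = ?A2 x y"
      using a by (simp_all add: cubic_def cubic_x_def cubic_z_def bq1_def[of 0 0])
    have Cx: "cubic_x c x y z = l * cubic_x a x y z + ?Dx x y" "cubic_z c x y z = l * cubic_z a x y z"
      using a c l by (simp_all add: cubic_x_def cubic_z_def d_def bq_defs algebra_simps)
    show ?thesis unfolding planar_infl_def Cx C unfolding A Q_def by (simp add: algebra_simps power2_eq_square)
  qed
  have "zpoly_infl a c x y = Q x y" for x y
  proof -
    have "poly (zpoly_infl a c x y) = poly (Q x y)" by (rule ext) (simp add: poly_zpoly_infl T)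
    then show ?thesis by (simp only: poly_eq_poly_eq_iff)
  qed
  then have Q0: "coeff (Q x y) j = 0" if "0 < j" for j x y using co[OF that, of x y] by simp
  have "?A2 x y * (?A2 x y * ?Dx x y - ?D x y * ?A2x x y) = 0" for x y
    using Q0[of 2 x y] by (simp add: Q_def numeral_2_eq_2)
  from bq_cancel[where f="?A2" and g="\<lambda>x y. ?A2 x y * ?Dx x y - ?D x y * ?A2x x y", OF this A2nz]
  have "?A2 x y * ?Dx x y - ?D x y * ?A2x x y = 0" for x y by (simp add: form_intros)
  then have "?A2 x y * ?Dx x y = ?D x y * ?A2x x y" for x y by simp
  from proportional_by_derivative_2[OF A2 this] obtain m where m: "d 0 = 0" "d 1 = m * a 4" "d 2 = m * a 5" "d 3 = m * a 6" by metis
  have D: "?D x y = m * y * ?A2 x y" "?Dx x y = m * y * ?A2x x y" for x y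
    unfolding m by (simp_all add: bq_defs algebra_simps power2_eq_square power3_eq_cube)
  have m0: "m \<noteq> 0"
  proof
    assume "m = 0"
    then have "?D x y = 0" "?Dx x y = 0" for x y by (simp_all add: D del: One_nat_def)
    then have "poly (Q x y) z = 0" for x y z by (simp only: Q_def) simp
    then show False using planar_not_all_0[OF cf] T by metis
  qed
  have "(m * y * ?A2 x y) * (?A2 x y * ?A3x x y + l * ?A2 x y * ?A2 x y - ?A3 x y * ?A2x x y) = 0" for x y
    using Q0[of 1 x y] unfolding Q_def D by (simp add: algebra_simps)
  note prod = this
  have mA: "\<not> (\<forall>x y. m * y * ?A2 x y = 0)"
  proof
    assume h: "\<forall>x y. m * y * ?A2 x y = 0"
    have "bq3 0 (m * a 4) (m * a 5) (m * a 6) x y = 0" for x y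
      using spec[OF spec[OF h, of x], of y] by (simp add: bq_defs algebra_simps power2_eq_square power3_eq_cube)
    then show False using bq_all_0(3)[of 0 "m * a 4" "m * a 5" "m * a 6"] A2 m0 by auto
  qed
  from bq_cancel[where f="\<lambda>x y. m * y * ?A2 x y" and g="\<lambda>x y. ?A2 x y * ?A3x x y + l * ?A2 x y * ?A2 x y - ?A3 x y * ?A2x x y", OF prod mA]
  have E: "?A2 x y * ?A3x x y + l * ?A2 x y * ?A2 x y = ?A3 x y * ?A2x x y" for x y by (simp add: form_intros)
  have "?A2 x y * bq2 (3 * (a 0 + l * a 4)) (2 * (a 1 + l * a 5)) (a 2 + l * a 6) x y
     = bq3 (a 0 + l * a 4) (a 1 + l * a 5) (a 2 + l * a 6) (a 3) x y * ?A2x x y" for x y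
    using E[of x y] unfolding bq_defs by algebra
  from proportional_by_derivative_2[OF A2 this] obtain n where
    n: "a 0 + l * a 4 = 0" "a 1 + l * a 5 = n * a 4" "a 2 + l * a 6 = n * a 5" "a 3 = n * a 6" by metis
  have A: "cubic a x y z = ?A2 x y * (z - l * x + n * y)" for x y z
    using n a unfolding cubic_def bq_defs by algebra
  obtain u v where uv: "(u, v) \<noteq> (0, 0)" "\<And>x y. u * x + v * y = 0 \<Longrightarrow> ?A2 x y = 0" using quadratic_splits[OF A2] by blast
  obtain x y z where *: "dot (vector [u, v, 0]) (vector [x, y, z]) = 0"
      "y * cubic c x y z \<noteq> 0 \<or> x * cubic c x y z \<noteq> z * cubic a x y z \<or> y * cubic a x y z \<noteq> 0"
    by (rule planar_no_common_line[OF cf(1,3), of "vector [u, v, 0]"]) (use uv(1) in \<open>auto simp: vec3_eq_iff\<close>)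
  have "?A2 x y = 0" using uv(2) *(1) by (simp add: dot_def)
  then show False using *(2) by (simp add: C A D del: One_nat_def)
qed

text \<open>If \<open>x + \<kappa> y\<close> divides \<open>A\<close>, this line is invariant too.  Subtracting the multiple of the radial field
  that cancels \<open>A\<close>, and exchanging both lines, lowers the degree in \<open>z\<close> of the components.\<close>

lemma swap_gauge:
  assumes cf: "convex_field Z Ls" "ex2 \<in> set Ls" "planar Z a c" and thru: "\<And>L. L \<in> set Ls \<Longrightarrow> L$3 = 0"
    and A: "\<And>x y z. cubic a x y z = (x + \<kappa> * y) * (bq2 s0 s1 s2 x y + z * bq1 h0 h1 x y)"
    and c: "c 7 = h0" "c 8 = h1" "c 9 = 0"
  obtains Y b d Ks where "convex_field Y Ks" "ex2 \<in> set Ks" "planar Y b d" "\<And>L. L \<in> set Ks \<Longrightarrow> L$3 = 0"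
    "\<And>W. field_equiv Y W \<Longrightarrow> field_equiv Z W" "b 7 = 0" "b 8 = 0" "b 9 = 0" "d 7 = 0" "d 8 = 0" "d 9 = 0"
    "h0 = 0 \<Longrightarrow> h1 = 0 \<Longrightarrow> s0 = c 4 \<Longrightarrow> s1 = c 5 \<Longrightarrow> s2 = c 6 \<Longrightarrow>
       b 4 = 0 \<and> b 5 = 0 \<and> b 6 = 0 \<and> d 4 = 0 \<and> d 5 = 0 \<and> d 6 = 0"
proof -
  define U where "U x y z = bq2 s0 s1 s2 x y + z * bq1 h0 h1 x y" for x y z
  obtain k where k: "k \<noteq> 0" "\<And>x y z. planar_infl a c x y z = k * (\<Prod>L\<leftarrow>remove1 ex2 Ls. dot L (vector [x, y, z]))"
    using planar_rest[OF cf] by blast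
  have Az: "cubic_z a x y z = (x + \<kappa> * y) * bq1 h0 h1 x y" for x y z
  proof -
    have "cubic a x y z = (x + \<kappa> * y) * bq2 s0 s1 s2 x y + ((x + \<kappa> * y) * bq1 h0 h1 x y) * z + 0 * z^2 + 0 * z^3" for z
      by (simp add: A algebra_simps)
    from cubic_zcoeffs[OF this] show ?thesis by (simp add: cubic_z_def)
  qed
  have "planar_infl a c (- \<kappa>) 1 0 = 0" by (simp add: planar_infl_def A Az)
  then have "(\<Prod>L\<leftarrow>remove1 ex2 Ls. dot L (vector [- \<kappa>, 1, 0])) = 0" using k(2)[of "- \<kappa>" 1 0] k(1) by simp
  then obtain L where L: "L \<in> set (remove1 ex2 Ls)" "dot L (vector [- \<kappa>, 1, 0]) = 0" by (auto simp: prod_list_zero_iff)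
  then have L': "L \<in> set Ls" by (meson notin_set_remove1)
  define l where "l = L$1"
  have L2: "L$2 = \<kappa> * l" using L(2) by (simp add: dot_def l_def algebra_simps)
  have l0: "l \<noteq> 0"
  proof
    assume "l = 0"
    then have "L = 0" using L2 thru[OF L'] by (simp add: vec3_eq_iff l_def)
    then show False using convex_fieldD(2)[OF cf(1) L'] by simp
  qed
  define M :: "complex^3^3" where "M = vector [vector [- \<kappa>, 1 / l, 0], vector [1, 0, 0], vector [0, 0, 1]]"
  have M: "invertible M" using l0 by (simp add: invertible_det_nz det_3 M_def)
  have Mv: "M *v q = vector [q$2 / l - \<kappa> * q$1, q$1, q$3]" for q
    by (simp add: vec3_eq_iff mv3_nth M_def)
  have Mi: "matrix_inv M *v v = vector [v$2, l * (v$1 + \<kappa> * v$2), v$3]" for v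
  proof -
    have "M *v vector [v$2, l * (v$1 + \<kappa> * v$2), v$3] = v" using l0 by (simp add: Mv vec3_eq_iff)
    then show ?thesis using matrix_inv3(2)[OF M, of "vector [v$2, l * (v$1 + \<kappa> * v$2), v$3]"] by simp
  qed
  have LM: "L v* M = ex2" using L2 l0 thru[OF L'] by (simp add: vec3_eq_iff vm3_nth M_def l_def)
  let ?Z1 = "transport M Z" and ?Ks = "map (\<lambda>L. L v* M) Ls"
  have cf1: "convex_field ?Z1 ?Ks" by (rule convex_field_transport[OF cf(1) M])
  have mem: "ex2 \<in> set ?Ks" using L' LM by (force simp: image_iff)
  have thru1: "L$3 = 0" if "L \<in> set ?Ks" for L using that thru by (auto simp: vm3_nth M_def)
  let ?g = "\<lambda>q. - U ((M *v q)$1) ((M *v q)$2) ((M *v q)$3)"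
  have "hom 2 (\<lambda>q. bq2 (- s0) (- s1) (- s2) (q$1) (q$2) + q$3 * bq1 (- h0) (- h1) (q$1) (q$2) + (q$3)^2 * 0)"
    by (rule hom_quadratic)
  from hom_linear[OF this, of M] have hg: "hom 2 ?g" by (simp add: U_def bq_defs algebra_simps)
  define Y where "Y = (\<lambda>q. 1 *s ?Z1 q + ?g q *s q)"
  have cfY: "convex_field Y ?Ks" unfolding Y_def by (rule convex_field_gauge[OF cf1 hg]) simp
  have Zv: "Z v = vector [(v$1 + \<kappa> * v$2) * U (v$1) (v$2) (v$3), 0, cubic c (v$1) (v$2) (v$3)]" for v
    using cf(3) vec3_collapse[of v] A unfolding planar_def U_def by metis
  have Yv: "Y (vector [x, y, z]) = vector [- x * U (y / l - \<kappa> * x) x z, 0, cubic c (y / l - \<kappa> * x) x z - z * U (y / l - \<kappa> * x) x z]" for x y z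
    using l0 by (simp add: Y_def transport_def Mi Zv Mv vec3_eq_iff)
  have "dot ex2 (Y v) = 0" for v using Yv[of "v$1" "v$2" "v$3"] by (simp add: vec3_collapse)
  then obtain b d where pl: "planar Y b d" using planar_exists[OF cfY] by metis
  have bd: "cubic b x y z = - x * bq2 s0 s1 s2 (y / l - \<kappa> * x) x + (- x * bq1 h0 h1 (y / l - \<kappa> * x) x) * z + 0 * z^2 + 0 * z^3"
    "cubic d x y z = bq3 (c 0) (c 1) (c 2) (c 3) (y / l - \<kappa> * x) x
       + (bq2 (c 4) (c 5) (c 6) (y / l - \<kappa> * x) x - bq2 s0 s1 s2 (y / l - \<kappa> * x) x) * z + 0 * z^2 + 0 * z^3" for x y z
    using pl Yv[of x y z] c by (simp_all add: planar_def vec3_eq_iff U_def cubic_def algebra_simps power2_eq_square del: One_nat_def)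
  note b' = cubic_zcoeffs[OF bd(1)] and d' = cubic_zcoeffs[OF bd(2)]
  have z1: "b 7 = 0 \<and> b 8 = 0" "d 7 = 0 \<and> d 8 = 0" using bq_all_0(1)[of "b 7" "b 8"] b'(3) bq_all_0(1)[of "d 7" "d 8"] d'(3) by auto
  have last: "b 4 = 0 \<and> b 5 = 0 \<and> b 6 = 0 \<and> d 4 = 0 \<and> d 5 = 0 \<and> d 6 = 0"
    if "h0 = 0" "h1 = 0" "s0 = c 4" "s1 = c 5" "s2 = c 6"
    using bq_all_0(2)[of "b 4" "b 5" "b 6"] b'(2) bq_all_0(2)[of "d 4" "d 5" "d 6"] d'(2) that by (simp add: bq1_def)
  have "field_equiv Z W" if "field_equiv Y W" for W
  proof -
    have "field_form Y p = 1 *s field_form ?Z1 p" for p unfolding Y_def by (rule field_form_gauge)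
    then have "field_equiv ?Z1 W" using field_equiv_form[of Y 1 ?Z1 W] that by simp
    then show ?thesis by (rule field_equiv_transport[OF M])
  qed
  then show ?thesis using that[OF cfY mem pl thru1] z1 last b'(4) d'(4) by blast
qed

text \<open>The coefficients of \<open>z\<^sup>3\<close> and \<open>z\<close> of the inflection polynomial give either \<open>zfree_pair\<close> directly or a factor
  \<open>x + \<kappa> y\<close> of \<open>A\<close>; \<open>swap_gauge\<close> reduces the second case to the first one.\<close>

lemma degenerate_concurrent_0:
  assumes cf: "convex_field Z Ls" "ex2 \<in> set Ls" "planar Z a c" and thru: "\<And>L. L \<in> set Ls \<Longrightarrow> L$3 = 0"
    and a: "a 4 = 0" "a 5 = 0" "a 6 = 0" "a 7 = 0" "a 8 = 0" "a 9 = 0" and c9: "c 9 = 0"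
  shows "field_equiv Z ZF1"
proof -
  have av: "avoid3 Ls = 0" using thru by (simp add: filter_empty_conv)
  have co: "coeff (zpoly_infl a c x y) j = 0" if "0 < j" for j x y using planar_coeff[OF cf] av that by simp
  let ?A3 = "\<lambda>x y. bq3 (a 0) (a 1) (a 2) (a 3) x y" and ?A3x = "\<lambda>x y. bq2 (3 * a 0) (2 * a 1) (a 2) x y"
  let ?C2 = "\<lambda>x y. bq2 (c 4) (c 5) (c 6) x y" and ?C2x = "\<lambda>x y. bq1 (2 * c 4) (c 5) x y"
  let ?C1 = "\<lambda>x y. bq1 (c 7) (c 8) x y"
  have A3nz: "\<not> (\<forall>x y. ?A3 x y = 0)"
  proof
    assume "\<forall>x y. ?A3 x y = 0"
    then have "a 0 = 0" "a 1 = 0" "a 2 = 0" "a 3 = 0" using bq_all_0(3)[of "a 0" "a 1" "a 2" "a 3"] by auto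
    then have "planar_infl a c x y z = 0" for x y z using a by (simp add: planar_infl_def cubic_defs)
    then show False using planar_not_all_0[OF cf] by blast
  qed
  have "?A3 x y * (?C1 x y * ?C1 x y) = 0" for x y
    using co[of 3 x y] zpoly_infl_degenerate(2)[of a c x y] a c9 by (simp add: bq1_def[of 0 0] bq2_def[of 0 0 0] algebra_simps)
  from bq_cancel[where f="?A3" and g="\<lambda>x y. ?C1 x y * ?C1 x y", OF this A3nz]
  have "?C1 x y * ?C1 x y = 0" for x y by (simp add: form_intros)
  then have "?C1 x y = 0" for x y by simp
  then have c78: "c 7 = 0" "c 8 = 0" using bq_all_0(1)[of "c 7" "c 8"] by blast+
  show ?thesis
  proof (cases "(c 4, c 5, c 6) = (0, 0, 0)")
    case True
    then show ?thesis using zfree_pair[OF cf thru a _ _ _ c78 c9] by simp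
  next
    case False
    have "?A3 x y * (?A3 x y * ?C2x x y + ?C2 x y * ?C2 x y - ?C2 x y * ?A3x x y) = 0" for x y
      using co[of 1 x y] zpoly_infl_degenerate(3)[of a c x y] a c9 c78 by simp
    from bq_cancel[where f="?A3" and g="\<lambda>x y. ?A3 x y * ?C2x x y + ?C2 x y * ?C2 x y - ?C2 x y * ?A3x x y", OF this A3nz]
    have E: "?A3 x y * ?C2x x y + ?C2 x y * ?C2 x y - ?C2 x y * ?A3x x y = 0" for x y by (simp add: form_intros)
    have "?C2 x y * bq2 (3 * (a 0 - c 4)) (2 * (a 1 - c 5)) (a 2 - c 6) x y = bq3 (a 0 - c 4) (a 1 - c 5) (a 2 - c 6) (a 3) x y * ?C2x x y" for x y
      using E[of x y] unfolding bq_defs by algebra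
    from proportional_by_derivative_2[OF False this] obtain \<kappa> where
      k: "a 0 - c 4 = 0" "a 1 - c 5 = \<kappa> * c 4" "a 2 - c 6 = \<kappa> * c 5" "a 3 = \<kappa> * c 6" by metis
    have A: "cubic a x y z = (x + \<kappa> * y) * (bq2 (c 4) (c 5) (c 6) x y + z * bq1 0 0 x y)" for x y z
      using k a unfolding cubic_def bq_defs by algebra
    obtain Y b d Ks where Y: "convex_field Y Ks" "ex2 \<in> set Ks" "planar Y b d" "\<And>L. L \<in> set Ks \<Longrightarrow> L$3 = 0"
      "\<And>W. field_equiv Y W \<Longrightarrow> field_equiv Z W" "b 7 = 0" "b 8 = 0" "b 9 = 0" "d 7 = 0" "d 8 = 0" "d 9 = 0"
      "b 4 = 0 \<and> b 5 = 0 \<and> b 6 = 0 \<and> d 4 = 0 \<and> d 5 = 0 \<and> d 6 = 0"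
      using swap_gauge[OF cf thru A c78 c9] by (metis (no_types, lifting))
    show ?thesis using zfree_pair[OF Y(1-4)] Y(5-12) by blast
  qed
qed

lemma degenerate_coeffs:
  assumes pl: "planar Z a c" and d: "degenerate_at Z ex3"
  shows "a 7 = 0" "a 8 = 0" "a 9 = 0" "c 9 = 0"
proof -
  have arg: "ex3 + t *s vector [x, y, 0] = vector [t * x, t * y, 1]" for t x y by (simp add: vec3_eq_iff)
  have "\<exists>q. \<forall>t. - (cubic c (t * x) (t * y) 1) * (t * y) = t^2 * poly q t" for x y
    using d pl unfolding degenerate_at_def
    by (elim conjE, erule_tac allE[of _ "vector [x, y, 0]"], erule_tac allE[of _ 1]) (simp add: arg planar_def field_form_def algebra_simps)
  then obtain q where q: "\<And>t. - (cubic c (t * 0) (t * 1) 1) * (t * 1) = t^2 * poly q t" by metis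
  have "[:0, - c 9, - c 8, - c 6, - c 3:] = [:0, 0, 1:] * q"
  proof -
    have "poly [:0, - c 9, - c 8, - c 6, - c 3:] = poly ([:0, 0, 1:] * q)"
      by (rule ext) (use q in \<open>simp add: cubic_def bq_defs algebra_simps power2_eq_square power3_eq_cube\<close>)
    then show ?thesis by (simp only: poly_eq_poly_eq_iff)
  qed
  from arg_cong[OF this, of "\<lambda>p. coeff p 1"] show c9: "c 9 = 0" by simp
  have *: "\<exists>q. \<forall>t. cubic c (t * x) (t * y) 1 * (t * x) - cubic a (t * x) (t * y) 1 = t^2 * poly q t" for x y
    using d pl unfolding degenerate_at_def
    by (elim conjE, erule_tac allE[of _ "vector [x, y, 0]"], erule_tac allE[of _ 2]) (simp add: arg planar_def field_form_def algebra_simps)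
  have **: "a 9 = 0 \<and> bq1 (a 7) (a 8) x y = 0" for x y
  proof -
    obtain q where q: "\<And>t. cubic c (t * x) (t * y) 1 * (t * x) - cubic a (t * x) (t * y) 1 = t^2 * poly q t" using * by metis
    let ?p = "[:- a 9, - bq1 (a 7) (a 8) x y, bq1 (c 7) (c 8) x y * x - bq2 (a 4) (a 5) (a 6) x y,
       bq2 (c 4) (c 5) (c 6) x y * x - bq3 (a 0) (a 1) (a 2) (a 3) x y, bq3 (c 0) (c 1) (c 2) (c 3) x y * x:]"
    have "poly ?p = poly ([:0, 0, 1:] * q)"
      by (rule ext) (use q c9 in \<open>simp add: cubic_def bq_defs algebra_simps power2_eq_square power3_eq_cube\<close>)
    then have e: "?p = [:0, 0, 1:] * q" by (simp only: poly_eq_poly_eq_iff)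
    from arg_cong[OF e, of "\<lambda>p. coeff p 0"] arg_cong[OF e, of "\<lambda>p. coeff p 1"] show ?thesis by simp
  qed
  show "a 9 = 0" using ** by blast
  show "a 7 = 0" "a 8 = 0" using bq_all_0(1)[of "a 7" "a 8"] ** by blast+
qed

text \<open>If \<open>A\<close> has terms linear in \<open>z\<close>, \<open>node_quadratic\<close> forces a term in \<open>z\<^sup>2\<close> in \<open>C\<close>.  The coefficients of
  \<open>z\<^sup>4\<close> and \<open>z\<^sup>3\<close> then yield a linear factor \<open>x + \<kappa> y\<close> of \<open>A\<close>.  The field obtained from \<open>swap_gauge\<close> has no
  such terms, so that by \<open>node_quadratic\<close> it satisfies the assumptions of \<open>degenerate_concurrent_0\<close>.\<close>

lemma degenerate_concurrent:
  assumes cf: "convex_field Z Ls" "ex2 \<in> set Ls" and thru: "\<And>L. L \<in> set Ls \<Longrightarrow> L$3 = 0"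
    and d: "degenerate_at Z ex3"
  shows "field_equiv Z ZF1"
proof -
  obtain Y a c where Y: "convex_field Y Ls" "\<And>p. field_form Y p = field_form Z p" "planar Y a c" using planar_gauge[OF cf] by metis
  have eq: "field_equiv Y W \<Longrightarrow> field_equiv Z W" for W using field_equiv_form[of Y 1 Z W] Y(2) by simp
  have "degenerate_at Y ex3" using degenerate_form[of Z Y] Y(2) d by metis
  note a = degenerate_coeffs[OF Y(3) this]
  note cfY = Y(1) cf(2) Y(3)
  have av: "avoid3 Ls = 0" using thru by (simp add: filter_empty_conv)
  have co: "coeff (zpoly_infl a c x y) j = 0" if "0 < j" for j x y using planar_coeff[OF cfY] av that by simp
  show ?thesis
  proof (cases "(a 4, a 5, a 6) = (0, 0, 0)")
    case True
    then show ?thesis using eq degenerate_concurrent_0[OF cfY thru _ _ _ a] by simp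
  next
    case A2: False
    let ?A2 = "\<lambda>x y. bq2 (a 4) (a 5) (a 6) x y" and ?A2x = "\<lambda>x y. bq1 (2 * a 4) (a 5) x y"
    let ?A3 = "\<lambda>x y. bq3 (a 0) (a 1) (a 2) (a 3) x y" and ?A3x = "\<lambda>x y. bq2 (3 * a 0) (2 * a 1) (a 2) x y"
    let ?C2 = "\<lambda>x y. bq2 (c 4) (c 5) (c 6) x y" and ?C2x = "\<lambda>x y. bq1 (2 * c 4) (c 5) x y"
    let ?C1 = "\<lambda>x y. bq1 (c 7) (c 8) x y"
    have A2nz: "\<not> (\<forall>x y. ?A2 x y = 0)" using bq_all_0(2)[of "a 4" "a 5" "a 6"] A2 by blast
    have C1: "(c 7, c 8) \<noteq> (0, 0)" using node_quadratic[OF cfY thru a(1-3) _ _ a(4) A2] by auto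
    have C1nz: "\<not> (\<forall>x y. ?C1 x y = 0)" using bq_all_0(1)[of "c 7" "c 8"] C1 by blast
    have "?A2 x y * (?A2 x y * c 7 + ?C1 x y * ?C1 x y - ?C1 x y * ?A2x x y) = 0" for x y
      using co[of 4 x y] zpoly_infl_degenerate(1)[where a=a and c=c and x=x and y=y] a by simp
    from bq_cancel[where f="?A2" and g="\<lambda>x y. ?A2 x y * c 7 + ?C1 x y * ?C1 x y - ?C1 x y * ?A2x x y", OF this A2nz]
    have E: "?A2 x y * c 7 + ?C1 x y * ?C1 x y - ?C1 x y * ?A2x x y = 0" for x y by (simp add: form_intros)
    have "?C1 x y * bq1 (2 * (a 4 - c 7)) (a 5 - c 8) x y = bq2 (a 4 - c 7) (a 5 - c 8) (a 6) x y * c 7" for x y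
      using E[of x y] unfolding bq_defs by algebra
    from proportional_by_derivative_1[OF C1 this] obtain \<kappa> where
      k: "a 4 - c 7 = 0" "a 5 - c 8 = \<kappa> * c 7" "a 6 = \<kappa> * c 8" by metis
    let ?X = "\<lambda>x y. bq1 1 \<kappa> x y"
    have k': "a 4 = c 7" "a 5 = \<kappa> * c 7 + c 8" "a 6 = \<kappa> * c 8" using k by (simp_all add: algebra_simps)
    have A2': "?A2 x y = ?X x y * ?C1 x y" "?A2x x y = ?C1 x y + ?X x y * c 7" for x y
      unfolding k' by (simp_all add: bq_defs algebra_simps power2_eq_square)
    let ?E = "\<lambda>x y. ?X x y * ?X x y * ?C1 x y * ?C2x x y - ?X x y * ?X x y * c 7 * ?C2 x y + ?X x y * c 7 * ?A3 x y
        - ?X x y * ?C1 x y * ?A3x x y + ?C1 x y * ?A3 x y"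
    have "?C1 x y * ?E x y = 0" for x y
      using co[of 3 x y] zpoly_infl_degenerate(2)[where a=a and c=c and x=x and y=y] a unfolding A2' by (simp add: algebra_simps)
    from bq_cancel[where f="?C1" and g="?E", OF this C1nz]
    have E3: "?E x y = 0" for x y by (simp add: form_intros)
    have X0: "?X (- \<kappa>) 1 = 0" by (simp add: bq1_def)
    have A30: "?A3 (- \<kappa>) 1 = 0"
    proof (cases "?C1 (- \<kappa>) 1 = 0")
      case False then show ?thesis using E3[of "- \<kappa>" 1] X0 by simp
    next
      case True
      then have c8: "c 8 = \<kappa> * c 7" by (simp add: bq1_def)
      then have c7: "c 7 \<noteq> 0" using C1 by auto
      have "c 7 \<noteq> 0 \<Longrightarrow> ?X x y * (?X x y * ?X x y * ?C2x x y - ?X x y * ?C2 x y + 2 * ?A3 x y - ?X x y * ?A3x x y) = 0" for x y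
      proof -
        have C1': "?C1 x y = c 7 * ?X x y" unfolding c8 by (simp add: bq1_def algebra_simps)
        have "c 7 * (?X x y * (?X x y * ?X x y * ?C2x x y - ?X x y * ?C2 x y + 2 * ?A3 x y - ?X x y * ?A3x x y)) = ?E x y"
          unfolding C1' by (simp add: algebra_simps)
        then show ?thesis using E3[of x y] c7 by simp
      qed
      note prod = this[OF c7]
      have Xnz: "\<not> (\<forall>x y. ?X x y = 0)" using bq_all_0(1)[of 1 \<kappa>] by auto
      from bq_cancel[where f="?X" and g="\<lambda>x y. ?X x y * ?X x y * ?C2x x y - ?X x y * ?C2 x y + 2 * ?A3 x y - ?X x y * ?A3x x y", OF prod Xnz]
      have "?X x y * ?X x y * ?C2x x y - ?X x y * ?C2 x y + 2 * ?A3 x y - ?X x y * ?A3x x y = 0" for x y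
        by (simp add: form_intros)
      from this[of "- \<kappa>" 1] show ?thesis using X0 by simp
    qed
    define s1 where "s1 = a 1 - \<kappa> * a 0"
    define s2 where "s2 = a 2 - \<kappa> * s1"
    have a3: "a 3 = \<kappa> * s2" using A30 by (simp add: bq3_def s1_def s2_def) algebra
    have A: "cubic a x y z = (x + \<kappa> * y) * (bq2 (a 0) s1 s2 x y + z * bq1 (c 7) (c 8) x y)" for x y z
    proof -
      have "a 1 = s1 + \<kappa> * a 0" "a 2 = s2 + \<kappa> * s1" by (simp_all add: s1_def s2_def)
      then show ?thesis using a a3 k' unfolding cubic_def bq_defs by algebra
    qed
    obtain Y' b d Ks where Y': "convex_field Y' Ks" "ex2 \<in> set Ks" "planar Y' b d" "\<And>L. L \<in> set Ks \<Longrightarrow> L$3 = 0"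
      "\<And>W. field_equiv Y' W \<Longrightarrow> field_equiv Y W" "b 7 = 0" "b 8 = 0" "b 9 = 0" "d 7 = 0" "d 8 = 0" "d 9 = 0"
      using swap_gauge[OF cfY thru A refl refl a(4)] by (metis (no_types, lifting))
    have "(b 4, b 5, b 6) = (0, 0, 0)" using node_quadratic[OF Y'(1-4) Y'(6-11)] by blast
    then have "field_equiv Y' ZF1" using degenerate_concurrent_0[OF Y'(1-4) _ _ _ Y'(6-8,11)] by simp
    then show ?thesis using eq Y'(5) by blast
  qed
qed

lemma zpoly_infl_nilpotent:
  assumes "b 7 = 0" "b 9 = 0" "d 9 = 0" "d 7 = 0"
  shows "coeff (zpoly_infl b d x 1) 5 = b 8 * b 8 * bq1 (2 * d 4) (d 5) x 1 - b 8 * d 8 * bq1 (2 * b 4) (b 5) x 1"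
   "coeff (zpoly_infl b d x 1) 4 = b 8 * b 8 * bq2 (3 * d 0) (2 * d 1) (d 2) x 1
     + 2 * b 8 * bq2 (b 4) (b 5) (b 6) x 1 * bq1 (2 * d 4) (d 5) x 1
     + b 8 * d 8 * (bq2 (d 4) (d 5) (d 6) x 1 - bq2 (3 * b 0) (2 * b 1) (b 2) x 1)
     + (b 8 * bq2 (d 4) (d 5) (d 6) x 1 + d 8 * bq2 (b 4) (b 5) (b 6) x 1) * (2 * d 8 - bq1 (2 * b 4) (b 5) x 1)
     - d 8 * d 8 * bq2 (b 4) (b 5) (b 6) x 1 - 4 * b 8 * d 8 * bq2 (d 4) (d 5) (d 6) x 1"
proof -
  have 78: "bq1 0 q x 1 = q" for q by (simp add: bq1_def)
  show "coeff (zpoly_infl b d x 1) 5 = b 8 * b 8 * bq1 (2 * d 4) (d 5) x 1 - b 8 * d 8 * bq1 (2 * b 4) (b 5) x 1"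
   "coeff (zpoly_infl b d x 1) 4 = b 8 * b 8 * bq2 (3 * d 0) (2 * d 1) (d 2) x 1
     + 2 * b 8 * bq2 (b 4) (b 5) (b 6) x 1 * bq1 (2 * d 4) (d 5) x 1
     + b 8 * d 8 * (bq2 (d 4) (d 5) (d 6) x 1 - bq2 (3 * b 0) (2 * b 1) (b 2) x 1)
     + (b 8 * bq2 (d 4) (d 5) (d 6) x 1 + d 8 * bq2 (b 4) (b 5) (b 6) x 1) * (2 * d 8 - bq1 (2 * b 4) (b 5) x 1)
     - d 8 * d 8 * bq2 (b 4) (b 5) (b 6) x 1 - 4 * b 8 * d 8 * bq2 (d 4) (d 5) (d 6) x 1"
    unfolding zpoly_infl_def zpoly_def zpoly_x_def assms 78
    by (simp_all add: pderiv_pCons power2_eq_square numeral_eq_Suc algebra_simps)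
qed

text \<open>If the nine lines coincide, their center is degenerate: otherwise \<open>a 8 \<noteq> 0\<close>, and the coefficients of
  \<open>z\<^sup>6\<close>, \<open>z\<^sup>5\<close>, \<open>z\<^sup>4\<close> annihilate \<open>C\<close> on \<open>y = 0\<close>, so that \<open>y\<close> is a common factor.\<close>

lemma single_line:
  assumes cf: "convex_field Z Ls" "ex2 \<in> set Ls" and one: "\<And>L. L \<in> set Ls \<Longrightarrow> L$1 = 0 \<and> L$3 = 0"
  shows "field_equiv Z ZF1"
proof -
  obtain Y a c where Y: "convex_field Y Ls" "\<And>p. field_form Y p = field_form Z p" "planar Y a c" using planar_gauge[OF cf] by metis
  have eq: "field_equiv Y W \<Longrightarrow> field_equiv Z W" for W using field_equiv_form[of Y 1 Z W] Y(2) by simp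
  note cfY = Y(1) cf(2) Y(3)
  obtain k where k: "k \<noteq> 0" "\<And>x y z. planar_infl a c x y z = k * (\<Prod>L\<leftarrow>remove1 ex2 Ls. dot L (vector [x, y, z]))"
    using planar_rest[OF cfY] by blast
  have "length (remove1 ex2 Ls) = 8" using convex_field_length[OF cf(1)] cf(2) by (simp add: length_remove1)
  then obtain L where "L \<in> set (remove1 ex2 Ls)" by (cases "remove1 ex2 Ls") auto
  moreover have "L$1 = 0 \<and> L$3 = 0" if "L \<in> set (remove1 ex2 Ls)" for L using that one by (meson notin_set_remove1)
  ultimately have "(\<Prod>L\<leftarrow>remove1 ex2 Ls. dot L (vector [x, 0, z])) = 0" for x z
    by (auto simp: prod_list_zero_iff dot_def image_iff intro!: bexI[of _ L])
  then have T: "planar_infl a c x 0 z = 0" for x z by (simp add: k(2))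
  obtain M b d where M: "invertible M" "ex2 v* M = ex2" and pl: "planar (transport M Y) b d"
    and b: "b 0 = 0" "b 4 = 0" "b 7 = 0" "b 9 = 0" using multiple_line_center[OF cfY T] by metis
  let ?Ks = "map (\<lambda>L. L v* M) Ls"
  have cf': "convex_field (transport M Y) ?Ks" by (rule convex_field_transport[OF Y(1) M(1)])
  have mem: "ex2 \<in> set ?Ks" using cf(2) M(2) by (metis image_eqI list.set_map)
  have thru: "L$3 = 0" if "L \<in> set ?Ks" for L
  proof -
    have "L \<in> (\<lambda>L. L v* M) ` set Ls" using that by simp
    then obtain K where K: "K \<in> set Ls" "L = K v* M" by blast
    have "K = K$2 *s ex2" using one[OF K(1)] by (simp add: vec3_eq_iff)
    then have "L = K$2 *s ex2" using K(2) M(2) vm_scale by metis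
    then show ?thesis by simp
  qed
  have av: "avoid3 ?Ks = 0" using thru by (simp add: filter_empty_conv)
  have co: "coeff (zpoly_infl b d x y) j = 0" if "0 < j" for j x y using planar_coeff[OF cf' mem pl] av that by simp
  have d9: "d 9 = 0" using radial_point(1)[OF cf' mem pl b(4,3)] av by auto
  have "field_equiv (transport M Y) ZF1"
  proof (cases "b 8 = 0")
    case True
    show ?thesis by (rule degenerate_concurrent[OF cf' mem thru planar_degenerate[OF pl b(3) True b(4) d9]])
  next
    case b8: False
    have "coeff (zpoly_infl b d 0 1) 6 = 0" by (rule co) simp
    then have d7: "d 7 = 0" using b8 b d9
      by (simp add: zpoly_infl_def zpoly_def zpoly_x_def bq_defs pderiv_pCons power2_eq_square numeral_eq_Suc)
    have "coeff (zpoly_infl b d x 1) 5 = 0" for x by (rule co) simp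
    then have e5: "b 8 * b 8 * bq1 (2 * d 4) (d 5) x 1 - b 8 * d 8 * bq1 (2 * b 4) (b 5) x 1 = 0" for x
      using zpoly_infl_nilpotent(1)[OF b(3,4) d9 d7] by simp
    from e5[of 0] e5[of 1] have "b 8 * b 8 * d 4 = 0" using b unfolding bq1_def by algebra
    then have d4: "d 4 = 0" using b8 by simp
    have "coeff (zpoly_infl b d x 1) 4 = 0" for x by (rule co) simp
    note e4 = this[unfolded zpoly_infl_nilpotent(2)[OF b(3,4) d9 d7]]
    from e4[of 0] e4[of 1] e4[of "-1"] have "b 8 * b 8 * d 0 = 0"
      by (simp add: bq_defs b d4 algebra_simps) algebra
    then have d0: "d 0 = 0" using b8 by simp
    obtain x y z where *: "dot ex2 (vector [x, y, z]) = 0"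
      "y * cubic d x y z \<noteq> 0 \<or> x * cubic d x y z \<noteq> z * cubic b x y z \<or> y * cubic b x y z \<noteq> 0"
      by (rule planar_no_common_line[OF cf' pl, of ex2]) (auto simp: vec3_eq_iff)
    then show ?thesis using b d9 d7 d4 d0 by (simp add: cubic_def bq_defs)
  qed
  then show ?thesis using field_equiv_transport[OF M(1)] eq by blast
qed

text \<open>Unless the lines all coincide, their common point is degenerate: otherwise \<open>saddle_node\<close> applies
  to one of two distinct lines and allows at most five lines through the point.\<close>

theorem concurrent_lines:
  assumes cf: "convex_field Z Ls" and p: "p \<noteq> 0" "\<And>L. L \<in> set Ls \<Longrightarrow> dot L p = 0"
  shows "field_equiv Z ZF1"
proof -
  obtain L where L: "L \<in> set Ls" using convex_field_length[OF cf] by (cases Ls) auto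
  show ?thesis
  proof (cases "\<forall>J\<in>set Ls. ccross J L = 0")
    case True
    obtain M where M: "invertible M" "L v* M = ex2" using adapt_one[OF convex_fieldD(2)[OF cf L] p(1) p(2)[OF L]] by metis
    let ?Ks = "map (\<lambda>L. L v* M) Ls"
    have "ex2 \<in> set ?Ks" using L M(2) by (metis image_eqI list.set_map)
    moreover have "J$1 = 0 \<and> J$3 = 0" if J: "J \<in> set ?Ks" for J
    proof -
      have "J \<in> (\<lambda>L. L v* M) ` set Ls" using J by simp
      then obtain K where K: "K \<in> set Ls" "J = K v* M" by blast
      then show ?thesis using True ccross_transport[OF M(1), of K L] M(2) ccross_ex2 by metis
    qed
    ultimately have "field_equiv (transport M Z) ZF1" by (rule single_line[OF convex_field_transport[OF cf M(1)]])
    then show ?thesis by (rule field_equiv_transport[OF M(1)])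
  next
    case False
    then obtain K where K: "K \<in> set Ls" "ccross K L \<noteq> 0" by blast
    obtain M where M: "invertible M" "K v* M = ex1" "L v* M = ex2" "M *v ex3 = p" using adapt_two[OF K(2) p(1) p(2)[OF K(1)] p(2)[OF L]] by metis
    let ?Ks = "map (\<lambda>L. L v* M) Ls"
    have mem: "ex1 \<in> set ?Ks" "ex2 \<in> set ?Ks" using L K(1) M(2,3) by (metis image_eqI list.set_map)+
    have thru: "J$3 = 0" if "J \<in> set ?Ks" for J using that p(2) by (auto simp: vm_nth3 M(4))
    obtain Y a c where Y: "convex_field Y ?Ks" "\<And>p. field_form Y p = field_form (transport M Z) p" "planar Y a c"
      using planar_gauge[OF convex_field_transport[OF cf M(1)] mem(2)] by metis
    have eq: "field_equiv Y W \<Longrightarrow> field_equiv Z W" for W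
      using field_equiv_transport[OF M(1), of Z W] field_equiv_form[of Y 1 "transport M Z" W] Y(2) by simp
    have "bq3 (a 3) (a 6) (a 8) (a 9) y z = 0" for y z
      using planar_invariant[OF Y(1,3) mem(1), of 0 y z] by (simp add: cubic_def bq_defs algebra_simps power2_eq_square)
    then have a0: "a 3 = 0" "a 6 = 0" "a 8 = 0" "a 9 = 0" using bq_all_0(3)[of "a 3" "a 6" "a 8" "a 9"] by blast+
    have av: "avoid3 ?Ks = 0" using thru by (simp add: filter_empty_conv)
    \<comment> \<open>nine lines through one point are too many for a saddle-node\<close>
    have many: False if "length (filter (\<lambda>J. dot J ex3 = 0 \<and> ccross J E \<noteq> 0) ?Ks) = 1"
      "length (filter (\<lambda>J. ccross J E = 0) ?Ks) \<le> 4" for E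
    proof -
      have "filter (\<lambda>J. \<not> ccross J E = 0) ?Ks = filter (\<lambda>J. dot J ex3 = 0 \<and> ccross J E \<noteq> 0) ?Ks"
        by (rule filter_cong) (use thru in auto)
      then show False using length_filter_not[of ?Ks "\<lambda>J. ccross J E = 0"] convex_field_length[OF Y(1)] that by simp
    qed
    have e12: "ccross ex1 ex2 \<noteq> 0" "ccross ex2 ex1 \<noteq> 0" "ex3 \<noteq> 0" by (simp_all add: vec3_eq_iff)
    have "degenerate_at Y ex3"
    proof (rule ccontr)
      assume nd: "\<not> degenerate_at Y ex3"
      have Y3: "Y ex3 = vector [a 9, 0, c 9]" using Y(3) by (simp add: planar_def cubic_def bq_defs)
      have c9: "c 9 \<noteq> 0"
      proof
        assume "c 9 = 0"
        then have 1: "Y ex3 = 0" using Y3 a0 by (simp add: vec3_eq_iff)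
        have 2: "dot ex2 (Y v) = 0" for v using Y(3) vec3_collapse[of v] unfolding planar_def by (metis dot_ex(2) vector_3(2))
        note s = saddle_node[OF Y(1) mem e12(1,3) _ _ 2 1 nd]
        show False using many[of ex2] s(1,3) by simp
      qed
      have a7: "a 7 \<noteq> 0" using radial_point(1)[OF Y(1) mem(2) Y(3) a0(4) _ c9] av by auto
      have "coeff (zpoly_infl a c 1 0) 7 = 0" by (rule planar_coeff[OF Y(1) mem(2) Y(3)]) (use av in simp)
      then have "a 7 * c 9 * (c 9 - a 7) = 0" using a0
        by (simp add: zpoly_infl_def zpoly_def zpoly_x_def bq_defs pderiv_pCons power2_eq_square numeral_eq_Suc algebra_simps)
      then have ac: "c 9 = a 7" using a7 c9 by simp
      let ?g = "\<lambda>p :: complex^3. bq2 (- a 0) (- a 1) (- a 2) (p$1) (p$2) + p$3 * bq1 (- a 4) (- a 5) (p$1) (p$2) + (p$3)^2 * (- a 7)"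
      define X where "X = (\<lambda>p. 1 *s Y p + ?g p *s p)"
      have cX: "convex_field X ?Ks" unfolding X_def by (rule convex_field_gauge[OF Y(1) hom_quadratic]) simp
      have ndX: "\<not> degenerate_at X ex3"
      proof -
        have "field_form X p = field_form Y p" for p unfolding X_def using field_form_gauge[of 1 Y ?g p] by simp
        then show ?thesis using degenerate_form nd by blast
      qed
      have Yv: "Y v = vector [cubic a (v$1) (v$2) (v$3), 0, cubic c (v$1) (v$2) (v$3)]" for v
        using Y(3) vec3_collapse[of v] unfolding planar_def by metis
      have X1: "dot ex1 (X v) = 0" for v
        by (simp add: X_def Yv cubic_def bq_defs a0 algebra_simps power2_eq_square power3_eq_cube)
      have X3: "X ex3 = 0" by (simp add: X_def Y3 vec3_eq_iff a0 ac bq_defs)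
      note s = saddle_node[OF cX mem(2,1) e12(2,3) _ _ X1 X3 ndX]
      show False using many[of ex1] s(1,3) by simp
    qed
    then show ?thesis using degenerate_concurrent[OF Y(1) mem(2) thru] eq by blast
  qed
qed

section \<open>Two degenerate points\<close>

text \<open>The inflection polynomial, in the chart \<open>z = 1\<close>, of the field \<open>(x U, y V, 0)\<close> where
  \<open>U = u0 + u1 x + u2 y + u3 x y\<close> and \<open>V = v0 + v1 x + v2 y + v3 x y\<close>.  This is the normal form of a field
  with degenerate points at \<open>(1, 0, 0)\<close> and \<open>(0, 1, 0)\<close> and invariant lines \<open>x = 0\<close> and \<open>y = 0\<close>.\<close>

definition bilin_infl where
  "bilin_infl u0 u1 u2 u3 v0 v1 v2 v3 x y =
     (let a = x * (u0 + u1 * x + u2 * y + u3 * x * y); b = y * (v0 + v1 * x + v2 * y + v3 * x * y);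
          ax = u0 + 2 * u1 * x + u2 * y + 2 * u3 * x * y; ay = x * (u2 + u3 * x);
          bx = y * (v1 + v3 * y); by' = v0 + v1 * x + 2 * v2 * y + 2 * v3 * x * y
      in a * (bx * a + by' * b) - b * (ax * a + ay * b) :: complex)"

lemma bilin_infl_swap: "bilin_infl u0 u1 u2 u3 v0 v1 v2 v3 x y = - bilin_infl v0 v2 v1 v3 u0 u2 u1 u3 y x"
proof -
  have e: "y * (v0 + v2 * y + v1 * x + v3 * y * x) = y * (v0 + v1 * x + v2 * y + v3 * x * y)"
    "x * (u0 + u2 * y + u1 * x + u3 * y * x) = x * (u0 + u1 * x + u2 * y + u3 * x * y)"
    "v0 + 2 * v2 * y + v1 * x + 2 * v3 * y * x = v0 + v1 * x + 2 * v2 * y + 2 * v3 * x * y"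
    "u0 + u2 * y + 2 * u1 * x + 2 * u3 * y * x = u0 + 2 * u1 * x + u2 * y + 2 * u3 * x * y"
    by (simp_all add: algebra_simps)
  have g: "a * (bx * a + bb * b) - b * (ax * a + ay * b) = - (b * (ay * b + ax * a) - a * (bb * b + bx * a))"
    for a b ax ay bx bb :: complex by (simp add: algebra_simps)
  show ?thesis unfolding bilin_infl_def Let_def e by (rule g)
qed

definition bilin_poly where
  "bilin_poly u0 u1 u2 u3 v0 v1 v2 v3 y =
     (let U0 = u0 + u2 * y; U1 = u1 + u3 * y; V0 = v0 + v2 * y; V1 = v1 + v3 * y;
          E0 = 2 * V0 - v0 - U0; E1 = 2 * V1 - v1 - 2 * U1; D0 = U0 - u0; D1 = U1 - u1
      in [:0, y * (U0 * V0 * E0 - V0^2 * D0),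
           y * (U0^2 * V1 + U0 * V0 * E1 + (U0 * V1 + U1 * V0) * E0 - V0^2 * D1 - 2 * V0 * V1 * D0),
           y * (2 * U0 * U1 * V1 + (U0 * V1 + U1 * V0) * E1 + U1 * V1 * E0 - 2 * V0 * V1 * D1 - V1^2 * D0),
           y * (U1^2 * V1 + U1 * V1 * E1 - V1^2 * D1) :: complex:])"

lemma poly_bilin: "poly (bilin_poly u0 u1 u2 u3 v0 v1 v2 v3 y) x = bilin_infl u0 u1 u2 u3 v0 v1 v2 v3 x y"
proof -
  define U0 where "U0 = u0 + u2 * y"
  define U1 where "U1 = u1 + u3 * y"
  define V0 where "V0 = v0 + v2 * y"
  define V1 where "V1 = v1 + v3 * y"
  define E0 where "E0 = 2 * V0 - v0 - U0"
  define E1 where "E1 = 2 * V1 - v1 - 2 * U1"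
  define D0 where "D0 = U0 - u0"
  define D1 where "D1 = U1 - u1"
  define A where "A = x * (U0 + U1 * x)"
  define B where "B = y * (V0 + V1 * x)"
  have "bilin_infl u0 u1 u2 u3 v0 v1 v2 v3 x y = A * (y * V1 * A + (v0 + v1 * x + 2 * v2 * y + 2 * v3 * x * y) * B)
     - B * ((U0 + 2 * U1 * x) * A + x * (u2 + u3 * x) * B)"
  proof -
    have "x * (u0 + u1 * x + u2 * y + u3 * x * y) = A" "y * (v0 + v1 * x + v2 * y + v3 * x * y) = B"
      "u0 + 2 * u1 * x + u2 * y + 2 * u3 * x * y = U0 + 2 * U1 * x"
      by (simp_all add: A_def B_def U0_def U1_def V0_def V1_def algebra_simps)
    then show ?thesis by (simp only: bilin_infl_def Let_def V1_def)
  qed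
  also have "\<dots> = A * A * (y * V1) + A * B * (v0 + v1 * x + 2 * v2 * y + 2 * v3 * x * y - (U0 + 2 * U1 * x)) - B * (x * (u2 + u3 * x) * B)"
    by (simp add: algebra_simps)
  also have "v0 + v1 * x + 2 * v2 * y + 2 * v3 * x * y - (U0 + 2 * U1 * x) = E0 + E1 * x"
    by (simp add: E0_def E1_def U0_def U1_def V0_def V1_def algebra_simps)
  also have "x * (u2 + u3 * x) * B = x * (D0 + D1 * x) * (V0 + V1 * x)"
    by (simp add: B_def D0_def D1_def U0_def U1_def algebra_simps)
  also have "A * A * (y * V1) + A * B * (E0 + E1 * x) - B * (x * (D0 + D1 * x) * (V0 + V1 * x))
     = poly (bilin_poly u0 u1 u2 u3 v0 v1 v2 v3 y) x"
    unfolding bilin_poly_def Let_def U0_def[symmetric] U1_def[symmetric] V0_def[symmetric] V1_def[symmetric]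
      E0_def[symmetric] E1_def[symmetric] D0_def[symmetric] D1_def[symmetric] A_def B_def
    by (simp add: algebra_simps power2_eq_square)
  finally show ?thesis by simp
qed

lemma quadratic_factor:
  fixes a b c :: complex assumes "a \<noteq> 0"
  obtains r s where "b = - a * (r + s)" "c = a * r * s"
proof -
  have "degree [:c, b, a:] \<noteq> 0" using assms by simp
  then obtain r where r: "poly [:c, b, a:] r = 0"
    using fundamental_theorem_of_algebra[of "[:c, b, a:]"] constant_degree[of "[:c, b, a:]"] by auto
  define s where "s = - b / a - r"
  have b: "b = - a * (r + s)" using assms by (simp add: s_def field_simps)
  have "c = a * r * s" using r by (simp add: b algebra_simps)
  then show ?thesis using that b by blast
qed

lemma only_zero_root:
  fixes g :: "complex poly" assumes "\<And>y. poly g y = 0 \<Longrightarrow> y = 0"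
  shows "\<exists>k n. g = monom k n"
  using assms
proof (induction "degree g" arbitrary: g rule: less_induct)
  case less
  show ?case
  proof (cases "degree g = 0")
    case True
    then obtain k where "g = [:k:]" using degree_eq_zeroE by blast
    then show ?thesis by (intro exI[of _ k] exI[of _ 0]) (simp add: monom_0)
  next
    case False
    then obtain r where "poly g r = 0" using fundamental_theorem_of_algebra[of g] constant_degree[of g] by auto
    then have "poly g 0 = 0" using less.prems by auto
    then obtain h where h: "g = [:- 0, 1:] * h" using poly_eq_0_iff_dvd dvdE by metis
    have "h \<noteq> 0" using h False by auto
    then have "degree h < degree g" unfolding h by (subst degree_mult_eq) auto
    moreover have "y = 0" if "poly h y = 0" for y using less.prems[of y] that by (simp add: h)
    ultimately obtain k n where "h = monom k n" using less.hyps by blast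
    then have "g = monom k (Suc n)" by (simp add: h monom_Suc)
    then show ?thesis by blast
  qed
qed

lemma coeff_quintuple:
  "coeff [:a0, a1, a2, a3, a4:] 1 = a1" "coeff [:a0, a1, a2, a3, a4:] 2 = a2"
  "coeff [:a0, a1, a2, a3, a4:] 3 = a3" "coeff [:a0, a1, a2, a3, a4:] 4 = a4"
  by (simp_all add: numeral_eq_Suc)

text \<open>Here \<open>u3 \<noteq> v3\<close> excludes the common factor \<open>z\<close> and forces every invariant line to be parallel to an
  axis, so that the inflection polynomial is a product \<open>f(x) g(y)\<close>.  The last four assumptions
  exclude other common linear factors.  Since the roles of \<open>x\<close> and \<open>y\<close> can be exchanged
  (\<open>swap\<close>), half of the cases suffice.\<close>

locale bilinear_field =
  fixes u0 u1 u2 u3 v0 v1 v2 v3 :: complex and f g :: "complex poly"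
  assumes fg: "\<And>x y. bilin_infl u0 u1 u2 u3 v0 v1 v2 v3 x y = poly f x * poly g y"
    and f_root: "\<And>x. poly f x = 0 \<Longrightarrow> x = 0 \<or> (u0 + u1 * x = 0 \<and> u2 + u3 * x = 0)"
    and g_root: "\<And>y. poly g y = 0 \<Longrightarrow> y = 0 \<or> (v0 + v2 * y = 0 \<and> v1 + v3 * y = 0)"
    and u3v3: "u3 \<noteq> v3"
    and no_x: "\<not> (v0 = 0 \<and> v2 = 0)"
    and no_y: "\<not> (u0 = 0 \<and> u1 = 0)"
    and no_y1: "\<And>y. y \<noteq> 0 \<Longrightarrow> u0 + u2 * y = 0 \<Longrightarrow> u1 + u3 * y = 0 \<Longrightarrow> v0 + v2 * y = 0 \<Longrightarrow> v1 + v3 * y = 0 \<Longrightarrow> False"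
    and no_x1: "\<And>x. x \<noteq> 0 \<Longrightarrow> u0 + u1 * x = 0 \<Longrightarrow> u2 + u3 * x = 0 \<Longrightarrow> v0 + v1 * x = 0 \<Longrightarrow> v2 + v3 * x = 0 \<Longrightarrow> False"
begin

lemma swap: "bilinear_field v0 v2 v1 v3 u0 u2 u1 u3 g (- f)"
proof unfold_locales
  show "bilin_infl v0 v2 v1 v3 u0 u2 u1 u3 x y = poly g x * poly (- f) y" for x y
    using bilin_infl_swap[of v0 v2 v1 v3 u0 u2 u1 u3 x y] fg[of y x] by simp
  show "x = 0 \<or> v0 + v2 * x = 0 \<and> v1 + v3 * x = 0" if "poly g x = 0" for x using g_root[OF that] .
  show "y = 0 \<or> u0 + u1 * y = 0 \<and> u2 + u3 * y = 0" if "poly (- f) y = 0" for y using f_root[of y] that by simp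
  show "v3 \<noteq> u3" using u3v3 by simp
  show "\<not> (u0 = 0 \<and> u1 = 0)" "\<not> (v0 = 0 \<and> v2 = 0)" by (rule no_y no_x)+
qed (use no_x1 no_y1 in blast)+

lemma coeff_x: "coeff (bilin_poly u0 u1 u2 u3 v0 v1 v2 v3 y) j = coeff f j * poly g y"
proof -
  have "poly (bilin_poly u0 u1 u2 u3 v0 v1 v2 v3 y) = poly (smult (poly g y) f)"
    by (rule ext) (simp add: poly_bilin fg)
  then have "bilin_poly u0 u1 u2 u3 v0 v1 v2 v3 y = smult (poly g y) f" by (simp only: poly_eq_poly_eq_iff)
  then show ?thesis by simp
qed

lemma coeff_x4:
  "y * (v1 + v3 * y) * ((u1 + u3 * y) * (v1 + v3 * y) - (u1 + u3 * y)^2 + u1 * (v1 + v3 * y) - v1 * (u1 + u3 * y))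
    = coeff f 4 * poly g y"
proof -
  have "coeff (bilin_poly u0 u1 u2 u3 v0 v1 v2 v3 y) 4 =
    y * (v1 + v3 * y) * ((u1 + u3 * y) * (v1 + v3 * y) - (u1 + u3 * y)^2 + u1 * (v1 + v3 * y) - v1 * (u1 + u3 * y))"
  proof -
    have "y * (p * p * q + p * q * (2 * q - v1 - 2 * p) - q * q * (p - u1)) = y * q * (p * q - p * p + u1 * q - v1 * p)" for p q :: complex
      by (simp add: algebra_simps)
    then show ?thesis unfolding bilin_poly_def Let_def coeff_quintuple power2_eq_square .
  qed
  then show ?thesis using coeff_x[of y 4] by simp
qed

text \<open>The coefficient of \<open>x\<^sup>4\<close> has degree four in \<open>y\<close>, so it is a nonzero multiple of \<open>g\<close>.  Its factors
  are explicit, and each of their roots must be \<open>0\<close> or satisfy \<open>V(x, y) = 0\<close> for all \<open>x\<close>.\<close>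

lemma both_nonzero_y:
  assumes "u3 \<noteq> 0" "v3 \<noteq> 0"
  shows "(u1 = 0 \<and> v1 = 0) \<or> (v1 \<noteq> 0 \<and> v0 * v3 = v1 * v2 \<and> (u1 = 0 \<or> u1 * v3 = u3 * v1 \<or> u3 = 2 * v3))"
proof -
  let ?br = "\<lambda>y. (u1 + u3 * y) * (v1 + v3 * y) - (u1 + u3 * y)^2 + u1 * (v1 + v3 * y) - v1 * (u1 + u3 * y)"
  let ?l = "u3 * (v3 - u3)"
  have l: "?l \<noteq> 0" using assms u3v3 by simp
  have f4: "coeff f 4 \<noteq> 0"
  proof
    assume "coeff f 4 = 0"
    then have "0 + (v1 * (u1 * v1 - u1^2)) * y + (v3 * (u1 * v1 - u1^2) + v1 * (2 * u1 * v3 - 2 * u1 * u3)) * y^2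
      + (v1 * ?l + v3 * (2 * u1 * v3 - 2 * u1 * u3)) * y^3 + (v3 * ?l) * y^4 = 0" for y using coeff_x4[of y] by algebra
    from poly4_coeffs(5)[OF this] show False using l assms by simp
  qed
  have R: "y = 0 \<or> (v0 + v2 * y = 0 \<and> v1 + v3 * y = 0)" if "(v1 + v3 * y) * ?br y = 0" for y
  proof -
    have "coeff f 4 * poly g y = y * ((v1 + v3 * y) * ?br y)" by (simp only: coeff_x4[symmetric] mult.assoc)
    then show ?thesis using that f4 g_root by simp
  qed
  obtain r s where rs: "2 * u1 * (v3 - u3) = - ?l * (r + s)" "u1 * v1 - u1^2 = ?l * r * s" using quadratic_factor[OF l] by metis
  have br: "?br y = ?l * ((y - r) * (y - s))" for y using rs by algebra
  have rsR: "r = 0 \<or> v1 + v3 * r = 0" "s = 0 \<or> v1 + v3 * s = 0" using R[of r] R[of s] br by auto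
  show ?thesis
  proof (cases "v1 = 0")
    case True
    then have "r = 0" "s = 0" using rsR assms by auto
    then have "u1^2 = 0" using rs(2) True by simp
    then show ?thesis using True by simp
  next
    case False
    have "v0 + v2 * (- v1 / v3) = 0" using R[of "- v1 / v3"] assms False by auto
    then have v0: "v0 * v3 = v1 * v2" using assms by (simp add: field_simps)
    have vu: "v3 - u3 \<noteq> 0" using u3v3 by simp
    have e: "2 * u1 = - u3 * (r + s)" using rs(1) vu by algebra
    consider "r = 0" "s = 0" | "r = 0" "v1 + v3 * s = 0" | "v1 + v3 * r = 0" "s = 0" | "v1 + v3 * r = 0" "v1 + v3 * s = 0"
      using rsR by blast
    then have "u1 = 0 \<or> u1 * v3 = u3 * v1 \<or> u3 = 2 * v3"
    proof cases
      case 1 then show ?thesis using e by simp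
    next
      case 2
      then have "u1 * (v1 - u1) = 0" using rs(2) by (simp add: power2_eq_square algebra_simps)
      moreover have "2 * u1 * v3 = u3 * v1" using e 2 by algebra
      ultimately show ?thesis using False by auto
    next
      case 3
      then have "u1 * (v1 - u1) = 0" using rs(2) by (simp add: power2_eq_square algebra_simps)
      moreover have "2 * u1 * v3 = u3 * v1" using e 3 by algebra
      ultimately show ?thesis using False by auto
    next
      case 4
      have "2 * (u1 * v3) = 2 * (u3 * v1)" using e 4 by algebra
      then show ?thesis by simp
    qed
    then show ?thesis using False v0 by blast
  qed
qed

text \<open>The alternatives of \<open>both_nonzero_y\<close> and its mirror image either give a common linear factor or
  require \<open>u3 = 2 v3\<close> and \<open>v3 = 2 u3\<close>.  If all mixed coefficients vanish, the coefficient of \<open>x\<^sup>2\<close> is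
  proportional to \<open>y\<^sup>2\<close> and that of \<open>x\<^sup>4\<close> to \<open>y\<^sup>4\<close>, but both are multiples of \<open>g\<close>.\<close>

lemma both_nonzero:
  assumes "u3 \<noteq> 0" "v3 \<noteq> 0" shows False
proof -
  interpret sw: bilinear_field v0 v2 v1 v3 u0 u2 u1 u3 g "- f" by (rule swap)
  consider "u1 = 0" "v1 = 0" "u2 = 0" "v2 = 0"
    | "v1 \<noteq> 0" "v0 * v3 = v1 * v2" "v2 = 0" | "u2 \<noteq> 0" "u0 * u3 = u2 * u1" "u1 = 0"
    | "v1 \<noteq> 0" "v0 * v3 = v1 * v2" "u1 \<noteq> 0" "u1 * v3 = u3 * v1 \<or> u3 = 2 * v3"
      "u2 \<noteq> 0" "u0 * u3 = u2 * u1" "v2 \<noteq> 0" "v2 * u3 = v3 * u2 \<or> v3 = 2 * u3"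
    using both_nonzero_y[OF assms] sw.both_nonzero_y[OF assms(2,1)] by blast
  then show False
  proof cases
    case 1
    have e4: "(u3 * v3 * (v3 - u3)) * y^4 = coeff f 4 * poly g y" for y using coeff_x4[of y] 1 by (simp add: algebra_simps) algebra
    have e2: "3 * u0 * v0 * (v3 - u3) * y^2 = coeff f 2 * poly g y" for y
      using coeff_x[of y 2] unfolding bilin_poly_def Let_def coeff_quintuple 1 by algebra
    have "u3 * v3 * (v3 - u3) \<noteq> 0" using assms u3v3 by simp
    then have f4: "coeff f 4 \<noteq> 0" using e4[of 1] by auto
    define c where "c = u3 * v3 * (v3 - u3)"
    have "coeff f 4 * poly g 1 = c" unfolding c_def e4[symmetric] by simp
    moreover have "coeff f 4 * poly g 2 = 16 * c" unfolding c_def e4[symmetric] by simp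
    ultimately have "coeff f 4 * poly g 2 = coeff f 4 * (16 * poly g 1)" by (simp only: mult.left_commute)
    then have "poly g 2 = 16 * poly g 1" using f4 mult_left_cancel by blast
    then have "12 * (3 * u0 * v0 * (v3 - u3)) = 0" using e2[of 1] e2[of 2] by (simp add: algebra_simps)
    then show False using 1 no_x no_y u3v3 by auto
  next
    case 2 then show False using no_x assms by simp
  next
    case 3 then show False using no_y assms by simp
  next
    case 4
    have u: "u0 + u2 * (- u1 / u3) = 0" "u0 + u1 * (- u2 / u3) = 0" and v: "v0 + v2 * (- v1 / v3) = 0" "v0 + v1 * (- v2 / v3) = 0"
      using 4 assms by (simp_all add: field_simps)
    have "u3 = 2 * v3"
    proof (rule ccontr)
      assume "u3 \<noteq> 2 * v3"
      then have eq: "- u1 / u3 = - v1 / v3" using 4 assms by (simp add: field_simps)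
      have "u1 + u3 * (- u1 / u3) = 0" using assms by simp
      from no_y1[OF _ u(1)[unfolded eq] this[unfolded eq] v(1)] show False using 4 assms by simp
    qed
    moreover have "v3 = 2 * u3"
    proof (rule ccontr)
      assume "v3 \<noteq> 2 * u3"
      then have eq: "- u2 / u3 = - v2 / v3" using 4 assms by (simp add: field_simps)
      have "u2 + u3 * (- u2 / u3) = 0" using assms by simp
      from no_x1[OF _ u(2)[unfolded eq] this[unfolded eq] v(2)] show False using 4 assms by simp
    qed
    ultimately show False using assms by simp
  qed
qed

text \<open>If \<open>v2 \<noteq> 0\<close>, the coefficient of \<open>y\<^sup>4\<close> determines \<open>f\<close> and leads to a common linear factor.  If \<open>v2 = 0\<close>, the
  only root of \<open>g\<close> is \<open>0\<close>, so that \<open>g\<close> is a monomial and all but one of the coefficients of powers of \<open>y\<close>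
  vanish.\<close>

lemma one_zero: assumes v3: "v3 = 0" shows False
proof -
  interpret sw: bilinear_field v0 v2 v1 v3 u0 u2 u1 u3 g "- f" by (rule swap)
  have u3: "u3 \<noteq> 0" using u3v3 v3 by simp
  have X: "y * v1 * (u1 * v1 - (u1 + u3 * y)^2) = coeff f 4 * poly g y" for y
    using coeff_x4[of y] unfolding v3 by algebra
  have Y: "x * (u2 + u3 * x) * v2 * (u2 + 2 * u3 * x - v2) = - coeff g 4 * poly f x" for x
    using sw.coeff_x4[of x] unfolding v3 poly_minus by algebra
  show False
  proof (cases "v2 = 0")
    case False
    have "poly [:0, u2 * v2 * (u2 - v2), v2 * (u3 * (u2 - v2) + 2 * u2 * u3), 2 * u3^2 * v2:] = poly (smult (- coeff g 4) f)"
      by (rule ext) (use Y in \<open>simp add: algebra_simps power2_eq_square\<close>)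
    then have fe: "[:0, u2 * v2 * (u2 - v2), v2 * (u3 * (u2 - v2) + 2 * u2 * u3), 2 * u3^2 * v2:] = smult (- coeff g 4) f"
      by (simp only: poly_eq_poly_eq_iff)
    have "coeff g 4 * coeff f 3 \<noteq> 0" "coeff g 4 * coeff f 4 = 0"
      using arg_cong[OF fe, of "\<lambda>p. coeff p 3"] arg_cong[OF fe, of "\<lambda>p. coeff p 4"] u3 False by (auto simp: numeral_eq_Suc)
    then have g4: "coeff g 4 \<noteq> 0" and f3: "coeff f 3 \<noteq> 0" and f4: "coeff f 4 = 0" by auto
    have "0 + v1 * (u1 * v1 - u1^2) * y + (- 2 * v1 * u1 * u3) * y^2 + (- v1 * u3^2) * y^3 + 0 * y^4 = 0" for y
      using X[of y] f4 by algebra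
    from poly4_coeffs(4)[OF this] have v1: "v1 = 0" using u3 by simp
    have froot: "x = 0 \<or> (u0 + u1 * x = 0 \<and> u2 + u3 * x = 0)" if "(u2 + u3 * x) * (u2 + 2 * u3 * x - v2) = 0" for x
    proof -
      have "coeff g 4 * poly f x = 0" using Y[of x] that by auto
      then show ?thesis using g4 f_root by simp
    qed
    define r where "r = (v2 - u2) / (2 * u3)"
    have r: "2 * u3 * r = v2 - u2" using u3 by (simp add: r_def)
    then have "(u2 + u3 * r) * (u2 + 2 * u3 * r - v2) = 0" by simp
    then have "u2 = v2 \<or> u2 = - v2" using froot[of r] r by (auto simp: eq_neg_iff_add_eq_0) algebra
    then have u2: "u2 \<noteq> 0" using False by auto
    have u0: "u0 + u1 * (- u2 / u3) = 0" using froot[of "- u2 / u3"] u2 u3 by auto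
    have u1: "u1 \<noteq> 0" using u0 no_y by auto
    define y where "y = - u1 / u3"
    have y: "y \<noteq> 0" "u1 + u3 * y = 0" "u0 + u2 * y = 0" using u0 u1 u3 by (auto simp: y_def field_simps)
    have "coeff (bilin_poly u0 u1 u2 u3 v0 v1 v2 v3 y) 3 = 0"
      unfolding bilin_poly_def Let_def coeff_quintuple y v1 v3 by simp
    then have "poly g y = 0" using coeff_x[of y 3] f3 by simp
    then have "v0 + v2 * y = 0" using g_root y by blast
    then show False using no_y1[OF y(1,3,2)] v1 v3 by simp
  next
    case v2: True
    then have v0: "v0 \<noteq> 0" using no_x by simp
    have "y = 0" if "poly g y = 0" for y using g_root[OF that] v0 v2 by simp
    then obtain k n where g: "g = monom k n" using only_zero_root by metis
    show False
    proof (cases "v1 = 0")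
      case v1: False
      have "poly [:0, v1 * (u1 * v1 - u1^2), - 2 * v1 * u1 * u3, - v1 * u3^2:] = poly (monom (coeff f 4 * k) n)"
        by (rule ext) (use X in \<open>simp add: g poly_monom algebra_simps power2_eq_square\<close>)
      then have e: "[:0, v1 * (u1 * v1 - u1^2), - 2 * v1 * u1 * u3, - v1 * u3^2:] = monom (coeff f 4 * k) n"
        by (simp only: poly_eq_poly_eq_iff)
      have n: "n = 3" using arg_cong[OF e, of "\<lambda>p. coeff p 3"] v1 u3 by (auto simp: numeral_eq_Suc split: if_splits)
      have "- 2 * v1 * u1 * u3 = 0" using arg_cong[OF e, of "\<lambda>p. coeff p 2"] by (simp add: n numeral_eq_Suc)
      then have u1: "u1 = 0" using v1 u3 by simp
      have h0: "coeff (bilin_poly v0 v2 v1 v3 u0 u2 u1 u3 x) 1 = 0" for x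
        unfolding sw.coeff_x g n by simp
      have h: "x * ((v0 + v1 * x) * u0 * (u0 - v0 - v1 * x) - u0^2 * (v1 * x)) = 0" for x
        using h0[of x] unfolding bilin_poly_def Let_def coeff_quintuple v2 v3 u1 by algebra
      have "0 + (v0 * u0 * (u0 - v0)) * x + (v1 * u0 * (u0 - v0) - v0 * u0 * v1 - u0^2 * v1) * x^2 + (- (v1^2) * u0) * x^3 + 0 * x^4 = 0" for x
        using h[of x] by algebra
      from poly4_coeffs(4)[OF this] have "u0 = 0" using v1 by simp
      then show False using no_y u1 by simp
    next
      case v1: True
      have c3: "x * (v0 * (u2 + u3 * x) * (u2 + 2 * u3 * x)) = - coeff g 3 * poly f x" for x
        using sw.coeff_x[of x 3] unfolding bilin_poly_def Let_def coeff_quintuple v1 v2 v3 by (simp add: algebra_simps)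
      have "coeff g 3 \<noteq> 0"
      proof
        assume g3: "coeff g 3 = 0"
        have "0 + (v0 * u2^2) * x + (3 * v0 * u2 * u3) * x^2 + (2 * v0 * u3^2) * x^3 + 0 * x^4 = 0" for x
          using c3[of x] g3 by algebra
        from poly4_coeffs(4)[OF this] show False using v0 u3 by simp
      qed
      then have n: "n = 3" and k: "k \<noteq> 0" by (auto simp: g split: if_splits)
      have "k * poly f (- u2 / (2 * u3)) = 0" using c3[of "- u2 / (2 * u3)"] u3 by (simp add: g n)
      then have "poly f (- u2 / (2 * u3)) = 0" using k by simp
      from f_root[OF this] have u2: "u2 = 0" using u3 by (auto simp: field_simps)
      have h0: "coeff (bilin_poly v0 v2 v1 v3 u0 u2 u1 u3 x) 1 = 0" for x unfolding sw.coeff_x g n by simp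
      have h: "x * (v0 * (u0 + u1 * x) * (u0 + 2 * u1 * x - v0)) = 0" for x
        using h0[of x] unfolding bilin_poly_def Let_def coeff_quintuple v1 v2 v3 u2 by algebra
      have "0 + (v0 * u0 * (u0 - v0)) * x + (v0 * u1 * (u0 - v0) + 2 * v0 * u0 * u1) * x^2 + (2 * v0 * u1^2) * x^3 + 0 * x^4 = 0" for x
        using h[of x] by algebra
      note c = poly4_coeffs[OF this]
      have u1: "u1 = 0" using c(4) v0 by simp
      then have u0: "u0 = v0" using c(2) v0 no_y by auto
      have "coeff (bilin_poly v0 v2 v1 v3 u0 u2 u1 u3 1) 2 = 0" unfolding sw.coeff_x g n by simp
      then have "3 * v0^2 * u3 = 0"
        unfolding bilin_poly_def Let_def coeff_quintuple v1 v2 v3 u2 u1 u0 by (simp add: algebra_simps power2_eq_square)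
      then show False using v0 u3 by simp
    qed
  qed
qed

theorem contradiction: False
proof -
  interpret sw: bilinear_field v0 v2 v1 v3 u0 u2 u1 u3 g "- f" by (rule swap)
  show False using both_nonzero one_zero sw.one_zero by blast
qed

end

lemma degenerate_transport_inverse:
  assumes M: "invertible M" and d: "degenerate_at Z s"
  shows "degenerate_at (transport M Z) (matrix_inv M *v s)"
proof -
  have inv2: "matrix_inv (matrix_inv M) *v q = M *v q" for q
    using matrix_inv3(2)[OF invertible_inv[OF M], of "M *v q"] by (simp only: matrix_inv3(2)[OF M])
  have "transport (matrix_inv M) (transport M Z) = Z"
    by (rule ext) (simp add: transport_def inv2 matrix_inv3[OF M])
  then show ?thesis using degenerate_transport[OF invertible_inv[OF M], of "transport M Z" s] d by simp
qed

lemma degenerate_scale: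
  assumes Z: "\<And>i. hom 3 (\<lambda>p. Z p $ i)" and c: "c \<noteq> 0" and d: "degenerate_at Z (c *s p)"
  shows "degenerate_at Z p"
  unfolding degenerate_at_def
proof (intro conjI allI)
  show "p \<noteq> 0" using d by (auto simp: degenerate_at_def)
  fix v i
  obtain q where q: "\<And>t. field_form Z (c *s p + t *s (c *s v)) $ i = t^2 * poly q t"
    using d unfolding degenerate_at_def by metis
  have "Z (s *s p) = s^3 *s Z p" for s p using hom_homogeneous[OF Z] by (simp add: vec_eq_iff)
  then have ff: "field_form Z (s *s p) = s^4 *s field_form Z p" for s p
    by (simp add: field_form_def vec3_eq_iff algebra_simps eval_nat_numeral)
  have "field_form Z (p + t *s v) $ i = t^2 * poly (smult (1 / c^4) q) t" for t
  proof -
    have "c *s p + t *s (c *s v) = c *s (p + t *s v)" by (simp add: vec_eq_iff algebra_simps)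
    then have "field_form Z (c *s p + t *s (c *s v)) = c^4 *s field_form Z (p + t *s v)" by (simp only: ff)
    then have "c^4 * field_form Z (p + t *s v) $ i = t^2 * poly q t" using q[of t] by simp
    then show ?thesis using c by (simp add: field_simps)
  qed
  then show "\<exists>q. \<forall>t. field_form Z (p + t *s v) $ i = t\<^sup>2 * poly q t" by blast
qed

lemma order_two_coeffs:
  assumes "\<And>t::complex. poly p t = t^2 * poly q t" shows "coeff p 0 = 0" "coeff p 1 = 0"
proof -
  have "poly p = poly ([:0, 0, 1:] * q)" by (rule ext) (simp add: assms power2_eq_square)
  then have "p = [:0, 0, 1:] * q" by (simp only: poly_eq_poly_eq_iff)
  then show "coeff p 0 = 0" "coeff p 1 = 0" by simp_all
qed

lemma prod_list_filter_split:
  "(\<Prod>x\<leftarrow>xs. f x) = (\<Prod>x\<leftarrow>filter P xs. f x) * (\<Prod>x\<leftarrow>filter (\<lambda>x. \<not> P x) xs. (f x :: complex))"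
  by (induction xs) auto

lemma poly_prod_list_map: "poly (\<Prod>x\<leftarrow>xs. f x) t = (\<Prod>x\<leftarrow>xs. poly (f x) t)"
  by (induction xs) auto

lemma prod_list_map_zero: "(\<Prod>x\<leftarrow>xs. f x) = (0 :: complex) \<Longrightarrow> \<exists>x\<in>set xs. f x = 0"
  by (induction xs) auto

text \<open>The line \<open>K\<close> passes through \<open>s'\<close> but not through \<open>s\<close>, the line \<open>L\<close> through \<open>s\<close> but not through \<open>s'\<close>.  With
  \<open>s = (1, 0, 0)\<close>, \<open>s' = (0, 1, 0)\<close> and the third component of the field cancelled by a multiple of the
  radial field, degeneracy at both points leaves the normal form of \<open>bilinear_field\<close>.\<close>

lemma two_degenerate:
  assumes cf: "convex_field Z Ls" and KL: "K \<in> set Ls" "L \<in> set Ls"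
    and d: "degenerate_at Z s" "degenerate_at Z s'"
    and Ks: "dot K s \<noteq> 0" "dot K s' = 0" and L: "dot L s = 0" "dot L s' \<noteq> 0"
  shows False
proof -
  let ?N = "ccross s s'"
  have "dot ?N (ccross K L) = dot K s * dot L s' - dot L s * dot K s'" by (simp add: dot_def algebra_simps)
  then have "dot ?N (ccross K L) \<noteq> 0" using Ks L by simp
  from adapt_rows[OF this] obtain M where M: "invertible M" "K v* M = ex1" "L v* M = ex2" "?N v* M = ex3" .
  let ?Z1 = "transport M Z" and ?Ks = "map (\<lambda>L. L v* M) Ls"
  have cf1: "convex_field ?Z1 ?Ks" by (rule convex_field_transport[OF cf M(1)])
  have mem: "ex1 \<in> set ?Ks" "ex2 \<in> set ?Ks" using KL M(2,3) by (metis image_eqI list.set_map)+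
  have "dot ?N s = 0" "dot ?N s' = 0" by (simp_all add: dot_def algebra_simps)
  then have "matrix_inv M *v s = dot K s *s ex1" "matrix_inv M *v s' = dot L s' *s ex2"
    using mv_eqI[OF M, of s] mv_eqI[OF M, of s'] Ks L by (simp_all add: vec3_eq_iff)
  then have d1: "degenerate_at ?Z1 ex1" "degenerate_at ?Z1 ex2"
    using degenerate_transport_inverse[OF M(1)] d degenerate_scale[OF convex_fieldD(1)[OF cf1]] Ks L by metis+
  obtain c where c: "\<And>x y z. ?Z1 (vector [x, y, z]) $ 3 = cubic c x y z"
    using hom3_coeffs[OF convex_fieldD(1)[OF cf1, of 3]] by blast
  let ?g = "\<lambda>p :: complex^3. bq2 (- c 4) (- c 5) (- c 6) (p$1) (p$2) + p$3 * bq1 (- c 7) (- c 8) (p$1) (p$2) + (p$3)^2 * (- c 9)"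
  define Y where "Y = (\<lambda>p. 1 *s ?Z1 p + ?g p *s p)"
  have cY: "convex_field Y ?Ks" unfolding Y_def by (rule convex_field_gauge[OF cf1 hom_quadratic]) simp
  have "field_form Y p = field_form ?Z1 p" for p unfolding Y_def using field_form_gauge[of 1 ?Z1 ?g p] by simp
  then have dY: "degenerate_at Y ex1" "degenerate_at Y ex2" using degenerate_form[of ?Z1 Y] d1 by metis+
  have Y3: "Y (vector [x, y, z]) $ 3 = bq3 (c 0) (c 1) (c 2) (c 3) x y" for x y z
    by (simp add: Y_def c cubic_def bq_defs algebra_simps power2_eq_square power3_eq_cube)
  obtain a where a: "\<And>x y z. Y (vector [x, y, z]) $ 1 = cubic a x y z" using hom3_coeffs[OF convex_fieldD(1)[OF cY, of 1]] by blast
  obtain b where b: "\<And>x y z. Y (vector [x, y, z]) $ 2 = cubic b x y z" using hom3_coeffs[OF convex_fieldD(1)[OF cY, of 2]] by blast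
  have "bq3 (a 3) (a 6) (a 8) (a 9) y z = 0" for y z
    using convex_fieldD(3)[OF cY mem(1), of "vector [0, y, z]"] by (simp add: a cubic_def bq_defs algebra_simps power2_eq_square)
  then have a0: "a 3 = 0" "a 6 = 0" "a 8 = 0" "a 9 = 0" using bq_all_0(3)[of "a 3" "a 6" "a 8" "a 9"] by blast+
  have "bq3 (b 0) (b 4) (b 7) (b 9) y z = 0" for y z
    using convex_fieldD(3)[OF cY mem(2), of "vector [y, 0, z]"] by (simp add: b cubic_def bq_defs algebra_simps power2_eq_square)
  then have b0: "b 0 = 0" "b 4 = 0" "b 7 = 0" "b 9 = 0" using bq_all_0(3)[of "b 0" "b 4" "b 7" "b 9"] by blast+
  have arg1: "ex1 + t *s vector [0, y, z] = vector [1, t * y, t * z]" and arg2: "ex2 + t *s vector [y, 0, z] = vector [t * y, 1, t * z]" for t y z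
    by (simp_all add: vec3_eq_iff)
  have P1: "c 0 = 0 \<and> c 1 * y - a 0 * z = 0 \<and> a 0 * y - b 1 * y = 0" for y z
  proof -
    have "\<exists>q. \<forall>t. field_form Y (vector [1, t * y, t * z]) $ i = t^2 * poly q t" for i
      using dY(1) arg1 unfolding degenerate_at_def by metis
    then obtain q2 q3 where q2: "\<And>t. field_form Y (vector [1, t * y, t * z]) $ 2 = t^2 * poly q2 t"
      and q3: "\<And>t. field_form Y (vector [1, t * y, t * z]) $ 3 = t^2 * poly q3 t" by metis
    have e2: "poly [:c 0, c 1 * y - a 0 * z, c 2 * y^2 - (a 1 * y + a 4 * z) * z, c 3 * y^3 - (a 2 * y^2 + a 5 * y * z + a 7 * z^2) * z:] t
        = t^2 * poly q2 t" for t
      unfolding q2[symmetric] by (simp add: field_form_def a Y3 cubic_def bq_defs a0 algebra_simps power2_eq_square power3_eq_cube)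
    have e3: "poly [:0, a 0 * y - b 1 * y, (a 1 * y + a 4 * z) * y - b 2 * y^2 - b 5 * y * z,
         (a 2 * y^2 + a 5 * y * z + a 7 * z^2) * y - b 3 * y^3 - b 6 * y^2 * z - b 8 * y * z^2:] t
        = t^2 * poly q3 t" for t
      unfolding q3[symmetric] by (simp add: field_form_def a b cubic_def bq_defs a0 b0 algebra_simps power2_eq_square power3_eq_cube)
    show ?thesis using order_two_coeffs[OF e2] order_two_coeffs[OF e3] by simp
  qed
  have P2: "c 3 = 0 \<and> b 3 * z - c 2 * x = 0 \<and> a 2 * x - b 3 * x = 0" for x z
  proof -
    have "\<exists>q. \<forall>t. field_form Y (vector [t * x, 1, t * z]) $ i = t^2 * poly q t" for i
      using dY(2) arg2 unfolding degenerate_at_def by metis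
    then obtain q1 q3 where q1: "\<And>t. field_form Y (vector [t * x, 1, t * z]) $ 1 = t^2 * poly q1 t"
      and q3: "\<And>t. field_form Y (vector [t * x, 1, t * z]) $ 3 = t^2 * poly q3 t" by metis
    have e1: "poly [:- c 3, b 3 * z - c 2 * x, (b 2 * x + b 6 * z) * z - c 1 * x^2, (b 1 * x^2 + b 5 * x * z + b 8 * z^2) * z - c 0 * x^3:] t
        = t^2 * poly q1 t" for t
      unfolding q1[symmetric] by (simp add: field_form_def b Y3 cubic_def bq_defs b0 algebra_simps power2_eq_square power3_eq_cube)
    have e3: "poly [:0, a 2 * x - b 3 * x, a 1 * x^2 + a 5 * x * z - (b 2 * x + b 6 * z) * x,
         a 0 * x^3 + a 4 * x^2 * z + a 7 * x * z^2 - (b 1 * x^2 + b 5 * x * z + b 8 * z^2) * x:] t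
        = t^2 * poly q3 t" for t
      unfolding q3[symmetric] by (simp add: field_form_def a b cubic_def bq_defs a0 b0 algebra_simps power2_eq_square power3_eq_cube)
    show ?thesis using order_two_coeffs[OF e1] order_two_coeffs[OF e3] by simp
  qed
  have z1: "a 0 = 0" "b 1 = 0" "c 0 = 0" "c 1 = 0" using P1[of 1 0] P1[of 0 1] by auto
  have z2: "a 2 = 0" "b 3 = 0" "c 2 = 0" "c 3 = 0" using P2[of 1 0] P2[of 0 1] by auto
  define A where "A x y z = x * (a 7 * z^2 + a 4 * x * z + a 5 * y * z + a 1 * x * y)" for x y z
  define B where "B x y z = y * (b 8 * z^2 + b 5 * x * z + b 6 * y * z + b 2 * x * y)" for x y z
  have Yv: "Y (vector [x, y, z]) = vector [A x y z, B x y z, 0]" for x y z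
    using z1 z2 a0 b0 by (simp add: vec3_eq_iff a b Y3 A_def B_def cubic_def bq_defs algebra_simps power2_eq_square power3_eq_cube)
  have ff: "field_form Y (vector [x, y, z]) = vector [B x y z * z, - (A x y z * z), A x y z * y - B x y z * x]" for x y z
    by (simp add: field_form_def Yv vec3_eq_iff)
  have nodiv: False if "E \<noteq> 0" "\<And>x y z. dot E (vector [x, y, z]) = 0 \<Longrightarrow> A x y z * z = 0 \<and> B x y z * z = 0 \<and> A x y z * y = B x y z * x" for E
  proof -
    note E = that
    obtain p where p: "dot E p = 0" "field_form Y p \<noteq> 0" using convex_fieldD(4)[OF cY E(1)] by blast
    have "field_form Y (vector [p$1, p$2, p$3]) = 0"
      unfolding ff using E(2)[of "p$1" "p$2" "p$3"] p(1) by (simp add: vec3_collapse vec3_eq_iff)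
    then show False using p(2) by (simp add: vec3_collapse)
  qed
  have inv: "J$1 * A x y z + J$2 * B x y z = 0" if "J \<in> set ?Ks" "dot J (vector [x, y, z]) = 0" for J x y z
    using convex_fieldD(3)[OF cY that] by (simp add: Yv dot_def)
  \<comment> \<open>otherwise \<open>z\<close> is a common factor of the form\<close>
  have u3v3: "a 1 \<noteq> b 2"
  proof
    assume "a 1 = b 2"
    then show False using nodiv[of ex3] by (auto simp: A_def B_def vec3_eq_iff)
  qed
  have J12: "J$1 = 0 \<or> J$2 = 0" if "J \<in> set ?Ks" for J
  proof -
    have "J$1 * A (J$2) (- J$1) 0 + J$2 * B (J$2) (- J$1) 0 = 0" by (rule inv[OF that]) (simp add: dot_def)
    moreover have "J$1 * A (J$2) (- J$1) 0 + J$2 * B (J$2) (- J$1) 0 = (J$1)^2 * (J$2)^2 * (b 2 - a 1)"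
      by (simp add: A_def B_def algebra_simps power2_eq_square)
    ultimately have "(J$1)^2 * (J$2)^2 * (b 2 - a 1) = 0" by simp
    then show ?thesis using u3v3 by auto
  qed
  obtain k where k: "k \<noteq> 0" "\<And>p. infl Y p = k * (\<Prod>L\<leftarrow>?Ks. dot L p)" using convex_fieldD(5)[OF cY] by blast
  define f where "f = (\<Prod>L\<leftarrow>filter (\<lambda>L. L$2 = 0) ?Ks. [:L$3, L$1:])"
  define g where "g = smult k (\<Prod>L\<leftarrow>filter (\<lambda>L. L$2 \<noteq> 0) ?Ks. [:L$3, L$2:])"
  have J0: "J \<noteq> 0" if "J \<in> set ?Ks" for J using convex_fieldD(2)[OF cY that] .
  have "bilinear_field (a 7) (a 4) (a 5) (a 1) (b 8) (b 5) (b 6) (b 2) f g"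
  proof
    fix x y
    have "infl Y (vector [x, y, 1]) = bilin_infl (a 7) (a 4) (a 5) (a 1) (b 8) (b 5) (b 6) (b 2) x y"
    proof -
      have dA: "((\<lambda>t. A (x+t*u) (y+t * v) (z+t*w)) has_field_derivative
          ((a 7 * z^2 + 2 * a 4 * x * z + a 5 * y * z + 2 * a 1 * x * y) * u + x * (a 5 * z + a 1 * x) * v
           + x * (2 * a 7 * z + a 4 * x + a 5 * y) * w)) (at 0)" for x y z u v w
        unfolding A_def by (auto intro!: derivative_eq_intros simp: algebra_simps power2_eq_square)
      have dB: "((\<lambda>t. B (x+t*u) (y+t * v) (z+t*w)) has_field_derivative
          (y * (b 5 * z + b 2 * y) * u + (b 8 * z^2 + b 5 * x * z + 2 * b 6 * y * z + 2 * b 2 * x * y) * v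
           + y * (2 * b 8 * z + b 5 * x + b 6 * y) * w)) (at 0)" for x y z u v w
        unfolding B_def by (auto intro!: derivative_eq_intros simp: algebra_simps power2_eq_square)
      have d0: "((\<lambda>t. 0) has_field_derivative (0 * u + 0 * v + 0 * w)) (at 0)" for u v w :: complex by simp
      have "x * (a 7 + a 4 * x + a 5 * y + a 1 * x * y) = A x y 1" "y * (b 8 + b 5 * x + b 6 * y + b 2 * x * y) = B x y 1"
        by (simp_all add: A_def B_def)
      then show ?thesis
        by (subst infl_cubic[OF Yv dA dB d0]) (simp add: Let_def bilin_infl_def)
    qed
    also have "infl Y (vector [x, y, 1]) = k * ((\<Prod>L\<leftarrow>filter (\<lambda>L. L$2 = 0) ?Ks. dot L (vector [x, y, 1])) * (\<Prod>L\<leftarrow>filter (\<lambda>L. L$2 \<noteq> 0) ?Ks. dot L (vector [x, y, 1])))"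
      using prod_list_filter_split[of "\<lambda>L. dot L (vector [x, y, 1])" ?Ks "\<lambda>L. L$2 = 0"] k(2) by simp
    also have "(\<Prod>L\<leftarrow>filter (\<lambda>L. L$2 = 0) ?Ks. dot L (vector [x, y, 1])) = poly f x"
      unfolding f_def poly_prod_list_map by (rule arg_cong[of _ _ prod_list], rule map_cong) (auto simp: dot_def)
    also have "(\<Prod>L\<leftarrow>filter (\<lambda>L. L$2 \<noteq> 0) ?Ks. dot L (vector [x, y, 1])) = (\<Prod>L\<leftarrow>filter (\<lambda>L. L$2 \<noteq> 0) ?Ks. poly [:L$3, L$2:] y)"
      by (rule arg_cong[of _ _ prod_list], rule map_cong) (use J12 in \<open>auto simp: dot_def algebra_simps\<close>)
    finally show "bilin_infl (a 7) (a 4) (a 5) (a 1) (b 8) (b 5) (b 6) (b 2) x y = poly f x * poly g y"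
      by (simp add: g_def poly_prod_list_map mult_ac del: poly_pCons)
  next
    fix x assume "poly f x = 0"
    then obtain J where j: "J \<in> set (filter (\<lambda>L. L$2 = 0) ?Ks)" "poly [:J$3, J$1:] x = 0"
      unfolding f_def poly_prod_list_map using prod_list_map_zero by blast
    have J: "J \<in> set ?Ks" "J$2 = 0" using j(1) by (simp_all only: set_filter mem_Collect_eq)
    have J3: "J$3 + x * J$1 = 0" using j(2) by simp
    have "J$1 \<noteq> 0" using J0[OF J(1)] J(2) J3 by (auto simp: vec3_eq_iff)
    then have "A x y 1 = 0" for y using inv[OF J(1), of x y 1] J(2) J3 by (simp add: dot_def algebra_simps)
    moreover have "A x 0 1 = x * (a 7 + a 4 * x)" "A x 1 1 = x * ((a 7 + a 4 * x) + (a 5 + a 1 * x))"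
      by (simp_all add: A_def algebra_simps)
    ultimately show "x = 0 \<or> a 7 + a 4 * x = 0 \<and> a 5 + a 1 * x = 0" by (metis add_0 mult_eq_0_iff)
  next
    fix y assume "poly g y = 0"
    then have "(\<Prod>L\<leftarrow>filter (\<lambda>L. L$2 \<noteq> 0) ?Ks. poly [:L$3, L$2:] y) = 0"
      using k(1) unfolding g_def poly_smult poly_prod_list_map by (simp only: mult_eq_0_iff) simp
    then obtain J where j: "J \<in> set (filter (\<lambda>L. L$2 \<noteq> 0) ?Ks)" "poly [:J$3, J$2:] y = 0"
      using prod_list_map_zero by blast
    have J: "J \<in> set ?Ks" "J$2 \<noteq> 0" using j(1) unfolding set_filter mem_Collect_eq by blast+
    have J3: "J$3 + y * J$2 = 0" using j(2) by simp
    have "J$1 = 0" using J12[OF J(1)] J(2) by simp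
    then have "B x y 1 = 0" for x using inv[OF J(1), of x y 1] J(2) J3 by (simp add: dot_def algebra_simps)
    moreover have "B 0 y 1 = y * (b 8 + b 6 * y)" "B 1 y 1 = y * ((b 8 + b 6 * y) + (b 5 + b 2 * y))"
      by (simp_all add: B_def algebra_simps)
    ultimately show "y = 0 \<or> b 8 + b 6 * y = 0 \<and> b 5 + b 2 * y = 0" by (metis add_0 mult_eq_0_iff)
  next
    show "a 1 \<noteq> b 2" by (rule u3v3)
  next
    show "\<not> (b 8 = 0 \<and> b 6 = 0)"
      using nodiv[of ex1] by (auto simp: A_def B_def vec3_eq_iff)
  next
    show "\<not> (a 7 = 0 \<and> a 4 = 0)"
      using nodiv[of ex2] by (auto simp: A_def B_def vec3_eq_iff)
  next
    fix y assume h: "y \<noteq> 0" "a 7 + a 5 * y = 0" "a 4 + a 1 * y = 0" "b 8 + b 6 * y = 0" "b 5 + b 2 * y = 0"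
    have e: "A x (y * z) z = 0" "B x (y * z) z = 0" for x z
    proof -
      have "A x (y * z) z = x * z * (z * (a 7 + a 5 * y) + x * (a 4 + a 1 * y))" by (simp add: A_def algebra_simps power2_eq_square)
      then show "A x (y * z) z = 0" using h by simp
      have "B x (y * z) z = y * z * z * (z * (b 8 + b 6 * y) + x * (b 5 + b 2 * y))" by (simp add: B_def algebra_simps power2_eq_square)
      then show "B x (y * z) z = 0" using h by simp
    qed
    show False
    proof (rule nodiv[of "vector [0, 1, - y]"])
      fix x y' z assume "dot (vector [0, 1, - y]) (vector [x, y', z]) = 0"
      then have "y' = y * z" by (simp add: dot_def)
      then show "A x y' z * z = 0 \<and> B x y' z * z = 0 \<and> A x y' z * y' = B x y' z * x" using e by simp
    qed (simp add: vec3_eq_iff)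
  next
    fix x assume h: "x \<noteq> 0" "a 7 + a 4 * x = 0" "a 5 + a 1 * x = 0" "b 8 + b 5 * x = 0" "b 6 + b 2 * x = 0"
    have e: "A (x * z) y z = 0" "B (x * z) y z = 0" for y z
    proof -
      have "A (x * z) y z = x * z * z * (z * (a 7 + a 4 * x) + y * (a 5 + a 1 * x))" by (simp add: A_def algebra_simps power2_eq_square)
      then show "A (x * z) y z = 0" using h by simp
      have "B (x * z) y z = y * z * (z * (b 8 + b 5 * x) + y * (b 6 + b 2 * x))" by (simp add: B_def algebra_simps power2_eq_square)
      then show "B (x * z) y z = 0" using h by simp
    qed
    show False
    proof (rule nodiv[of "vector [1, 0, - x]"])
      fix x' y z assume "dot (vector [1, 0, - x]) (vector [x', y, z]) = 0"
      then have "x' = x * z" by (simp add: dot_def)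
      then show "A x' y z * z = 0 \<and> B x' y z * z = 0 \<and> A x' y z * y = B x' y z * x'" using e by simp
    qed (simp add: vec3_eq_iff)
  qed
  then show False by (rule bilinear_field.contradiction)
qed

lemma parallel_dot:
  assumes "ccross K L = 0" "L \<noteq> 0" "dot L s = 0" shows "dot K s = 0"
proof -
  have e: "L$1 * dot K s = K$1 * dot L s" "L$2 * dot K s = K$2 * dot L s" "L$3 * dot K s = K$3 * dot L s"
    using assms(1) unfolding vec3_eq_iff ccross_nth zero_index dot_def by algebra+
  then show ?thesis using assms(2,3) by (auto simp: vec3_eq_iff)
qed

lemma intersection_unique:
  assumes "ccross K L \<noteq> 0" "dot K p = 0" "dot L p = 0" "dot K q = 0" "dot L q = 0" "q \<noteq> 0"
  obtains c where "p = c *s q"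
proof -
  obtain M where M: "invertible M" "K v* M = ex1" "L v* M = ex2" "M *v ex3 = q" using adapt_two[OF assms(1,6,4,5)] by metis
  have "matrix_inv M *v p = (matrix_inv M *v p)$3 *s ex3"
    using dot_matrix_inv[OF M(1), of K p] dot_matrix_inv[OF M(1), of L p] assms(2,3) by (simp add: M(2,3) vec3_eq_iff)
  then have "M *v (matrix_inv M *v p) = (matrix_inv M *v p)$3 *s (M *v ex3)" by (metis vector_scalar_commute)
  then show ?thesis using that by (simp add: matrix_inv3[OF M(1)] M(4))
qed

text \<open>Otherwise each inflection line has a degenerate point by \<open>line_dichotomy\<close>.  Take such a point on one
  line, one on a line avoiding it, and one on a line avoiding the latter: \<open>two_degenerate\<close> forces incidences
  that make the last two points equal, a contradiction.\<close>

theorem exists_radial_two: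
  assumes cf: "convex_field Z Ls" and nc: "\<And>p. p \<noteq> 0 \<Longrightarrow> \<exists>K\<in>set Ls. dot K p \<noteq> 0"
  shows "\<exists>Y Ks. convex_field Y Ks \<and> ex2 \<in> set Ks \<and> radial_two Y \<and> (\<forall>W. field_equiv Y W \<longrightarrow> field_equiv Z W)"
proof (rule ccontr)
  assume no: "\<not> ?thesis"
  have deg: "\<exists>p. dot L p = 0 \<and> degenerate_at Z p" if "L \<in> set Ls" for L using line_dichotomy[OF cf that nc] no by blast
  have nz: "p \<noteq> 0" if "degenerate_at Z p" for p using that by (simp add: degenerate_at_def)
  obtain L0 where L0: "L0 \<in> set Ls" using convex_field_length[OF cf] by (cases Ls) auto
  obtain s where s: "dot L0 s = 0" "degenerate_at Z s" using deg[OF L0] by blast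
  obtain K where K: "K \<in> set Ls" "dot K s \<noteq> 0" using nc[OF nz[OF s(2)]] by blast
  obtain s' where s': "dot K s' = 0" "degenerate_at Z s'" using deg[OF K(1)] by blast
  have 1: "dot L0 s' = 0" using two_degenerate[OF cf K(1) L0 s(2) s'(2) K(2) s'(1) s(1)] by blast
  obtain L where L: "L \<in> set Ls" "dot L s' \<noteq> 0" using nc[OF nz[OF s'(2)]] by blast
  have 2: "dot L s \<noteq> 0" using two_degenerate[OF cf K(1) L(1) s(2) s'(2) K(2) s'(1) _ L(2)] by blast
  obtain s'' where s'': "dot L s'' = 0" "degenerate_at Z s''" using deg[OF L(1)] by blast
  have 3: "dot K s'' = 0" using two_degenerate[OF cf L(1) K(1) s'(2) s''(2) L(2) s''(1) s'(1)] by blast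
  have 4: "dot L0 s'' = 0" using two_degenerate[OF cf L(1) L0 s(2) s''(2) 2 s''(1) s(1)] by blast
  have "ccross K L0 \<noteq> 0" using parallel_dot convex_fieldD(2)[OF cf L0] s(1) K(2) by blast
  then obtain r where "s' = r *s s''" using intersection_unique[OF _ s'(1) 1 3 4 nz[OF s''(2)]] by blast
  then show False using L(2) s''(1) by simp
qed

section \<open>Normal form at a radial point of order two\<close>

definition quartic where "quartic p1 p2 p3 p4 x y = p1 * x^3 * y + p2 * x^2 * y^2 + p3 * x * y^3 + (p4 :: complex) * y^4"

text \<open>Vieta's formulas for a quintic without term of degree four.\<close>

lemma quintic_roots:
  assumes "\<And>z. 3 * z^5 + 4 * w1 * z^3 + 3 * w0 * z^2 + h * z + k = 3 * ((z - l1) * (z - l2) * (z - l3) * (z - l4) * (z - l5 :: complex))"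
  shows "l5 = - (l1 + l2 + l3 + l4)"
    "4 * w1 = 3 * (l1*l2+l1*l3+l1*l4+l1*l5+l2*l3+l2*l4+l2*l5+l3*l4+l3*l5+l4*l5)"
    "w0 = - (l1*l2*l3+l1*l2*l4+l1*l2*l5+l1*l3*l4+l1*l3*l5+l1*l4*l5+l2*l3*l4+l2*l3*l5+l2*l4*l5+l3*l4*l5)"
    "h = 3 * (l1*l2*l3*l4+l1*l2*l3*l5+l1*l2*l4*l5+l1*l3*l4*l5+l2*l3*l4*l5)"
    "k = - 3 * (l1*l2*l3*l4*l5)"
proof -
  let ?R = "[:3:] * ([:- l1, 1:] * [:- l2, 1:] * [:- l3, 1:] * [:- l4, 1:] * [:- l5, 1:])"
  have pf: "poly [:- a, 1:] z = z - a" "poly [:a:] z = a" for a z :: complex by simp_all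
  have "poly [:k, h, 3 * w0, 4 * w1, 0, 3:] z = 3 * z^5 + 4 * w1 * z^3 + 3 * w0 * z^2 + h * z + k" for z
    by (simp add: algebra_simps eval_nat_numeral)
  then have "poly [:k, h, 3 * w0, 4 * w1, 0, 3:] z = poly ?R z" for z
    unfolding poly_mult pf assms by simp
  then have "poly [:k, h, 3 * w0, 4 * w1, 0, 3:] = poly ?R" by (rule ext)
  then have e: "[:k, h, 3 * w0, 4 * w1, 0, 3:] = ?R" by (simp only: poly_eq_poly_eq_iff)
  have c: "0 = - 3 * (l1 + l2 + l3 + l4 + l5)"
    "4 * w1 = 3 * (l1*l2+l1*l3+l1*l4+l1*l5+l2*l3+l2*l4+l2*l5+l3*l4+l3*l5+l4*l5)"
    "3 * w0 = - 3 * (l1*l2*l3+l1*l2*l4+l1*l2*l5+l1*l3*l4+l1*l3*l5+l1*l4*l5+l2*l3*l4+l2*l3*l5+l2*l4*l5+l3*l4*l5)"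
    "h = 3 * (l1*l2*l3*l4+l1*l2*l3*l5+l1*l2*l4*l5+l1*l3*l4*l5+l2*l3*l4*l5)"
    "k = - 3 * (l1*l2*l3*l4*l5)"
    using arg_cong[OF e, of "\<lambda>p. coeff p 4"] arg_cong[OF e, of "\<lambda>p. coeff p 3"] arg_cong[OF e, of "\<lambda>p. coeff p 2"]
      arg_cong[OF e, of "\<lambda>p. coeff p 1"] arg_cong[OF e, of "\<lambda>p. coeff p 0"]
    by (simp_all add: eval_nat_numeral algebra_simps)
  show "l5 = - (l1 + l2 + l3 + l4)" using c(1) by algebra
  show "w0 = - (l1*l2*l3+l1*l2*l4+l1*l2*l5+l1*l3*l4+l1*l3*l5+l1*l4*l5+l2*l3*l4+l2*l3*l5+l2*l4*l5+l3*l4*l5)"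
    using c(3) by algebra
  show "4 * w1 = 3 * (l1*l2+l1*l3+l1*l4+l1*l5+l2*l3+l2*l4+l2*l5+l3*l4+l3*l5+l4*l5)"
    "h = 3 * (l1*l2*l3*l4+l1*l2*l3*l5+l1*l2*l4*l5+l1*l3*l4*l5+l2*l3*l4*l5)" "k = - 3 * (l1*l2*l3*l4*l5)" by (fact c)+
qed

text \<open>Normal form at a radial point of order two: \<open>A\<close> and the radial multiple are absorbed by the Hamiltonian
  field of the quartic \<open>P\<close>, and a shear removes the term in \<open>z\<^sup>2\<close> of the last component.  The quartic has no
  term in \<open>x\<^sup>4\<close>, as \<open>y = 0\<close> is invariant.\<close>

locale radial_normal =
  fixes Z :: "complex^3 \<Rightarrow> complex^3" and Ls :: "(complex^3) list"
    and p1 p2 p3 p4 u0 u1 u2 v0 v1 v2 v3 :: complex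
  assumes cf: "convex_field Z Ls"
    and Z: "\<And>x y z. Z (vector [x, y, z]) =
      vector [- bq3 p1 (2 * p2) (3 * p3) (4 * p4) x y, bq3 0 (3 * p1) (2 * p2) p3 x y,
        z^3 + z * bq2 u0 u1 u2 x y + bq3 v0 v1 v2 v3 x y]"
begin

abbreviation "P \<equiv> quartic p1 p2 p3 p4"
abbreviation "Px \<equiv> bq3 0 (3 * p1) (2 * p2) p3"
abbreviation "Py \<equiv> bq3 p1 (2 * p2) (3 * p3) (4 * p4)"
abbreviation "Pxx \<equiv> bq2 0 (6 * p1) (2 * p2)"
abbreviation "Pxy \<equiv> bq2 (3 * p1) (4 * p2) (3 * p3)"
abbreviation "Pyy \<equiv> bq2 (2 * p2) (6 * p3) (12 * p4)"
abbreviation "W1 \<equiv> bq2 u0 u1 u2"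
abbreviation "W0 \<equiv> bq3 v0 v1 v2 v3"
definition "B1 x y = bq1 u1 (2 * u2) x y * Px x y - bq1 (2 * u0) u1 x y * Py x y"
definition "B0 x y = bq2 v1 (2 * v2) (3 * v3) x y * Px x y - bq2 (3 * v0) (2 * v1) v2 x y * Py x y"
definition "lin_coeff x y = W1 x y ^ 2 + B1 x y + (Pxx x y * Pyy x y - Pxy x y ^ 2) / 3"

definition "Q x y z = 3 * z^5 + 4 * W1 x y * z^3 + 3 * W0 x y * z^2 + lin_coeff x y * z + (B0 x y + W0 x y * W1 x y)"

lemma euler: "Px x y = (x * Pxx x y + y * Pxy x y) / 3" "Py x y = (x * Pxy x y + y * Pyy x y) / 3"
  "P x y = (x^2 * Pxx x y + 2 * x * y * Pxy x y + y^2 * Pyy x y) / 12"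
  by (simp_all add: quartic_def bq_defs field_simps eval_nat_numeral)

text \<open>By Euler's relation, the terms of the determinant that come from the Hamiltonian field
  alone add up to a third of the Hessian of \<open>P\<close>, times \<open>4 P z\<close>.\<close>

lemma infl_normal: "infl Z (vector [x, y, z]) = 4 * P x y * Q x y z"
proof -
  have dA: "((\<lambda>t. - Py (x+t*u) (y+t * v)) has_field_derivative (- Pxy x y * u + (- Pyy x y) * v + 0 * w)) (at 0)" for x y z u v w :: complex
    unfolding bq_defs by (auto intro!: derivative_eq_intros simp: algebra_simps power2_eq_square)
  have dB: "((\<lambda>t. Px (x+t*u) (y+t * v)) has_field_derivative (Pxx x y * u + Pxy x y * v + 0 * w)) (at 0)" for x y z u v w :: complex
    unfolding bq_defs by (auto intro!: derivative_eq_intros simp: algebra_simps power2_eq_square)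
  have dC: "((\<lambda>t. (z+t*w)^3 + (z+t*w) * W1 (x+t*u) (y+t * v) + W0 (x+t*u) (y+t * v)) has_field_derivative
      ((z * bq1 (2 * u0) u1 x y + bq2 (3 * v0) (2 * v1) v2 x y) * u + (z * bq1 u1 (2 * u2) x y + bq2 v1 (2 * v2) (3 * v3) x y) * v
         + (3 * z^2 + W1 x y) * w)) (at 0)" for x y z u v w
    unfolding bq_defs by (auto intro!: derivative_eq_intros simp: algebra_simps power2_eq_square)
  have *: "x * (b * c' - c * b') + y * (c * a' - a * c') + z * (a * b' - b * a') = 4 * q * (c' + z * (xx * yy - xy^2) / 3)"
    if "b = (x * xx + y * xy) / 3" "a = - ((x * xy + y * yy) / 3)" "q = (x^2 * xx + 2 * x * y * xy + y^2 * yy) / 12"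
      "a' = - xy * a + (- yy) * b + 0 * c" "b' = xx * a + xy * b + 0 * c"
    for a b c a' b' c' xx xy yy q :: complex
    unfolding that by (simp add: field_simps power2_eq_square)
  have mPy: "- Py x y = - ((x * Pxy x y + y * Pyy x y) / 3)" by (simp only: euler(2))
  have eQ: "((z * bq1 (2 * u0) u1 x y + bq2 (3 * v0) (2 * v1) v2 x y) * - Py x y + (z * bq1 u1 (2 * u2) x y + bq2 v1 (2 * v2) (3 * v3) x y) * Px x y
         + (3 * z^2 + W1 x y) * (z^3 + z * W1 x y + W0 x y)) + z * (Pxx x y * Pyy x y - Pxy x y ^ 2) / 3 = Q x y z"
    unfolding Q_def lin_coeff_def B1_def B0_def by (simp add: algebra_simps eval_nat_numeral)
  show ?thesis
    unfolding infl_cubic[OF Z dA dB dC] Let_def *[OF euler(1) mPy euler(3) refl refl] eQ ..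
qed

lemma P_nonzero: "\<exists>x y. P x y \<noteq> 0"
proof -
  obtain k where k: "k \<noteq> 0" "\<And>p. infl Z p = k * (\<Prod>L\<leftarrow>Ls. dot L p)" using convex_fieldD(5)[OF cf] by blast
  obtain p where "(\<Prod>L\<leftarrow>Ls. dot L p) \<noteq> 0" using prod_list_dot_nonzero convex_fieldD(2)[OF cf] by blast
  then have "infl Z (vector [p$1, p$2, p$3]) \<noteq> 0" using k by (simp add: vec3_collapse)
  then show ?thesis unfolding infl_normal by auto
qed

lemma P_generic:
  assumes "\<And>x y. P x y \<noteq> 0 \<Longrightarrow> f x y = g x y"
    "poly_on_lines (\<lambda>p. f (p$1) (p$2))" "poly_on_lines (\<lambda>p. g (p$1) (p$2))"
  shows "f x y = g x y"
proof -
  have "(\<forall>x y. P x y = 0) \<or> (\<forall>x y. f x y - g x y = 0)"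
    by (rule bq_domain) (use assms in \<open>auto simp: quartic_def intro!: pol_intros\<close>)
  then show ?thesis using P_nonzero by auto
qed

text \<open>Invariance of the line \<open>z = a x + b y\<close>.\<close>

definition invariant_form :: "complex \<Rightarrow> complex \<Rightarrow> bool" where
  "invariant_form a b \<longleftrightarrow> (\<forall>x y. bq1 a b x y ^ 3 + W1 x y * bq1 a b x y + W0 x y = b * Px x y - a * Py x y)"

text \<open>Over a point with \<open>P \<noteq> 0\<close> the polynomial \<open>Q\<close> has degree five in \<open>z\<close>, which is the number of inflection
  lines that avoid \<open>(0, 0, 1)\<close>.  The leading coefficients show that the remaining lines account
  exactly for \<open>P\<close>.\<close>

lemma five_roots:
  obtains L where "length L = 5" "\<And>x y z. Q x y z = 3 * (\<Prod>(a, b)\<leftarrow>L. z - bq1 a b x y)"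
    "\<And>a b. (a, b) \<in> set L \<Longrightarrow> invariant_form a b"
proof -
  obtain k where k: "k \<noteq> 0" "\<And>p. infl Z p = k * (\<Prod>L\<leftarrow>Ls. dot L p)" using convex_fieldD(5)[OF cf] by blast
  define G where "G = filter (\<lambda>K. K$3 \<noteq> 0) Ls"
  define R where "R x y = k * (\<Prod>K\<leftarrow>filter (\<lambda>K. \<not> K$3 \<noteq> 0) Ls. dot K (vector [x, y, 0]))" for x y
  have eq: "4 * P x y * Q x y z = R x y * (\<Prod>K\<leftarrow>G. dot K (vector [x, y, z]))" for x y z
  proof -
    have "(\<Prod>K\<leftarrow>filter (\<lambda>K. \<not> K$3 \<noteq> 0) Ls. dot K (vector [x, y, z])) = (\<Prod>K\<leftarrow>filter (\<lambda>K. \<not> K$3 \<noteq> 0) Ls. dot K (vector [x, y, 0]))"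
      by (rule arg_cong[of _ _ prod_list], rule map_cong) (auto simp: dot_def)
    then show ?thesis
      using prod_list_filter_split[of "\<lambda>K. dot K (vector [x, y, z])" Ls "\<lambda>K. K$3 \<noteq> 0"] k(2)[of "vector [x, y, z]"]
      unfolding infl_normal R_def G_def by simp
  qed
  define q where "q x y = [:4 * P x y:] * [:B0 x y + W0 x y * W1 x y, lin_coeff x y, 3 * W0 x y, 4 * W1 x y, 0, 3:]" for x y
  have q: "poly (q x y) z = 4 * P x y * Q x y z" for x y z
    by (simp add: q_def Q_def algebra_simps eval_nat_numeral)
  obtain x y where xy: "P x y \<noteq> 0" using P_nonzero by blast
  have "degree (q x y) = length G" unfolding G_def
    by (rule prod_lines_degree[where k=k and x=x and y=y]) (use xy q k(2) infl_normal in \<open>auto simp: q_def\<close>)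
  then have "length G = 5" using xy by (simp add: q_def)
  then obtain K1 K2 K3 K4 K5 where G5: "G = [K1, K2, K3, K4, K5]"
    by (auto simp: length_Suc_conv numeral_eq_Suc)
  have G: "K$3 \<noteq> 0" "K \<in> set Ls" if "K \<in> set G" for K using that by (auto simp: G_def)
  have K0: "K1$3 \<noteq> 0" "K2$3 \<noteq> 0" "K3$3 \<noteq> 0" "K4$3 \<noteq> 0" "K5$3 \<noteq> 0" using G by (auto simp: G5)
  define l where "l K = (- K$1 / K$3, - K$2 / K$3)" for K :: "complex^3"
  let ?l = "\<lambda>K x y. bq1 (- K$1 / K$3) (- K$2 / K$3) x y"
  have dl: "dot K (vector [x, y, z]) = K$3 * (z - ?l K x y)" if "K$3 \<noteq> 0" for K x y z
    using that by (simp add: dot_def bq1_def field_simps)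
  have Qeq: "Q x y z = 3 * (\<Prod>(a, b)\<leftarrow>map l G. z - bq1 a b x y)" for x y z
  proof (rule P_generic[where f="\<lambda>x y. Q x y z" and g="\<lambda>x y. 3 * (\<Prod>(a, b)\<leftarrow>map l G. z - bq1 a b x y)"])
    fix x y assume P: "P x y \<noteq> 0"
    define r where "r = R x y * (K1$3 * K2$3 * K3$3 * K4$3 * K5$3)"
    have F: "4 * P x y * Q x y z = r * ((z - ?l K1 x y) * (z - ?l K2 x y) * (z - ?l K3 x y) * (z - ?l K4 x y) * (z - ?l K5 x y))" for z
      unfolding eq G5 r_def using K0 by (simp add: dl mult_ac)
    have pf: "poly [:- a, 1:] z = z - a" "poly [:a:] z = a" for a z :: complex by simp_all
    let ?R = "[:r:] * ([:- ?l K1 x y, 1:] * [:- ?l K2 x y, 1:] * [:- ?l K3 x y, 1:] * [:- ?l K4 x y, 1:] * [:- ?l K5 x y, 1:])"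
    have "poly (q x y) z = poly ?R z" for z
      unfolding q F poly_mult pf ..
    then have "poly (q x y) = poly ?R" by (rule ext)
    then have e: "q x y = ?R" by (simp only: poly_eq_poly_eq_iff)
    from arg_cong[OF e, of "\<lambda>p. coeff p 5"] have r12: "r = 12 * P x y" by (simp add: q_def eval_nat_numeral)
    have "4 * P x y * Q x y z = 12 * P x y * (\<Prod>(a, b)\<leftarrow>map l G. z - bq1 a b x y)"
      unfolding F r12 by (simp add: G5 l_def mult_ac)
    then show "Q x y z = 3 * (\<Prod>(a, b)\<leftarrow>map l G. z - bq1 a b x y)" using P by simp
  next
    show "poly_on_lines (\<lambda>p. Q (p$1) (p$2) z)"
      unfolding Q_def lin_coeff_def B1_def B0_def bq_defs divide_complex_def by (intro pol_intros)
    show "poly_on_lines (\<lambda>p. 3 * (\<Prod>(a, b)\<leftarrow>map l G. z - bq1 a b (p$1) (p$2)))"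
      unfolding G5 list.map prod_list.Cons prod_list.Nil bq1_def l_def prod.case by (intro pol_intros)
  qed
  have inv: "invariant_form (- K$1 / K$3) (- K$2 / K$3)" if "K \<in> set G" for K
    unfolding invariant_form_def
  proof (intro allI)
    fix x y
    let ?z = "?l K x y"
    have "dot K (vector [x, y, ?z]) = 0" using dl[OF G(1)[OF that], of x y ?z] by simp
    from convex_fieldD(3)[OF cf G(2)[OF that] this] G(1)[OF that]
    show "?z ^ 3 + W1 x y * ?z + W0 x y = - K$2 / K$3 * Px x y - - K$1 / K$3 * Py x y"
      unfolding Z by (simp add: dot_def field_simps)
  qed
  show ?thesis
    by (rule that[of "map l G"]) (use Qeq \<open>length G = 5\<close> inv in \<open>auto simp: l_def\<close>)
qed

text \<open>The sum of the five invariance relations is \<open>p\<^sub>3 + 5 w\<^sub>0 = 0\<close>, where \<open>p\<^sub>3\<close> is the sum of the cubes of the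
  roots, because the sum of the roots is zero.  On the other hand \<open>p\<^sub>3 = 3 e\<^sub>3 = - 3 w\<^sub>0\<close>.  Hence
  \<open>w\<^sub>0 = 0\<close>, the constant term of \<open>Q\<close> vanishes and with it one of the roots.\<close>

lemma four_roots:
  obtains a1 b1 a2 b2 a3 b3 a4 b4 where
    "\<And>x y z. Q x y z = 3 * ((z - bq1 a1 b1 x y) * (z - bq1 a2 b2 x y) * (z - bq1 a3 b3 x y) * (z - bq1 a4 b4 x y) * (z - 0))"
    "invariant_form a1 b1" "invariant_form a2 b2" "invariant_form a3 b3" "invariant_form a4 b4"
    "v0 = 0" "v1 = 0" "v2 = 0" "v3 = 0"
proof -
  obtain L where L: "length L = 5" and Q: "\<And>x y z. Q x y z = 3 * (\<Prod>(a, b)\<leftarrow>L. z - bq1 a b x y)"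
    and inv: "\<And>a b. (a, b) \<in> set L \<Longrightarrow> invariant_form a b" using five_roots by metis
  obtain q1 q2 q3 q4 q5 where "L = [q1, q2, q3, q4, q5]" using L by (auto simp: length_Suc_conv numeral_eq_Suc)
  then obtain a1 b1 a2 b2 a3 b3 a4 b4 a5 b5 where L5: "L = [(a1, b1), (a2, b2), (a3, b3), (a4, b4), (a5, b5)]"
    by (metis surj_pair)
  have Q5: "3 * z^5 + 4 * W1 x y * z^3 + 3 * W0 x y * z^2 + lin_coeff x y * z + (B0 x y + W0 x y * W1 x y)
      = 3 * ((z - bq1 a1 b1 x y) * (z - bq1 a2 b2 x y) * (z - bq1 a3 b3 x y) * (z - bq1 a4 b4 x y) * (z - bq1 a5 b5 x y))" for x y z
    using Q[of x y z] unfolding Q_def by (simp add: L5 mult_ac)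
  note r = quintic_roots[OF Q5]
  have ab: "a5 = - (a1 + a2 + a3 + a4)" "b5 = - (b1 + b2 + b3 + b4)"
    using r(1)[of 1 0] r(1)[of 0 1] by (simp_all add: bq1_def)
  have W0: "W0 x y = 0" for x y
  proof -
    have i: "bq1 a b x y ^ 3 + W1 x y * bq1 a b x y + W0 x y = b * Px x y - a * Py x y" if "(a, b) \<in> set L" for a b
      using inv[OF that] unfolding invariant_form_def by blast
    have "2 * w0 = 0" if "l1^3 + w1 * l1 + w0 = b1 * px - a1 * py" "l2^3 + w1 * l2 + w0 = b2 * px - a2 * py"
      "l3^3 + w1 * l3 + w0 = b3 * px - a3 * py" "l4^3 + w1 * l4 + w0 = b4 * px - a4 * py"
      "l5^3 + w1 * l5 + w0 = b5 * px - a5 * py"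
      "w0 = - (l1*l2*l3+l1*l2*l4+l1*l2*l5+l1*l3*l4+l1*l3*l5+l1*l4*l5+l2*l3*l4+l2*l3*l5+l2*l4*l5+l3*l4*l5)"
      "l5 = - (l1 + l2 + l3 + l4)" for l1 l2 l3 l4 l5 w0 w1 px py
    proof -
      have "(l1^3 + w1 * l1 + w0) + (l2^3 + w1 * l2 + w0) + (l3^3 + w1 * l3 + w0) + (l4^3 + w1 * l4 + w0) + (l5^3 + w1 * l5 + w0) = 0"
        unfolding that(1-5) ab by (simp add: algebra_simps)
      then have "l1^3 + l2^3 + l3^3 + l4^3 + l5^3 + 5 * w0 = 0" unfolding that(7) by (simp add: algebra_simps)
      moreover have "l1^3 + l2^3 + l3^3 + l4^3 + l5^3 = - 3 * w0" unfolding that(6,7) by (simp add: algebra_simps power3_eq_cube)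
      ultimately show ?thesis by algebra
    qed
    from this[OF i i i i i r(3) r(1)] show ?thesis by (simp add: L5)
  qed
  have v: "v0 = 0" "v1 = 0" "v2 = 0" "v3 = 0" using bq_all_0(3)[of v0 v1 v2 v3] W0 by blast+
  have "(0, 0) \<in> set L"
  proof (rule ccontr)
    assume n: "(0, 0) \<notin> set L"
    let ?Ks = "map (\<lambda>(a, b). vector [a, b, 0] :: complex^3) L"
    have "\<forall>K\<in>set ?Ks. K \<noteq> 0" using n by (auto simp: vec3_eq_iff)
    then obtain p where p: "(\<Prod>K\<leftarrow>?Ks. dot K p) \<noteq> 0" using prod_list_dot_nonzero by blast
    have "B0 (p$1) (p$2) = 0" unfolding B0_def by (simp add: v bq_defs)
    then have "(bq1 a1 b1 (p$1) (p$2) * bq1 a2 b2 (p$1) (p$2) * bq1 a3 b3 (p$1) (p$2) * bq1 a4 b4 (p$1) (p$2) * bq1 a5 b5 (p$1) (p$2)) = 0"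
      using r(5)[of "p$1" "p$2"] W0 by simp
    then show False using p by (auto simp: L5 dot_def bq1_def)
  qed
  define L' where "L' = remove1 (0, 0) L"
  have "length L' = 4" using \<open>(0, 0) \<in> set L\<close> L by (simp add: L'_def length_remove1)
  then obtain q1 q2 q3 q4 where "L' = [q1, q2, q3, q4]" by (auto simp: length_Suc_conv numeral_eq_Suc)
  then obtain c1 d1 c2 d2 c3 d3 c4 d4 where L4: "L' = [(c1, d1), (c2, d2), (c3, d3), (c4, d4)]"
    by (metis surj_pair)
  have Qf: "Q x y z = 3 * ((z - bq1 c1 d1 x y) * (z - bq1 c2 d2 x y) * (z - bq1 c3 d3 x y) * (z - bq1 c4 d4 x y) * (z - 0))" for x y z
    using prod_list_remove1[OF \<open>(0, 0) \<in> set L\<close>, of "\<lambda>(a, b). z - bq1 a b x y"]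
    unfolding Q L'_def[symmetric] L4 by (simp add: bq1_def)
  have invf: "invariant_form a b" if "(a, b) \<in> set L'" for a b
    using inv that unfolding L'_def by (meson notin_set_remove1)
  show ?thesis by (rule that[OF Qf invf invf invf invf v]) (simp_all add: L4)
qed

text \<open>Four forms with \<open>e\<^sub>1 = e\<^sub>3 = 0\<close> satisfy \<open>(l\<^sub>1 + l\<^sub>2) (l\<^sub>1 + l\<^sub>3) (l\<^sub>2 + l\<^sub>3) = 0\<close>, so they are two pairs of
  opposite forms.\<close>

lemma two_forms:
  obtains a b c d where "invariant_form a b" "invariant_form c d"
    "\<And>x y. W1 x y = - 3 / 4 * (bq1 a b x y ^ 2 + bq1 c d x y ^ 2)" "\<And>x y. W0 x y = 0"
    "\<And>x y. lin_coeff x y = 3 * bq1 a b x y ^ 2 * bq1 c d x y ^ 2"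
proof -
  obtain a1 b1 a2 b2 a3 b3 a4 b4 where
    Q: "\<And>x y z. Q x y z = 3 * ((z - bq1 a1 b1 x y) * (z - bq1 a2 b2 x y) * (z - bq1 a3 b3 x y) * (z - bq1 a4 b4 x y) * (z - 0))"
    and inv: "invariant_form a1 b1" "invariant_form a2 b2" "invariant_form a3 b3" "invariant_form a4 b4"
    and v: "v0 = 0" "v1 = 0" "v2 = 0" "v3 = 0" using four_roots by metis
  have W0: "W0 x y = 0" for x y by (simp add: v bq_defs)
  note r = quintic_roots[OF Q[unfolded Q_def]]
  have s4: "bq1 a4 b4 x y = - (bq1 a1 b1 x y + bq1 a2 b2 x y + bq1 a3 b3 x y)" for x y
    using r(1)[of x y] by (simp add: algebra_simps eq_neg_iff_add_eq_0)
  have "(bq1 a1 b1 x y + bq1 a2 b2 x y) * ((bq1 a1 b1 x y + bq1 a3 b3 x y) * (bq1 a2 b2 x y + bq1 a3 b3 x y)) = 0" for x y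
    using r(3)[of x y] unfolding W0 s4 by (simp add: algebra_simps)
  then have "(\<forall>x y. bq1 a1 b1 x y + bq1 a2 b2 x y = 0) \<or> (\<forall>x y. (bq1 a1 b1 x y + bq1 a3 b3 x y) * (bq1 a2 b2 x y + bq1 a3 b3 x y) = 0)"
    by (rule bq_domain) (auto simp: bq1_def intro!: pol_intros)
  moreover have "(\<forall>x y. bq1 a1 b1 x y + bq1 a3 b3 x y = 0) \<or> (\<forall>x y. bq1 a2 b2 x y + bq1 a3 b3 x y = 0)"
    if "\<forall>x y. (bq1 a1 b1 x y + bq1 a3 b3 x y) * (bq1 a2 b2 x y + bq1 a3 b3 x y) = 0"
    by (rule bq_domain[OF that[rule_format]]) (auto simp: bq1_def intro!: pol_intros)
  ultimately have split: "(\<forall>x y. bq1 a1 b1 x y + bq1 a2 b2 x y = 0) \<or> (\<forall>x y. bq1 a1 b1 x y + bq1 a3 b3 x y = 0) \<or> (\<forall>x y. bq1 a2 b2 x y + bq1 a3 b3 x y = 0)"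
    by blast
  have id: "4 * w1 = - 3 * (l^2 + m^2) \<and> h = 3 * l^2 * m^2"
    if "4 * w1 = 3 * (l1*l2+l1*l3+l1*l4+l1*0+l2*l3+l2*l4+l2*0+l3*l4+l3*0+l4*0)"
      "h = 3 * (l1*l2*l3*l4+l1*l2*l3*0+l1*l2*l4*0+l1*l3*l4*0+l2*l3*l4*0)" "l4 = - (l1 + l2 + l3)"
      "l2 = - l1 \<and> l = l1 \<and> m = l3 \<or> l3 = - l1 \<and> l = l1 \<and> m = l2 \<or> l3 = - l2 \<and> l = l2 \<and> m = l1" for w1 h l1 l2 l3 l4 l m :: complex
    using that(4) unfolding that(1-3) by (auto simp: algebra_simps power2_eq_square)
  define good where "good a b c d \<longleftrightarrow> invariant_form a b \<and> invariant_form c d \<and>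
     (\<forall>x y. bq1 a2 b2 x y = - bq1 a1 b1 x y \<and> bq1 a b x y = bq1 a1 b1 x y \<and> bq1 c d x y = bq1 a3 b3 x y
       \<or> bq1 a3 b3 x y = - bq1 a1 b1 x y \<and> bq1 a b x y = bq1 a1 b1 x y \<and> bq1 c d x y = bq1 a2 b2 x y
       \<or> bq1 a3 b3 x y = - bq1 a2 b2 x y \<and> bq1 a b x y = bq1 a2 b2 x y \<and> bq1 c d x y = bq1 a1 b1 x y)" for a b c d
  have n: "v = - u" if "u + v = 0" for u v :: complex using that by (metis add_eq_0_iff)
  have "good a1 b1 a3 b3 \<or> good a1 b1 a2 b2 \<or> good a2 b2 a1 b1"
    using split inv n unfolding good_def by blast
  then obtain a b c d where g: "good a b c d" by blast
  have e: "4 * W1 x y = - 3 * (bq1 a b x y ^ 2 + bq1 c d x y ^ 2) \<and> lin_coeff x y = 3 * bq1 a b x y ^ 2 * bq1 c d x y ^ 2" for x y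
    by (rule id[OF r(2) r(4) s4]) (use g in \<open>simp add: good_def\<close>)
  show ?thesis
    by (rule that[of a b c d]) (use g W0 e in \<open>auto simp: good_def field_simps\<close>)
qed

lemma fixed_forms:
  assumes "\<And>x y. W0 x y = 0" "\<And>x y. W1 x y = - 3 / 4 * (bq1 a b x y ^ 2 + bq1 c d x y ^ 2)"
  shows "Z p $ 3 = ((p :: complex^3)$3)^3 - 3 / 4 * (bq1 a b (p$1) (p$2) ^ 2 + bq1 c d (p$1) (p$2) ^ 2) * p$3"
    "Z p $ 1 = - Py (p$1) (p$2)" "Z p $ 2 = Px (p$1) (p$2)"
  using Z[of "p$1" "p$2" "p$3"] unfolding assms vec3_collapse by simp_all

text \<open>In the coordinates \<open>l, m, z\<close> the field is \<open>(l\<^sup>3, m\<^sup>3, z\<^sup>3)\<close> minus \<open>3 (l\<^sup>2 + m\<^sup>2) / 4\<close> times the radial field.\<close>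

lemma independent_forms:
  assumes i: "invariant_form a b" "invariant_form c d" and W: "\<And>x y. W0 x y = 0" "\<And>x y. W1 x y = - 3 / 4 * (bq1 a b x y ^ 2 + bq1 c d x y ^ 2)"
    and det: "a * d - b * c \<noteq> 0"
  shows "field_equiv Z ZF3"
proof (rule field_equivI[where s=1 and g="\<lambda>p. - 3 / 4 * (bq1 a b (p$1) (p$2) ^ 2 + bq1 c d (p$1) (p$2) ^ 2)"])
  let ?N = "vector [vector [a, b, 0], vector [c, d, 0], ex3] :: complex^3^3"
  show "invertible ?N" using det by (simp add: invertible_det_nz det_3)
  fix p :: "complex^3"
  note f = fixed_forms[OF W, of p]
  have "b * Px (p$1) (p$2) - a * Py (p$1) (p$2) = bq1 a b (p$1) (p$2) ^ 3 + W1 (p$1) (p$2) * bq1 a b (p$1) (p$2)"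
    "d * Px (p$1) (p$2) - c * Py (p$1) (p$2) = bq1 c d (p$1) (p$2) ^ 3 + W1 (p$1) (p$2) * bq1 c d (p$1) (p$2)"
    using i unfolding invariant_form_def W(1) by simp_all
  then show "?N *v Z p = 1 *s ZF3 (?N *v p) + (- 3 / 4 * (bq1 a b (p$1) (p$2) ^ 2 + bq1 c d (p$1) (p$2) ^ 2)) *s (?N *v p)"
    unfolding W(2) by (simp add: vec3_eq_iff mv3_nth f ZF3_def bq1_def algebra_simps)
qed simp

text \<open>If \<open>P\<close> varies along the direction that fixes \<open>l\<close> at the rate \<open>s l\<^sup>3\<close>, then \<open>P = l\<^sup>3 n\<close> for a linear form \<open>n\<close>
  with \<open>l\<^sub>y n\<^sub>x - l\<^sub>x n\<^sub>y = s\<close>.\<close>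

lemma triple_root:
  assumes e: "\<And>x y. b * Px x y - a * Py x y = s * bq1 a b x y ^ 3" and ab: "(a, b) \<noteq> (0, 0)"
  obtains c d where "b * c - a * d = s" "\<And>x y. d * Px x y - c * Py x y = - 3 * s * bq1 a b x y ^ 2 * bq1 c d x y"
proof -
  note result = that
  have "bq3 (- a * p1 - s * a^3) (3 * b * p1 - 2 * a * p2 - 3 * s * a^2 * b) (2 * b * p2 - 3 * a * p3 - 3 * s * a * b^2) (b * p3 - 4 * a * p4 - s * b^3) x y = 0" for x y
    using e[of x y] by (simp add: bq_defs algebra_simps power2_eq_square power3_eq_cube)
  then have z: "- a * p1 - s * a^3 = 0" "3 * b * p1 - 2 * a * p2 - 3 * s * a^2 * b = 0" "2 * b * p2 - 3 * a * p3 - 3 * s * a * b^2 = 0" "b * p3 - 4 * a * p4 - s * b^3 = 0"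
    using bq_all_0(3) by blast+
  have *: thesis if pc: "a^3 * c = 0" "p1 = 3 * a^2 * b * c + a^3 * d" "p2 = 3 * a * b^2 * c + 3 * a^2 * b * d"
      "p3 = b^3 * c + 3 * a * b^2 * d" "p4 = b^3 * d" and s: "b * c - a * d = s" for c d
  proof (rule result)
    show "b * c - a * d = s" by fact
    fix x y
    have "bq1 d (- c) (Px x y) (Py x y) = bq1 d (- c) (bq3 (4 * (a^3 * c)) (3 * p1) (2 * p2) p3 x y) (Py x y)" unfolding pc(1) by simp
    also have "\<dots> = - 3 * s * bq1 a b x y ^ 2 * bq1 c d x y"
      unfolding pc(2-5) s[symmetric] by (simp add: bq_defs algebra_simps power2_eq_square power3_eq_cube)
    finally show "d * Px x y - c * Py x y = - 3 * s * bq1 a b x y ^ 2 * bq1 c d x y" by (simp add: bq1_def)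
  qed
  show thesis
  proof (cases "a = 0")
    case False
    define d where "d = - s / a"
    have s: "s = - (a * d)" using False by (simp add: d_def)
    have "a * (p1 - a^3 * d) = 0" using z(1) unfolding s by algebra
    then have 1: "p1 = a^3 * d" using False by simp
    have "a * (p2 - 3 * a^2 * b * d) = 0" using z(2) unfolding s 1 by algebra
    then have 2: "p2 = 3 * a^2 * b * d" using False by simp
    have "a * (p3 - 3 * a * b^2 * d) = 0" using z(3) unfolding s 2 by algebra
    then have 3: "p3 = 3 * a * b^2 * d" using False by simp
    have "a * (p4 - b^3 * d) = 0" using z(4) unfolding s 3 by algebra
    then have "p4 = b^3 * d" using False by simp
    then show thesis using *[of 0 d] 1 2 3 s by simp
  next
    case True
    then have b: "b \<noteq> 0" using ab by simp
    have "p1 = 0" "p2 = 0" using z b True by auto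
    moreover have "p3 = b^3 * (s / b)" "p4 = b^3 * (p4 / b^3)" using z(4) b True by (auto simp: field_simps power3_eq_cube)
    ultimately show thesis using *[of "s / b" "p4 / b^3"] b True by simp
  qed
qed

text \<open>Comparing the invariance relations for \<open>l\<close> and \<open>m = r l\<close> gives \<open>r = 0\<close> or \<open>r\<^sup>2 = 1\<close>.  In the coordinates
  \<open>l, n, z\<close> of \<open>triple_root\<close> the field becomes, modulo the radial field, \<open>(l\<^sup>3, 0, z\<^sup>3)\<close> in the first case and
  \<open>- 2 (l\<^sup>3, 0, (3 l\<^sup>2 z - z\<^sup>3) / 2)\<close> in the second one.  The latter is \<open>H3\<close> in the variables
  \<open>x = (l + z) / 2\<close>, \<open>y = (l - z) / 2\<close>, since \<open>x + y\<close> and \<open>x - y\<close> then have the derivatives \<open>l\<^sup>3\<close> and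
  \<open>(3 l\<^sup>2 z - z\<^sup>3) / 2\<close>.\<close>

lemma dependent_forms:
  assumes i: "invariant_form a b" "invariant_form c d" and W: "\<And>x y. W0 x y = 0" "\<And>x y. W1 x y = - 3 / 4 * (bq1 a b x y ^ 2 + bq1 c d x y ^ 2)"
    and ab: "(a, b) \<noteq> (0, 0)" and det: "a * d - b * c = 0"
  shows "field_equiv Z ZH1 \<or> field_equiv Z ZH3"
proof -
  obtain r where r: "c = r * a" "d = r * b"
  proof (cases "a = 0")
    case True then show ?thesis using that[of "d / b"] ab det by auto
  next
    case False then show ?thesis using that[of "c / a"] det by (auto simp: field_simps)
  qed
  have rl: "bq1 c d x y = r * bq1 a b x y" for x y by (simp add: bq1_def r algebra_simps)
  define s where "s = (1 - 3 * r^2) / 4"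
  have e: "b * Px x y - a * Py x y = s * bq1 a b x y ^ 3" for x y
    using i(1) unfolding invariant_form_def W rl s_def by (simp add: field_simps power2_eq_square power3_eq_cube)
  have e': "r * (b * Px x y - a * Py x y) = r * (r^2 - 3) / 4 * bq1 a b x y ^ 3" for x y
  proof -
    have "bq1 c d x y ^ 3 + W1 x y * bq1 c d x y + W0 x y = d * Px x y - c * Py x y" using i(2) unfolding invariant_form_def by blast
    then have "d * Px x y - c * Py x y = r * (r^2 - 3) / 4 * bq1 a b x y ^ 3"
      unfolding W rl by (simp add: field_simps power2_eq_square power3_eq_cube)
    then show ?thesis by (simp add: r algebra_simps)
  qed
  obtain x y where xy: "bq1 a b x y \<noteq> 0" using ab bq_all_0(1)[of a b] by auto
  have "(r * (r^2 - 1)) * bq1 a b x y ^ 3 = 0" using e'[of x y] unfolding e s_def by (simp add: field_simps power2_eq_square)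
  then have "r = 0 \<or> r^2 = 1" using xy by simp
  then have rs: "r = 0 \<and> s = 1 / 4 \<or> r^2 = 1 \<and> s = - 1 / 2" by (auto simp: s_def)
  obtain c' d' where n: "b * c' - a * d' = s" "\<And>x y. d' * Px x y - c' * Py x y = - 3 * s * bq1 a b x y ^ 2 * bq1 c' d' x y"
    using triple_root[OF e ab] by blast
  note f = fixed_forms[OF W]
  from rs show ?thesis
  proof
    assume h: "r = 0 \<and> s = 1 / 4"
    let ?N = "vector [vector [a, b, 0], ex3, vector [c', d', 0]] :: complex^3^3"
    have "field_equiv Z ZH1"
    proof (rule field_equivI[where N="?N" and s=1 and g="\<lambda>p. - 3 / 4 * bq1 a b (p$1) (p$2) ^ 2"])
      show "invertible ?N" 
      proof -
        have "det ?N = b * c' - a * d'" by (simp add: det_3 algebra_simps)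
        then have "det ?N \<noteq> 0" unfolding n(1) using h by auto
        then show ?thesis by (simp add: invertible_det_nz)
      qed
      fix p :: "complex^3"
      define l where "l = bq1 a b (p$1) (p$2)"
      define k where "k = bq1 c' d' (p$1) (p$2)"
      have N: "?N *v q = vector [bq1 a b (q$1) (q$2), q$3, bq1 c' d' (q$1) (q$2)]" for q
        by (simp add: vec3_eq_iff mv3_nth bq1_def)
      have 1: "bq1 a b (Z p$1) (Z p$2) = l^3 / 4" using e[of "p$1" "p$2"] h by (simp add: f bq1_def l_def)
      have 2: "bq1 c' d' (Z p$1) (Z p$2) = - 3 / 4 * l^2 * k" using n(2)[of "p$1" "p$2"] h by (simp add: f bq1_def l_def k_def)
      have 3: "Z p $ 3 = (p$3)^3 - 3 / 4 * l^2 * p$3" using h by (simp add: f rl l_def)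
      show "?N *v Z p = 1 *s ZH1 (?N *v p) + (- 3 / 4 * bq1 a b (p$1) (p$2) ^ 2) *s (?N *v p)"
        unfolding N 1 2 3 ZH1_def l_def[symmetric] k_def[symmetric]
        by (simp add: vec3_eq_iff field_simps power2_eq_square power3_eq_cube)
    qed simp
    then show ?thesis ..
  next
    assume h: "r^2 = 1 \<and> s = - 1 / 2"
    let ?N = "vector [vector [a / 2, b / 2, 1 / 2], vector [a / 2, b / 2, - 1 / 2], vector [c', d', 0]] :: complex^3^3"
    have "field_equiv Z ZH3"
    proof (rule field_equivI[where N="?N" and s="- 2" and g="\<lambda>p. 3 / 2 * bq1 a b (p$1) (p$2) ^ 2"])
      show "invertible ?N" 
      proof -
        have "det ?N = - (b * c' - a * d') / 2" by (simp add: det_3 field_simps)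
        then have "det ?N \<noteq> 0" unfolding n(1) using h by auto
        then show ?thesis by (simp add: invertible_det_nz)
      qed
      fix p :: "complex^3"
      define l where "l = bq1 a b (p$1) (p$2)"
      define k where "k = bq1 c' d' (p$1) (p$2)"
      have N: "?N *v q = vector [(bq1 a b (q$1) (q$2) + q$3) / 2, (bq1 a b (q$1) (q$2) - q$3) / 2, bq1 c' d' (q$1) (q$2)]" for q
        by (simp add: vec3_eq_iff mv3_nth bq1_def field_simps)
      have 1: "bq1 a b (Z p$1) (Z p$2) = - (l^3) / 2" using e[of "p$1" "p$2"] h by (simp add: f bq1_def l_def)
      have 2: "bq1 c' d' (Z p$1) (Z p$2) = 3 / 2 * l^2 * k" using n(2)[of "p$1" "p$2"] h by (simp add: f bq1_def l_def k_def)
      have 3: "Z p $ 3 = (p$3)^3 - 3 / 2 * l^2 * p$3" using h by (simp add: f rl l_def power_mult_distrib)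
      show "?N *v Z p = (- 2) *s ZH3 (?N *v p) + (3 / 2 * bq1 a b (p$1) (p$2) ^ 2) *s (?N *v p)"
        unfolding N 1 2 3 ZH3_def l_def[symmetric] k_def[symmetric]
        by (simp add: vec3_eq_iff field_simps power2_eq_square power3_eq_cube)
    qed simp
    then show ?thesis ..
  qed
qed

text \<open>A binary quartic with vanishing Hessian is the fourth power of a linear form, here of \<open>y\<close>.\<close>

lemma zero_forms:
  assumes W: "\<And>x y. W0 x y = 0" "\<And>x y. W1 x y = 0" and h: "\<And>x y. lin_coeff x y = 0"
  shows "field_equiv Z ZF1"
proof -
  have u: "u0 = 0" "u1 = 0" "u2 = 0" using bq_all_0(2)[of u0 u1 u2] W(2) by blast+
  have "lin_coeff x y = (Pxx x y * Pyy x y - Pxy x y ^ 2) / 3" for x y unfolding lin_coeff_def W B1_def by (simp add: u bq1_def)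
  then have hs: "Pxx x y * Pyy x y - Pxy x y ^ 2 = 0" for x y using h[of x y] by (metis divide_eq_0_iff zero_neq_numeral)
  have H: "(- 9 * p1^2) * x^4 + (- 12 * p1 * p2) * x^3 * y + (18 * p1 * p3 - 12 * p2^2) * x^2 * y^2
      + (72 * p1 * p4 - 12 * p2 * p3) * x * y^3 + (24 * p2 * p4 - 9 * p3^2) * y^4 = 0" for x y
    using hs[of x y] by (simp add: bq_defs algebra_simps eval_nat_numeral)
  have "(24 * p2 * p4 - 9 * p3^2) + (72 * p1 * p4 - 12 * p2 * p3) * x + (18 * p1 * p3 - 12 * p2^2) * x^2 + (- 12 * p1 * p2) * x^3 + (- 9 * p1^2) * x^4 = 0" for x
    using H[of x 1] by (simp add: algebra_simps)
  note c = poly4_coeffs[OF this]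
  have p: "p1 = 0" "p2 = 0" "p3 = 0" using c by auto
  have p4: "p4 \<noteq> 0" using P_nonzero by (auto simp: quartic_def p)
  let ?N = "vector [ex2, ex3, vector [- 1 / (4 * p4), 0, 0]] :: complex^3^3"
  have Zv: "Z p $ 1 = - 4 * p4 * (p$2)^3" "Z p $ 2 = 0" "Z p $ 3 = (p$3)^3" for p
    using Z[of "p$1" "p$2" "p$3"] unfolding W vec3_collapse by (simp_all add: p bq_defs)
  show ?thesis
  proof (rule field_equivI[where N="?N" and s=1 and g="\<lambda>_. 0"])
    show "invertible ?N" using p4 by (simp add: invertible_det_nz det_3)
    show "?N *v Z p = 1 *s ZF1 (?N *v p) + 0 *s (?N *v p)" for p
      using p4 by (simp add: vec3_eq_iff mv3_nth Zv ZF1_def)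
  qed simp
qed

theorem classification: "field_equiv Z ZH1 \<or> field_equiv Z ZH3 \<or> field_equiv Z ZF1 \<or> field_equiv Z ZF3"
proof -
  obtain a b c d where i: "invariant_form a b" "invariant_form c d"
    and W: "\<And>x y. W0 x y = 0" "\<And>x y. W1 x y = - 3 / 4 * (bq1 a b x y ^ 2 + bq1 c d x y ^ 2)"
    and h: "\<And>x y. lin_coeff x y = 3 * bq1 a b x y ^ 2 * bq1 c d x y ^ 2"
    using two_forms by metis
  have W': "W1 x y = - 3 / 4 * (bq1 c d x y ^ 2 + bq1 a b x y ^ 2)" for x y unfolding W by (simp add: algebra_simps)
  show ?thesis
  proof (cases "a * d - b * c = 0")
    case False then show ?thesis using independent_forms[OF i W] by blast
  next
    case det: True
    consider "(a, b) \<noteq> (0, 0)" | "(c, d) \<noteq> (0, 0)" | "a = 0" "b = 0" "c = 0" "d = 0" by auto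
    then show ?thesis
    proof cases
      case 1 then show ?thesis using dependent_forms[OF i W _ det] by blast
    next
      case 2
      have "c * b - d * a = 0" using det by (simp add: algebra_simps)
      then show ?thesis using dependent_forms[OF i(2,1) W(1) W' 2] by blast
    next
      case 3 then show ?thesis using zero_forms W h by (simp add: bq1_def)
    qed
  qed
qed

end

text \<open>Adding \<open>- A\<^sub>x / 4\<close> times the radial field turns the first two components \<open>(A, 0)\<close> into the Hamiltonian field of
  \<open>P = - y A / 4\<close>.  The shear \<open>z \<mapsto> z - h(x, y)\<close> completes the cube in the last component.\<close>

theorem radial_two_classification:
  assumes cf: "convex_field Y Ks" and r: "radial_two Y"
  shows "field_equiv Y ZH1 \<or> field_equiv Y ZH3 \<or> field_equiv Y ZF1 \<or> field_equiv Y ZF3"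
proof -
  obtain a c where pl: "planar Y a c" and a: "a 9 = 0" "a 7 = 0" "a 8 = 0" "a 4 = 0" "a 5 = 0" "a 6 = 0" and c: "c 9 \<noteq> 0"
    using r unfolding radial_two_def by blast
  define s where "s = 1 / c 9"
  \<comment> \<open>minus a quarter of the \<open>x\<close>-derivative of the first component, after division by \<open>c 9\<close>\<close>
  let ?g = "\<lambda>p :: complex^3. bq2 (- 3 * a 0 * s / 4) (- 2 * a 1 * s / 4) (- a 2 * s / 4) (p$1) (p$2) + p$3 * bq1 0 0 (p$1) (p$2) + (p$3)^2 * 0"
  define Y1 where "Y1 = (\<lambda>p. s *s Y p + ?g p *s p)"
  have s0: "s \<noteq> 0" using c by (simp add: s_def)
  have cf1: "convex_field Y1 Ks" unfolding Y1_def by (rule convex_field_gauge[OF cf hom_quadratic s0])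
  define p1 p2 p3 p4 where "p1 = - a 0 * s / 4" and "p2 = - a 1 * s / 4" and "p3 = - a 2 * s / 4" and "p4 = - a 3 * s / 4"
  have a': "a 0 * s = - 4 * p1" "a 1 * s = - 4 * p2" "a 2 * s = - 4 * p3" "a 3 * s = - 4 * p4"
    by (simp_all add: p1_def p2_def p3_def p4_def)
  have Yv: "Y (vector [x, y, z]) = vector [bq3 (a 0) (a 1) (a 2) (a 3) x y, 0, cubic c x y z]" for x y z
    using pl unfolding planar_def by (simp add: cubic_def a bq_defs)
  have g: "?g (vector [x, y, z]) = bq2 (3 * p1) (2 * p2) p3 x y" for x y z
    by (simp add: p1_def p2_def p3_def bq_defs field_simps)
  have sA: "s * bq3 (a 0) (a 1) (a 2) (a 3) x y = bq3 (- 4 * p1) (- 4 * p2) (- 4 * p3) (- 4 * p4) x y" for x y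
    unfolding a'[symmetric] by (simp add: bq_defs algebra_simps)
  have Y12: "Y1 (vector [x, y, z]) $ 1 = - bq3 p1 (2 * p2) (3 * p3) (4 * p4) x y" "Y1 (vector [x, y, z]) $ 2 = bq3 0 (3 * p1) (2 * p2) p3 x y" for x y z
    using sA[of x y] unfolding Y1_def g Yv by (simp_all add: bq_defs algebra_simps power2_eq_square power3_eq_cube)
  obtain e where e: "\<And>x y z. Y1 (vector [x, y, z]) $ 3 = cubic e x y z" using hom3_coeffs[OF convex_fieldD(1)[OF cf1, of 3]] by blast
  have e9: "e 9 = 1" using e[of 0 0 1] c unfolding Y1_def g Yv by (simp add: s_def cubic_def bq_defs)
  define M :: "complex^3^3" where "M = vector [ex1, ex2, vector [- e 7 / 3, - e 8 / 3, 1]]"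
  define N :: "complex^3^3" where "N = vector [ex1, ex2, vector [e 7 / 3, e 8 / 3, 1]]"
  have MN: "M ** N = mat 1" "N ** M = mat 1"
    by (simp_all add: vec_eq_iff forall_3 matrix_matrix_mult_def sum_3 mat_def M_def N_def)
  then have M: "invertible M" unfolding invertible_def by blast
  have iM: "matrix_inv M = N" using matrix_inv[OF M] MN by (metis matrix_mul_assoc matrix_mul_lid matrix_mul_rid)
  define X where "X = transport M Y1"
  have cfX: "convex_field X (map (\<lambda>L. L v* M) Ks)" unfolding X_def by (rule convex_field_transport[OF cf1 M])
  define h where "h x y = e 7 / 3 * x + e 8 / 3 * y" for x y
  have Mv: "M *v vector [x, y, z] = vector [x, y, z - h x y]" for x y z
    by (simp add: vec3_eq_iff mv3_nth M_def h_def)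
  have X12: "X (vector [x, y, z]) $ 1 = - bq3 p1 (2 * p2) (3 * p3) (4 * p4) x y" "X (vector [x, y, z]) $ 2 = bq3 0 (3 * p1) (2 * p2) p3 x y" for x y z
    unfolding X_def transport_def Mv iM by (simp_all add: mv3_nth N_def Y12)
  have X3: "X (vector [x, y, z]) $ 3 = cubic e x y (z - h x y) + h (- bq3 p1 (2 * p2) (3 * p3) (4 * p4) x y) (bq3 0 (3 * p1) (2 * p2) p3 x y)" for x y z
    unfolding X_def transport_def Mv iM by (simp add: mv3_nth N_def Y12 e h_def)
  obtain f where f: "\<And>x y z. X (vector [x, y, z]) $ 3 = cubic f x y z" using hom3_coeffs[OF convex_fieldD(1)[OF cfX, of 3]] by blast
  have f9: "f 9 = 1" using f[of 0 0 1] unfolding X3 by (simp add: cubic_def bq_defs h_def e9)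
  \<comment> \<open>the coefficient of \<open>z\<^sup>2\<close> as a second difference\<close>
  have "bq1 (f 7) (f 8) x y = 0" for x y
  proof -
    have "2 * bq1 (f 7) (f 8) x y = cubic f x y 1 + cubic f x y (-1) - 2 * cubic f x y 0"
      by (simp add: cubic_def)
    also have "\<dots> = cubic e x y (1 - h x y) + cubic e x y (- 1 - h x y) - 2 * cubic e x y (0 - h x y)"
      unfolding f[symmetric] X3 by simp
    also have "\<dots> = 0"
      by (simp add: cubic_def e9 h_def bq1_def field_simps power2_eq_square power3_eq_cube)
    finally show ?thesis by simp
  qed
  then have f78: "f 7 = 0" "f 8 = 0" using bq_all_0(1)[of "f 7" "f 8"] by blast+
  have "radial_normal X (map (\<lambda>L. L v* M) Ks) p1 p2 p3 p4 (f 4) (f 5) (f 6) (f 0) (f 1) (f 2) (f 3)"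
  proof
    show "convex_field X (map (\<lambda>L. L v* M) Ks)" by (rule cfX)
    show "X (vector [x, y, z]) = vector [- bq3 p1 (2 * p2) (3 * p3) (4 * p4) x y, bq3 0 (3 * p1) (2 * p2) p3 x y,
        z^3 + z * bq2 (f 4) (f 5) (f 6) x y + bq3 (f 0) (f 1) (f 2) (f 3) x y]" for x y z
      unfolding vec3_eq_iff X12 f by (simp add: cubic_def f78 f9 bq1_def)
  qed
  from radial_normal.classification[OF this]
  have "field_equiv Y1 ZH1 \<or> field_equiv Y1 ZH3 \<or> field_equiv Y1 ZF1 \<or> field_equiv Y1 ZF3"
    unfolding X_def using field_equiv_transport[OF M] by blast
  then show ?thesis using field_equiv_form[of Y1 s Y] field_form_gauge[of s Y ?g] s0 unfolding Y1_def by blast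
qed

theorem convex_field_classification:
  assumes cf: "convex_field Z Ls"
  shows "field_equiv Z ZH1 \<or> field_equiv Z ZH3 \<or> field_equiv Z ZF1 \<or> field_equiv Z ZF3"
proof (cases "\<exists>p. p \<noteq> 0 \<and> (\<forall>L\<in>set Ls. dot L p = 0)")
  case True then show ?thesis using concurrent_lines[OF cf] by blast
next
  case False
  then obtain Y Ks where "convex_field Y Ks" "radial_two Y" "\<And>W. field_equiv Y W \<Longrightarrow> field_equiv Z W"
    using exists_radial_two[OF cf] by blast
  then show ?thesis using radial_two_classification by blast
qed

section \<open>Polynomials and polynomial functions\<close>

text \<open>The variables are substituted from the outermost, \<open>z\<close>, to the innermost, \<open>x\<close>.\<close>

definition ev :: "poly3 \<Rightarrow> complex^3 \<Rightarrow> complex" where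
  "ev P p = poly (poly (poly P [:[:p$3:]:]) [:p$2:]) (p$1)"

definition evf :: "poly3^3 \<Rightarrow> complex^3 \<Rightarrow> complex^3" where
  "evf V p = (\<chi> i. ev (V$i) p)"

lemma evf_nth [simp]: "evf V p $ i = ev (V$i) p" by (simp add: evf_def)

lemma coords_nth: "coords $ 1 = [:[:[:0, 1:]:]:]" "coords $ 2 = [:[:0, 1:]:]" "coords $ 3 = [:0, 1:]"
  by (simp_all add: coords_def)

lemma ev_simps [simp]:
  "ev (P + Q) p = ev P p + ev Q p" "ev (P - Q) p = ev P p - ev Q p" "ev (P * Q) p = ev P p * ev Q p"
  "ev (- P) p = - ev P p" "ev 0 p = 0" "ev 1 p = 1" "ev (P ^ n) p = ev P p ^ n" "ev [:[:[:c:]:]:] p = c"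
  "ev (smult [:[:c:]:] P) p = c * ev P p"
  by (simp_all add: ev_def)

lemma ev_coords: "ev (coords $ i) p = p $ i"
  using exhaust_3[of i] by (auto simp: ev_def coords_nth)

lemma ev_prod_list: "ev (prod_list Ps) p = (\<Prod>P\<leftarrow>Ps. ev P p)"
  by (induction Ps) auto

text \<open>Constants are enough to detect a zero polynomial over an infinite domain, which gives injectivity of the
  evaluation one variable at a time.\<close>

lemma poly_constants_0:
  assumes "infinite (UNIV :: 'a::idom set)" "\<And>y. poly (q :: 'a poly poly) [:y:] = 0" shows "q = 0"
proof (rule ccontr)
  assume "q \<noteq> 0"
  then have "finite {c. poly q c = 0}" by (rule poly_roots_finite)
  moreover have "range (\<lambda>y. [:y:]) \<subseteq> {c. poly q c = 0}" using assms(2) by auto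
  moreover have "inj (\<lambda>y :: 'a. [:y:])" by (simp add: inj_on_def)
  ultimately show False using assms(1) by (meson finite_imageD finite_subset)
qed

lemma ev_eq_0: assumes "\<And>p. ev P p = 0" shows "P = 0"
proof -
  have e: "poly (poly (poly P [:[:z:]:]) [:y:]) x = 0" for x y z
    using assms[of "vector [x, y, z]"] by (simp add: ev_def)
  have e2: "poly P [:[:z:]:] = 0" for z
    by (rule poly_constants_0[OF infinite_UNIV_char_0]) (use e poly_all_0_iff_0 in blast)
  show "P = 0"
  proof (rule ccontr)
    assume "P \<noteq> 0"
    then have "finite {c. poly P c = 0}" by (rule poly_roots_finite)
    moreover have "range (\<lambda>z. [:[:z:]:]) \<subseteq> {c. poly P c = 0}" using e2 by auto
    moreover have "inj (\<lambda>z :: complex. [:[:z:]:])" by (simp add: inj_on_def)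
    ultimately show False using infinite_UNIV_char_0 by (meson finite_imageD finite_subset)
  qed
qed

lemma ev_inject: "(\<And>p. ev P p = ev Q p) \<Longrightarrow> P = Q"
  using ev_eq_0[of "P - Q"] by simp

lemma evf_inject: "(\<And>p. evf V p = evf W p) \<Longrightarrow> V = W"
  unfolding vec_eq_iff evf_nth by (intro allI ev_inject) blast

lemma hom_monomial: "hom (i + j + k) (\<lambda>p. c * ((p$1)^i * (p$2)^j * (p$3)^k))"
proof -
  have h: "hom n (\<lambda>p. (p$l)^n)" for n and l :: 3 using hom_power[OF hom_coord1[of l], of n] by simp
  show ?thesis by (intro hom_scale hom_mult h)
qed

lemma homogeneous_hom: assumes "homogeneous n P" shows "hom n (ev P)"
proof -
  let ?t = "\<lambda>k j i p. coeff (coeff (coeff P k) j) i * ((p$1)^i * (p$2)^j * (p$3 :: complex)^k)"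
  have eq: "ev P = (\<lambda>p. \<Sum>k\<le>degree P. \<Sum>j\<le>degree (coeff P k). \<Sum>i\<le>degree (coeff (coeff P k) j). ?t k j i p)"
  proof
    fix p
    have c: "poly (poly (q :: poly2) [:y:]) x = (\<Sum>j\<le>degree q. \<Sum>i\<le>degree (coeff q j). coeff (coeff q j) i * (x^i * y^j))" for q x y
    proof -
      have "poly (poly q [:y:]) x = (\<Sum>j\<le>degree q. poly (coeff q j) x * y^j)"
        by (subst poly_altdef) (simp add: poly_sum)
      also have "\<dots> = (\<Sum>j\<le>degree q. \<Sum>i\<le>degree (coeff q j). coeff (coeff q j) i * (x^i * y^j))"
        by (simp add: poly_altdef[of "coeff q _"] sum_distrib_left mult_ac)
      finally show ?thesis .
    qed
    have "ev P p = (\<Sum>k\<le>degree P. poly (poly (coeff P k) [:p$2:]) (p$1) * (p$3)^k)"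
      unfolding ev_def by (subst poly_altdef) (simp add: poly_sum)
    also have "\<dots> = (\<Sum>k\<le>degree P. \<Sum>j\<le>degree (coeff P k). \<Sum>i\<le>degree (coeff (coeff P k) j). ?t k j i p)"
      unfolding c by (simp add: sum_distrib_left mult_ac)
    finally show "ev P p = (\<Sum>k\<le>degree P. \<Sum>j\<le>degree (coeff P k). \<Sum>i\<le>degree (coeff (coeff P k) j). ?t k j i p)" .
  qed
  have t: "hom n (?t k j i)" for k j i
  proof (cases "coeff (coeff (coeff P k) j) i = 0")
    case True then show ?thesis by (simp add: hom_zero)
  next
    case False
    then have "i + j + k = n" using assms unfolding homogeneous_def by blast
    then show ?thesis using hom_monomial[of i j k "coeff (coeff (coeff P k) j) i"] by (simp only:)
  qed
  show ?thesis unfolding eq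
    by (rule hom_sum[OF finite_atMost], rule hom_sum[OF finite_atMost], rule hom_sum[OF finite_atMost], rule t)
qed

lemma homogeneous_add: "homogeneous n P \<Longrightarrow> homogeneous n Q \<Longrightarrow> homogeneous n (P + Q)"
  unfolding homogeneous_def by (metis add_0 coeff_add)

lemma homogeneous_diff: "homogeneous n P \<Longrightarrow> homogeneous n Q \<Longrightarrow> homogeneous n (P - Q)"
  unfolding homogeneous_def by (metis diff_0_right coeff_diff)

lemma homogeneous_0: "homogeneous n 0" by (simp add: homogeneous_def)

lemma homogeneous_mult:
  assumes "homogeneous n P" "homogeneous m Q" shows "homogeneous (n + m) (P * Q)"
  unfolding homogeneous_def
proof (intro allI impI)
  fix i j k
  assume "coeff (coeff (coeff (P * Q) k) j) i \<noteq> 0"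
  then have "(\<Sum>a\<le>k. \<Sum>b\<le>j. \<Sum>c\<le>i. coeff (coeff (coeff P a) b) c * coeff (coeff (coeff Q (k - a)) (j - b)) (i - c)) \<noteq> 0"
    by (simp add: coeff_mult coeff_sum)
  then obtain a b c where "a \<le> k" "b \<le> j" "c \<le> i" "coeff (coeff (coeff P a) b) c * coeff (coeff (coeff Q (k - a)) (j - b)) (i - c) \<noteq> 0"
    by (meson atMost_iff sum.not_neutral_contains_not_neutral)
  moreover from this(4) have "coeff (coeff (coeff P a) b) c \<noteq> 0" "coeff (coeff (coeff Q (k - a)) (j - b)) (i - c) \<noteq> 0" by auto
  then have "c + b + a = n" "(i - c) + (j - b) + (k - a) = m"
    using assms unfolding homogeneous_def by blast+
  ultimately show "i + j + k = n + m" by linarith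
qed

lemma homogeneous_const: "homogeneous 0 (const3 c)"
  by (auto simp: homogeneous_def coeff_pCons split: nat.splits)

lemma homogeneous_coords: "homogeneous 1 (coords $ i)"
  using exhaust_3[of i] by (auto simp: homogeneous_def coords_nth coeff_pCons of_bool_def split: nat.splits if_splits)

lemma homogeneous_power: "homogeneous n P \<Longrightarrow> homogeneous (k * n) (P ^ k)"
  by (induction k) (use homogeneous_const[of 1] homogeneous_mult in \<open>auto simp: one_pCons[symmetric]\<close>)

section \<open>Derivatives and inflection\<close>

lemma ev_gradient:
  "((\<lambda>t. ev P (p + t *s v)) has_field_derivative
     ev (gradient P $ 1) p * v$1 + ev (gradient P $ 2) p * v$2 + ev (gradient P $ 3) p * v$3) (at 0)"
proof -
  define e2 :: "poly2 \<Rightarrow> complex \<Rightarrow> complex \<Rightarrow> complex" where "e2 q x y = poly (poly q [:y:]) x" for q x y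
  have e2_pCons: "e2 (pCons a q) x y = poly a x + y * e2 q x y" for a q x y by (simp add: e2_def)
  have d2: "((\<lambda>t. e2 q (x + t * u) (y + t * v)) has_field_derivative
      e2 (map_poly pderiv q) x y * u + e2 (pderiv q) x y * v) (at 0)" for q x y u v
  proof (induction q)
    case 0 then show ?case by (simp add: e2_def)
  next
    case (pCons a q)
    have "((\<lambda>t. poly a (x + t * u)) has_field_derivative poly (pderiv a) (x + 0 * u) * u) (at 0)"
      by (auto intro!: derivative_eq_intros)
    then show ?case
      by (auto intro!: derivative_eq_intros pCons.IH simp: e2_pCons map_poly_pCons pderiv_pCons e2_def[of "_ + _"] e2_def[symmetric])
         (simp add: e2_def algebra_simps)
  qed
  define e3 where "e3 P x y z = e2 (poly P [:[:z:]:]) x y" for P x y z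
  have e2_simps: "e2 (a + b) x y = e2 a x y + e2 b x y" "e2 (a * b) x y = e2 a x y * e2 b x y" "e2 [:[:c:]:] x y = c" for a b x y c
    by (simp_all add: e2_def)
  have e3_pCons: "e3 (pCons a P) x y z = e2 a x y + z * e3 P x y z" for a P x y z
    by (simp add: e3_def e2_def)
  have d3: "((\<lambda>t. e3 P (x + t * u) (y + t * v) (z + t * w)) has_field_derivative
      e3 (map_poly (map_poly pderiv) P) x y z * u + e3 (map_poly pderiv P) x y z * v + e3 (pderiv P) x y z * w) (at 0)" for P x y z u v w
  proof (induction P)
    case 0 then show ?case by (simp add: e3_def e2_def)
  next
    case (pCons a P)
    have "e3 (pderiv (pCons a P)) x y z = e3 P x y z + z * e3 (pderiv P) x y z"
      by (simp add: pderiv_pCons e3_def e2_def)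
    then show ?case
      by (auto intro!: derivative_eq_intros d2 pCons.IH simp: e3_pCons map_poly_pCons algebra_simps)
  qed
  have "ev P q = e3 P (q$1) (q$2) (q$3)" for P q by (simp add: ev_def e3_def e2_def)
  then show ?thesis using d3[of P "p$1" "v$1" "p$2" "v$2" "p$3" "v$3"] by (simp add: gradient_def)
qed

lemma ev_act: "((\<lambda>t. ev P (p + t *s evf V p)) has_field_derivative ev (act V P) p) (at 0)"
  using ev_gradient[of P p "evf V p"] by (simp add: act_def sum_3 mult_ac)

lemma act_coords: "act V (coords $ i) = V $ i"
proof (rule ev_inject)
  fix p
  have "((\<lambda>t. p $ i + t * ev (V $ i) p) has_field_derivative ev (V $ i) p) (at 0)"
    by (auto intro!: derivative_eq_intros)
  then show "ev (act V (coords $ i)) p = ev (V $ i) p"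
    using ev_act[of "coords $ i" p V] DERIV_unique by (simp add: ev_coords) blast
qed

lemma ev_inflection: "ev (inflection V) p = infl (evf V) p"
proof -
  have "deriv (\<lambda>t. evf V (p + t *s evf V p) $ i) 0 = ev (act V (V $ i)) p" for i
    by (rule DERIV_imp_deriv) (simp add: ev_act)
  then show ?thesis
    by (simp add: inflection_def act_coords det_3 infl_def field_square_def dot_def ev_coords algebra_simps)
qed

lemma evf_form_of_field: "evf (form_of_field V) p = field_form (evf V) p"
  by (simp add: vec3_eq_iff form_of_field_def field_form_def det_3 axis_def ev_coords algebra_simps)

section \<open>Substitutions\<close>

lemma ev_subst3: "ev (subst3 Q P) p = ev P (\<chi> i. ev (Q $ i) p)"
proof -
  define s1 where "s1 q = poly (map_poly const3 q) (Q $ 1)" for q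
  define s2 where "s2 q = poly (map_poly s1 q) (Q $ 2)" for q
  let ?x = "ev (Q $ 1) p" and ?y = "ev (Q $ 2) p" and ?z = "ev (Q $ 3) p"
  have 1: "ev (s1 q) p = poly q ?x" for q
    unfolding s1_def by (induction q) (simp_all add: map_poly_pCons)
  have s10: "s1 0 = 0" by (simp add: s1_def)
  have 2: "ev (s2 q) p = poly (poly q [:?y:]) ?x" for q
    unfolding s2_def by (induction q) (simp_all add: map_poly_pCons s10 1)
  have s20: "s2 0 = 0" by (simp add: s2_def)
  have 3: "ev (poly (map_poly s2 P) (Q $ 3)) p = poly (poly (poly P [:[:?z:]:]) [:?y:]) ?x"
    by (induction P) (simp_all add: map_poly_pCons s20 2)
  have "subst3 Q P = poly (map_poly s2 P) (Q $ 3)"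
    unfolding subst3_def s2_def[abs_def] s1_def[abs_def] ..
  then show ?thesis using 3 by (simp add: ev_def)
qed

definition linear_map :: "complex^3^3 \<Rightarrow> poly3^3" where
  "linear_map M = (\<chi> i j. const3 (M $ i $ j)) *v coords"

lemma ev_linear_map: "ev (linear_map M $ i) p = (M *v p) $ i"
  by (simp add: linear_map_def matrix_vector_mult_def sum_3 mv3_nth ev_coords)

lemma ev_subst_linear: "ev (subst3 (linear_map M) P) p = ev P (M *v p)"
  unfolding ev_subst3 ev_linear_map by simp

lemma evf_pullback: "evf (pullback M \<Omega>) p = evf \<Omega> (M *v p) v* M"
  by (simp add: pullback_def Let_def linear_map_def[symmetric] vec_eq_iff vector_matrix_mult_def sum_3 vm3_nth ev_subst_linear)

lemma pullback_id: "pullback (mat 1) \<Omega> = \<Omega>"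
  by (rule evf_inject) (simp add: evf_pullback vm_id)

lemma pullback_comp: "pullback N (pullback M \<Omega>) = pullback (M ** N) \<Omega>"
  by (rule evf_inject) (simp add: evf_pullback vm_assoc matrix_vector_mul_assoc)

lemma aut_equiv_equiv: "equiv UNIV aut_equiv"
proof (rule equivI)
  show "aut_equiv \<subseteq> UNIV \<times> UNIV" by simp
  show "refl aut_equiv"
    by (rule refl_onI) (auto simp: aut_equiv_def pullback_id intro!: exI[of _ "mat 1"] invertible_one)
  show "sym aut_equiv"
  proof (rule symI)
    fix F G assume "(F, G) \<in> aut_equiv"
    then obtain M where M: "invertible M" "G = pullback M ` F" unfolding aut_equiv_def by blast
    have "F = pullback (matrix_inv M) ` G"
      unfolding M(2) image_image pullback_comp matrix_inv[OF M(1)] pullback_id by simp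
    then show "(G, F) \<in> aut_equiv" unfolding aut_equiv_def using invertible_inv[OF M(1)] by blast
  qed
  show "trans aut_equiv"
  proof (rule transI)
    fix F G H assume "(F, G) \<in> aut_equiv" "(G, H) \<in> aut_equiv"
    then obtain M N where M: "invertible M" "G = pullback M ` F" "invertible N" "H = pullback N ` G" unfolding aut_equiv_def by blast
    have "H = pullback (M ** N) ` F" unfolding M(2,4) image_image pullback_comp ..
    then show "(F, H) \<in> aut_equiv" unfolding aut_equiv_def using invertible_mult[OF M(1,3)] by blast
  qed
qed

section \<open>Linear factors\<close>

definition linear_form :: "complex^3 \<Rightarrow> poly3" where
  "linear_form L = (\<Sum>i\<in>UNIV. const3 (L $ i) * coords $ i)"

lemma ev_linear_form: "ev (linear_form L) p = dot L p"
  by (simp add: linear_form_def sum_3 dot_def ev_coords)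

lemma homogeneous_linear_form: "homogeneous 1 (linear_form L)"
proof -
  have "homogeneous (0 + 1) (const3 (L $ i) * coords $ i)" for i
    by (rule homogeneous_mult[OF homogeneous_const homogeneous_coords])
  then show ?thesis unfolding linear_form_def sum_3 by (intro homogeneous_add) simp_all
qed

text \<open>In coordinates in which the line is \<open>z = 0\<close>, this is the factor theorem for the outermost variable.\<close>

lemma vanishing_on_line:
  assumes "L \<noteq> 0" "\<And>p. dot L p = 0 \<Longrightarrow> ev P p = 0" shows "linear_form L dvd P"
proof -
  obtain K where K: "ccross K L \<noteq> 0"
  proof -
    have "ccross ex1 L \<noteq> 0 \<or> ccross ex2 L \<noteq> 0" using assms(1) by (auto simp: vec3_eq_iff)
    then show ?thesis using that by blast
  qed
  let ?J = "ccross K L"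
  have "\<exists>N. dot N ?J \<noteq> 0" using K dot_all_0[of ?J] dot_commute by metis
  then obtain N where "dot N ?J \<noteq> 0" by blast
  from adapt_rows[OF this] obtain M0 where M0: "invertible M0" "K v* M0 = ex1" "L v* M0 = ex2" .
  define M where "M = M0"
  note M = M0[folded M_def]
  let ?Q = "subst3 (linear_map M) P"
  \<comment> \<open>in the new coordinates the line is \<open>y = 0\<close>\<close>
  have Q0: "ev ?Q p = 0" if "p $ 2 = 0" for p
    unfolding ev_subst_linear by (rule assms(2)) (use that M in \<open>simp add: dot_vm[symmetric]\<close>)
  let ?S = "vector [ex1, ex3, ex2] :: complex^3^3"
  have S: "invertible ?S" by (simp add: invertible_det_nz det_3)
  have Sp: "?S *v p = vector [p$1, p$3, p$2]" for p by (simp add: vec3_eq_iff mv3_nth)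
  let ?R = "subst3 (linear_map ?S) ?Q"
  have "ev ?R (vector [x, y, 0]) = 0" for x y
    unfolding ev_subst_linear[of ?S] Sp by (rule Q0) simp
  then have "poly (poly (poly ?R 0) [:y:]) x = 0" for x y by (simp add: ev_def)
  then have "poly ?R 0 = 0"
    by (intro poly_constants_0[OF infinite_UNIV_char_0]) (use poly_all_0_iff_0 in blast)
  then obtain T where T: "?R = [:0, 1:] * T" by (auto simp: poly_eq_0_iff_dvd elim: dvdE)
  define M' where "M' = matrix_inv ?S ** matrix_inv M"
  have inv: "M *v (?S *v (M' *v p)) = p" for p
    by (simp add: M'_def matrix_vector_mul_assoc[symmetric] matrix_inv3[OF S] matrix_inv3[OF M(1)])
  have "P = linear_form L * subst3 (linear_map M') T"
  proof (rule ev_inject)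
    fix p
    have "ev P p = ev ?R (M' *v p)" unfolding ev_subst_linear inv ..
    also have "\<dots> = (M' *v p) $ 3 * ev T (M' *v p)"
      unfolding T ev_simps by (simp add: ev_def)
    also have "(M' *v p) $ 3 = dot L p"
    proof -
      have "dot (L v* M) (?S *v (M' *v p)) = dot L p" unfolding dot_vm inv ..
      then show ?thesis unfolding M(3) by (simp add: Sp)
    qed
    finally show "ev P p = ev (linear_form L * subst3 (linear_map M') T) p"
      by (simp add: ev_linear_form ev_subst_linear)
  qed
  then show ?thesis by (metis dvd_triv_left)
qed

lemma invariant_lineD:
  assumes "invariant_line V P"
  obtains L where "L \<noteq> 0" "P = linear_form L" "\<And>p. dot L p = 0 \<Longrightarrow> dot L (evf V p) = 0"
proof -
  from assms have P: "homogeneous 1 P" "P \<noteq> 0" "P dvd act V P" by (auto simp: invariant_line_def)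
  obtain a b c where abc: "\<And>x y z. ev P (vector [x, y, z]) = a * x + b * y + c * z"
    using hom1_coeffs[OF homogeneous_hom[OF P(1)]] by blast
  let ?L = "vector [a, b, c] :: complex^3"
  have L: "ev P p = dot ?L p" for p using abc[of "p$1" "p$2" "p$3"] by (simp add: vec3_collapse dot_def)
  have PL: "P = linear_form ?L" by (rule ev_inject) (simp add: L ev_linear_form)
  obtain K where K: "act V P = P * K" using P(3) by (rule dvdE)
  have "dot ?L (evf V p) = 0" if "dot ?L p = 0" for p
  proof -
    have "((\<lambda>t. dot ?L p + t * dot ?L (evf V p)) has_field_derivative dot ?L (evf V p)) (at 0)"
      by (auto intro!: derivative_eq_intros)
    then have "ev (act V P) p = dot ?L (evf V p)"
      using ev_act[of P p V] DERIV_unique unfolding L by simp blast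
    then show ?thesis using that unfolding K by (simp add: L)
  qed
  moreover have "?L \<noteq> 0"
  proof
    assume "?L = 0"
    then have "ev P p = 0" for p unfolding L by (simp only: dot_simps)
    then show False using P(2) ev_eq_0 by blast
  qed
  ultimately show ?thesis using that PL by blast
qed

lemma invariant_lineI:
  assumes "L \<noteq> 0" "\<And>p. dot L p = 0 \<Longrightarrow> dot L (evf V p) = 0"
  shows "invariant_line V (linear_form L)"
  unfolding invariant_line_def
proof (intro conjI)
  show "homogeneous 1 (linear_form L)" by (rule homogeneous_linear_form)
  show "linear_form L \<noteq> 0" using assms(1) dot_all_0[of L] ev_linear_form[of L] by (metis ev_simps(5))
  show "linear_form L dvd act V (linear_form L)"
  proof (rule vanishing_on_line[OF assms(1)])
    fix p assume p: "dot L p = 0"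
    have "((\<lambda>t. dot L p + t * dot L (evf V p)) has_field_derivative dot L (evf V p)) (at 0)"
      by (auto intro!: derivative_eq_intros)
    then have "ev (act V (linear_form L)) p = dot L (evf V p)"
      using ev_act[of "linear_form L" p V] DERIV_unique unfolding ev_linear_form by simp blast
    then show "ev (act V (linear_form L)) p = 0" using assms(2)[OF p] by simp
  qed
qed

section \<open>From convex foliations to convex fields\<close>

lemma linear_form_not_unit: "L \<noteq> 0 \<Longrightarrow> \<not> linear_form L dvd 1"
proof
  assume "linear_form L dvd 1"
  then obtain K where "1 = linear_form L * K" by (rule dvdE)
  from arg_cong[OF this, of "\<lambda>P. ev P 0"] show False by (simp add: ev_linear_form)
qed

lemma foliation_of_scale: "r \<noteq> 0 \<Longrightarrow> foliation_of (const3 r *s \<Omega>) = foliation_of \<Omega>"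
proof -
  assume r: "r \<noteq> 0"
  have e: "const3 s *s (const3 r *s \<Omega>) = const3 (s * r) *s \<Omega>" for s by (simp add: vec_eq_iff mult.commute)
  have "s \<noteq> 0 \<Longrightarrow> \<exists>c. const3 s *s \<Omega> = const3 (c * r) *s \<Omega> \<and> c \<noteq> 0" for s
    by (rule exI[of _ "s / r"]) (use r in simp)
  then show ?thesis unfolding foliation_of_def e using r by fastforce
qed

text \<open>A common linear factor of the form of \<open>V\<close> would contradict that the foliation is given by a form without
  common factors.\<close>

lemma convex_foliation_field:
  assumes "F \<in> convex_foliations 3"
  obtains V Ls where "F = foliation_of (form_of_field V)" "convex_field (evf V) Ls"
proof -
  obtain \<Omega> V c Ps where \<Omega>: "F = foliation_of \<Omega>" "foliation_form 3 \<Omega>" and V: "foliation_field 3 V" "form_of_field V \<in> F"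
    and c: "c \<noteq> 0" "\<And>P. P \<in> set Ps \<Longrightarrow> invariant_line V P" "inflection V = const3 c * prod_list Ps"
    using assms unfolding convex_foliations_def foliations_def by blast
  obtain r where r: "r \<noteq> 0" "form_of_field V = const3 r *s \<Omega>" using V(2) unfolding \<Omega>(1) foliation_of_def by blast
  have "foliation_of (form_of_field V) = F" unfolding \<Omega>(1) r(2) by (rule foliation_of_scale[OF r(1)])
  obtain f where f: "\<And>P. P \<in> set Ps \<Longrightarrow> f P \<noteq> 0 \<and> P = linear_form (f P) \<and> (\<forall>p. dot (f P) p = 0 \<longrightarrow> dot (f P) (evf V p) = 0)"
  proof -
    have "\<exists>L. P \<in> set Ps \<longrightarrow> L \<noteq> 0 \<and> P = linear_form L \<and> (\<forall>p. dot L p = 0 \<longrightarrow> dot L (evf V p) = 0)" for P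
      using c(2) invariant_lineD by metis
    then show ?thesis using that by metis
  qed
  have "convex_field (evf V) (map f Ps)"
    unfolding convex_field_def
  proof (intro conjI allI impI ballI)
    show "hom 3 (\<lambda>p. evf V p $ i)" for i using V(1) homogeneous_hom unfolding foliation_field_def by simp
    show "\<exists>c. c \<noteq> 0 \<and> (\<forall>p. infl (evf V) p = c * (\<Prod>L\<leftarrow>map f Ps. dot L p))"
    proof (intro exI conjI allI)
      show "c \<noteq> 0" by fact
      fix p
      have "(\<Prod>P\<leftarrow>Ps. ev P p) = (\<Prod>L\<leftarrow>map f Ps. dot L p)"
        unfolding map_map o_def by (rule arg_cong[of _ _ prod_list], rule map_cong) (use f ev_linear_form in \<open>auto, metis\<close>)
      then show "infl (evf V) p = c * (\<Prod>L\<leftarrow>map f Ps. dot L p)"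
        unfolding ev_inflection[symmetric] c(3) by (simp add: ev_prod_list)
    qed
  next
    fix L :: "complex^3" assume L: "L \<noteq> 0"
    show "\<exists>p. dot L p = 0 \<and> field_form (evf V) p \<noteq> 0"
    proof (rule ccontr)
      assume n: "\<not> ?thesis"
      have "linear_form L dvd \<Omega> $ i" for i
      proof (rule vanishing_on_line[OF L])
        fix p assume "dot L p = 0"
        then have "evf (form_of_field V) p $ i = 0" using n by (simp add: evf_form_of_field)
        then show "ev (\<Omega> $ i) p = 0" using r by simp
      qed
      then show False using \<Omega>(2) linear_form_not_unit[OF L] unfolding foliation_form_def no_common_factor_def by blast
    qed
  qed (use f in auto)
  then show ?thesis using that \<open>foliation_of (form_of_field V) = F\<close> by blast
qed

lemma pullback_foliation_of: "pullback M ` foliation_of \<Omega> = foliation_of (pullback M \<Omega>)"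
proof -
  have "pullback M (const3 c *s \<Omega>) = const3 c *s pullback M \<Omega>" for c
  proof (rule evf_inject)
    fix p
    have "evf (const3 c *s \<Omega>) q = c *s evf \<Omega> q" for q \<Omega> by (simp add: vec_eq_iff)
    then show "evf (pullback M (const3 c *s \<Omega>)) p = evf (const3 c *s pullback M \<Omega>) p"
      by (simp add: evf_pullback vm_scale)
  qed
  moreover have "foliation_of \<Omega> = (\<lambda>c. const3 c *s \<Omega>) ` {c. c \<noteq> 0}" for \<Omega> unfolding foliation_of_def by auto
  ultimately show ?thesis by (simp add: image_image)
qed

lemma aut_equivI:
  assumes "field_equiv (evf V) (evf W)"
  shows "(foliation_of (form_of_field V), foliation_of (form_of_field W)) \<in> aut_equiv"
proof -
  obtain M s where M: "invertible M" "s \<noteq> 0" "\<And>p. field_form (evf V) (M *v p) v* M = s *s field_form (evf W) p"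
    using assms unfolding field_equiv_def by blast
  have "pullback M (form_of_field V) = const3 s *s form_of_field W"
  proof (rule evf_inject)
    fix p
    show "evf (pullback M (form_of_field V)) p = evf (const3 s *s form_of_field W) p"
      unfolding evf_pullback evf_form_of_field M(3) by (simp add: vec_eq_iff evf_form_of_field[symmetric])
  qed
  then have "pullback M ` foliation_of (form_of_field V) = foliation_of (const3 s *s form_of_field W)"
    unfolding pullback_foliation_of by simp
  then show ?thesis unfolding foliation_of_scale[OF M(2)] aut_equiv_def using M(1) by blast
qed

section \<open>Foliations in the affine chart\<close>

text \<open>Degrees eliminate the variables of a common factor one at a time: a member of the ideal free of \<open>z\<close>
  makes the factor free of \<open>z\<close>, so that it divides all coefficients of powers of \<open>z\<close>, and so on for \<open>y\<close> and \<open>x\<close>.\<close>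

lemma no_common_factorI:
  assumes q: "\<Omega> $ l = [:q:]" "q \<noteq> 0"
    and u: "\<And>s. (\<And>i k. s dvd coeff (\<Omega> $ i) k) \<Longrightarrow> s dvd [:u:]" "u \<noteq> 0"
    and c: "coeff (coeff (\<Omega> $ m) k) j = [:c:]" "c \<noteq> 0"
  shows "no_common_factor \<Omega>"
  unfolding no_common_factor_def
proof (intro allI impI)
  fix r assume r: "\<forall>i. r dvd \<Omega> $ i"
  have "degree r \<le> 0" using dvd_imp_degree_le[of r "[:q:]"] r q by (metis degree_pCons_0 pCons_eq_0_iff)
  then obtain s where s: "r = [:s:]" using degree_eq_zeroE by (metis le_zero_eq)
  have sd: "s dvd coeff (\<Omega> $ i) k" for i k using r unfolding s const_poly_dvd_iff by blast
  have "degree s \<le> 0" using dvd_imp_degree_le[of s "[:u:]"] u(1)[OF sd] u(2) by (metis degree_pCons_0 pCons_eq_0_iff)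
  then obtain w where w: "s = [:w:]" using degree_eq_zeroE by (metis le_zero_eq)
  have "w dvd [:c:]" using sd[of m k] c(1) unfolding w const_poly_dvd_iff by metis
  moreover have "[:c:] dvd 1" using c(2) by (simp add: is_unit_const_poly_iff dvd_field_iff)
  ultimately have "w dvd 1" by (rule dvd_trans)
  then show "r dvd 1" by (simp add: s w is_unit_const_poly_iff)
qed

lemma form_of_field_nth:
  "form_of_field V $ 1 = V$2 * coords$3 - V$3 * coords$2"
  "form_of_field V $ 2 = V$3 * coords$1 - V$1 * coords$3"
  "form_of_field V $ 3 = V$1 * coords$2 - V$2 * coords$1"
  by (simp_all add: form_of_field_def det_3 axis_def algebra_simps)

lemma foliation_form_of_field:
  assumes "\<And>i. homogeneous d (V $ i)" "no_common_factor (form_of_field V)"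
  shows "foliation_form d (form_of_field V)"
  unfolding foliation_form_def
proof (intro conjI allI)
  have h: "homogeneous (d + 1) (V $ i * coords $ j)" for i j by (rule homogeneous_mult[OF assms(1) homogeneous_coords])
  show "homogeneous (d + 1) (form_of_field V $ i)" for i
    using exhaust_3[of i] h by (auto simp only: form_of_field_nth intro!: homogeneous_diff)
  show "(\<Sum>i\<in>UNIV. coords $ i * form_of_field V $ i) = 0"
    by (simp add: sum_3 form_of_field_nth algebra_simps)
qed (rule assms(2))

lemma const3_1: "const3 1 *s \<Omega> = (\<Omega> :: poly3^3)"
  by (rule evf_inject) (simp add: vec_eq_iff)

lemma foliation_of_self: "\<Omega> \<in> foliation_of \<Omega>"
  unfolding foliation_of_def using const3_1[of \<Omega>] by (intro CollectI exI[of _ 1]) simp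

lemma convex_foliationI:
  assumes V: "\<And>i. homogeneous 3 (V $ i)" and ncf: "no_common_factor (form_of_field V)"
    and infl: "c \<noteq> 0" "\<And>p. infl (evf V) p = c * (\<Prod>L\<leftarrow>Ls. dot L p)"
    and inv: "\<And>L. L \<in> set Ls \<Longrightarrow> L \<noteq> 0" "\<And>L p. L \<in> set Ls \<Longrightarrow> dot L p = 0 \<Longrightarrow> dot L (evf V p) = 0"
  shows "foliation_of (form_of_field V) \<in> convex_foliations 3"
proof -
  have "no_common_factor V"
    unfolding no_common_factor_def
  proof (intro allI impI)
    fix r assume "\<forall>i. r dvd V $ i"
    then have "\<forall>i. r dvd form_of_field V $ i" unfolding forall_3 form_of_field_nth by (intro conjI dvd_diff dvd_mult2) auto
    then show "r dvd 1" using ncf unfolding no_common_factor_def by blast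
  qed
  moreover have "inflection V = const3 c * prod_list (map linear_form Ls)"
    by (rule ev_inject) (simp add: ev_inflection infl(2) ev_prod_list ev_linear_form o_def)
  moreover have "invariant_line V P" if "P \<in> set (map linear_form Ls)" for P
    using that inv by (auto intro: invariant_lineI)
  ultimately show ?thesis
    using foliation_form_of_field[OF V ncf] foliation_of_self[of "form_of_field V"] V infl(1)
    unfolding convex_foliations_def foliations_def foliation_field_def by blast
qed

lemma affine_part_nth: "affine_part \<Omega> $ 1 = poly (\<Omega> $ 1) 1" "affine_part \<Omega> $ 2 = poly (\<Omega> $ 2) 1"
  by (simp_all add: affine_part_def axis_def)

text \<open>Homogeneity recovers the first two coefficients from the chart up to \<open>z\<^sup>k\<close>, and the Euler relation recovers the
  third one.  As \<open>z\<close> is not a common factor, \<open>k = 0\<close>.\<close>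

lemma affine_unique_le:
  assumes \<Omega>': "foliation_form (d + k) \<Omega>'" and \<Omega>: "foliation_form d \<Omega>" and a: "affine_part \<Omega>' = [:[:c:]:] *s affine_part \<Omega>"
  shows "\<Omega>' = const3 c *s \<Omega>"
proof -
  have h: "hom (d + k + 1) (ev (\<Omega>' $ i))" "hom (d + 1) (ev (\<Omega> $ i))" for i
    using \<Omega>' \<Omega> by (auto simp: foliation_form_def intro: homogeneous_hom simp del: hom.simps)
  have chart: "ev (\<Omega>' $ i) (vector [x, y, 1]) = c * ev (\<Omega> $ i) (vector [x, y, 1])" if "i = 1 \<or> i = 2" for i x y
  proof -
    have "poly (\<Omega>' $ i) 1 = [:[:c:]:] * poly (\<Omega> $ i) 1"
      using that a affine_part_nth[of \<Omega>'] affine_part_nth[of \<Omega>] by (metis vector_smult_component)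
    moreover have "ev P (vector [x, y, 1]) = poly (poly (poly P 1) [:y:]) x" for P
      by (simp add: ev_def one_pCons)
    ultimately show ?thesis by simp
  qed
  have two: "p$3 * ev (\<Omega>' $ i) p = p$3 * (c * (p$3)^k * ev (\<Omega> $ i) p)" if i: "i = 1 \<or> i = 2" for i p
  proof (cases "p$3 = 0")
    case False
    let ?q = "vector [p$1 / p$3, p$2 / p$3, 1] :: complex^3"
    have p: "p = p$3 *s ?q" using False by (simp add: vec3_eq_iff)
    have "ev (\<Omega>' $ i) p = (p$3)^(d + k + 1) * ev (\<Omega>' $ i) ?q" "ev (\<Omega> $ i) p = (p$3)^(d + 1) * ev (\<Omega> $ i) ?q"
      using hom_homogeneous[OF h(1)[of i], of "p$3" ?q] hom_homogeneous[OF h(2)[of i], of "p$3" ?q] p by metis+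
    then show ?thesis using chart[OF i] by (simp add: power_add algebra_simps)
  qed simp
  have euler: "p$1 * ev (\<Omega> $ 1) p + p$2 * ev (\<Omega> $ 2) p + p$3 * ev (\<Omega> $ 3) p = 0" if "foliation_form e \<Omega>" for e \<Omega> p
  proof -
    have "(\<Sum>i\<in>UNIV. coords $ i * \<Omega> $ i) = 0" using that by (simp add: foliation_form_def)
    from arg_cong[OF this, of "\<lambda>P. ev P p"] show ?thesis by (simp add: sum_3 ev_coords)
  qed
  have id: "z * (z * w') = z * (z * (t * w))"
    if "x * u' + y * v' + z * w' = 0" "x * u + y * v + z * w = 0" "z * u' = z * (t * u)" "z * v' = z * (t * v)" for x y z t u v w u' v' w' :: complex
    using that by algebra
  have three: "p$3 * (p$3 * ev (\<Omega>' $ 3) p) = p$3 * (p$3 * (c * (p$3)^k * ev (\<Omega> $ 3) p))" for p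
    by (rule id[OF euler[OF \<Omega>', of p] euler[OF \<Omega>, of p] two[OF disjI1[OF refl], of p] two[OF disjI2[OF refl], of p]])
  have each: "p$3 * (p$3 * ev (\<Omega>' $ i) p) = p$3 * (p$3 * (c * (p$3)^k * ev (\<Omega> $ i) p))" for i p
  proof (cases "i = 3")
    case True then show ?thesis using three by simp
  next
    case False
    then have "i = 1 \<or> i = 2" using exhaust_3[of i] by blast
    then show ?thesis by (simp only: two)
  qed
  have all: "coords$3 * (coords$3 * \<Omega>' $ i) = coords$3 * (coords$3 * (const3 c * coords$3 ^ k * \<Omega> $ i))" for i
  proof (rule ev_inject)
    show "ev (coords$3 * (coords$3 * \<Omega>' $ i)) p = ev (coords$3 * (coords$3 * (const3 c * coords$3 ^ k * \<Omega> $ i))) p" for p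
      using each[of p i] by (simp only: ev_simps ev_coords)
  qed
  have z: "coords $ 3 \<noteq> 0" by (simp add: coords_nth)
  have eq: "\<Omega>' $ i = const3 c * coords$3 ^ k * \<Omega> $ i" for i using all[of i] z by (metis mult_left_cancel)
  have "k = 0"
  proof (rule ccontr)
    assume "k \<noteq> 0"
    then have "coords $ 3 dvd coords $ 3 ^ k" by (simp add: dvd_power)
    then have "coords $ 3 dvd \<Omega>' $ i" for i unfolding eq by (intro dvd_mult2 dvd_mult)
    then have "coords $ 3 dvd 1" using \<Omega>' unfolding foliation_form_def no_common_factor_def by blast
    then obtain K where "1 = coords $ 3 * K" by (rule dvdE)
    from arg_cong[OF this, of "\<lambda>P. ev P 0"] show False by (simp add: ev_coords)
  qed
  then show ?thesis unfolding vec_eq_iff using eq by simp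
qed

lemma affine_foliation_eq:
  assumes \<Omega>: "foliation_form d \<Omega>" and a: "affine_part \<Omega> = [:[:c:]:] *s \<omega>" "c \<noteq> 0"
  shows "affine_foliation \<omega> = foliation_of \<Omega>"
proof
  have w: "\<omega> = [:[:1 / c:]:] *s affine_part \<Omega>" using a by (simp add: vec_eq_iff one_pCons[symmetric])
  show "affine_foliation \<omega> \<subseteq> foliation_of \<Omega>"
  proof
    fix \<Omega>' assume "\<Omega>' \<in> affine_foliation \<omega>"
    then obtain e c' where e: "foliation_form e \<Omega>'" "c' \<noteq> 0" "affine_part \<Omega>' = [:[:c':]:] *s \<omega>"
      unfolding affine_foliation_def by blast
    have 1: "affine_part \<Omega>' = [:[:c' / c:]:] *s affine_part \<Omega>" unfolding e(3) w by (simp add: vec_eq_iff)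
    have 2: "affine_part \<Omega> = [:[:c / c':]:] *s affine_part \<Omega>'" unfolding 1 using e(2) a(2) by (simp add: vec_eq_iff one_pCons[symmetric])
    show "\<Omega>' \<in> foliation_of \<Omega>"
    proof (cases "d \<le> e")
      case True
      then have "\<Omega>' = const3 (c' / c) *s \<Omega>" using affine_unique_le[OF _ \<Omega> 1, of "e - d"] e(1) by simp
      then show ?thesis unfolding foliation_of_def using e(2) a(2) by (intro CollectI exI[of _ "c' / c"]) simp
    next
      case False
      then have "\<Omega> = const3 (c / c') *s \<Omega>'" using affine_unique_le[OF _ e(1) 2, of "d - e"] \<Omega> by simp
      then have "const3 (c' / c) *s \<Omega> = \<Omega>'" using e(2) a(2) const3_1[of \<Omega>'] by (simp add: vec_eq_iff)
      then show ?thesis unfolding foliation_of_def using e(2) a(2) by (intro CollectI exI[of _ "c' / c"]) auto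
    qed
  qed
  show "foliation_of \<Omega> \<subseteq> affine_foliation \<omega>"
  proof
    fix \<Omega>' assume "\<Omega>' \<in> foliation_of \<Omega>"
    then obtain s where s: "s \<noteq> 0" "\<Omega>' = const3 s *s \<Omega>" unfolding foliation_of_def by blast
    have "foliation_form d \<Omega>'"
      unfolding foliation_form_def
    proof (intro conjI allI)
      have "homogeneous (0 + (d + 1)) (const3 s * \<Omega> $ i)" for i
        using \<Omega> by (intro homogeneous_mult homogeneous_const) (simp add: foliation_form_def)
      then show "homogeneous (d + 1) (\<Omega>' $ i)" for i by (simp add: s(2))
      show "no_common_factor \<Omega>'"
        unfolding no_common_factor_def
      proof (intro allI impI)
        fix r assume "\<forall>i. r dvd \<Omega>' $ i"
        then have "r dvd const3 (1 / s) * \<Omega>' $ i" for i by (intro dvd_mult) blast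
        moreover have "const3 (1 / s) * \<Omega>' $ i = \<Omega> $ i" for i using s const3_1[of \<Omega>] by (simp add: vec_eq_iff)
        ultimately show "r dvd 1" using \<Omega> unfolding foliation_form_def no_common_factor_def by metis
      qed
      have "(\<Sum>i\<in>UNIV. coords $ i * \<Omega>' $ i) = const3 s * (\<Sum>i\<in>UNIV. coords $ i * \<Omega> $ i)"
        unfolding s(2) sum_distrib_left vector_smult_component by (simp only: mult.left_commute)
      then show "(\<Sum>i\<in>UNIV. coords $ i * \<Omega>' $ i) = 0" using \<Omega> by (simp add: foliation_form_def)
    qed
    moreover have "affine_part \<Omega>' = [:[:s * c:]:] *s \<omega>"
    proof -
      have "affine_part \<Omega>' = [:[:s:]:] *s affine_part \<Omega>"
        unfolding s(2) by (simp add: vec_eq_iff forall_2 affine_part_nth)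
      then show ?thesis unfolding a(1) by (simp add: vec_eq_iff mult.commute)
    qed
    ultimately show "\<Omega>' \<in> affine_foliation \<omega>" unfolding affine_foliation_def using s(1) a(2) by (metis (mono_tags, lifting) mem_Collect_eq mult_eq_0_iff)
  qed
qed

section \<open>The four foliations\<close>

definition VH1 :: "poly3^3" where "VH1 = vector [coords$1^3, coords$2^3, 0]"
definition VH3 :: "poly3^3" where
  "VH3 = vector [coords$1^2 * (coords$1 + const3 3 * coords$2), coords$2^2 * (const3 3 * coords$1 + coords$2), 0]"
definition VF1 :: "poly3^3" where "VF1 = vector [0, coords$2^3, coords$1^3]"
definition VF3 :: "poly3^3" where "VF3 = vector [coords$1^3, coords$2^3, coords$3^3]"

lemma evf_fields: "evf VH1 = ZH1" "evf VH3 = ZH3" "evf VF1 = ZF1" "evf VF3 = ZF3"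
  unfolding fun_eq_iff vec3_eq_iff
  by (simp_all add: VH1_def VH3_def VF1_def VF3_def ZH1_def ZH3_def ZF1_def ZF3_def ev_coords)

lemma homogeneous_cubes:
  "homogeneous 3 (coords $ i ^ 3)" "homogeneous 3 (coords $ i ^ 2 * (const3 a * coords $ j + coords $ k))"
  "homogeneous 3 (coords $ i ^ 2 * (coords $ j + const3 a * coords $ k))"
proof -
  show "homogeneous 3 (coords $ i ^ 3)" using homogeneous_power[OF homogeneous_coords[of i], of 3] by simp
  have c: "homogeneous 1 (const3 a * coords $ j)" for j
    using homogeneous_mult[OF homogeneous_const homogeneous_coords, of a j] by simp
  have "homogeneous 3 (coords $ i ^ 2 * P)" if "homogeneous 1 P" for P
    using homogeneous_mult[OF homogeneous_power[OF homogeneous_coords[of i], of 2] that] by simp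
  then show "homogeneous 3 (coords $ i ^ 2 * (const3 a * coords $ j + coords $ k))"
    "homogeneous 3 (coords $ i ^ 2 * (coords $ j + const3 a * coords $ k))"
    using c homogeneous_coords by (blast intro: homogeneous_add)+
qed

lemma homogeneous_fields: "homogeneous 3 (VH1 $ i)" "homogeneous 3 (VH3 $ i)" "homogeneous 3 (VF1 $ i)" "homogeneous 3 (VF3 $ i)"
  using exhaust_3[of i] homogeneous_0[of 3] homogeneous_cubes
  by (auto simp: VH1_def VH3_def VF1_def VF3_def)

definition LH1 :: "(complex^3) list" where
  "LH1 = [ex1, ex1, ex1, ex2, ex2, ex2, ex3, vector [1, -1, 0], vector [1, 1, 0]]"
definition LH3 :: "(complex^3) list" where
  "LH3 = [ex1, ex1, ex2, ex2, ex3, vector [1, -1, 0], vector [1, 1, 0], vector [1, 1, 0], vector [1, 1, 0]]"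
definition LF1 :: "(complex^3) list" where
  "LF1 = [ex1, ex1, ex1, ex1, ex2, ex2, ex2, ex2, ex2]"
definition LF3 :: "(complex^3) list" where
  "LF3 = [ex1, ex2, ex3, vector [1, -1, 0], vector [1, 1, 0], vector [1, 0, -1], vector [1, 0, 1], vector [0, 1, -1], vector [0, 1, 1]]"

lemma infl_of_cubic:
  assumes "\<And>x y z. Z (vector [x, y, z]) = vector [cubic a x y z, cubic b x y z, cubic c x y z]"
  shows "infl Z (vector [x, y, z]) =
     (let u = cubic a x y z; v = cubic b x y z; w = cubic c x y z;
          u' = cubic_x a x y z * u + cubic_y a x y z * v + cubic_z a x y z * w;
          v' = cubic_x b x y z * u + cubic_y b x y z * v + cubic_z b x y z * w;
          w' = cubic_x c x y z * u + cubic_y c x y z * v + cubic_z c x y z * w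
      in x * (v * w' - w * v') + y * (w * u' - u * w') + z * (u * v' - v * u'))"
  by (rule infl_cubic[OF assms cubic_deriv cubic_deriv cubic_deriv])

abbreviation "unit_coeff k \<equiv> (\<lambda>i. if i = k then 1 else 0 :: complex)"

lemma infl_ZH1: "infl ZH1 p = - 3 * (\<Prod>L\<leftarrow>LH1. dot L p)"
proof -
  have e: "ZH1 (vector [x, y, z]) = vector [cubic (unit_coeff 0) x y z, cubic (unit_coeff 3) x y z, cubic (\<lambda>_. 0) x y z]" for x y z
    by (simp add: ZH1_def cubic_def bq_defs)
  have "infl ZH1 (vector [x, y, z]) = - 3 * (\<Prod>L\<leftarrow>LH1. dot L (vector [x, y, z]))" for x y z
    unfolding infl_of_cubic[OF e] by (simp add: LH1_def Let_def cubic_defs dot_def[of "vector _"] algebra_simps eval_nat_numeral)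
  from this[of "p$1" "p$2" "p$3"] show ?thesis by (simp add: vec3_collapse)
qed

lemma infl_ZH3: "infl ZH3 p = - 6 * (\<Prod>L\<leftarrow>LH3. dot L p)"
proof -
  have e: "ZH3 (vector [x, y, z]) = vector [cubic (\<lambda>i. if i = 0 then 1 else if i = 1 then 3 else 0) x y z,
     cubic (\<lambda>i. if i = 3 then 1 else if i = 2 then 3 else 0) x y z, cubic (\<lambda>_. 0) x y z]" for x y z
    by (simp add: ZH3_def cubic_def bq_defs algebra_simps power2_eq_square power3_eq_cube)
  have "infl ZH3 (vector [x, y, z]) = - 6 * (\<Prod>L\<leftarrow>LH3. dot L (vector [x, y, z]))" for x y z
    unfolding infl_of_cubic[OF e] by (simp add: LH3_def Let_def cubic_defs dot_def[of "vector _"] algebra_simps eval_nat_numeral)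
  from this[of "p$1" "p$2" "p$3"] show ?thesis by (simp add: vec3_collapse)
qed

lemma infl_ZF1: "infl ZF1 p = - 3 * (\<Prod>L\<leftarrow>LF1. dot L p)"
proof -
  have e: "ZF1 (vector [x, y, z]) = vector [cubic (\<lambda>_. 0) x y z, cubic (unit_coeff 3) x y z, cubic (unit_coeff 0) x y z]" for x y z
    by (simp add: ZF1_def cubic_def bq_defs)
  have "infl ZF1 (vector [x, y, z]) = - 3 * (\<Prod>L\<leftarrow>LF1. dot L (vector [x, y, z]))" for x y z
    unfolding infl_of_cubic[OF e] by (simp add: LF1_def Let_def cubic_defs algebra_simps eval_nat_numeral)
  from this[of "p$1" "p$2" "p$3"] show ?thesis by (simp add: vec3_collapse)
qed

lemma infl_ZF3: "infl ZF3 p = - 3 * (\<Prod>L\<leftarrow>LF3. dot L p)"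
proof -
  have e: "ZF3 (vector [x, y, z]) = vector [cubic (unit_coeff 0) x y z, cubic (unit_coeff 3) x y z, cubic (unit_coeff 9) x y z]" for x y z
    by (simp add: ZF3_def cubic_def bq_defs)
  have "infl ZF3 (vector [x, y, z]) = - 3 * (\<Prod>L\<leftarrow>LF3. dot L (vector [x, y, z]))" for x y z
    unfolding infl_of_cubic[OF e] by (simp add: LF3_def Let_def cubic_defs dot_def[of "vector _"] algebra_simps eval_nat_numeral)
  from this[of "p$1" "p$2" "p$3"] show ?thesis by (simp add: vec3_collapse)
qed

lemma line_eqs:
  "dot (vector [1, -1, 0]) p = 0 \<longleftrightarrow> p$1 = p$2" "dot (vector [1, 1, 0]) p = 0 \<longleftrightarrow> p$1 = - p$2"
  "dot (vector [1, 0, -1]) p = 0 \<longleftrightarrow> p$1 = p$3" "dot (vector [1, 0, 1]) p = 0 \<longleftrightarrow> p$1 = - p$3"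
  "dot (vector [0, 1, -1]) p = 0 \<longleftrightarrow> p$2 = p$3" "dot (vector [0, 1, 1]) p = 0 \<longleftrightarrow> p$2 = - p$3"
  by (auto simp: dot_def eq_neg_iff_add_eq_0)

lemma lines_nonzero: "L \<in> set LH1 \<Longrightarrow> L \<noteq> 0" "L \<in> set LH3 \<Longrightarrow> L \<noteq> 0" "L \<in> set LF1 \<Longrightarrow> L \<noteq> 0" "L \<in> set LF3 \<Longrightarrow> L \<noteq> 0"
  by (auto simp: LH1_def LH3_def LF1_def LF3_def vec3_eq_iff)

lemma lines_invariant:
  "L \<in> set LH1 \<Longrightarrow> dot L p = 0 \<Longrightarrow> dot L (ZH1 p) = 0" "L \<in> set LH3 \<Longrightarrow> dot L p = 0 \<Longrightarrow> dot L (ZH3 p) = 0"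
  "L \<in> set LF1 \<Longrightarrow> dot L p = 0 \<Longrightarrow> dot L (ZF1 p) = 0" "L \<in> set LF3 \<Longrightarrow> dot L p = 0 \<Longrightarrow> dot L (ZF3 p) = 0"
  by (auto simp: LH1_def LH3_def LF1_def LF3_def line_eqs ZH1_def ZH3_def ZF1_def ZF3_def)

lemma ncf_H1: "no_common_factor (form_of_field VH1)"
proof (rule no_common_factorI[where l=3 and m=1 and k=1 and j=3 and c=1 and u="[:0, 0, 0, 1:]"])
  show "form_of_field VH1 $ 3 = [:[:0, [:0, 0, 0, 1:], 0, - [:0, 1:]:]:]"
    by (simp add: form_of_field_nth VH1_def coords_nth power3_eq_cube)
  fix s assume "\<And>i k. s dvd coeff (form_of_field VH1 $ i) k"
  from this[of 2 1] have "s dvd - [:[:0, 0, 0, 1:]:]" by (simp add: form_of_field_nth VH1_def coords_nth power3_eq_cube)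
  then show "s dvd [:[:0, 0, 0, 1:]:]" by (simp only: dvd_minus_iff)
next
  show "coeff (coeff (form_of_field VH1 $ 1) 1) 3 = [:1:]"
    by (simp add: form_of_field_nth VH1_def coords_nth power3_eq_cube eval_nat_numeral)
qed simp_all

lemma ncf_H3: "no_common_factor (form_of_field VH3)"
proof (rule no_common_factorI[where l=3 and m=1 and k=1 and j=3 and c=1 and u="[:0, 0, 0, 0, 0, 0, 0, 0, 0, 8:]"])
  show "form_of_field VH3 $ 3 = [:[:0, [:0, 0, 0, 1:], 0, - [:0, 1:]:]:]"
    by (simp add: form_of_field_nth VH3_def coords_nth power2_eq_square)
  fix s assume s: "\<And>i k. s dvd coeff (form_of_field VH3 $ i) k"
  let ?A = "[:0, 0, [:0, 3:], 1:] :: poly2" and ?B = "[:[:0, 0, 0, 1:], [:0, 0, 3:]:] :: poly2"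
  have A: "s dvd ?A" using s[of 1 1] by (simp add: form_of_field_nth VH3_def coords_nth power2_eq_square one_pCons)
  have "s dvd - ?B" using s[of 2 1] by (simp add: form_of_field_nth VH3_def coords_nth power2_eq_square)
  then have B: "s dvd ?B" by (simp only: dvd_minus_iff)
  \<comment> \<open>pseudo-division of the first polynomial by the second one, in \<open>y\<close>\<close>
  have "[:[:0, 0, 0, 0, 0, 0, 27:]:] * ?A - [:[:0, 0, 0, 0, 0, 0, - 8:], [:0, 0, 0, 0, 0, 24:], [:0, 0, 0, 0, 9:]:] * ?B
     = [:[:0, 0, 0, 0, 0, 0, 0, 0, 0, 8:]:]"
    by simp
  then show "s dvd [:[:0, 0, 0, 0, 0, 0, 0, 0, 0, 8:]:]" using A B by (metis dvd_diff dvd_mult)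
next
  show "coeff (coeff (form_of_field VH3 $ 1) 1) 3 = [:1:]"
    by (simp add: form_of_field_nth VH3_def coords_nth power2_eq_square eval_nat_numeral)
qed simp_all

lemma ncf_F1: "no_common_factor (form_of_field VF1)"
proof (rule no_common_factorI[where l=3 and m=1 and k=1 and j=3 and c=1 and u="[:0, 0, 0, 0, 1:]"])
  show "form_of_field VF1 $ 3 = [:[:0, 0, 0, - [:0, 1:]:]:]"
    by (simp add: form_of_field_nth VF1_def coords_nth power3_eq_cube)
  fix s assume s: "\<And>i k. s dvd coeff (form_of_field VF1 $ i) k"
  show "s dvd [:[:0, 0, 0, 0, 1:]:]" using s[of 2 0] by (simp add: form_of_field_nth VF1_def coords_nth power3_eq_cube)
next
  show "coeff (coeff (form_of_field VF1 $ 1) 1) 3 = [:1:]"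
    by (simp add: form_of_field_nth VF1_def coords_nth power3_eq_cube eval_nat_numeral)
qed simp_all

lemma ncf_F3: "no_common_factor (form_of_field VF3)"
proof (rule no_common_factorI[where l=3 and m=1 and k=3 and j=1 and c="-1" and u="[:0, 1:]"])
  show "form_of_field VF3 $ 3 = [:[:0, [:0, 0, 0, 1:], 0, - [:0, 1:]:]:]"
    by (simp add: form_of_field_nth VF3_def coords_nth power3_eq_cube)
  fix s assume s: "\<And>i k. s dvd coeff (form_of_field VF3 $ i) k"
  show "s dvd [:[:0, 1:]:]" using s[of 2 3] by (simp add: form_of_field_nth VF3_def coords_nth power3_eq_cube eval_nat_numeral)
next
  show "coeff (coeff (form_of_field VF3 $ 1) 3) 1 = [:-1:]"
    by (simp add: one_pCons form_of_field_nth VF3_def coords_nth power3_eq_cube eval_nat_numeral)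
qed simp_all

lemma H1_eq: "H1 = foliation_of (form_of_field VH1)"
  unfolding H1_def
proof (rule affine_foliation_eq[OF foliation_form_of_field[OF homogeneous_fields(1) ncf_H1], where c=1])
  show "affine_part (form_of_field VH1) = [:[:1:]:] *s (aff_y^3 *s aff_dx - aff_x^3 *s aff_dy)"
    by (simp add: vec_eq_iff forall_2 affine_part_nth form_of_field_nth VH1_def axis_def coords_nth one_pCons power3_eq_cube)
qed simp

lemma H3_eq: "H3 = foliation_of (form_of_field VH3)"
  unfolding H3_def
proof (rule affine_foliation_eq[OF foliation_form_of_field[OF homogeneous_fields(2) ncf_H3], where c=1])
  have 3: "(3 :: poly2) = [:[:3:]:]" by (simp add: numeral_poly)
  show "affine_part (form_of_field VH3) = [:[:1:]:] *s ((aff_y^2 * (3 * aff_x + aff_y)) *s aff_dx - (aff_x^2 * (aff_x + 3 * aff_y)) *s aff_dy)"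
    unfolding 3 by (simp add: vec_eq_iff forall_2 affine_part_nth form_of_field_nth VH3_def axis_def coords_nth one_pCons power2_eq_square)
qed simp

lemma F1_eq: "F1 = foliation_of (form_of_field VF1)"
  unfolding F1_def
proof (rule affine_foliation_eq[OF foliation_form_of_field[OF homogeneous_fields(3) ncf_F1], where c=1])
  show "affine_part (form_of_field VF1) = [:[:1:]:] *s (aff_y^3 *s aff_dx + aff_x^3 *s (aff_x *s aff_dy - aff_y *s aff_dx))"
    by (simp add: vec_eq_iff forall_2 affine_part_nth form_of_field_nth VF1_def axis_def coords_nth one_pCons power3_eq_cube)
qed simp

lemma F3_eq: "F3 = foliation_of (form_of_field VF3)"
  unfolding F3_def
proof (rule affine_foliation_eq[OF foliation_form_of_field[OF homogeneous_fields(4) ncf_F3], where c="-1"])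
  show "affine_part (form_of_field VF3) = [:[:-1:]:] *s ((aff_x^3 - aff_x) *s aff_dy - (aff_y^3 - aff_y) *s aff_dx)"
    by (simp add: vec_eq_iff forall_2 affine_part_nth form_of_field_nth VF3_def axis_def coords_nth one_pCons power3_eq_cube)
qed simp

lemma four_convex: "H1 \<in> convex_foliations 3" "H3 \<in> convex_foliations 3" "F1 \<in> convex_foliations 3" "F3 \<in> convex_foliations 3"
proof -
  show "H1 \<in> convex_foliations 3"
    unfolding H1_eq by (rule convex_foliationI[OF homogeneous_fields(1) ncf_H1, where c="-3" and Ls=LH1])
      (use infl_ZH1 lines_nonzero(1) lines_invariant(1) in \<open>auto simp: evf_fields\<close>)
  show "H3 \<in> convex_foliations 3"
    unfolding H3_eq by (rule convex_foliationI[OF homogeneous_fields(2) ncf_H3, where c="-6" and Ls=LH3])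
      (use infl_ZH3 lines_nonzero(2) lines_invariant(2) in \<open>auto simp: evf_fields\<close>)
  show "F1 \<in> convex_foliations 3"
    unfolding F1_eq by (rule convex_foliationI[OF homogeneous_fields(3) ncf_F1, where c="-3" and Ls=LF1])
      (use infl_ZF1 lines_nonzero(3) lines_invariant(3) in \<open>auto simp: evf_fields\<close>)
  show "F3 \<in> convex_foliations 3"
    unfolding F3_eq by (rule convex_foliationI[OF homogeneous_fields(4) ncf_F3, where c="-3" and Ls=LF3])
      (use infl_ZF3 lines_nonzero(4) lines_invariant(4) in \<open>auto simp: evf_fields\<close>)
qed

section \<open>Multiplicities of the inflection lines\<close>

definition multiplicity :: "complex^3 \<Rightarrow> (complex^3) list \<Rightarrow> nat" where
  "multiplicity K Ls = length (filter (\<lambda>L. ccross K L = 0) Ls)"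

text \<open>A set suffices to tell the four foliations apart.\<close>

definition multiplicities :: "(complex^3) list \<Rightarrow> nat set" where
  "multiplicities Ls = (\<lambda>L. multiplicity L Ls) ` set Ls"

lemma parallel_scale:
  assumes "ccross K L = 0" "K \<noteq> 0" obtains t where "L = t *s K"
proof -
  have e: "K$2 * L$3 = K$3 * L$2" "K$3 * L$1 = K$1 * L$3" "K$1 * L$2 = K$2 * L$1"
    using assms(1) unfolding vec3_eq_iff by simp_all
  consider "K$1 \<noteq> 0" | "K$2 \<noteq> 0" | "K$3 \<noteq> 0" using assms(2) by (auto simp: vec3_eq_iff)
  then show ?thesis
  proof cases
    case 1 then show ?thesis using e by (intro that[of "L$1 / K$1"]) (simp add: vec3_eq_iff field_simps)
  next
    case 2 then show ?thesis using e by (intro that[of "L$2 / K$2"]) (simp add: vec3_eq_iff field_simps)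
  next
    case 3 then show ?thesis using e by (intro that[of "L$3 / K$3"]) (simp add: vec3_eq_iff field_simps)
  qed
qed

lemma ccross_scale: "ccross (t *s K) L = t *s ccross K L"
  by (simp add: vec3_eq_iff algebra_simps)

text \<open>After moving \<open>K\<close> to \<open>y = 0\<close>, the forms not parallel to \<open>K\<close> restrict to nonzero forms in \<open>x, z\<close>, and so
  does their product.\<close>

lemma vanishing_product:
  assumes K: "K \<noteq> 0" and v: "\<And>p. dot K p = 0 \<Longrightarrow> (\<Prod>L\<leftarrow>Ls. dot L p) = 0"
  shows "\<exists>L\<in>set Ls. ccross K L = 0"
proof -
  have "\<exists>p. p \<noteq> 0 \<and> dot K p = 0"
  proof (cases "K$1 = 0")
    case True then show ?thesis by (intro exI[of _ ex1]) (simp add: vec3_eq_iff)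
  next
    case False then show ?thesis by (intro exI[of _ "vector [- K$2, K$1, 0]"]) (simp add: vec3_eq_iff dot_def algebra_simps)
  qed
  then obtain p0 where "p0 \<noteq> 0" "dot K p0 = 0" by blast
  from adapt_one[OF K this] obtain M where M: "invertible M" "K v* M = ex2" by metis
  let ?r = "\<lambda>L. vector [(L v* M)$1, 0, (L v* M)$3] :: complex^3"
  have "\<exists>L\<in>set Ls. ?r L = 0"
  proof (rule ccontr)
    assume "\<not> ?thesis"
    then have "\<forall>J\<in>set (map ?r Ls). J \<noteq> 0" by auto
    then obtain p where p: "(\<Prod>J\<leftarrow>map ?r Ls. dot J p) \<noteq> 0" using prod_list_dot_nonzero by blast
    let ?q = "M *v vector [p$1, 0, p$3]"
    have "dot (?r L) p = dot L ?q" for L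
      unfolding dot_vm[symmetric] by (simp add: dot_def)
    then have "(\<Prod>L\<leftarrow>Ls. dot L ?q) \<noteq> 0" using p by (simp add: o_def)
    moreover have "dot K ?q = 0" unfolding dot_vm[symmetric] M(2) by simp
    ultimately show False using v by blast
  qed
  then obtain L where L: "L \<in> set Ls" "?r L = 0" by blast
  have "ccross (K v* M) (L v* M) = 0" using L(2) unfolding M(2) by (simp add: vec3_eq_iff)
  then show ?thesis using L(1) ccross_transport[OF M(1)] by blast
qed

text \<open>Unique factorization for products of linear forms: parallel factors are cancelled in pairs.\<close>

lemma multiplicity_eq:
  assumes "\<And>p. c * (\<Prod>L\<leftarrow>As. dot L p) = d * (\<Prod>L\<leftarrow>Bs. dot L p)" "c \<noteq> 0" "d \<noteq> 0" "K \<noteq> 0"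
    "\<And>L. L \<in> set As \<Longrightarrow> L \<noteq> 0" "\<And>L. L \<in> set Bs \<Longrightarrow> L \<noteq> 0"
  shows "multiplicity K As = multiplicity K Bs"
  using assms
proof (induction "length As" arbitrary: As Bs d rule: less_induct)
  case less
  have par: "\<exists>L\<in>set Ys. ccross K L = 0" if "x \<noteq> 0" "y \<noteq> 0" "\<And>p. x * (\<Prod>L\<leftarrow>Xs. dot L p) = y * (\<Prod>L\<leftarrow>Ys. dot L p)" "A \<in> set Xs" "ccross K A = 0" for x y Xs Ys A
  proof (rule vanishing_product[OF less.prems(4)])
    note h = that
    fix p assume "dot K p = 0"
    moreover obtain t where "A = t *s K" using parallel_scale[OF h(5) less.prems(4)] .
    ultimately have "dot A p = 0" by simp
    then have "(\<Prod>L\<leftarrow>Xs. dot L p) = 0" using prod_list_remove1[OF h(4), of "\<lambda>L. dot L p"] by simp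
    then show "(\<Prod>L\<leftarrow>Ys. dot L p) = 0" using h(2) h(3)[of p] by simp
  qed
  show ?case
  proof (cases "\<exists>A\<in>set As. ccross K A = 0")
    case False
    moreover have "\<not> (\<exists>B\<in>set Bs. ccross K B = 0)" using False par[OF less.prems(3,2) less.prems(1)[symmetric]] by blast
    ultimately show ?thesis by (simp add: multiplicity_def filter_empty_conv)
  next
    case True
    then obtain A where A: "A \<in> set As" "ccross K A = 0" by blast
    then obtain B where B: "B \<in> set Bs" "ccross K B = 0" using par[OF less.prems(2,3,1)] by blast
    obtain t u where tu: "A = t *s K" "B = u *s K" using parallel_scale less.prems(4) A(2) B(2) by metis
    have nz: "t \<noteq> 0" "u \<noteq> 0" using less.prems(5)[OF A(1)] less.prems(6)[OF B(1)] tu by auto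
    have eq: "(c * t) * (\<Prod>L\<leftarrow>remove1 A As. dot L p) = (d * u) * (\<Prod>L\<leftarrow>remove1 B Bs. dot L p)" for p
    proof (rule pol_cancel_dot[where L=K and f="\<lambda>p. (c * t) * (\<Prod>L\<leftarrow>remove1 A As. dot L p)" and g="\<lambda>p. (d * u) * (\<Prod>L\<leftarrow>remove1 B Bs. dot L p)"])
      fix p
      show "dot K p * ((c * t) * (\<Prod>L\<leftarrow>remove1 A As. dot L p)) = dot K p * ((d * u) * (\<Prod>L\<leftarrow>remove1 B Bs. dot L p))"
        using less.prems(1)[of p] prod_list_remove1[OF A(1), of "\<lambda>L. dot L p"] prod_list_remove1[OF B(1), of "\<lambda>L. dot L p"]
        by (simp add: tu mult_ac)
    qed (use less.prems(4) in \<open>auto intro: pol_intros pol_prod_list\<close>)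
    have "c * (\<Prod>L\<leftarrow>remove1 A As. dot L p) = (d * u / t) * (\<Prod>L\<leftarrow>remove1 B Bs. dot L p)" for p
      using eq[of p] nz by (simp add: field_simps)
    then have "multiplicity K (remove1 A As) = multiplicity K (remove1 B Bs)"
      by (rule less.hyps[rotated]) (use less.prems nz A(1) length_pos_if_in_set[OF A(1)] in \<open>auto simp: length_remove1 dest: notin_set_remove1 split: if_splits\<close>)
    then show ?thesis using A B unfolding multiplicity_def by (simp add: length_filter_remove1)
  qed
qed

lemma multiplicities_eq:
  assumes e: "\<And>p. c * (\<Prod>L\<leftarrow>As. dot L p) = d * (\<Prod>L\<leftarrow>Bs. dot L p)" "c \<noteq> 0" "d \<noteq> 0"
    and nz: "\<And>L. L \<in> set As \<Longrightarrow> L \<noteq> 0" "\<And>L. L \<in> set Bs \<Longrightarrow> L \<noteq> 0"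
  shows "multiplicities As = multiplicities Bs"
proof -
  have sub: "multiplicities As \<subseteq> multiplicities Bs"
    if e: "\<And>p. c * (\<Prod>L\<leftarrow>As. dot L p) = d * (\<Prod>L\<leftarrow>Bs. dot L p)" "c \<noteq> 0" "d \<noteq> 0"
      and nz: "\<And>L. L \<in> set As \<Longrightarrow> L \<noteq> 0" "\<And>L. L \<in> set Bs \<Longrightarrow> L \<noteq> 0" for c d As Bs
  proof
    fix n assume "n \<in> multiplicities As"
    then obtain L where L: "L \<in> set As" "n = multiplicity L As" unfolding multiplicities_def by blast
    have n: "n = multiplicity L Bs" unfolding L(2) by (rule multiplicity_eq[OF e nz(1)[OF L(1)] nz])
    have "ccross L L = 0" by (simp add: vec3_eq_iff)
    then have "L \<in> set (filter (\<lambda>J. ccross L J = 0) As)" using L(1) by simp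
    then have "n \<noteq> 0" unfolding L(2) multiplicity_def by (metis length_pos_if_in_set less_numeral_extra(3))
    then obtain K where K: "K \<in> set Bs" "ccross L K = 0" unfolding n multiplicity_def by (auto simp: filter_empty_conv)
    obtain t where t: "K = t *s L" using parallel_scale[OF K(2) nz(1)[OF L(1)]] .
    then have "t \<noteq> 0" using nz(2)[OF K(1)] by auto
    then have "ccross K J = 0 \<longleftrightarrow> ccross L J = 0" for J unfolding t ccross_scale by (simp add: vec3_eq_iff)
    then have "n = multiplicity K Bs" unfolding n multiplicity_def by simp
    then show "n \<in> multiplicities Bs" using K(1) unfolding multiplicities_def by blast
  qed
  show ?thesis using sub[OF e nz] sub[OF e(1)[symmetric] e(3,2) nz(2,1)] by blast
qed

lemma multiplicities_transport:
  assumes "invertible M" shows "multiplicities (map (\<lambda>L. L v* M) Ls) = multiplicities Ls"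
proof -
  have "multiplicity (K v* M) (map (\<lambda>L. L v* M) Ls) = multiplicity K Ls" for K
    unfolding multiplicity_def filter_map length_map o_def ccross_transport[OF assms] ..
  then show ?thesis unfolding multiplicities_def by (simp add: image_image)
qed

text \<open>If two fields define proportional forms, their difference \<open>D\<close> is parallel to the radial field at every point.
  Then \<open>x\<close> divides the first component of \<open>D\<close>, and the quotient is the required quadratic form.\<close>

lemma same_form_gauge:
  assumes Y: "\<And>i. hom 3 (\<lambda>p. Y p $ i)" and X: "\<And>i. hom 3 (\<lambda>p. X p $ i)"
    and e: "\<And>p. field_form Y p = s *s field_form X p"
  obtains g where "hom 2 g" "\<And>p. Y p = s *s X p + g p *s p"
proof -
  let ?D = "\<lambda>i p. Y p $ i - s * X p $ i"
  have D: "hom 3 (?D i)" for i by (intro hom_diff hom_scale Y X)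
  have cr: "p$1 * ?D 2 p = p$2 * ?D 1 p" "p$1 * ?D 3 p = p$3 * ?D 1 p" for p
    using e[of p] unfolding field_form_def vec3_eq_iff vector_smult_component ccross_nth by algebra+
  obtain a where a: "\<And>x y z. ?D 1 (vector [x, y, z]) = cubic a x y z" using hom3_coeffs[OF D[of 1]] by blast
  have "bq3 (a 3) (a 6) (a 8) (a 9) y z = 0" for y z
  proof -
    have e: "?D 1 (vector [0, y, z]) = bq3 (a 3) (a 6) (a 8) (a 9) y z"
      unfolding a by (simp add: cubic_def bq_defs algebra_simps power2_eq_square)
    show ?thesis using cr[of "vector [0, y, z]"] unfolding e by (cases "y = 0"; cases "z = 0") (auto simp: bq_defs)
  qed
  then have a0: "a 3 = 0" "a 6 = 0" "a 8 = 0" "a 9 = 0" using bq_all_0(3)[of "a 3" "a 6" "a 8" "a 9"] by blast+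
  define g where "g p = bq2 (a 0) (a 1) (a 2) (p$1) (p$2) + p$3 * bq1 (a 4) (a 5) (p$1) (p$2) + (p$3)^2 * a 7" for p :: "complex^3"
  have hg: "hom 2 g" unfolding g_def[abs_def] by (rule hom_quadratic)
  have 1: "?D 1 p = p$1 * g p" for p
    using a[of "p$1" "p$2" "p$3"] unfolding vec3_collapse by (simp add: g_def cubic_def bq_defs a0 algebra_simps power2_eq_square power3_eq_cube)
  have c: "?D i p = p$i * g p" if "\<And>p. p$1 * ?D i p = p$i * ?D 1 p" for i p
  proof (rule pol_cancel_dot[where L=ex1 and f="?D i" and g="\<lambda>p. p$i * g p"])
    show "poly_on_lines (?D i)" by (rule pol_hom[OF D])
    show "poly_on_lines (\<lambda>p. p$i * g p)" by (intro pol_mult pol_coord pol_hom[OF hg])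
    show "dot ex1 p * ?D i p = dot ex1 p * (p$i * g p)" for p using that[of p] unfolding 1 by (simp add: algebra_simps)
  qed (simp add: vec3_eq_iff)
  have "Y p = s *s X p + g p *s p" for p
    using 1[of p] c[of 2 p] c[of 3 p] cr by (simp add: vec3_eq_iff algebra_simps)
  then show ?thesis using that hg by blast
qed

text \<open>The pulled back field differs from a multiple of \<open>W\<close> by a multiple of the radial field, so the inflection
  polynomials correspond under the linear map, up to a scalar.\<close>

lemma equivalent_multiplicities:
  assumes e: "(foliation_of (form_of_field V), foliation_of (form_of_field W)) \<in> aut_equiv"
    and V: "\<And>i. homogeneous 3 (V $ i)" and W: "\<And>i. homogeneous 3 (W $ i)"
    and iV: "\<And>p. infl (evf V) p = c * (\<Prod>L\<leftarrow>As. dot L p)" "c \<noteq> 0" "\<And>L. L \<in> set As \<Longrightarrow> L \<noteq> 0"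
    and iW: "\<And>p. infl (evf W) p = d * (\<Prod>L\<leftarrow>Bs. dot L p)" "d \<noteq> 0" "\<And>L. L \<in> set Bs \<Longrightarrow> L \<noteq> 0"
  shows "multiplicities As = multiplicities Bs"
proof -
  obtain M where M: "invertible M" "foliation_of (form_of_field W) = foliation_of (pullback M (form_of_field V))"
    using e unfolding aut_equiv_def by (auto simp: pullback_foliation_of)
  then obtain r where r: "r \<noteq> 0" "form_of_field W = const3 r *s pullback M (form_of_field V)"
    using foliation_of_self[of "form_of_field W"] unfolding M(2) foliation_of_def by blast
  let ?X = "transport M (evf V)"
  define s where "s = r * det M"
  have s: "s \<noteq> 0" using r(1) M(1) by (simp add: s_def invertible_det_nz)
  have hV: "hom 3 (\<lambda>p. evf V p $ i)" and hW: "hom 3 (\<lambda>p. evf W p $ i)" for i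
    using homogeneous_hom[OF V] homogeneous_hom[OF W] by simp_all
  have hX: "hom 3 (\<lambda>p. ?X p $ i)" for i
    unfolding transport_def mv3_nth by (intro hom_add hom_scale hom_linear hV)
  have "field_form (evf W) p = s *s field_form ?X p" for p
  proof -
    have "field_form (evf W) p = r *s evf (pullback M (form_of_field V)) p"
      unfolding evf_form_of_field[symmetric] r(2) by (simp add: vec_eq_iff)
    also have "\<dots> = s *s field_form ?X p"
      unfolding evf_pullback evf_form_of_field field_form_transport[OF M(1)] s_def by (simp add: vec_eq_iff)
    finally show ?thesis .
  qed
  then obtain g where g: "hom 2 g" "\<And>p. evf W p = s *s ?X p + g p *s p" using same_form_gauge[OF hW hX] by metis
  have w: "infl (evf W) p = s^3 * infl ?X p" for p
    using infl_gauge[OF hX g(1), of s p] g(2) by (simp add: g(2)[abs_def])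
  have v: "infl (evf V) (M *v p) = det M * infl ?X p" for p by (rule infl_transport[OF hV M(1)])
  have "(s^3 * c) * (\<Prod>L\<leftarrow>map (\<lambda>L. L v* M) As. dot L p) = (det M * d) * (\<Prod>L\<leftarrow>Bs. dot L p)" for p
  proof -
    have "(\<Prod>L\<leftarrow>map (\<lambda>L. L v* M) As. dot L p) = (\<Prod>L\<leftarrow>As. dot L (M *v p))" by (simp add: o_def dot_vm)
    moreover have "c * (\<Prod>L\<leftarrow>As. dot L (M *v p)) = det M * infl ?X p" "d * (\<Prod>L\<leftarrow>Bs. dot L p) = s^3 * infl ?X p"
      using v[of p] w[of p] unfolding iV(1) iW(1) .
    ultimately show ?thesis by (metis mult.assoc mult.left_commute)
  qed
  then have "multiplicities (map (\<lambda>L. L v* M) As) = multiplicities Bs"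
    by (rule multiplicities_eq) (use s iV(2,3) iW(2,3) M(1) in \<open>auto simp: invertible_det_nz dest: vm_eq_0[OF M(1)]\<close>)
  then show ?thesis unfolding multiplicities_transport[OF M(1)] .
qed

lemma multiplicities_lists:
  "multiplicities LH1 = {1, 3}" "multiplicities LH3 = {1, 2, 3}" "multiplicities LF1 = {4, 5}" "multiplicities LF3 = {1}"
  by (auto simp: multiplicities_def multiplicity_def LH1_def LH3_def LF1_def LF3_def vec3_eq_iff)

theorem classification_of_convex_foliations:
  assumes "F \<in> convex_foliations 3"
  shows "(F, H1) \<in> aut_equiv \<or> (F, H3) \<in> aut_equiv \<or> (F, F1) \<in> aut_equiv \<or> (F, F3) \<in> aut_equiv"
proof -
  obtain V Ls where V: "F = foliation_of (form_of_field V)" "convex_field (evf V) Ls" using convex_foliation_field[OF assms] .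
  show ?thesis
    using convex_field_classification[OF V(2)] aut_equivI
    unfolding V(1) H1_eq H3_eq F1_eq F3_eq evf_fields[symmetric] by blast
qed

theorem mainTheorem3:
  "{H1, H3, F1, F3} \<subseteq> convex_foliations 3 \<and>
   convex_foliations 3 // aut_equiv =
     {aut_equiv `` {H1}, aut_equiv `` {H3}, aut_equiv `` {F1}, aut_equiv `` {F3}} \<and>
   card (convex_foliations 3 // aut_equiv) = 4"
  proof (intro conjI)
  show "{H1, H3, F1, F3} \<subseteq> convex_foliations 3" using four_convex by blast
  have cls: "aut_equiv `` {F} = aut_equiv `` {G} \<longleftrightarrow> (F, G) \<in> aut_equiv" for F G
    using eq_equiv_class_iff[OF aut_equiv_equiv, of F G] by simp
  show quotient: "convex_foliations 3 // aut_equiv =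
     {aut_equiv `` {H1}, aut_equiv `` {H3}, aut_equiv `` {F1}, aut_equiv `` {F3}}"
  proof
    show "convex_foliations 3 // aut_equiv \<subseteq> {aut_equiv `` {H1}, aut_equiv `` {H3}, aut_equiv `` {F1}, aut_equiv `` {F3}}"
    proof
      fix X assume "X \<in> convex_foliations 3 // aut_equiv"
      then obtain F where F: "F \<in> convex_foliations 3" "X = aut_equiv `` {F}" by (rule quotientE)
      show "X \<in> {aut_equiv `` {H1}, aut_equiv `` {H3}, aut_equiv `` {F1}, aut_equiv `` {F3}}"
        using classification_of_convex_foliations[OF F(1)] cls unfolding F(2) by blast
    qed
    show "{aut_equiv `` {H1}, aut_equiv `` {H3}, aut_equiv `` {F1}, aut_equiv `` {F3}} \<subseteq> convex_foliations 3 // aut_equiv"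
      using four_convex by (auto intro: quotientI)
  qed
  have mem: "2 \<in> multiplicities LH3" "2 \<notin> multiplicities LH1" "2 \<notin> multiplicities LF1" "2 \<notin> multiplicities LF3"
    "3 \<in> multiplicities LH1" "3 \<notin> multiplicities LF1" "3 \<notin> multiplicities LF3" "5 \<in> multiplicities LF1" "5 \<notin> multiplicities LF3"
    by (simp_all add: multiplicities_lists)
  have "(H1, H3) \<notin> aut_equiv" "(H1, F1) \<notin> aut_equiv" "(H1, F3) \<notin> aut_equiv"
    "(H3, F1) \<notin> aut_equiv" "(H3, F3) \<notin> aut_equiv" "(F1, F3) \<notin> aut_equiv"
    using mem
      equivalent_multiplicities[of VH1 VH3, unfolded evf_fields, OF _ homogeneous_fields(1,2) infl_ZH1 _ lines_nonzero(1) infl_ZH3 _ lines_nonzero(2)]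
      equivalent_multiplicities[of VH1 VF1, unfolded evf_fields, OF _ homogeneous_fields(1,3) infl_ZH1 _ lines_nonzero(1) infl_ZF1 _ lines_nonzero(3)]
      equivalent_multiplicities[of VH1 VF3, unfolded evf_fields, OF _ homogeneous_fields(1,4) infl_ZH1 _ lines_nonzero(1) infl_ZF3 _ lines_nonzero(4)]
      equivalent_multiplicities[of VH3 VF1, unfolded evf_fields, OF _ homogeneous_fields(2,3) infl_ZH3 _ lines_nonzero(2) infl_ZF1 _ lines_nonzero(3)]
      equivalent_multiplicities[of VH3 VF3, unfolded evf_fields, OF _ homogeneous_fields(2,4) infl_ZH3 _ lines_nonzero(2) infl_ZF3 _ lines_nonzero(4)]
      equivalent_multiplicities[of VF1 VF3, unfolded evf_fields, OF _ homogeneous_fields(3,4) infl_ZF1 _ lines_nonzero(3) infl_ZF3 _ lines_nonzero(4)]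
    unfolding H1_eq[symmetric] H3_eq[symmetric] F1_eq[symmetric] F3_eq[symmetric] by auto
  then show "card (convex_foliations 3 // aut_equiv) = 4"
    unfolding quotient by (simp add: cls)
qed

end
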